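(* Let $\mathcal G$ be a compact Lie group and $0\le\delta<\rho\le1$. Let $m>0$, let $\sigma_A\in\mathcal S^m_{\rho,\delta}(\mathcal G\times\widehat{\mathcal G})$ be parameter-elliptic with respect to a sector $\Lambda$, and let $\sigma_A^\sharp(x,\xi,\lambda)$ be the corresponding parameter-dependent parametrix. Let $F$ be analytic in $\mathbb C\setminus\Lambda_\epsilon$, continuous up to the boundary, and satisfy $|F(\lambda)|\le C|\lambda|^s$ for some $s\in(-1,0)$, and define the operator $F(A)$ by the symbol $$\sigma_{F(A)}(x,\xi):=\frac1{2\pi i}\oint_\Gamma F(\lambda)\,\sigma_A^\sharp(x,\xi,\lambda)\,d\lambda .$$ Then $\sigma_{F(A)}\in\mathcal S^{ms}_{\rho,\delta}(\mathcal G\times\widehat{\mathcal G})$.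
   Context: Notation. $\mathcal G$ is a compact Lie group with normalized Haar measure; $\widehat{\mathcal G}$ is the set of equivalence classes $[\xi]$ of irreducible unitary representations $\xi:\mathcal G\to\mathrm U(d_\xi)$ (one representative is fixed per class). Fourier transform: $\widehat f(\xi)=\int_{\mathcal G}f(x)\xi(x)^*\,dx\in\mathbb C^{d_\xi\times d_\xi}$, with inversion $f(x)=\sum_{[\xi]}d_\xi\operatorname{trace}(\xi(x)\widehat f(\xi))$. $\mathcal L_{\mathcal G}$ is the (negative) Laplacian (Casimir element) and $\langle\xi\rangle$ is the eigenvalue of $(1-\mathcal L_{\mathcal G})^{1/2}$ on the span of the matrix coefficients of $\xi$. A sequence $\sigma(\xi)\in\mathbb C^{d_\xi\times d_\xi}$ is moderately growing (belongs to $\mathfrak s'(\widehat{\mathcal G})$) if $\|\sigma(\xi)\|_{\rm op}\le C\langle\xi\rangle^N$ for some $C,N$; these are exactly the Fourier transforms of distributions on $\mathcal G$. Difference operators. For $q\in C^\infty(\mathcal G)$ put $\Delta_q\sigma:=\mathcal F[q\,\mathcal F^{-1}\sigma]$. Fix finitely many representations $\eta_1,\dots,\eta_K$ of $\mathcal G$ such that the functions $(\eta_k(x)-\mathrm I)_{ij}$ vanish to first order at the identity $e$ and $e$ is their only common zero; list all these functions as $q_1,\dots,q_n$, let $q^\beta=q_1^{\beta_1}\cdots q_n^{\beta_n}$ and $\mathbb D_\xi^\beta:=\Delta_{q^\beta}$. $\partial_x^\alpha$ denotes (ordered) monomials in a fixed basis of left-invariant vector fields on $\mathcal G$. Symbols.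 $\mathcal S^m_{\rho,\delta}(\mathcal G\times\widehat{\mathcal G})$ is the set of $\sigma\in C^\infty(\mathcal G;\mathfrak s'(\widehat{\mathcal G}))$ with $\|\partial_x^\alpha\mathbb D_\xi^\beta\sigma(x,\xi)\|_{\rm op}\le C_{\alpha,\beta}\langle\xi\rangle^{m-\rho|\beta|+\delta|\alpha|}$ for all $\alpha,\beta$; $\mathcal S^{-\infty}=\bigcap_m\mathcal S^m_{1,0}$. Quantization: $\operatorname{Op}(\sigma)f(x)=\sum_{[\xi]}d_\xi\operatorname{trace}(\xi(x)\sigma(x,\xi)\widehat f(\xi))$; for $\delta<\rho$, $\sigma\sharp\tau$ is the symbol of $\operatorname{Op}(\sigma)\operatorname{Op}(\tau)$. Changing a symbol (smoothly in $x$) at finitely many $[\xi]$ does not affect membership in these classes; "co-finitely many" means all but finitely many (independently of $x,\lambda$), and values of $\sigma_{F(A)}$ at finitely many exceptional $[\xi]$ are immaterial. Sector: $\Lambda=\{re^{i\theta}:r\ge0,\ \theta_1\le\theta\le\theta_2\}$ with $0\le\theta_2-\theta_1<2\pi$ (a ray is allowed). $\sigma_A\in\mathcal S^m_{\rho,\delta}$, $m>0$, is parameter-elliptic with respect to $\Lambda$ if there is $C$ such that $\|(\sigma_A(x,\xi)-\lambda\mathrm I)^{-1}\|_{\rm op}\le C(|\lambda|^{1/m}+\langle\xi\rangle)^{-m}$ (with invertibility) for all $x\in\mathcal G$, $\lambda\in\Lambda$ and co-finitely many $[\xi]$. $\Lambda_\epsilon=\Lambda\cup\{|\lambda|\le\epsilon\}$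 with $\epsilon>0$ fixed so small that this estimate extends (with another constant) to $\lambda\in\Lambda_\epsilon$. Parameter-dependent parametrix: a family of symbols $\sigma_A^\sharp(x,\xi,\lambda)$, $\lambda\in\Lambda_\epsilon$, with $\sigma_A^\sharp(\cdot,\cdot,\lambda)\sharp(\sigma_A-\lambda\mathrm I)-\mathrm I$ and $(\sigma_A-\lambda\mathrm I)\sharp\sigma_A^\sharp(\cdot,\cdot,\lambda)-\mathrm I$ in $\mathcal S^{-\infty}(\mathcal G\times\widehat{\mathcal G})$, and satisfying $\|\partial_\lambda^k\partial_x^\alpha\mathbb D_\xi^\beta\sigma_A^\sharp(x,\xi,\lambda)\|_{\rm op}\le C_{k,\alpha,\beta}(|\lambda|^{1/m}+\langle\xi\rangle)^{-m(k+1)}\langle\xi\rangle^{-\rho|\beta|+\delta|\alpha|}$ for all $k,\alpha,\beta$, uniformly in $x$ and $\lambda\in\Lambda_\epsilon$ and for co-finitely many $[\xi]$. (Such a parametrix exists.) Contour. $\Gamma=\partial\Lambda_\epsilon$ is oriented clockwise around $\mathbb C\setminus\Lambda_\epsilon$: it comes from $\infty$ along $\arg\lambda=\theta_2$ to $|\lambda|=\epsilon$, runs counterclockwise along $|\lambda|=\epsilon$ from argument $\theta_2$ to $\theta_1+2\pi$, and goes to $\infty$ along $\arg\lambda=\theta_1+2\pi$; on $\Gamma$ the values of $F$ are the boundary values from $\mathbb C\setminus\Lambda_\epsilon$. *)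

theory Defs
  imports
    "HOL-Analysis.Analysis"
    "HOL-Algebra.Group"
    "Jordan_Normal_Form.Schur_Decomposition"
begin

section \<open>Smooth functions and Lie groups\<close>

primrec Ck_on :: "nat \<Rightarrow> ('a::euclidean_space \<Rightarrow> 'b::real_normed_vector) \<Rightarrow> 'a set \<Rightarrow> bool" where
  "Ck_on 0 f U \<longleftrightarrow> continuous_on U f"
| "Ck_on (Suc n) f U \<longleftrightarrow>
     (\<forall>x\<in>U. f differentiable (at x)) \<and> (\<forall>v. Ck_on n (\<lambda>x. frechet_derivative f (at x) v) U)"

text \<open>Smoothness on an arbitrary subset of a Euclidean space: local extendability to a smooth
  function on an open set.\<close>

definition smooth_on :: "'a::euclidean_space set \<Rightarrow> ('a \<Rightarrow> 'b::real_normed_vector) \<Rightarrow> bool" where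
  "smooth_on S f \<longleftrightarrow>
     (\<forall>x\<in>S. \<exists>U g. open U \<and> x \<in> U \<and> (\<forall>n. Ck_on n g U) \<and> (\<forall>y\<in>S \<inter> U. g y = f y))"

text \<open>A Lie group is modelled on a linear subspace \<open>model\<close> of the Euclidean space \<open>'e\<close>
  (rather than on all of \<open>'e\<close>), so that dimension 0, i.e. finite groups, is included. A chart is a
  pair of its domain and its coordinate map; its image is a relatively open subset of \<open>model\<close>.\<close>

type_synonym ('g, 'e) chart = "'g set \<times> ('g \<Rightarrow> 'e)"

definition chart_inv :: "('g, 'e) chart \<Rightarrow> 'e \<Rightarrow> 'g" where
  "chart_inv c = inv_into (fst c) (snd c)"

record ('g, 'e) lie_data = "'g monoid" +
  model :: "'e set"
  atlas :: "('g, 'e) chart set"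

definition smooth_atlas :: "'e::euclidean_space set \<Rightarrow> ('g::t2_space, 'e) chart set \<Rightarrow> bool" where
  "smooth_atlas V \<A> \<longleftrightarrow>
     (\<Union>c\<in>\<A>. fst c) = UNIV \<and>
     (\<forall>c\<in>\<A>. open (fst c) \<and> openin (top_of_set V) (snd c ` fst c) \<and>
        homeomorphism (fst c) (snd c ` fst c) (snd c) (chart_inv c)) \<and>
     (\<forall>c\<in>\<A>. \<forall>c'\<in>\<A>. smooth_on (snd c ` (fst c \<inter> fst c')) (\<lambda>u. snd c' (chart_inv c u)))"

definition compact_lie_group :: "('g::t2_space, 'e::euclidean_space, 'z) lie_data_scheme \<Rightarrow> bool" where
  "compact_lie_group K \<longleftrightarrow>
     group K \<and> carrier K = UNIV \<and> compact (UNIV :: 'g set) \<and>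
     Real_Vector_Spaces.subspace (model K) \<and> smooth_atlas (model K) (atlas K) \<and>
     continuous_on UNIV (\<lambda>(x, y). x \<otimes>\<^bsub>K\<^esub> y) \<and>
     (\<forall>a\<in>atlas K. \<forall>b\<in>atlas K. \<forall>c\<in>atlas K.
        smooth_on {(snd a x, snd b y) | x y. x \<in> fst a \<and> y \<in> fst b \<and> x \<otimes>\<^bsub>K\<^esub> y \<in> fst c}
          (\<lambda>(u, v). snd c (chart_inv a u \<otimes>\<^bsub>K\<^esub> chart_inv b v))) \<and>
     continuous_on UNIV (\<lambda>x. inv\<^bsub>K\<^esub> x) \<and>
     (\<forall>a\<in>atlas K. \<forall>c\<in>atlas K.
        smooth_on {snd a x | x. x \<in> fst a \<and> inv\<^bsub>K\<^esub> x \<in> fst c}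
          (\<lambda>u. snd c (inv\<^bsub>K\<^esub> (chart_inv a u))))"

definition smooth_fun :: "('g, 'e::euclidean_space, 'z) lie_data_scheme \<Rightarrow> ('g \<Rightarrow> complex) \<Rightarrow> bool" where
  "smooth_fun K f \<longleftrightarrow> (\<forall>c\<in>atlas K. smooth_on (snd c ` fst c) (\<lambda>u. f (chart_inv c u)))"


section \<open>The data fixed on the group\<close>

text \<open>\<open>unit_chart\<close> is a chart around the unit, through which the tangent space at the unit is
  identified with \<open>model\<close>. \<open>frame\<close> is the basis of that tangent space giving the left-invariant
  vector fields used for the derivatives in \<open>x\<close>; \<open>metric\<close> is an Ad-invariant inner product on it,
  with orthonormal basis \<open>onb\<close>, and determines the Laplacian. \<open>dual\<close> has one representative of each
  class of irreducible unitary representations, so a symbol is a matrix function of \<open>x\<close> and of the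
  representative \<open>\<xi>\<close>. \<open>diff_reps\<close> are the representations defining the difference operators.\<close>

record ('g, 'e) calculus_data = "('g, 'e) lie_data" +
  haar :: "'g measure"
  unit_chart :: "('g, 'e) chart"
  frame :: "'e list"
  metric :: "'e \<Rightarrow> 'e \<Rightarrow> real"
  onb :: "'e list"
  dual :: "('g \<Rightarrow> complex mat) set"
  diff_reps :: "('g \<Rightarrow> complex mat) list"

type_synonym 'g rep = "'g \<Rightarrow> complex mat"
type_synonym 'g symbol = "'g \<Rightarrow> 'g rep \<Rightarrow> complex mat"

definition haar_measure :: "('g::t2_space, 'z) monoid_scheme \<Rightarrow> 'g measure \<Rightarrow> bool" where
  "haar_measure G \<mu> \<longleftrightarrow>
     sets \<mu> = sets borel \<and> emeasure \<mu> UNIV = 1 \<and> (\<forall>g. distr \<mu> \<mu> (\<lambda>x. g \<otimes>\<^bsub>G\<^esub> x) = \<mu>)"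

text \<open>A curve through the unit with velocity \<open>v\<close>; only small \<open>t\<close> matter.\<close>

definition unit_curve ::
    "('g, 'e::euclidean_space) calculus_data \<Rightarrow> 'e \<Rightarrow> real \<Rightarrow> 'g" where
  "unit_curve K v t = chart_inv (unit_chart K) (snd (unit_chart K) \<one>\<^bsub>K\<^esub> + t *\<^sub>R v)"

text \<open>The left-invariant vector field extending the tangent vector \<open>v\<close> at the unit.\<close>

definition left_deriv ::
    "('g, 'e::euclidean_space) calculus_data \<Rightarrow> 'e \<Rightarrow> ('g \<Rightarrow> complex) \<Rightarrow> 'g \<Rightarrow> complex" where
  "left_deriv K v f x = vector_derivative (\<lambda>t. f (x \<otimes>\<^bsub>K\<^esub> unit_curve K v t)) (at 0)"

definition Ad :: "('g, 'e::euclidean_space) calculus_data \<Rightarrow> 'g \<Rightarrow> 'e \<Rightarrow> 'e" where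
  "Ad K g v =
     vector_derivative
       (\<lambda>t. snd (unit_chart K) (g \<otimes>\<^bsub>K\<^esub> unit_curve K v t \<otimes>\<^bsub>K\<^esub> inv\<^bsub>K\<^esub> g)) (at 0)"

definition invariant_inner :: "('g, 'e::euclidean_space) calculus_data \<Rightarrow> ('e \<Rightarrow> 'e \<Rightarrow> real) \<Rightarrow> bool" where
  "invariant_inner K b \<longleftrightarrow>
     (\<forall>u\<in>model K. \<forall>v\<in>model K. b u v = b v u) \<and>
     (\<forall>u\<in>model K. \<forall>v\<in>model K. \<forall>w\<in>model K. \<forall>r. b (r *\<^sub>R u + v) w = r * b u w + b v w) \<and>
     (\<forall>u\<in>model K. u \<noteq> 0 \<longrightarrow> 0 < b u u) \<and>
     (\<forall>g. \<forall>u\<in>model K. \<forall>v\<in>model K. b (Ad K g u) (Ad K g v) = b u v)"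

definition basis_list :: "'e::euclidean_space set \<Rightarrow> 'e list \<Rightarrow> bool" where
  "basis_list V vs \<longleftrightarrow>
     distinct vs \<and> Real_Vector_Spaces.independent (set vs) \<and>
     Real_Vector_Spaces.span (set vs) = V"

definition orthonormal_basis_list ::
    "'e::euclidean_space set \<Rightarrow> ('e \<Rightarrow> 'e \<Rightarrow> real) \<Rightarrow> 'e list \<Rightarrow> bool" where
  "orthonormal_basis_list V b vs \<longleftrightarrow>
     basis_list V vs \<and>
     (\<forall>i<length vs. \<forall>j<length vs. b (vs ! i) (vs ! j) = (if i = j then 1 else 0))"


section \<open>Representations\<close>

definition rep_dim :: "('g, 'z) monoid_scheme \<Rightarrow> 'g rep \<Rightarrow> nat" where
  "rep_dim G \<xi> = dim_row (\<xi> \<one>\<^bsub>G\<^esub>)"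

definition representation :: "('g::topological_space, 'z) monoid_scheme \<Rightarrow> 'g rep \<Rightarrow> bool" where
  "representation G \<xi> \<longleftrightarrow>
     (\<forall>x. \<xi> x \<in> carrier_mat (rep_dim G \<xi>) (rep_dim G \<xi>)) \<and>
     \<xi> \<one>\<^bsub>G\<^esub> = 1\<^sub>m (rep_dim G \<xi>) \<and>
     (\<forall>x y. \<xi> (x \<otimes>\<^bsub>G\<^esub> y) = \<xi> x * \<xi> y) \<and>
     (\<forall>i<rep_dim G \<xi>. \<forall>j<rep_dim G \<xi>. continuous_on UNIV (\<lambda>x. \<xi> x $$ (i, j)))"

definition unitary_rep :: "('g::topological_space, 'z) monoid_scheme \<Rightarrow> 'g rep \<Rightarrow> bool" where
  "unitary_rep G \<xi> \<longleftrightarrow>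
     representation G \<xi> \<and> (\<forall>x. mat_adjoint (\<xi> x) * \<xi> x = 1\<^sub>m (rep_dim G \<xi>))"

definition irreducible_rep :: "('g::topological_space, 'z) monoid_scheme \<Rightarrow> 'g rep \<Rightarrow> bool" where
  "irreducible_rep G \<xi> \<longleftrightarrow>
     representation G \<xi> \<and> 0 < rep_dim G \<xi> \<and>
     (\<forall>W. VectorSpace.subspace class_ring W (module_vec TYPE(complex) (rep_dim G \<xi>)) \<and>
          (\<forall>x. \<forall>w\<in>W. \<xi> x *\<^sub>v w \<in> W) \<longrightarrow>
        W = {0\<^sub>v (rep_dim G \<xi>)} \<or> W = carrier_vec (rep_dim G \<xi>))"

definition equivalent_rep :: "('g, 'z) monoid_scheme \<Rightarrow> 'g rep \<Rightarrow> 'g rep \<Rightarrow> bool" where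
  "equivalent_rep G \<xi> \<eta> \<longleftrightarrow>
     rep_dim G \<xi> = rep_dim G \<eta> \<and>
     (\<exists>T\<in>carrier_mat (rep_dim G \<xi>) (rep_dim G \<xi>).
        invertible_mat T \<and> (\<forall>x. T * \<xi> x = \<eta> x * T))"

definition unitary_dual :: "('g::topological_space, 'z) monoid_scheme \<Rightarrow> 'g rep set \<Rightarrow> bool" where
  "unitary_dual G D \<longleftrightarrow>
     (\<forall>\<xi>\<in>D. unitary_rep G \<xi> \<and> irreducible_rep G \<xi>) \<and>
     (\<forall>\<eta>. unitary_rep G \<eta> \<and> irreducible_rep G \<eta> \<longrightarrow> (\<exists>!\<xi>. \<xi> \<in> D \<and> equivalent_rep G \<xi> \<eta>))"

text \<open>The functions \<open>(\<eta>(x) - I)\<^sub>i\<^sub>j\<close>, for all \<open>\<eta>\<close> in \<open>diff_reps\<close>.\<close>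

definition diff_functions :: "('g, 'e) calculus_data \<Rightarrow> ('g \<Rightarrow> complex) list" where
  "diff_functions K =
     concat (map (\<lambda>\<eta>. [(\<lambda>x. (\<eta> x - 1\<^sub>m (rep_dim K \<eta>)) $$ (i, j)).
                         i \<leftarrow> [0..<rep_dim K \<eta>], j \<leftarrow> [0..<rep_dim K \<eta>]]) (diff_reps K))"

text \<open>Vanishing to first order is a condition on the functions jointly: they vanish at the unit and
  their differentials there have no common kernel. (Some of the individual functions may well be
  identically zero.)\<close>

definition admissible_diff_reps :: "('g::t2_space, 'e::euclidean_space) calculus_data \<Rightarrow> bool" where
  "admissible_diff_reps K \<longleftrightarrow>
     (\<forall>\<eta>\<in>set (diff_reps K). representation K \<eta>) \<and>
     (\<forall>q\<in>set (diff_functions K). q \<one>\<^bsub>K\<^esub> = 0) \<and>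
     (\<forall>v\<in>model K. v \<noteq> 0 \<longrightarrow> (\<exists>q\<in>set (diff_functions K). left_deriv K v q \<one>\<^bsub>K\<^esub> \<noteq> 0)) \<and>
     (\<forall>x. (\<forall>q\<in>set (diff_functions K). q x = 0) \<longrightarrow> x = \<one>\<^bsub>K\<^esub>)"

definition calculus_setting :: "('g::t2_space, 'e::euclidean_space) calculus_data \<Rightarrow> bool" where
  "calculus_setting K \<longleftrightarrow>
     compact_lie_group K \<and>
     haar_measure K (haar K) \<and>
     unit_chart K \<in> atlas K \<and> \<one>\<^bsub>K\<^esub> \<in> fst (unit_chart K) \<and>
     basis_list (model K) (frame K) \<and>
     invariant_inner K (metric K) \<and>
     orthonormal_basis_list (model K) (metric K) (onb K) \<and>
     unitary_dual K (dual K) \<and>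
     admissible_diff_reps K"

text \<open>By Ad-invariance of the metric the Laplacian acts as a scalar on the matrix coefficients of
  an irreducible \<open>\<xi>\<close>; \<open>bracket\<close> is the nonnegative square root of the eigenvalue of one minus it.\<close>

definition laplacian ::
    "('g, 'e::euclidean_space) calculus_data \<Rightarrow> ('g \<Rightarrow> complex) \<Rightarrow> 'g \<Rightarrow> complex" where
  "laplacian K f x = (\<Sum>v\<leftarrow>onb K. left_deriv K v (left_deriv K v f) x)"

definition bracket :: "('g, 'e::euclidean_space) calculus_data \<Rightarrow> 'g rep \<Rightarrow> real" where
  "bracket K \<xi> = (THE c. 0 \<le> c \<and>
     (\<forall>i<rep_dim K \<xi>. \<forall>j<rep_dim K \<xi>. \<forall>x.
        \<xi> x $$ (i, j) - laplacian K (\<lambda>y. \<xi> y $$ (i, j)) x = complex_of_real (c\<^sup>2) * \<xi> x $$ (i, j)))"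


section \<open>Fourier transform and difference operators\<close>

definition mat_trace :: "complex mat \<Rightarrow> complex" where
  "mat_trace A = sum_list (diag_mat A)"

definition vec_norm2 :: "complex vec \<Rightarrow> real" where
  "vec_norm2 v = L2_set (\<lambda>i. cmod (vec_index v i)) {..<dim_vec v}"

definition op_norm :: "complex mat \<Rightarrow> real" where
  "op_norm A = (SUP v\<in>{v \<in> carrier_vec (dim_col A). vec_norm2 v \<le> 1}. vec_norm2 (A *\<^sub>v v))"

definition fourier :: "('g, 'e) calculus_data \<Rightarrow> ('g \<Rightarrow> complex) \<Rightarrow> 'g rep \<Rightarrow> complex mat" where
  "fourier K f \<xi> = Matrix.mat (rep_dim K \<xi>) (rep_dim K \<xi>)
     (\<lambda>(i, j). \<integral>x. f x * mat_adjoint (\<xi> x) $$ (i, j) \<partial>haar K)"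

text \<open>Distributions are functionals on test functions, with the bilinear pairing extending
  \<open>\<integral> f \<phi>\<close>. The inverse Fourier transform of \<open>\<tau>\<close> is the distribution
  \<open>\<Sum>\<^sub>\<xi> d\<^sub>\<xi> trace (\<xi>(x) \<tau>(\<xi>))\<close>, summed weakly.\<close>

type_synonym 'g distribution = "('g \<Rightarrow> complex) \<Rightarrow> complex"

definition inv_fourier :: "('g, 'e) calculus_data \<Rightarrow> ('g rep \<Rightarrow> complex mat) \<Rightarrow> 'g distribution" where
  "inv_fourier K \<tau> \<phi> =
     (\<Sum>\<^sub>\<infinity>\<xi>\<in>dual K. of_nat (rep_dim K \<xi>) * (\<integral>x. mat_trace (\<xi> x * \<tau> \<xi>) * \<phi> x \<partial>haar K))"

definition dist_mult :: "('g \<Rightarrow> complex) \<Rightarrow> 'g distribution \<Rightarrow> 'g distribution" where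
  "dist_mult q u \<phi> = u (\<lambda>x. q x * \<phi> x)"

definition dist_fourier ::
    "('g, 'e) calculus_data \<Rightarrow> 'g distribution \<Rightarrow> 'g rep \<Rightarrow> complex mat" where
  "dist_fourier K u \<xi> = Matrix.mat (rep_dim K \<xi>) (rep_dim K \<xi>)
     (\<lambda>(i, j). u (\<lambda>x. mat_adjoint (\<xi> x) $$ (i, j)))"

definition diff_op ::
    "('g, 'e) calculus_data \<Rightarrow> ('g \<Rightarrow> complex) \<Rightarrow> ('g rep \<Rightarrow> complex mat) \<Rightarrow> 'g rep \<Rightarrow> complex mat" where
  "diff_op K q \<tau> = dist_fourier K (dist_mult q (inv_fourier K \<tau>))"

text \<open>Multi-indices are functions \<open>nat \<Rightarrow> nat\<close> of which only the first \<open>n\<close> values are used,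
  \<open>n\<close> being the number of difference functions or the dimension of the group.\<close>

definition q_power :: "('g, 'e) calculus_data \<Rightarrow> (nat \<Rightarrow> nat) \<Rightarrow> 'g \<Rightarrow> complex" where
  "q_power K \<beta> x = (\<Prod>i<length (diff_functions K). (diff_functions K ! i) x ^ \<beta> i)"

definition q_order :: "('g, 'e) calculus_data \<Rightarrow> (nat \<Rightarrow> nat) \<Rightarrow> nat" where
  "q_order K \<beta> = (\<Sum>i<length (diff_functions K). \<beta> i)"

text \<open>The ordered monomial \<open>X\<^sub>1^\<alpha>\<^sub>1 X\<^sub>2^\<alpha>\<^sub>2 \<cdots>\<close>, acting on functions and
  entrywise on matrix functions.\<close>

definition frame_deriv ::
    "('g, 'e::euclidean_space) calculus_data \<Rightarrow> (nat \<Rightarrow> nat) \<Rightarrow> ('g \<Rightarrow> complex) \<Rightarrow> 'g \<Rightarrow> complex" where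
  "frame_deriv K \<alpha> = foldr (\<lambda>i. left_deriv K (frame K ! i) ^^ \<alpha> i) [0..<length (frame K)]"

definition frame_order :: "('g, 'e) calculus_data \<Rightarrow> (nat \<Rightarrow> nat) \<Rightarrow> nat" where
  "frame_order K \<alpha> = (\<Sum>i<length (frame K). \<alpha> i)"

definition mat_deriv ::
    "('g, 'e::euclidean_space) calculus_data \<Rightarrow> (nat \<Rightarrow> nat) \<Rightarrow> ('g \<Rightarrow> complex mat) \<Rightarrow> 'g \<Rightarrow> complex mat" where
  "mat_deriv K \<alpha> A x = Matrix.mat (dim_row (A x)) (dim_col (A x))
     (\<lambda>(i, j). frame_deriv K \<alpha> (\<lambda>y. A y $$ (i, j)) x)"

definition symbol_deriv ::
    "('g, 'e::euclidean_space) calculus_data \<Rightarrow> (nat \<Rightarrow> nat) \<Rightarrow> (nat \<Rightarrow> nat) \<Rightarrow> 'g symbol \<Rightarrow> 'g symbol" where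
  "symbol_deriv K \<alpha> \<beta> \<sigma> x \<xi> = mat_deriv K \<alpha> (\<lambda>y. diff_op K (q_power K \<beta>) (\<sigma> y) \<xi>) x"


section \<open>Symbols and their quantization\<close>

definition smooth_mat_fun ::
    "('g, 'e::euclidean_space) calculus_data \<Rightarrow> nat \<Rightarrow> ('g \<Rightarrow> complex mat) \<Rightarrow> bool" where
  "smooth_mat_fun K d A \<longleftrightarrow>
     (\<forall>x. A x \<in> carrier_mat d d) \<and> (\<forall>i<d. \<forall>j<d. smooth_fun K (\<lambda>x. A x $$ (i, j)))"

text \<open>Smooth functions with values in the moderately growing sequences. The latter carry the
  inductive limit topology of the spaces of growth order \<open>N\<close>; by compactness of the group each
  derivative of such a function takes its values boundedly in one of these spaces.\<close>

definition smooth_symbol :: "('g, 'e::euclidean_space) calculus_data \<Rightarrow> 'g symbol \<Rightarrow> bool" where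
  "smooth_symbol K \<sigma> \<longleftrightarrow>
     (\<forall>\<xi>\<in>dual K. smooth_mat_fun K (rep_dim K \<xi>) (\<lambda>x. \<sigma> x \<xi>)) \<and>
     (\<forall>\<alpha>. \<exists>C N. \<forall>x. \<forall>\<xi>\<in>dual K. op_norm (mat_deriv K \<alpha> (\<lambda>y. \<sigma> y \<xi>) x) \<le> C * bracket K \<xi> powr N)"

definition symbol_class ::
    "('g, 'e::euclidean_space) calculus_data \<Rightarrow> real \<Rightarrow> real \<Rightarrow> real \<Rightarrow> 'g symbol set" where
  "symbol_class K m \<rho> \<delta> = {\<sigma>. smooth_symbol K \<sigma> \<and>
     (\<forall>\<alpha> \<beta>. \<exists>C. \<forall>x. \<forall>\<xi>\<in>dual K.
        op_norm (symbol_deriv K \<alpha> \<beta> \<sigma> x \<xi>)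
          \<le> C * bracket K \<xi> powr (m - \<rho> * real (q_order K \<beta>) + \<delta> * real (frame_order K \<alpha>)))}"

definition smoothing_symbols :: "('g, 'e::euclidean_space) calculus_data \<Rightarrow> 'g symbol set" where
  "smoothing_symbols K = (\<Inter>m. symbol_class K m 1 0)"

definition quantize ::
    "('g, 'e) calculus_data \<Rightarrow> 'g symbol \<Rightarrow> ('g \<Rightarrow> complex) \<Rightarrow> 'g \<Rightarrow> complex" where
  "quantize K \<sigma> f x =
     (\<Sum>\<^sub>\<infinity>\<xi>\<in>dual K. of_nat (rep_dim K \<xi>) * mat_trace (\<xi> x * \<sigma> x \<xi> * fourier K f \<xi>))"

text \<open>\<open>\<nu> = \<sigma> \<sharp> \<tau>\<close>, i.e. \<open>\<nu>\<close> is the symbol of the composition of the quantizations.\<close>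

definition is_sharp ::
    "('g, 'e::euclidean_space) calculus_data \<Rightarrow> 'g symbol \<Rightarrow> 'g symbol \<Rightarrow> 'g symbol \<Rightarrow> bool" where
  "is_sharp K \<nu> \<sigma> \<tau> \<longleftrightarrow> smooth_symbol K \<nu> \<and>
     (\<forall>f. smooth_fun K f \<longrightarrow> quantize K \<nu> f = quantize K \<sigma> (quantize K \<tau> f))"

definition symbol_minus :: "('g, 'e) calculus_data \<Rightarrow> 'g symbol \<Rightarrow> complex \<Rightarrow> 'g symbol" where
  "symbol_minus K \<sigma> z x \<xi> = \<sigma> x \<xi> - z \<cdot>\<^sub>m 1\<^sub>m (rep_dim K \<xi>)"


section \<open>Parameter-ellipticity and functions of a symbol\<close>

definition sector :: "real \<Rightarrow> real \<Rightarrow> complex set" where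
  "sector \<theta>1 \<theta>2 = {rcis r \<theta> | r \<theta>. 0 \<le> r \<and> \<theta>1 \<le> \<theta> \<and> \<theta> \<le> \<theta>2}"

definition sector_disc :: "real \<Rightarrow> real \<Rightarrow> real \<Rightarrow> complex set" where
  "sector_disc \<theta>1 \<theta>2 \<epsilon> = sector \<theta>1 \<theta>2 \<union> cball 0 \<epsilon>"

definition parameter_elliptic ::
    "('g, 'e::euclidean_space) calculus_data \<Rightarrow> real \<Rightarrow> 'g symbol \<Rightarrow> complex set \<Rightarrow> bool" where
  "parameter_elliptic K m \<sigma> S \<longleftrightarrow>
     (\<exists>C E. finite E \<and> (\<forall>\<xi>\<in>dual K - E. \<forall>x. \<forall>z\<in>S.
        \<exists>B\<in>carrier_mat (rep_dim K \<xi>) (rep_dim K \<xi>).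
          inverts_mat B (symbol_minus K \<sigma> z x \<xi>) \<and> inverts_mat (symbol_minus K \<sigma> z x \<xi>) B \<and>
          op_norm B \<le> C * (cmod z powr (1 / m) + bracket K \<xi>) powr (- m)))"

text \<open>Taken within \<open>S\<close>, so that it makes sense when \<open>S\<close> is a ray together with a disc.\<close>

primrec deriv_within :: "complex set \<Rightarrow> nat \<Rightarrow> (complex \<Rightarrow> complex) \<Rightarrow> complex \<Rightarrow> complex" where
  "deriv_within S 0 f = f"
| "deriv_within S (Suc k) f =
     (\<lambda>z. THE D. (deriv_within S k f has_field_derivative D) (at z within S))"

text \<open>The finite set \<open>E\<close> contains the exceptional representations, where no estimate is required.\<close>

definition parametrix ::
    "('g, 'e::euclidean_space) calculus_data \<Rightarrow> real \<Rightarrow> real \<Rightarrow> real \<Rightarrow> complex set \<Rightarrow> 'g rep set \<Rightarrow>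
      'g symbol \<Rightarrow> (complex \<Rightarrow> 'g symbol) \<Rightarrow> bool" where
  "parametrix K m \<rho> \<delta> S E \<sigma> P \<longleftrightarrow>
     (\<forall>z\<in>S. smooth_symbol K (P z) \<and>
        (\<exists>\<nu>. is_sharp K \<nu> (P z) (symbol_minus K \<sigma> z) \<and> symbol_minus K \<nu> 1 \<in> smoothing_symbols K) \<and>
        (\<exists>\<nu>. is_sharp K \<nu> (symbol_minus K \<sigma> z) (P z) \<and> symbol_minus K \<nu> 1 \<in> smoothing_symbols K)) \<and>
     (\<forall>\<alpha> \<beta> k x. \<forall>\<xi>\<in>dual K - E. \<forall>i<rep_dim K \<xi>. \<forall>j<rep_dim K \<xi>. \<forall>z\<in>S.
        deriv_within S k (\<lambda>w. symbol_deriv K \<alpha> \<beta> (P w) x \<xi> $$ (i, j))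
          field_differentiable (at z within S)) \<and>
     (\<forall>k \<alpha> \<beta>. \<exists>C. \<forall>x. \<forall>\<xi>\<in>dual K - E. \<forall>z\<in>S.
        op_norm (Matrix.mat (rep_dim K \<xi>) (rep_dim K \<xi>)
            (\<lambda>(i, j). deriv_within S k (\<lambda>w. symbol_deriv K \<alpha> \<beta> (P w) x \<xi> $$ (i, j)) z))
          \<le> C * (cmod z powr (1 / m) + bracket K \<xi>) powr (- m * (real k + 1))
              * bracket K \<xi> powr (- \<rho> * real (q_order K \<beta>) + \<delta> * real (frame_order K \<alpha>)))"

text \<open>\<open>Fb r \<theta>\<close> is the continuous extension of \<open>F (r e\<^sup>i\<^sup>\<theta>)\<close> from the complement of the sector
  with disc to its boundary. Polar coordinates keep the two sides apart when the sector is a ray.\<close>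

definition boundary_extension ::
    "real \<Rightarrow> real \<Rightarrow> real \<Rightarrow> (complex \<Rightarrow> complex) \<Rightarrow> (real \<Rightarrow> real \<Rightarrow> complex) \<Rightarrow> bool" where
  "boundary_extension \<theta>1 \<theta>2 \<epsilon> F Fb \<longleftrightarrow>
     continuous_on ({\<epsilon>..} \<times> {\<theta>2..\<theta>1 + 2 * pi}) (\<lambda>(r, \<theta>). Fb r \<theta>) \<and>
     (\<forall>r>\<epsilon>. \<forall>\<theta>\<in>{\<theta>2<..<\<theta>1 + 2 * pi}. Fb r \<theta> = F (rcis r \<theta>))"

text \<open>The integral of \<open>F g\<close> along the boundary contour, in along \<open>arg z = \<theta>2\<close>, counterclockwise
  along the circle, and out along \<open>arg z = \<theta>1 + 2\<pi>\<close>.\<close>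

definition contour_int ::
    "real \<Rightarrow> real \<Rightarrow> real \<Rightarrow> (real \<Rightarrow> real \<Rightarrow> complex) \<Rightarrow> (complex \<Rightarrow> complex) \<Rightarrow> complex" where
  "contour_int \<theta>1 \<theta>2 \<epsilon> Fb g =
     - (LBINT r:{\<epsilon>..}. Fb r \<theta>2 * g (rcis r \<theta>2) * cis \<theta>2)
     + (LBINT \<theta>:{\<theta>2..\<theta>1 + 2 * pi}. Fb \<epsilon> \<theta> * g (rcis \<epsilon> \<theta>) * (\<i> * rcis \<epsilon> \<theta>))
     + (LBINT r:{\<epsilon>..}. Fb r (\<theta>1 + 2 * pi) * g (rcis r (\<theta>1 + 2 * pi)) * cis (\<theta>1 + 2 * pi))"

definition function_symbol ::
    "('g, 'e) calculus_data \<Rightarrow> real \<Rightarrow> real \<Rightarrow> real \<Rightarrow> (real \<Rightarrow> real \<Rightarrow> complex) \<Rightarrow>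
      (complex \<Rightarrow> 'g symbol) \<Rightarrow> 'g symbol" where
  "function_symbol K \<theta>1 \<theta>2 \<epsilon> Fb P x \<xi> = Matrix.mat (rep_dim K \<xi>) (rep_dim K \<xi>)
     (\<lambda>(i, j). 1 / (2 * complex_of_real pi * \<i>) * contour_int \<theta>1 \<theta>2 \<epsilon> Fb (\<lambda>z. P z x \<xi> $$ (i, j)))"

end

theory Submission
  imports Defs "Jordan_Normal_Form.Spectral_Radius" "HOL-Library.Function_Algebras"
begin

text \<open>Differentiating under the contour integral reduces the claim to the estimates of the
  parametrix, since \<open>\<integral> r\<^sup>s (r\<^bsup>1/m\<^esup> + b)\<^bsup>-m\<^esup> dr\<close> over the rays is bounded by a multiple of
  \<open>b\<^bsup>ms\<^esup>\<close> for \<open>-1 < s < 0\<close>. Three points need an argument. The estimates concern ordered monomials in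
  the frame only, while smoothness in charts involves all words in it: the commutators of
  left-invariant fields are combinations of such fields, so that every word is a combination of ordered
  monomials. A difference operator commutes with the contour integral because, by orthogonality of
  matrix coefficients, its value at \<open>\<xi>\<close> depends on finitely many values of the symbol. Conversely a given
  exceptional representation influences only finitely many \<open>\<xi>\<close>, and there the estimate follows
  from compactness of the group, the bracket being positive because the Laplacian is negative.\<close>

section \<open>Calculus of continuously differentiable maps on open sets\<close>

text \<open>Differentiating an integral over the group needs one neighbourhood and one dominating
  function for all points. Both come from translating the unit chart: the differential of
  \<open>f (x \<star> cinv uc b)\<close> in \<open>b\<close> combines frame derivatives of
  \<open>f\<close> with coefficients, the Maurer-Cartan form, that depend on \<open>b\<close> alone.
  All words are treated at once, because the chart derivative of a word involves the words with one
  more letter in front. A representation is assumed only continuous, while the bracket is read off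
  from second derivatives. Differentiability is therefore produced first, by averaging against a
  bump function. The Casimir matrix is then scalar by Schur's lemma, and its trace is minus a sum of
  squares because derivatives of unitary representations are skew-Hermitian. The resulting bound
  \<open>1 \<le> bracket K \<xi>\<close> makes powers of the bracket monotone in the exponent, which
  the circular part of the contour uses. The symbol estimate is uniform in \<xi>, so the constants
  of the contour are fixed before the matrix size and the bracket.\<close>

lemma Ck_on_SucD:
  assumes "Ck_on (Suc n) f U" "x \<in> U"
  shows "(f has_derivative frechet_derivative f (at x)) (at x)"
  using assms by (simp add: frechet_derivative_works)

lemma Ck_on_Suc_imp: "Ck_on (Suc n) f U \<Longrightarrow> Ck_on n f U"
proof (induction n arbitrary: f)
  case 0
  then show ?case
    by (auto intro!: continuous_at_imp_continuous_on differentiable_imp_continuous_within)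
next
  case (Suc n)
  then show ?case by (metis Ck_on.simps(2))
qed

lemma Ck_on_le: "Ck_on n f U \<Longrightarrow> k \<le> n \<Longrightarrow> Ck_on k f U"
proof (induction n)
  case (Suc n)
  then show ?case using Ck_on_Suc_imp[of n f U] by (cases "k = Suc n") (auto simp del: Ck_on.simps)
qed simp

lemma Ck_on_continuous: "Ck_on n f U \<Longrightarrow> continuous_on U f"
  using Ck_on_le[of n f U 0] by simp

lemma Ck_on_subset: "Ck_on n f U \<Longrightarrow> T \<subseteq> U \<Longrightarrow> Ck_on n f T"
proof (induction n arbitrary: f)
  case 0
  then show ?case using continuous_on_subset by simp blast
qed auto

text \<open>\<open>Ck_on\<close> refers to derivatives in the full space; values on \<open>U\<close>
  determine them because \<open>U\<close> is open.\<close>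

lemma Ck_on_cong:
  assumes "open U" "\<And>x. x \<in> U \<Longrightarrow> f x = g x"
  shows "Ck_on n f U \<Longrightarrow> Ck_on n g U"
  using assms(2)
proof (induction n arbitrary: f g)
  case 0
  then show ?case by (metis Ck_on.simps(1) continuous_on_cong)
next
  case (Suc n)
  have eq: "(g has_derivative frechet_derivative f (at x)) (at x)" if "x \<in> U" for x
    using Ck_on_SucD[OF Suc.prems(1) that] assms(1) that Suc.prems(2)
    by (auto intro: has_derivative_transform_within_open)
  have eq': "frechet_derivative f (at x) = frechet_derivative g (at x)" if "x \<in> U" for x
    using frechet_derivative_at[OF eq[OF that]] .
  have "Ck_on n (\<lambda>x. frechet_derivative g (at x) v) U" for v
    by (rule Suc.IH[of "\<lambda>x. frechet_derivative f (at x) v"]) (use Suc.prems(1) eq' in simp_all)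
  moreover have "g differentiable (at x)" if "x \<in> U" for x
    using eq that by (auto simp: differentiable_def)
  ultimately show ?case by simp
qed

text \<open>Lets an explicit derivative \<open>D\<close> replace the chosen
  \<open>frechet_derivative\<close>; the closure properties of \<open>Ck_on\<close> are proved
  through it.\<close>

lemma Ck_on_SucI:
  assumes "open U" "\<And>x. x \<in> U \<Longrightarrow> (f has_derivative D x) (at x)" "\<And>v. Ck_on n (\<lambda>x. D x v) U"
  shows "Ck_on (Suc n) f U"
proof -
  have "frechet_derivative f (at x) = D x" if "x \<in> U" for x
    using frechet_derivative_at[OF assms(2)[OF that]] by simp
  then have "Ck_on n (\<lambda>x. frechet_derivative f (at x) v) U" for v
    by (intro Ck_on_cong[OF assms(1) _ assms(3)[of v]]) auto
  then show ?thesis using assms(2) by (auto simp: differentiable_def)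
qed

lemma Ck_on_local:
  assumes "\<And>x. x \<in> U \<Longrightarrow> \<exists>V. open V \<and> x \<in> V \<and> Ck_on n f V"
  shows "Ck_on n f U"
  using assms
proof (induction n arbitrary: f)
  case 0
  have "isCont f x" if "x \<in> U" for x
    using 0[OF that] by (auto simp: continuous_on_eq_continuous_at)
  then show ?case by (auto intro: continuous_at_imp_continuous_on)
next
  case (Suc n)
  have "Ck_on n (\<lambda>x. frechet_derivative f (at x) v) U" for v
    using Suc.prems by (intro Suc.IH) fastforce
  moreover have "\<forall>x\<in>U. f differentiable (at x)" using Suc.prems by fastforce
  ultimately show ?case by simp
qed

lemma Ck_on_const [simp]: "Ck_on n (\<lambda>x. c) U"
  by (induction n arbitrary: c) auto

lemma Ck_on_add:
  assumes "open U" "Ck_on n f U" "Ck_on n g U"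
  shows "Ck_on n (\<lambda>x. f x + g x) U"
  using assms(2,3)
proof (induction n arbitrary: f g)
  case (Suc n)
  show ?case
  proof (rule Ck_on_SucI[OF assms(1)])
    show "((\<lambda>x. f x + g x) has_derivative
        (\<lambda>v. frechet_derivative f (at x) v + frechet_derivative g (at x) v)) (at x)"
      if "x \<in> U" for x
      using Suc.prems that by (intro has_derivative_add Ck_on_SucD)
  qed (use Suc.prems in \<open>intro Suc.IH; simp\<close>)
qed (auto intro: continuous_intros)

lemma Ck_on_sum:
  assumes "open U" "\<And>i. i \<in> I \<Longrightarrow> Ck_on n (f i) U"
  shows "Ck_on n (\<lambda>x. \<Sum>i\<in>I. f i x) U"
  using assms(2)
  by (induction I rule: infinite_finite_induct) (auto intro: Ck_on_add[OF assms(1)])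

lemma (in bounded_linear) Ck_on_linear:
  assumes "open U" "Ck_on n g U"
  shows "Ck_on n (\<lambda>x. f (g x)) U"
  using assms(2)
proof (induction n arbitrary: g)
  case 0
  then show ?case using continuous_on[of U g] by simp
next
  case (Suc n)
  show ?case
  proof (rule Ck_on_SucI[OF assms(1)])
    show "((\<lambda>x. f (g x)) has_derivative (\<lambda>v. f (frechet_derivative g (at x) v))) (at x)"
      if "x \<in> U" for x
      using Suc.prems that by (intro has_derivative Ck_on_SucD)
  qed (use Suc.prems in \<open>intro Suc.IH; simp\<close>)
qed

lemma (in bounded_bilinear) Ck_on_bilinear:
  assumes "open U" "Ck_on n f U" "Ck_on n g U"
  shows "Ck_on n (\<lambda>x. prod (f x) (g x)) U"
  using assms(2,3)
proof (induction n arbitrary: f g)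
  case 0
  then show ?case using continuous_on[of U f g] by simp
next
  case (Suc n)
  note fn = Ck_on_Suc_imp[OF Suc.prems(1)] and gn = Ck_on_Suc_imp[OF Suc.prems(2)]
  show ?case
  proof (rule Ck_on_SucI[OF assms(1)])
    show "((\<lambda>x. prod (f x) (g x)) has_derivative
        (\<lambda>v. prod (f x) (frechet_derivative g (at x) v) + prod (frechet_derivative f (at x) v) (g x)))
        (at x)"
      if "x \<in> U" for x
      using Suc.prems that by (intro FDERIV Ck_on_SucD)
    show "Ck_on n (\<lambda>x. prod (f x) (frechet_derivative g (at x) v) +
        prod (frechet_derivative f (at x) v) (g x)) U" for v
      using Suc.prems fn gn by (intro Ck_on_add[OF assms(1)] Suc.IH) auto
  qed
qed

lemmas Ck_on_mult = bounded_bilinear.Ck_on_bilinear[OF bounded_bilinear_mult]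
lemmas Ck_on_scaleR = bounded_bilinear.Ck_on_bilinear[OF bounded_bilinear_scaleR]

lemma Ck_on_bounded_linear:
  assumes "bounded_linear f"
  shows "Ck_on n f U"
proof -
  have "Ck_on n f UNIV"
  proof (cases n)
    case 0
    then show ?thesis
      using assms by (simp add: bounded_linear.linear linear_continuous_on)
  next
    case (Suc k)
    then show ?thesis
      using assms Ck_on_SucI[of UNIV f "\<lambda>x. f" k]
      by (auto intro: bounded_linear_imp_has_derivative)
  qed
  then show ?thesis by (rule Ck_on_subset) auto
qed

lemma has_derivative_Basis_sum:
  fixes f :: "'b::euclidean_space \<Rightarrow> 'c::real_normed_vector"
  assumes "(f has_derivative D) F"
  shows "D w = (\<Sum>b\<in>Basis. inner w b *\<^sub>R D b)"
proof -
  have lin: "linear D" by (rule has_derivative_linear[OF assms])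
  have "(\<Sum>b\<in>Basis. inner w b *\<^sub>R D b) = D (\<Sum>b\<in>Basis. inner w b *\<^sub>R b)"
    unfolding linear_sum[OF lin] linear_scale[OF lin] ..
  then show ?thesis by (simp only: euclidean_representation)
qed

text \<open>In the chain rule both the base point \<open>g x\<close> and the direction vary with
  \<open>x\<close>. Expanding the direction in the standard basis turns the derivative into a sum of
  products. The induction hypothesis then applies with a directional derivative of \<open>f\<close>
  in place of \<open>f\<close>, while \<open>g\<close> stays the same.\<close>

lemma Ck_on_compose:
  fixes f :: "'b::euclidean_space \<Rightarrow> 'c::real_normed_vector" and g :: "'a::euclidean_space \<Rightarrow> 'b"
  assumes "open U" "open V" "g ` U \<subseteq> V" "Ck_on n f V" "Ck_on n g U"
  shows "Ck_on n (\<lambda>x. f (g x)) U"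
  using assms(4,5)
proof (induction n arbitrary: f)
  case 0
  then show ?case using assms(3) by (auto intro: continuous_on_compose2)
next
  case (Suc n)
  have gV: "g x \<in> V" if "x \<in> U" for x using that assms(3) by auto
  show ?case
  proof (rule Ck_on_SucI[OF assms(1)])
    fix x assume x: "x \<in> U"
    have f': "(f has_derivative frechet_derivative f (at (g x))) (at (g x))"
      using Suc.prems gV[OF x] by (intro Ck_on_SucD)
    have g': "(g has_derivative frechet_derivative g (at x)) (at x)"
      using Suc.prems x by (intro Ck_on_SucD)
    have "((\<lambda>x. f (g x)) has_derivative
        (\<lambda>v. frechet_derivative f (at (g x)) (frechet_derivative g (at x) v))) (at x)"
      using has_derivative_compose[OF g'] f' by auto
    then show "((\<lambda>x. f (g x)) has_derivative (\<lambda>v. \<Sum>b\<in>Basis.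
        inner (frechet_derivative g (at x) v) b *\<^sub>R frechet_derivative f (at (g x)) b)) (at x)"
      by (simp add: has_derivative_Basis_sum[OF f', symmetric])
  next
    fix v
    have "Ck_on n (\<lambda>x. frechet_derivative f (at (g x)) b) U" for b
      using Suc.prems(1) Ck_on_Suc_imp[OF Suc.prems(2)]
      by (rule_tac Suc.IH[of "\<lambda>y. frechet_derivative f (at y) b"]) auto
    moreover have "Ck_on n (\<lambda>x. inner (frechet_derivative g (at x) v) b) U" for b
      using Suc.prems by (intro bounded_linear.Ck_on_linear[OF bounded_linear_inner_left] assms) auto
    ultimately show "Ck_on n (\<lambda>x. \<Sum>b\<in>Basis. inner (frechet_derivative g (at x) v) b *\<^sub>R
        frechet_derivative f (at (g x)) b) U"
      by (intro Ck_on_sum Ck_on_scaleR assms)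
  qed
qed

lemma Ck_on_Pair:
  assumes "open U" "Ck_on n f U" "Ck_on n g U"
  shows "Ck_on n (\<lambda>x. (f x, g x)) U"
  using assms(2,3)
proof (induction n arbitrary: f g)
  case (Suc n)
  show ?case
  proof (rule Ck_on_SucI[OF assms(1)])
    show "((\<lambda>x. (f x, g x)) has_derivative
        (\<lambda>v. (frechet_derivative f (at x) v, frechet_derivative g (at x) v))) (at x)"
      if "x \<in> U" for x
      using Suc.prems that by (intro has_derivative_Pair Ck_on_SucD)
  qed (use Suc.prems in \<open>intro Suc.IH; simp\<close>)
qed (auto intro: continuous_intros)

text \<open>The second difference of \<open>f\<close> along \<open>s v\<close> and \<open>s w\<close> is \<open>s\<^sup>2\<close> times the mixed derivative up to
  \<open>o(s\<^sup>2)\<close>; it is symmetric in \<open>v\<close> and \<open>w\<close>.\<close>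

lemma second_difference_bound:
  fixes f :: "'a::real_normed_vector \<Rightarrow> 'b::real_normed_vector"
  assumes "open U" "x \<in> U" and f': "\<And>y. y \<in> U \<Longrightarrow> (f has_derivative f' y) (at y)"
    and D: "((\<lambda>y. f' y v) has_derivative D) (at x)" and "0 < e"
  shows "\<exists>d>0. \<forall>s. 0 < s \<and> s < d \<longrightarrow>
    norm (f (x + s *\<^sub>R v + s *\<^sub>R w) - f (x + s *\<^sub>R v) - f (x + s *\<^sub>R w) + f x - s\<^sup>2 *\<^sub>R D w) \<le> e * s\<^sup>2"
proof -
  define M where "M = 2 * norm v + norm w + 1"
  have M: "0 < M" by (simp add: M_def add_nonneg_pos)
  \<comment> \<open>The expansion of \<open>f' _ v\<close> at \<open>x\<close> is used at two points
    within distance \<open>s * M\<close>, so two errors \<open>e' * (s * M)\<close> have to add up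
    to \<open>e * s\<close>.\<close>
  define e' where "e' = e / (2 * M)"
  have e': "0 < e'" using M \<open>0 < e\<close> by (simp add: e'_def)
  have linD: "linear D" using D by (rule has_derivative_linear)
  obtain d1 where d1: "d1 > 0" "\<And>y. norm (y - x) < d1 \<Longrightarrow>
      norm (f' y v - f' x v - D (y - x)) \<le> e' * norm (y - x)"
    using D e' unfolding has_derivative_at_alt by blast
  obtain d2 where d2: "d2 > 0" "ball x d2 \<subseteq> U" using assms(1,2) open_contains_ball by blast
  define d where "d = min d1 d2 / M"
  have d: "d > 0" using d1 d2 M by (simp add: d_def)
  show ?thesis
  proof (intro exI[of _ d] conjI d allI impI)
    fix s assume s: "0 < s \<and> s < d"
    have sM: "s * M < d1" "s * M < d2" using s M by (auto simp: d_def field_simps)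
    have near: "norm (t *\<^sub>R v + r *\<^sub>R w) \<le> s * M" if "0 \<le> t" "t \<le> s" "0 \<le> r" "r \<le> s" for t r
    proof -
      have "norm (t *\<^sub>R v + r *\<^sub>R w) \<le> t * norm v + r * norm w"
        using that by (metis abs_of_nonneg norm_scaleR norm_triangle_ineq)
      also have "\<dots> \<le> s * norm v + s * norm w"
        using that by (intro add_mono mult_right_mono) auto
      also have "\<dots> \<le> s * M" using s by (simp add: M_def algebra_simps)
      finally show ?thesis .
    qed
    have inU: "x + t *\<^sub>R v + r *\<^sub>R w \<in> U" if "0 \<le> t" "t \<le> s" "0 \<le> r" "r \<le> s" for t r
    proof -
      have "dist (x + (t *\<^sub>R v + r *\<^sub>R w)) x < d2"
        using near[OF that] sM unfolding dist_norm add_diff_cancel_left' by linarith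
      then have "x + (t *\<^sub>R v + r *\<^sub>R w) \<in> U" by (intro subsetD[OF d2(2)]) (simp add: dist_commute)
      then show ?thesis by (simp only: add.assoc)
    qed
    \<comment> \<open>\<open>g s - g 0\<close> is the second difference minus
      \<open>s\<^sup>2 *\<^sub>R D w\<close>. The linear term in \<open>t\<close> makes the
      derivative of \<open>g\<close> of size \<open>e * s\<close>, and the mean value inequality
      over an interval of length \<open>s\<close> supplies the other factor.\<close>
    define g where "g t = f (x + t *\<^sub>R v + s *\<^sub>R w) - f (x + t *\<^sub>R v) - t *\<^sub>R (s *\<^sub>R D w)" for t
    have g': "(g has_vector_derivative
        (f' (x + t *\<^sub>R v + s *\<^sub>R w) v - f' (x + t *\<^sub>R v) v - s *\<^sub>R D w)) (at t within {0..s})"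
      if t: "t \<in> {0..s}" for t
    proof -
      have 1: "((\<lambda>t. f (x + t *\<^sub>R v + r *\<^sub>R w)) has_vector_derivative f' (x + t *\<^sub>R v + r *\<^sub>R w) v)
          (at t within {0..s})" if r: "0 \<le> r" "r \<le> s" for r
      proof -
        have F: "(f has_derivative f' (x + t *\<^sub>R v + r *\<^sub>R w)) (at (x + t *\<^sub>R v + r *\<^sub>R w))"
          using f' inU t r by auto
        have C: "((\<lambda>t. x + t *\<^sub>R v + r *\<^sub>R w) has_derivative (\<lambda>h. h *\<^sub>R v)) (at t within {0..s})"
          by (auto intro!: derivative_eq_intros)
        have "((\<lambda>t. f (x + t *\<^sub>R v + r *\<^sub>R w)) has_derivative
            (\<lambda>h. f' (x + t *\<^sub>R v + r *\<^sub>R w) (h *\<^sub>R v))) (at t within {0..s})"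
          using has_derivative_compose[OF C F] .
        then show ?thesis
          by (simp add: has_vector_derivative_def linear_scale[OF has_derivative_linear[OF F]])
      qed
      show ?thesis unfolding g_def
        using 1[of s] 1[of 0] s
        by (auto intro!: derivative_eq_intros simp: has_vector_derivative_def)
          (auto intro!: derivative_eq_intros simp: algebra_simps)
    qed
    have bd: "norm (f' (x + t *\<^sub>R v + s *\<^sub>R w) v - f' (x + t *\<^sub>R v) v - s *\<^sub>R D w) \<le> e * s"
      if t: "t \<in> {0..s}" for t
    proof -
      have one: "norm (f' (x + t *\<^sub>R v + r *\<^sub>R w) v - f' x v - D (t *\<^sub>R v + r *\<^sub>R w)) \<le> e' * (s * M)"
        if r: "0 \<le> r" "r \<le> s" for r
      proof -
        have n: "norm (t *\<^sub>R v + r *\<^sub>R w) \<le> s * M" using near t r by auto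
        have "norm (f' (x + t *\<^sub>R v + r *\<^sub>R w) v - f' x v - D (t *\<^sub>R v + r *\<^sub>R w))
            \<le> e' * norm (t *\<^sub>R v + r *\<^sub>R w)"
          using d1(2)[of "x + t *\<^sub>R v + r *\<^sub>R w"] n sM by (simp add: add.assoc)
        also have "\<dots> \<le> e' * (s * M)" using n e' by (intro mult_left_mono) auto
        finally show ?thesis .
      qed
      have "f' (x + t *\<^sub>R v + s *\<^sub>R w) v - f' (x + t *\<^sub>R v) v - s *\<^sub>R D w =
          (f' (x + t *\<^sub>R v + s *\<^sub>R w) v - f' x v - D (t *\<^sub>R v + s *\<^sub>R w)) -
          (f' (x + t *\<^sub>R v + 0 *\<^sub>R w) v - f' x v - D (t *\<^sub>R v + 0 *\<^sub>R w))"
        by (simp add: linear_add[OF linD] linear_scale[OF linD])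
      also have "norm \<dots> \<le> e' * (s * M) + e' * (s * M)"
        by (rule norm_triangle_le_diff[OF add_mono[OF one one]]) (use s in auto)
      also have "\<dots> = e * s" using M by (simp add: e'_def field_simps)
      finally show ?thesis .
    qed
    have "norm (g s - g 0) \<le> (e * s) * norm (s - 0)"
    proof (rule differentiable_bound[OF convex_real_interval(5)[of 0 s]])
      fix t assume t: "t \<in> {0..s}"
      let ?d = "f' (x + t *\<^sub>R v + s *\<^sub>R w) v - f' (x + t *\<^sub>R v) v - s *\<^sub>R D w"
      show "(g has_derivative (\<lambda>h. h *\<^sub>R ?d)) (at t within {0..s})"
        using g'[OF t] by (simp add: has_vector_derivative_def)
      show "onorm (\<lambda>h. h *\<^sub>R ?d) \<le> e * s"
        using mult_right_mono[OF bd[OF t]] by (intro onorm_le) (simp add: mult.commute)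
    qed (use s in auto)
    also have "\<dots> = e * s\<^sup>2" using s by (simp add: power2_eq_square)
    finally show "norm (f (x + s *\<^sub>R v + s *\<^sub>R w) - f (x + s *\<^sub>R v) - f (x + s *\<^sub>R w) + f x -
        s\<^sup>2 *\<^sub>R D w) \<le> e * s\<^sup>2"
      by (simp add: g_def algebra_simps power2_eq_square)
  qed
qed

lemma symmetric_second_derivative:
  fixes f :: "'a::real_normed_vector \<Rightarrow> 'b::real_normed_vector"
  assumes "open U" "x \<in> U" and f': "\<And>y. y \<in> U \<Longrightarrow> (f has_derivative f' y) (at y)"
    and D: "((\<lambda>y. f' y v) has_derivative D) (at x)" "((\<lambda>y. f' y w) has_derivative D') (at x)"
  shows "D w = D' v"
proof (rule ccontr)
  assume "D w \<noteq> D' v"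
  \<comment> \<open>A third, because the two approximations of the same second difference cost
    \<open>e * s\<^sup>2\<close> each, and \<open>2 * e\<close> must stay below the distance of the
    limits.\<close>
  define e where "e = norm (D w - D' v) / 3"
  have e: "e > 0" using \<open>D w \<noteq> D' v\<close> by (simp add: e_def)
  obtain d1 where d1: "d1 > 0" "\<And>s. 0 < s \<and> s < d1 \<Longrightarrow>
    norm (f (x + s *\<^sub>R v + s *\<^sub>R w) - f (x + s *\<^sub>R v) - f (x + s *\<^sub>R w) + f x - s\<^sup>2 *\<^sub>R D w) \<le> e * s\<^sup>2"
    using second_difference_bound[OF assms(1,2) f' D(1) e, of w] by blast
  obtain d2 where d2: "d2 > 0" "\<And>s. 0 < s \<and> s < d2 \<Longrightarrow>
    norm (f (x + s *\<^sub>R w + s *\<^sub>R v) - f (x + s *\<^sub>R w) - f (x + s *\<^sub>R v) + f x - s\<^sup>2 *\<^sub>R D' v) \<le> e * s\<^sup>2"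
    using second_difference_bound[OF assms(1,2) f' D(2) e, of v] by blast
  define s where "s = min d1 d2 / 2"
  have s: "0 < s" "s < d1" "s < d2" using d1 d2 by (auto simp: s_def min_def)
  define q where "q = f (x + s *\<^sub>R v + s *\<^sub>R w) - f (x + s *\<^sub>R v) - f (x + s *\<^sub>R w) + f x"
  have 1: "norm (q - s\<^sup>2 *\<^sub>R D w) \<le> e * s\<^sup>2" using d1(2)[of s] s by (simp add: q_def)
  have 2: "norm (q - s\<^sup>2 *\<^sub>R D' v) \<le> e * s\<^sup>2"
    using d2(2)[of s] s by (simp add: q_def algebra_simps)
  have "s\<^sup>2 * norm (D w - D' v) = norm ((q - s\<^sup>2 *\<^sub>R D' v) - (q - s\<^sup>2 *\<^sub>R D w))"
    by (simp flip: scaleR_diff_right)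
  also have "\<dots> \<le> e * s\<^sup>2 + e * s\<^sup>2"
    by (rule norm_triangle_le_diff[OF add_mono[OF 2 1]])
  finally have "s\<^sup>2 * (3 * e) \<le> s\<^sup>2 * (2 * e)" by (simp add: e_def)
  then show False using e s by simp
qed

section \<open>Smooth maps on open sets\<close>

definition Cinf :: "('a::euclidean_space \<Rightarrow> 'b::real_normed_vector) \<Rightarrow> 'a set \<Rightarrow> bool" where
  "Cinf f U \<longleftrightarrow> (\<forall>n. Ck_on n f U)"

lemma Cinf_subset: "Cinf f U \<Longrightarrow> T \<subseteq> U \<Longrightarrow> Cinf f T"
  unfolding Cinf_def using Ck_on_subset by blast

lemma Cinf_cong: "open U \<Longrightarrow> (\<And>x. x \<in> U \<Longrightarrow> f x = g x) \<Longrightarrow> Cinf f U \<Longrightarrow> Cinf g U"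
  unfolding Cinf_def using Ck_on_cong[of U f g] by blast

lemma Cinf_local:
  assumes "\<And>x. x \<in> U \<Longrightarrow> \<exists>V. open V \<and> x \<in> V \<and> Cinf f V"
  shows "Cinf f U"
  unfolding Cinf_def
proof
  fix n
  show "Ck_on n f U"
  proof (rule Ck_on_local)
    fix x assume "x \<in> U"
    then show "\<exists>V. open V \<and> x \<in> V \<and> Ck_on n f V" using assms unfolding Cinf_def by blast
  qed
qed

lemma Cinf_compose:
  fixes f :: "'b::euclidean_space \<Rightarrow> 'c::real_normed_vector" and g :: "'a::euclidean_space \<Rightarrow> 'b"
  shows "open U \<Longrightarrow> open V \<Longrightarrow> g ` U \<subseteq> V \<Longrightarrow> Cinf f V \<Longrightarrow> Cinf g U \<Longrightarrow> Cinf (\<lambda>x. f (g x)) U"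
  unfolding Cinf_def using Ck_on_compose[of U V g] by blast

lemma Cinf_Pair: "open U \<Longrightarrow> Cinf f U \<Longrightarrow> Cinf g U \<Longrightarrow> Cinf (\<lambda>x. (f x, g x)) U"
  unfolding Cinf_def using Ck_on_Pair by blast

lemma Cinf_bounded_linear: "bounded_linear f \<Longrightarrow> Cinf f U"
  unfolding Cinf_def using Ck_on_bounded_linear by blast

lemma Cinf_const [simp]: "Cinf (\<lambda>x. c) U"
  by (simp add: Cinf_def)

lemma Cinf_add: "open U \<Longrightarrow> Cinf f U \<Longrightarrow> Cinf g U \<Longrightarrow> Cinf (\<lambda>x. f x + g x) U"
  unfolding Cinf_def using Ck_on_add by blast

lemma Cinf_sum: "open U \<Longrightarrow> (\<And>i. i \<in> I \<Longrightarrow> Cinf (f i) U) \<Longrightarrow> Cinf (\<lambda>x. \<Sum>i\<in>I. f i x) U"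
  unfolding Cinf_def using Ck_on_sum[of U I] by blast

lemma Cinf_mult:
  fixes f g :: "'a::euclidean_space \<Rightarrow> 'b::real_normed_algebra"
  shows "open U \<Longrightarrow> Cinf f U \<Longrightarrow> Cinf g U \<Longrightarrow> Cinf (\<lambda>x. f x * g x) U"
  unfolding Cinf_def using Ck_on_mult by blast

lemma Cinf_linear: "bounded_linear h \<Longrightarrow> open U \<Longrightarrow> Cinf g U \<Longrightarrow> Cinf (\<lambda>x. h (g x)) U"
  unfolding Cinf_def using bounded_linear.Ck_on_linear by blast

lemma Cinf_has_derivative: "Cinf f U \<Longrightarrow> x \<in> U \<Longrightarrow> (f has_derivative frechet_derivative f (at x)) (at x)"
  unfolding Cinf_def using Ck_on_SucD by blast

lemma Cinf_frechet: "Cinf f U \<Longrightarrow> Cinf (\<lambda>x. frechet_derivative f (at x) v) U"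
  unfolding Cinf_def by (metis Ck_on.simps(2))

lemma Cinf_continuous: "Cinf f U \<Longrightarrow> continuous_on U f"
  unfolding Cinf_def using Ck_on_continuous by blast

text \<open>The case \<open>h x = x\<close> gives smoothness of the Maurer-Cartan form, the case of
  constant \<open>h\<close> that of left-invariant derivatives.\<close>

lemma Cinf_partial:
  fixes G :: "'a::euclidean_space \<times> 'b::euclidean_space \<Rightarrow> 'c::real_normed_vector"
  assumes "open W" "Cinf G W" "open U" "Cinf h U" "\<And>x. x \<in> U \<Longrightarrow> (x, h x) \<in> W"
  shows "Cinf (\<lambda>x. frechet_derivative G (at (x, h x)) (0, v)) U"
proof (rule Cinf_compose[OF assms(3,1)])
  show "Cinf (\<lambda>z. frechet_derivative G (at z) (0, v)) W"
    using assms(2) by (rule Cinf_frechet)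
  show "Cinf (\<lambda>x. (x, h x)) U"
    by (rule Cinf_Pair[OF assms(3) Cinf_bounded_linear[OF bounded_linear_ident] assms(4)])
qed (use assms in auto)

lemma has_derivative_partial:
  fixes G :: "'a::euclidean_space \<times> 'b::euclidean_space \<Rightarrow> 'c::real_normed_vector"
  assumes "Cinf G W" "(x, y) \<in> W"
  shows "((\<lambda>y. G (x, y)) has_derivative (\<lambda>v. frechet_derivative G (at (x, y)) (0, v))) (at y)"
proof -
  have "((\<lambda>y. (x, y)) has_derivative (\<lambda>v. (0, v))) (at y)"
    by (intro derivative_intros)
  from has_derivative_compose[OF this Cinf_has_derivative[OF assms]] show ?thesis by simp
qed

text \<open>Smoothness on an arbitrary set means local extendability, where the extension is not
  determined off the set. A smooth map from an open set into \<open>S\<close> does not see the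
  extension, so the composite is smooth in the ordinary sense. All axioms on charts enter through
  this lemma.\<close>

lemma smooth_on_compose:
  fixes h :: "'a::euclidean_space \<Rightarrow> 'b::euclidean_space" and F :: "'b \<Rightarrow> 'c::real_normed_vector"
  assumes "smooth_on S F" "open W" "Cinf h W" "h ` W \<subseteq> S"
  shows "Cinf (\<lambda>x. F (h x)) W"
proof (rule Cinf_local)
  fix x assume x: "x \<in> W"
  then have hx: "h x \<in> S" using assms(4) by auto
  from assms(1)[unfolded smooth_on_def, rule_format, OF hx]
  obtain U g where U: "open U" "h x \<in> U" "\<forall>n. Ck_on n g U" "\<forall>y\<in>S \<inter> U. g y = F y"
    by (elim exE conjE)
  define V where "V = W \<inter> h -` U"
  have V: "open V" "x \<in> V" "V \<subseteq> W"
    using continuous_open_preimage[OF Cinf_continuous[OF assms(3)] assms(2) U(1)] x U by (auto simp: V_def)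
  have "Cinf (\<lambda>x. g (h x)) V"
    by (rule Cinf_compose[OF V(1) U(1) _ _ Cinf_subset[OF assms(3) V(3)]])
      (use U in \<open>auto simp: V_def Cinf_def\<close>)
  then have "Cinf (\<lambda>x. F (h x)) V"
    by (rule Cinf_cong[OF V(1), rotated]) (use U assms(4) in \<open>auto simp: V_def\<close>)
  then show "\<exists>V. open V \<and> x \<in> V \<and> Cinf (\<lambda>x. F (h x)) V" using V by blast
qed

text \<open>The coordinate functionals of a basis of a subspace, extended linearly to the whole
  space. The extension is arbitrary, hence the choice.\<close>

definition dual_basis :: "'e::euclidean_space list \<Rightarrow> nat \<Rightarrow> 'e \<Rightarrow> real" where
  "dual_basis vs = (SOME co. \<forall>j<length vs. linear (co j) \<and>
     (\<forall>i<length vs. co j (vs ! i) = (if i = j then 1 else 0)))"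

lemma dual_basis:
  assumes "basis_list V vs"
  shows "\<forall>j<length vs. linear (dual_basis vs j) \<and>
     (\<forall>i<length vs. dual_basis vs j (vs ! i) = (if i = j then 1 else 0))"
proof -
  have vs: "distinct vs" "Real_Vector_Spaces.independent (set vs)"
    using assms by (auto simp: basis_list_def)
  have "\<exists>g. linear g \<and> (\<forall>x\<in>set vs. g x = (if x = vs ! j then 1 else 0 :: real))" for j
    by (rule real_vector.linear_independent_extend[OF vs(2)])
  then obtain co where "\<forall>j. linear (co j) \<and> (\<forall>x\<in>set vs. co j x = (if x = vs ! j then 1 else 0 :: real))"
    by metis
  then have "\<exists>co. \<forall>j<length vs. linear (co j) \<and>
     (\<forall>i<length vs. co j (vs ! i) = (if i = j then 1 else 0 :: real))"
    using vs(1) by (intro exI[of _ co]) (auto simp: nth_eq_iff_index_eq)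
  from someI_ex[OF this] show ?thesis unfolding dual_basis_def .
qed

lemma dual_basis_expand:
  assumes "basis_list V vs" "v \<in> V"
  shows "(\<Sum>j<length vs. dual_basis vs j v *\<^sub>R vs ! j) = v"
proof -
  have co: "linear (dual_basis vs j)"
    "i < length vs \<Longrightarrow> dual_basis vs j (vs ! i) = (if i = j then 1 else 0)" if "j < length vs" for i j
    using dual_basis[OF assms(1)] that by blast+
  have lin: "linear (\<lambda>v. \<Sum>j<length vs. dual_basis vs j v *\<^sub>R vs ! j)"
  proof (rule linear_compose_sum, intro ballI)
    fix j assume "j \<in> {..<length vs}"
    then have l: "linear (dual_basis vs j)" by (intro co) simp
    show "linear (\<lambda>v. dual_basis vs j v *\<^sub>R vs ! j)"
      by (rule linearI) (simp_all only: linear_add[OF l] linear_scale[OF l] scaleR_left_distrib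
          real_scaleR_def scaleR_scaleR)
  qed
  have "(\<Sum>j<length vs. dual_basis vs j b *\<^sub>R vs ! j) = id b" if "b \<in> set vs" for b
  proof -
    obtain i where i: "i < length vs" "b = vs ! i" using \<open>b \<in> set vs\<close> unfolding in_set_conv_nth by blast
    have "(\<Sum>j<length vs. dual_basis vs j b *\<^sub>R vs ! j) = (\<Sum>j<length vs. if j = i then vs ! i else 0)"
      by (rule sum.cong[OF refl]) (simp add: co i)
    then show ?thesis using i by simp
  qed
  from this real_vector.linear_eq_on[OF lin linear_id, of v "set vs"] show ?thesis
    using assms unfolding basis_list_def id_def by blast
qed

section \<open>Smooth maps into the group\<close>

locale lie_calculus =
  fixes K :: "('g::t2_space, 'e::euclidean_space) calculus_data"
  assumes setting: "calculus_setting K"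
begin

abbreviation mul (infixl "\<star>" 70) where "x \<star> y \<equiv> x \<otimes>\<^bsub>K\<^esub> y"
abbreviation iv where "iv x \<equiv> inv\<^bsub>K\<^esub> x"
abbreviation e1 where "e1 \<equiv> \<one>\<^bsub>K\<^esub>"
abbreviation uc where "uc \<equiv> unit_chart K"
abbreviation p0 where "p0 \<equiv> snd uc e1"
abbreviation nf where "nf \<equiv> length (frame K)"

text \<open>The images of charts are relatively open in the subspace \<open>model K\<close>. Composing inverse charts with the
  linear projection \<open>pr\<close> onto it gives maps defined on the open sets \<open>chart_dom c\<close> of the whole space.\<close>

definition co where "co = dual_basis (frame K)"
definition pr where "pr e = (\<Sum>j<nf. co j e *\<^sub>R frame K ! j)"
definition cinv where "cinv c a = chart_inv c (pr a)"
definition chart_dom where "chart_dom c = {a. pr a \<in> snd c ` fst c}"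

lemma lie: "compact_lie_group K" using setting by (simp add: calculus_setting_def)

lemma grp: "Group.group K" "carrier K = UNIV" using lie by (auto simp: compact_lie_group_def)

lemma compact_UNIV: "compact (UNIV :: 'g set)" using lie by (auto simp: compact_lie_group_def)

lemma mul_assoc: "x \<star> y \<star> z = x \<star> (y \<star> z)"
  using grp by (simp add: group.is_monoid monoid.m_assoc)

lemma mul_simps [simp]:
  "e1 \<star> x = x" "x \<star> e1 = x" "x \<star> iv x = e1" "iv x \<star> x = e1"
  "x \<star> (iv x \<star> y) = y" "iv x \<star> (x \<star> y) = y" "iv (iv x) = x" "iv e1 = e1"
  using grp by (simp_all add: group.is_monoid group.r_inv group.l_inv group.inv_inv monoid.inv_one
    flip: mul_assoc)

lemma uc: "uc \<in> atlas K" "e1 \<in> fst uc" using setting by (auto simp: calculus_setting_def)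

lemma frame: "basis_list (model K) (frame K)" using setting by (auto simp: calculus_setting_def)

lemma sub_model: "Real_Vector_Spaces.subspace (model K)" using lie by (auto simp: compact_lie_group_def)

lemma co_lin: "j < nf \<Longrightarrow> linear (co j)" and
  co_frame: "j < nf \<Longrightarrow> i < nf \<Longrightarrow> co j (frame K ! i) = (if i = j then 1 else 0)"
  using dual_basis[OF frame] by (auto simp: co_def)

lemma co_bl: "j < nf \<Longrightarrow> bounded_linear (co j)"
  using co_lin linear_conv_bounded_linear by blast

lemma frame_model: "j < nf \<Longrightarrow> frame K ! j \<in> model K"
  using frame unfolding basis_list_def by (metis nth_mem real_vector.span_base)

lemma pr_bl: "bounded_linear pr"
  unfolding pr_def
  by (intro bounded_linear_sum bounded_linear_scaleR_const co_bl) auto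

lemma pr_model: "pr v \<in> model K"
  unfolding pr_def
  by (intro real_vector.subspace_sum real_vector.subspace_scale sub_model frame_model) auto

lemma pr_id: "v \<in> model K \<Longrightarrow> pr v = v"
  unfolding pr_def co_def by (rule dual_basis_expand[OF frame])

lemma pr_pr [simp]: "pr (pr v) = pr v" by (rule pr_id[OF pr_model])

lemma co_pr [simp]: "j < nf \<Longrightarrow> co j (pr v) = co j v"
proof -
  assume j: "j < nf"
  have "co j (pr v) = (\<Sum>i<nf. co i v * co j (frame K ! i))"
    unfolding pr_def linear_sum[OF co_lin[OF j]] by (simp add: linear_scale[OF co_lin[OF j]])
  also have "\<dots> = (\<Sum>i<nf. if i = j then co i v else 0)" using j by (intro sum.cong) (auto simp: co_frame)
  finally show ?thesis using j by simp
qed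

lemma atl: "smooth_atlas (model K) (atlas K)" using lie by (auto simp: compact_lie_group_def)

lemma chart_open: "c \<in> atlas K \<Longrightarrow> open (fst c)"
  and chart_image: "c \<in> atlas K \<Longrightarrow> openin (top_of_set (model K)) (snd c ` fst c)"
  and chart_homeo: "c \<in> atlas K \<Longrightarrow> homeomorphism (fst c) (snd c ` fst c) (snd c) (chart_inv c)"
  using atl unfolding smooth_atlas_def by blast+

lemma atlas_cover: obtains c where "c \<in> atlas K" "x \<in> fst c"
  using atl unfolding smooth_atlas_def by blast

lemma chart_model: "c \<in> atlas K \<Longrightarrow> x \<in> fst c \<Longrightarrow> snd c x \<in> model K"
  using openin_imp_subset[OF chart_image] by blast

lemma pr_chart [simp]: "c \<in> atlas K \<Longrightarrow> x \<in> fst c \<Longrightarrow> pr (snd c x) = snd c x"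
  by (intro pr_id chart_model)

lemma chart_in_dom: "c \<in> atlas K \<Longrightarrow> x \<in> fst c \<Longrightarrow> snd c x \<in> chart_dom c"
  by (simp add: chart_dom_def)

lemma chart_inv_chart [simp]: "c \<in> atlas K \<Longrightarrow> x \<in> fst c \<Longrightarrow> chart_inv c (snd c x) = x"
  by (metis chart_homeo homeomorphism_apply1)

lemma cinv_chart [simp]: "c \<in> atlas K \<Longrightarrow> x \<in> fst c \<Longrightarrow> cinv c (snd c x) = x"
  by (simp add: cinv_def)

lemma cinv_in_chart: "c \<in> atlas K \<Longrightarrow> a \<in> chart_dom c \<Longrightarrow> cinv c a \<in> fst c"
  by (auto simp: cinv_def chart_dom_def)

lemma chart_cinv: "c \<in> atlas K \<Longrightarrow> a \<in> chart_dom c \<Longrightarrow> snd c (cinv c a) = pr a"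
  by (auto simp: cinv_def chart_dom_def)

lemma cinv_pr [simp]: "cinv c (pr a) = cinv c a" by (simp add: cinv_def)

lemma pr_cont: "continuous_on S pr" by (rule linear_continuous_on[OF pr_bl])

lemma chart_dom_open: assumes "c \<in> atlas K" shows "open (chart_dom c)"
proof -
  obtain T where T: "open T" "snd c ` fst c = T \<inter> model K"
    using chart_image[OF assms] by (auto simp: openin_subtopology)
  have "chart_dom c = pr -` T" using T(2) pr_model by (auto simp: chart_dom_def)
  then show ?thesis using open_vimage[OF T(1) pr_cont] by simp
qed

lemma chart_cont: "c \<in> atlas K \<Longrightarrow> continuous_on (fst c) (snd c)"
  using chart_homeo by (auto simp: homeomorphism_def)

lemma cinv_cont: assumes "c \<in> atlas K" shows "continuous_on (chart_dom c) (cinv c)"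
  unfolding cinv_def
  by (rule continuous_on_compose2[OF _ pr_cont, of "snd c ` fst c"])
    (use chart_homeo[OF assms] in \<open>auto simp: homeomorphism_def chart_dom_def\<close>)

lemma p0_dom: "p0 \<in> chart_dom uc" "cinv uc p0 = e1" using uc chart_in_dom by auto

lemma mul_cont: "continuous_on UNIV (\<lambda>(x, y). x \<star> y)" and iv_cont: "continuous_on UNIV iv"
  using lie by (auto simp: compact_lie_group_def)

lemma mul_cont2: "continuous_on S f \<Longrightarrow> continuous_on S g \<Longrightarrow> continuous_on S (\<lambda>s. f s \<star> g s)"
  using continuous_on_compose2[OF mul_cont continuous_on_Pair[of S f g]] by auto

lemma iv_cont2: "continuous_on S f \<Longrightarrow> continuous_on S (\<lambda>s. iv (f s))"
  using continuous_on_compose2[OF iv_cont, of S f] by auto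

text \<open>Continuity is a separate requirement: it makes the preimages of chart domains open, so
  that \<open>Cinf\<close> on them is meaningful.\<close>

definition gsmooth :: "'x::euclidean_space set \<Rightarrow> ('x \<Rightarrow> 'g) \<Rightarrow> bool" where
  "gsmooth W X \<longleftrightarrow> open W \<and> continuous_on W X \<and>
     (\<forall>c\<in>atlas K. Cinf (\<lambda>s. snd c (X s)) (W \<inter> X -` fst c))"

lemma gsmoothD:
  assumes "gsmooth W X"
  shows "open W" "continuous_on W X" "c \<in> atlas K \<Longrightarrow> Cinf (\<lambda>s. snd c (X s)) (W \<inter> X -` fst c)"
    "open T \<Longrightarrow> open (W \<inter> X -` T)"
  using assms continuous_open_preimage[of W X T] by (auto simp: gsmooth_def)

text \<open>Multiplication is given as smooth only in terms of charts. Around each \<open>s\<close>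
  the maps are therefore restricted to an open set on which \<open>X\<close>, \<open>Y\<close> and
  their product each stay in one chart.\<close>

lemma gsmooth_mul:
  assumes X: "gsmooth W X" and Y: "gsmooth W Y"
  shows "gsmooth W (\<lambda>s. X s \<star> Y s)"
  unfolding gsmooth_def
proof (intro conjI ballI)
  show oW: "open W" by (rule gsmoothD[OF X])
  show cont: "continuous_on W (\<lambda>s. X s \<star> Y s)" using X Y by (intro mul_cont2 gsmoothD)
  fix c assume c: "c \<in> atlas K"
  let ?XY = "\<lambda>s. X s \<star> Y s"
  show "Cinf (\<lambda>s. snd c (?XY s)) (W \<inter> ?XY -` fst c)"
  proof (rule Cinf_local)
    fix s assume s: "s \<in> W \<inter> ?XY -` fst c"
    obtain a b where ab: "a \<in> atlas K" "X s \<in> fst a" "b \<in> atlas K" "Y s \<in> fst b"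
      using atlas_cover by metis
    define V where "V = (W \<inter> X -` fst a) \<inter> (W \<inter> Y -` fst b) \<inter> (W \<inter> ?XY -` fst c)"
    have V: "open V" "s \<in> V"
      unfolding V_def
      by (rule open_Int[OF open_Int[OF gsmoothD(4)[OF X chart_open[OF ab(1)]]
            gsmoothD(4)[OF Y chart_open[OF ab(3)]]] continuous_open_preimage[OF cont oW chart_open[OF c]]])
        (use s ab in simp)
    let ?h = "\<lambda>s. (snd a (X s), snd b (Y s))"
    have h: "Cinf ?h V"
      by (intro Cinf_Pair[OF V(1)] Cinf_subset[OF gsmoothD(3)[OF X ab(1)]] Cinf_subset[OF gsmoothD(3)[OF Y ab(3)]])
        (auto simp: V_def)
    have "smooth_on {(snd a x, snd b y) | x y. x \<in> fst a \<and> y \<in> fst b \<and> x \<star> y \<in> fst c}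
          (\<lambda>(u, v). snd c (chart_inv a u \<star> chart_inv b v))"
      using lie ab c by (auto simp: compact_lie_group_def)
    from smooth_on_compose[OF this V(1) h]
    have "Cinf (\<lambda>s. snd c (chart_inv a (snd a (X s)) \<star> chart_inv b (snd b (Y s)))) V"
      by (auto simp: V_def)
    then have "Cinf (\<lambda>s. snd c (?XY s)) V"
      by (rule Cinf_cong[OF V(1), rotated]) (use ab in \<open>auto simp: V_def\<close>)
    then show "\<exists>V. open V \<and> s \<in> V \<and> Cinf (\<lambda>s. snd c (?XY s)) V" using V by blast
  qed
qed

lemma gsmooth_iv:
  assumes X: "gsmooth W X"
  shows "gsmooth W (\<lambda>s. iv (X s))"
  unfolding gsmooth_def
proof (intro conjI ballI)
  show oW: "open W" by (rule gsmoothD[OF X])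
  show cont: "continuous_on W (\<lambda>s. iv (X s))" using X by (intro iv_cont2 gsmoothD)
  fix c assume c: "c \<in> atlas K"
  show "Cinf (\<lambda>s. snd c (iv (X s))) (W \<inter> (\<lambda>s. iv (X s)) -` fst c)"
  proof (rule Cinf_local)
    fix s assume s: "s \<in> W \<inter> (\<lambda>s. iv (X s)) -` fst c"
    obtain a where a: "a \<in> atlas K" "X s \<in> fst a" using atlas_cover by metis
    define V where "V = (W \<inter> X -` fst a) \<inter> (W \<inter> (\<lambda>s. iv (X s)) -` fst c)"
    have V: "open V" "s \<in> V"
      unfolding V_def
      by (rule open_Int[OF gsmoothD(4)[OF X chart_open[OF a(1)]]
            continuous_open_preimage[OF cont oW chart_open[OF c]]])
        (use s a in simp)
    have h: "Cinf (\<lambda>s. snd a (X s)) V"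
      by (intro Cinf_subset[OF gsmoothD(3)[OF X a(1)]]) (auto simp: V_def)
    have "smooth_on {snd a x | x. x \<in> fst a \<and> iv x \<in> fst c} (\<lambda>u. snd c (iv (chart_inv a u)))"
      using lie a c by (auto simp: compact_lie_group_def)
    from smooth_on_compose[OF this V(1) h]
    have "Cinf (\<lambda>s. snd c (iv (chart_inv a (snd a (X s))))) V"
      by (auto simp: V_def)
    then have "Cinf (\<lambda>s. snd c (iv (X s))) V"
      by (rule Cinf_cong[OF V(1), rotated]) (use a in \<open>auto simp: V_def\<close>)
    then show "\<exists>V. open V \<and> s \<in> V \<and> Cinf (\<lambda>s. snd c (iv (X s))) V" using V by blast
  qed
qed

lemma gsmooth_const: "open W \<Longrightarrow> gsmooth W (\<lambda>s. x)"
  by (simp add: gsmooth_def)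

lemma gsmooth_compose:
  assumes X: "gsmooth V X" and h: "Cinf h W" "open W" "h ` W \<subseteq> V"
  shows "gsmooth W (\<lambda>s. X (h s))"
  unfolding gsmooth_def
proof (intro conjI ballI)
  show cont: "continuous_on W (\<lambda>s. X (h s))"
    using continuous_on_compose2[OF gsmoothD(2)[OF X] Cinf_continuous[OF h(1)] h(3)] .
  fix c assume c: "c \<in> atlas K"
  show "Cinf (\<lambda>s. snd c (X (h s))) (W \<inter> (\<lambda>s. X (h s)) -` fst c)"
    by (rule Cinf_compose[OF _ gsmoothD(4)[OF X chart_open[OF c]] _ gsmoothD(3)[OF X c] Cinf_subset[OF h(1)]])
      (use h chart_open[OF c] continuous_open_preimage[OF cont] in auto)
qed (rule h)

lemma gsmooth_cinv:
  assumes a: "a \<in> atlas K"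
  shows "gsmooth (chart_dom a) (cinv a)"
  unfolding gsmooth_def
proof (intro conjI ballI)
  fix c assume c: "c \<in> atlas K"
  have "smooth_on (snd a ` (fst a \<inter> fst c)) (\<lambda>u. snd c (chart_inv a u))"
    using atl a c by (auto simp: smooth_atlas_def)
  then show "Cinf (\<lambda>s. snd c (cinv a s)) (chart_dom a \<inter> cinv a -` fst c)"
    unfolding cinv_def
  proof (rule smooth_on_compose)
    show "open (chart_dom a \<inter> (\<lambda>s. chart_inv a (pr s)) -` fst c)"
      using continuous_open_preimage[OF cinv_cont[OF a] chart_dom_open[OF a] chart_open[OF c]]
      by (simp add: cinv_def[abs_def])
    show "pr ` (chart_dom a \<inter> (\<lambda>s. chart_inv a (pr s)) -` fst c) \<subseteq> snd a ` (fst a \<inter> fst c)"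
      using a by (auto simp: chart_dom_def)
  qed (rule Cinf_bounded_linear[OF pr_bl])
qed (use a in \<open>auto intro: chart_dom_open cinv_cont\<close>)

lemma smooth_fun_gsmooth:
  assumes f: "smooth_fun K f" and X: "gsmooth W X"
  shows "Cinf (\<lambda>s. f (X s)) W"
proof (rule Cinf_local)
  fix s assume s: "s \<in> W"
  obtain a where a: "a \<in> atlas K" "X s \<in> fst a" using atlas_cover by metis
  define V where "V = W \<inter> X -` fst a"
  have V: "open V" "s \<in> V" using s a gsmoothD(4)[OF X chart_open[OF a(1)]] by (simp_all add: V_def)
  have "smooth_on (snd a ` fst a) (\<lambda>u. f (chart_inv a u))" using f a by (auto simp: smooth_fun_def)
  from smooth_on_compose[OF this V(1)] gsmoothD(3)[OF X a(1)]
  have "Cinf (\<lambda>s. f (chart_inv a (snd a (X s)))) V" by (auto simp: V_def)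
  then have "Cinf (\<lambda>s. f (X s)) V"
    by (rule Cinf_cong[OF V(1), rotated]) (use a in \<open>auto simp: V_def\<close>)
  then show "\<exists>V. open V \<and> s \<in> V \<and> Cinf (\<lambda>s. f (X s)) V" using V by blast
qed

lemma smooth_funI:
  assumes "\<And>c. c \<in> atlas K \<Longrightarrow> Cinf (\<lambda>a. f (cinv c a)) (chart_dom c)"
  shows "smooth_fun K f"
  unfolding smooth_fun_def smooth_on_def
proof (intro ballI)
  fix c x assume c: "c \<in> atlas K" and x: "x \<in> snd c ` fst c"
  have "\<forall>y\<in>snd c ` fst c \<inter> chart_dom c. f (cinv c y) = f (chart_inv c y)" using c by auto
  moreover have "\<forall>n. Ck_on n (\<lambda>a. f (cinv c a)) (chart_dom c)" using assms[OF c] by (simp add: Cinf_def)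
  ultimately show "\<exists>U g. open U \<and> x \<in> U \<and> (\<forall>n. Ck_on n g U) \<and> (\<forall>y\<in>snd c ` fst c \<inter> U. g y = f (chart_inv c y))"
    using chart_dom_open[OF c] c x chart_in_dom[OF c] by (intro exI[of _ "chart_dom c"] exI[of _ "\<lambda>a. f (cinv c a)"]) auto
qed

lemma smooth_fun_cinv: "smooth_fun K f \<Longrightarrow> c \<in> atlas K \<Longrightarrow> Cinf (\<lambda>a. f (cinv c a)) (chart_dom c)"
  by (rule smooth_fun_gsmooth[OF _ gsmooth_cinv])

lemma smooth_fun_const [simp]: "smooth_fun K (\<lambda>x. c)"
  by (intro smooth_funI) simp

lemma smooth_fun_add: "smooth_fun K f \<Longrightarrow> smooth_fun K g \<Longrightarrow> smooth_fun K (\<lambda>x. f x + g x)"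
  by (rule smooth_funI, rule Cinf_add[OF chart_dom_open smooth_fun_cinv smooth_fun_cinv])

lemma smooth_fun_mult: "smooth_fun K f \<Longrightarrow> smooth_fun K g \<Longrightarrow> smooth_fun K (\<lambda>x. f x * g x)"
  by (rule smooth_funI, rule Cinf_mult[OF chart_dom_open smooth_fun_cinv smooth_fun_cinv])

lemma smooth_fun_sum: "(\<And>i. i \<in> I \<Longrightarrow> smooth_fun K (f i)) \<Longrightarrow> smooth_fun K (\<lambda>x. \<Sum>i\<in>I. f i x)"
  by (rule smooth_funI, rule Cinf_sum[OF chart_dom_open smooth_fun_cinv])

lemma smooth_fun_continuous:
  assumes "smooth_fun K f"
  shows "continuous_on UNIV f"
proof -
  have "isCont f x" for x
  proof -
    obtain c where c: "c \<in> atlas K" "x \<in> fst c" using atlas_cover by metis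
    have "continuous_on (chart_dom c) (\<lambda>a. f (cinv c a))"
      by (intro Cinf_continuous smooth_fun_cinv assms c)
    from continuous_on_compose2[OF this chart_cont[OF c(1)]] c
    have "continuous_on (fst c) (\<lambda>x. f (cinv c (snd c x)))" using chart_in_dom[OF c(1)] by blast
    then have "continuous_on (fst c) f"
      by (rule continuous_on_eq) (use c in auto)
    then show ?thesis using c chart_open by (simp add: continuous_on_eq_continuous_at)
  qed
  then show ?thesis by (simp add: continuous_at_imp_continuous_on)
qed

section \<open>Left-invariant derivatives\<close>

text \<open>Differentiability of all left translates of \<open>f\<close> at the unit; the differential of \<open>f\<close> is thus expressed in
  the left-invariant coframe, independently of charts.\<close>

definition has_left_derivs :: "('g \<Rightarrow> complex) \<Rightarrow> (nat \<Rightarrow> 'g \<Rightarrow> complex) \<Rightarrow> bool" where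
  "has_left_derivs f f' \<longleftrightarrow> (\<forall>x. ((\<lambda>b. f (x \<star> cinv uc b)) has_derivative (\<lambda>e. \<Sum>j<nf. co j e *\<^sub>R f' j x)) (at p0))"

text \<open>\<open>mc_form c j\<close> are the components of the left Maurer-Cartan form in the chart \<open>c\<close>: the derivative of
  \<open>x\<^sup>-\<^sup>1 x'\<close> with respect to \<open>x'\<close> at \<open>x' = x\<close>.\<close>

definition left_div where "left_div c z = snd uc (iv (cinv c (fst z)) \<star> cinv c (snd z))"

definition left_div_dom where
  "left_div_dom c = chart_dom c \<times> chart_dom c \<inter> (\<lambda>z. iv (cinv c (fst z)) \<star> cinv c (snd z)) -` fst uc"

definition mc_form where "mc_form c j a e = co j (frechet_derivative (left_div c) (at (a, a)) (0, e))"

lemma left_div_gsmooth: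
  assumes c: "c \<in> atlas K"
  shows "gsmooth (chart_dom c \<times> chart_dom c) (\<lambda>z. iv (cinv c (fst z)) \<star> cinv c (snd z))"
proof -
  have o: "open (chart_dom c \<times> chart_dom c)" using chart_dom_open[OF c] by (intro open_Times)
  have 1: "gsmooth (chart_dom c \<times> chart_dom c) (\<lambda>z. cinv c (fst z))"
    by (rule gsmooth_compose[OF gsmooth_cinv[OF c] Cinf_bounded_linear[OF bounded_linear_fst] o]) auto
  have 2: "gsmooth (chart_dom c \<times> chart_dom c) (\<lambda>z. cinv c (snd z))"
    by (rule gsmooth_compose[OF gsmooth_cinv[OF c] Cinf_bounded_linear[OF bounded_linear_snd] o]) auto
  show ?thesis by (rule gsmooth_mul[OF gsmooth_iv[OF 1] 2])
qed

lemma left_div_smooth: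
  assumes c: "c \<in> atlas K"
  shows "open (left_div_dom c)" "Cinf (left_div c) (left_div_dom c)"
  using gsmoothD(4)[OF left_div_gsmooth[OF c] chart_open[OF uc(1)]] gsmoothD(3)[OF left_div_gsmooth[OF c] uc(1)]
  by (simp_all add: left_div_dom_def left_div_def[abs_def])

lemma left_div_dom_diag: "a \<in> chart_dom c \<Longrightarrow> (a, a) \<in> left_div_dom c"
  using uc by (simp add: left_div_dom_def)

lemma left_div_derivative:
  assumes c: "c \<in> atlas K" and a: "a \<in> chart_dom c"
  shows "((\<lambda>a'. left_div c (a, a')) has_derivative (\<lambda>e. frechet_derivative (left_div c) (at (a, a)) (0, e))) (at a)"
  by (rule has_derivative_partial[OF left_div_smooth(2)[OF c] left_div_dom_diag[OF a]])

lemma mc_form_bl: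
  assumes "c \<in> atlas K" "a \<in> chart_dom c" "j < nf"
  shows "bounded_linear (mc_form c j a)"
  unfolding mc_form_def
  by (rule bounded_linear_compose[OF co_bl has_derivative_bounded_linear[OF left_div_derivative]])
    (use assms in auto)

lemma mc_form_smooth:
  assumes c: "c \<in> atlas K" and j: "j < nf"
  shows "Cinf (\<lambda>a. mc_form c j a e) (chart_dom c)"
  unfolding mc_form_def
  by (rule Cinf_linear[OF co_bl[OF j] chart_dom_open[OF c]],
      rule Cinf_partial[OF left_div_smooth[OF c] chart_dom_open[OF c] Cinf_bounded_linear[OF bounded_linear_ident]])
    (rule left_div_dom_diag)

text \<open>Near \<open>a\<close>, the point \<open>y \<star> cinv c a'\<close> is
  \<open>x = y \<star> cinv c a\<close> times the group element whose unit-chart coordinate is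
  \<open>left_div c (a, a')\<close>; the chain rule thus transports the differential from the unit.
  The coefficients depend neither on \<open>f\<close> nor on \<open>y\<close>, which is the source
  of all bounds uniform over the group.\<close>

lemma has_left_derivs_chart:
  assumes f: "has_left_derivs f f'" and c: "c \<in> atlas K" and a: "a \<in> chart_dom c"
  shows "((\<lambda>a'. f (y \<star> cinv c a')) has_derivative
    (\<lambda>e. \<Sum>j<nf. mc_form c j a e *\<^sub>R f' j (y \<star> cinv c a))) (at a)"
proof -
  define x where "x = y \<star> cinv c a"
  have t: "left_div c (a, a) = p0" by (simp add: left_div_def)
  have g: "((\<lambda>b. f (x \<star> cinv uc b)) has_derivative (\<lambda>e. \<Sum>j<nf. co j e *\<^sub>R f' j x)) (at (left_div c (a, a)))"
    using f unfolding has_left_derivs_def t by blast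
  have "((\<lambda>a'. f (x \<star> cinv uc (left_div c (a, a')))) has_derivative
    (\<lambda>e. \<Sum>j<nf. mc_form c j a e *\<^sub>R f' j x)) (at a)"
    unfolding mc_form_def by (rule has_derivative_compose[OF left_div_derivative[OF c a] g])
  then show ?thesis unfolding x_def[symmetric]
  proof (rule has_derivative_transform_within_open)
    show "open (Pair a -` left_div_dom c)"
      by (rule open_vimage[OF left_div_smooth(1)[OF c]]) (intro continuous_intros)
    show "a \<in> Pair a -` left_div_dom c" using left_div_dom_diag[OF a] by simp
    fix a' assume "a' \<in> Pair a -` left_div_dom c"
    then have "iv (cinv c a) \<star> cinv c a' \<in> fst uc" by (simp add: left_div_dom_def)
    then have "cinv uc (left_div c (a, a')) = iv (cinv c a) \<star> cinv c a'"
      using uc by (simp add: left_div_def)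
    then show "f (x \<star> cinv uc (left_div c (a, a'))) = f (y \<star> cinv c a')"
      by (simp add: x_def mul_assoc)
  qed
qed

lemma unit_curve_cinv: "v \<in> model K \<Longrightarrow> unit_curve K v t = cinv uc (p0 + t *\<^sub>R v)"
  unfolding unit_curve_def cinv_def
  by (subst pr_id)
    (auto intro!: real_vector.subspace_add real_vector.subspace_scale sub_model chart_model uc)

lemma left_deriv_eq:
  assumes v: "v \<in> model K" and D: "((\<lambda>b. f (x \<star> cinv uc b)) has_derivative D) (at p0)"
  shows "left_deriv K v f x = D v"
proof -
  have D': "((\<lambda>b. f (x \<star> cinv uc b)) has_derivative D) (at (p0 + 0 *\<^sub>R v))" using D by simp
  have "((\<lambda>t. p0 + t *\<^sub>R v) has_derivative (\<lambda>t. t *\<^sub>R v)) (at 0)"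
    by (auto intro!: derivative_eq_intros)
  from has_derivative_compose[OF this D']
  have "((\<lambda>t. f (x \<star> cinv uc (p0 + t *\<^sub>R v))) has_vector_derivative D v) (at 0)"
    unfolding has_vector_derivative_def linear_scale[OF has_derivative_linear[OF D]] .
  then show ?thesis
    unfolding left_deriv_def unit_curve_cinv[OF v] by (rule vector_derivative_at)
qed

lemma has_left_derivs_left_deriv:
  assumes "has_left_derivs f f'" "j < nf"
  shows "left_deriv K (frame K ! j) f = f' j"
proof
  fix x
  have "left_deriv K (frame K ! j) f x = (\<Sum>i<nf. co i (frame K ! j) *\<^sub>R f' i x)"
    using assms unfolding has_left_derivs_def by (intro left_deriv_eq frame_model) auto
  also have "\<dots> = (\<Sum>i<nf. if i = j then f' i x else 0)"
    using assms(2) by (intro sum.cong) (auto simp: co_frame)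
  finally show "left_deriv K (frame K ! j) f x = f' j x" using assms(2) by simp
qed

lemma pr_p0 [simp]: "pr p0 = p0"
  using uc by simp

text \<open>\<open>cinv uc\<close> factors through \<open>pr\<close>, which fixes \<open>p0\<close>.
  Differentiating with and without \<open>pr\<close> must give the same map, so only the component
  of the direction in \<open>model K\<close> counts.\<close>

lemma translate_derivative_pr:
  assumes "((\<lambda>b. f (x \<star> cinv uc b)) has_derivative D) (at p0)"
  shows "D (pr e) = D e"
proof -
  have D': "((\<lambda>b. f (x \<star> cinv uc b)) has_derivative D) (at (pr p0))" using assms by simp
  have "((\<lambda>b. f (x \<star> cinv uc (pr b))) has_derivative (\<lambda>e. D (pr e))) (at p0)"
    by (rule has_derivative_compose[OF bounded_linear_imp_has_derivative[OF pr_bl] D'])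
  then have "((\<lambda>b. f (x \<star> cinv uc b)) has_derivative (\<lambda>e. D (pr e))) (at p0)" by simp
  from has_derivative_unique[OF this assms] show ?thesis by metis
qed

lemma translate_smooth:
  assumes "smooth_fun K f" "c \<in> atlas K"
  shows "Cinf (\<lambda>b. f (x \<star> cinv c b)) (chart_dom c)"
  using assms by (intro smooth_fun_gsmooth[OF assms(1) gsmooth_mul] gsmooth_const gsmooth_cinv chart_dom_open)

lemma translate_derivative:
  assumes "smooth_fun K f"
  obtains D where "((\<lambda>b. f (x \<star> cinv uc b)) has_derivative D) (at p0)"
  using Cinf_has_derivative[OF translate_smooth[OF assms uc(1)] p0_dom(1)] by blast

lemma derivative_frame_expand:
  assumes D: "((\<lambda>b. f (x \<star> cinv uc b)) has_derivative D) (at p0)"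
  shows "D e = (\<Sum>j<nf. co j e *\<^sub>R left_deriv K (frame K ! j) f x)"
proof -
  have lin: "linear D" by (rule has_derivative_linear[OF D])
  have "D e = D (\<Sum>j<nf. co j e *\<^sub>R frame K ! j)"
    using translate_derivative_pr[OF D, of e] by (simp add: pr_def)
  also have "\<dots> = (\<Sum>j<nf. co j e *\<^sub>R D (frame K ! j))"
    unfolding linear_sum[OF lin] linear_scale[OF lin] ..
  also have "\<dots> = (\<Sum>j<nf. co j e *\<^sub>R left_deriv K (frame K ! j) f x)"
    by (rule sum.cong[OF refl]) (simp add: left_deriv_eq[OF frame_model D])
  finally show ?thesis .
qed

lemma smooth_has_left_derivs:
  assumes "smooth_fun K f"
  shows "has_left_derivs f (\<lambda>j. left_deriv K (frame K ! j) f)"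
  unfolding has_left_derivs_def
proof
  fix x
  obtain D where D: "((\<lambda>b. f (x \<star> cinv uc b)) has_derivative D) (at p0)"
    using translate_derivative[OF assms] .
  then show "((\<lambda>b. f (x \<star> cinv uc b)) has_derivative
      (\<lambda>e. \<Sum>j<nf. co j e *\<^sub>R left_deriv K (frame K ! j) f x)) (at p0)"
    by (simp only: derivative_frame_expand[OF D, symmetric])
qed

text \<open>The function \<open>G\<close> of base point and increment is jointly smooth. Its partial
  derivative in the increment at \<open>p0\<close> is the left derivative, as a function of the base
  point.\<close>

lemma smooth_left_deriv:
  assumes f: "smooth_fun K f" and v: "v \<in> model K"
  shows "smooth_fun K (left_deriv K v f)"
proof (rule smooth_funI)
  fix c assume c: "c \<in> atlas K"
  define W where "W = chart_dom c \<times> chart_dom uc"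
  have W: "open W" unfolding W_def by (intro open_Times chart_dom_open c uc)
  define G where "G z = f (cinv c (fst z) \<star> cinv uc (snd z))" for z
  have 1: "gsmooth W (\<lambda>z. cinv c (fst z))"
    by (rule gsmooth_compose[OF gsmooth_cinv[OF c] Cinf_bounded_linear[OF bounded_linear_fst] W])
      (auto simp: W_def)
  have 2: "gsmooth W (\<lambda>z. cinv uc (snd z))"
    by (rule gsmooth_compose[OF gsmooth_cinv[OF uc(1)] Cinf_bounded_linear[OF bounded_linear_snd] W])
      (auto simp: W_def)
  have G: "Cinf G W" unfolding G_def by (rule smooth_fun_gsmooth[OF f gsmooth_mul[OF 1 2]])
  have inW: "(a, p0) \<in> W" if "a \<in> chart_dom c" for a using that p0_dom by (simp add: W_def)
  have "Cinf (\<lambda>a. frechet_derivative G (at (a, p0)) (0, v)) (chart_dom c)"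
    by (rule Cinf_partial[OF W G chart_dom_open[OF c] Cinf_const inW])
  then show "Cinf (\<lambda>a. left_deriv K v f (cinv c a)) (chart_dom c)"
  proof (rule Cinf_cong[OF chart_dom_open[OF c], rotated])
    fix a assume a: "a \<in> chart_dom c"
    have "(\<lambda>b. G (a, b)) = (\<lambda>b. f (cinv c a \<star> cinv uc b))" by (simp add: G_def)
    from left_deriv_eq[OF v has_derivative_partial[OF G inW[OF a], unfolded this]]
    show "frechet_derivative G (at (a, p0)) (0, v) = left_deriv K v f (cinv c a)" by simp
  qed
qed

lemma left_deriv_add:
  assumes "smooth_fun K f" "smooth_fun K g" "v \<in> model K"
  shows "left_deriv K v (\<lambda>x. f x + g x) = (\<lambda>x. left_deriv K v f x + left_deriv K v g x)"
proof
  fix x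
  obtain D D' where D: "((\<lambda>b. f (x \<star> cinv uc b)) has_derivative D) (at p0)"
    "((\<lambda>b. g (x \<star> cinv uc b)) has_derivative D') (at p0)"
    using translate_derivative assms(1,2) by metis
  show "left_deriv K v (\<lambda>x. f x + g x) x = left_deriv K v f x + left_deriv K v g x"
    unfolding left_deriv_eq[OF assms(3) D(1)] left_deriv_eq[OF assms(3) D(2)]
    by (rule left_deriv_eq[OF assms(3) has_derivative_add[OF D]])
qed

lemma left_deriv_cmult:
  assumes "smooth_fun K f" "v \<in> model K"
  shows "left_deriv K v (\<lambda>x. c * f x) = (\<lambda>x. c * left_deriv K v f x)"
proof
  fix x
  obtain D where D: "((\<lambda>b. f (x \<star> cinv uc b)) has_derivative D) (at p0)"
    using translate_derivative assms(1) by metis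
  show "left_deriv K v (\<lambda>x. c * f x) x = c * left_deriv K v f x"
    unfolding left_deriv_eq[OF assms(2) D]
    by (rule left_deriv_eq[OF assms(2) has_derivative_mult_right[OF D]])
qed

section \<open>Words in the frame and their reduction to ordered monomials\<close>

definition word :: "nat list \<Rightarrow> ('g \<Rightarrow> complex) \<Rightarrow> 'g \<Rightarrow> complex" where
  "word w = foldr (\<lambda>i. left_deriv K (frame K ! i)) w"

lemma word_simps [simp]: "word [] f = f" "word (i # w) f = left_deriv K (frame K ! i) (word w f)"
  by (simp_all add: word_def)

lemma word_append: "word (u @ w) f = word u (word w f)"
  by (simp add: word_def)

lemma smooth_word: "smooth_fun K f \<Longrightarrow> set w \<subseteq> {..<nf} \<Longrightarrow> smooth_fun K (word w f)"
  by (induction w) (auto intro!: smooth_left_deriv frame_model)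

lemma word_add:
  "smooth_fun K f \<Longrightarrow> smooth_fun K g \<Longrightarrow> set w \<subseteq> {..<nf} \<Longrightarrow>
    word w (\<lambda>x. f x + g x) = (\<lambda>x. word w f x + word w g x)"
  by (induction w) (simp_all add: left_deriv_add smooth_word frame_model)

lemma word_cmult:
  "smooth_fun K f \<Longrightarrow> set w \<subseteq> {..<nf} \<Longrightarrow> word w (\<lambda>x. c * f x) = (\<lambda>x. c * word w f x)"
  by (induction w) (simp_all add: left_deriv_cmult smooth_word frame_model)

lemma smooth_fun_cmult: "smooth_fun K f \<Longrightarrow> smooth_fun K (\<lambda>x. c * f x)"
  by (rule smooth_fun_mult) simp

lemma word_sum:
  assumes "finite I" "\<And>i. i \<in> I \<Longrightarrow> smooth_fun K (f i)" "set w \<subseteq> {..<nf}"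
  shows "word w (\<lambda>x. \<Sum>i\<in>I. c i * f i x) = (\<lambda>x. \<Sum>i\<in>I. c i * word w (f i) x)"
  using assms(1,2)
proof (induction I rule: finite_induct)
  case empty
  show ?case using word_cmult[OF smooth_fun_const assms(3), of 0 0] by simp
next
  case (insert i I)
  have "smooth_fun K (\<lambda>x. \<Sum>i\<in>I. c i * f i x)" using insert.prems
    by (intro smooth_fun_sum smooth_fun_cmult) auto
  with insert show ?case
    by (simp add: word_add word_cmult smooth_fun_cmult assms(3))
qed

lemma mc_form_p0: "j < nf \<Longrightarrow> mc_form uc j p0 e = co j e"
proof -
  assume j: "j < nf"
  have "((\<lambda>a'. left_div uc (p0, a')) has_derivative pr) (at p0)"
  proof (rule has_derivative_transform_within_open[OF bounded_linear_imp_has_derivative[OF pr_bl]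
        chart_dom_open[OF uc(1)] p0_dom(1)])
    fix a assume "a \<in> chart_dom uc"
    then show "pr a = left_div uc (p0, a)" by (simp add: left_div_def p0_dom chart_cinv uc)
  qed
  from has_derivative_unique[OF this left_div_derivative[OF uc(1) p0_dom(1)]]
  have "frechet_derivative (left_div uc) (at (p0, p0)) (0, e) = pr e" by metis
  then show ?thesis using j by (simp add: mc_form_def)
qed

text \<open>In the translated unit chart the first derivative of \<open>f\<close> is the
  Maurer-Cartan form applied to the frame derivatives. Differentiating once more at
  \<open>p0\<close>, in two frame directions, gives a word of length two plus derivatives of the
  form times single letters. Symmetry of the second derivative equates the two orders, so the
  structure constants \<open>s\<close> come from the exterior derivative of the form and do not
  depend on \<open>f\<close> and \<open>x\<close>.\<close>

lemma commutator:
  assumes ij: "i < nf" "j < nf"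
  obtains s :: "nat \<Rightarrow> real" where "\<And>f x. smooth_fun K f \<Longrightarrow>
    word [i, j] f x = word [j, i] f x + (\<Sum>k<nf. s k * word [k] f x)"
proof -
  \<comment> \<open>\<open>m k v w\<close> is the derivative, in direction \<open>w\<close> at
    \<open>p0\<close>, of the component \<open>k\<close> of the form evaluated on \<open>v\<close>;
    its antisymmetric part gives \<open>s k\<close>.\<close>
  define m where "m k v w = frechet_derivative (\<lambda>b. mc_form uc k b v) (at p0) w" for k v w
  have main: "word [i, j] f x = word [j, i] f x +
      (\<Sum>k<nf. of_real (m k (frame K ! i) (frame K ! j) - m k (frame K ! j) (frame K ! i)) * word [k] f x)"
    if f: "smooth_fun K f" for f x
  proof -
    let ?X = "\<lambda>k. left_deriv K (frame K ! k) f"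
    define f' where "f' b e = (\<Sum>k<nf. mc_form uc k b e *\<^sub>R ?X k (x \<star> cinv uc b))" for b e
    have d1: "((\<lambda>b. f (x \<star> cinv uc b)) has_derivative f' b) (at b)" if "b \<in> chart_dom uc" for b
      unfolding f'_def by (rule has_left_derivs_chart[OF smooth_has_left_derivs[OF f] uc(1) that])
    have d2: "((\<lambda>b. f' b v) has_derivative
        (\<lambda>w. \<Sum>k<nf. mc_form uc k p0 v *\<^sub>R (\<Sum>l<nf. co l w *\<^sub>R left_deriv K (frame K ! l) (?X k) x) +
          m k v w *\<^sub>R ?X k (x \<star> cinv uc p0))) (at p0)" for v
      unfolding f'_def
    proof (intro has_derivative_sum has_derivative_scaleR)
      fix k assume k: "k \<in> {..<nf}"
      show "((\<lambda>b. mc_form uc k b v) has_derivative m k v) (at p0)"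
        unfolding m_def using k by (intro Cinf_has_derivative[OF mc_form_smooth[OF uc(1)] p0_dom(1)]) auto
      have "has_left_derivs (?X k) (\<lambda>l. left_deriv K (frame K ! l) (?X k))"
        using k by (intro smooth_has_left_derivs smooth_left_deriv f frame_model) auto
      then show "((\<lambda>b. ?X k (x \<star> cinv uc b)) has_derivative
          (\<lambda>w. \<Sum>l<nf. co l w *\<^sub>R left_deriv K (frame K ! l) (?X k) x)) (at p0)"
        unfolding has_left_derivs_def by blast
    qed
    have ev: "(\<Sum>k<nf. mc_form uc k p0 (frame K ! p) *\<^sub>R (\<Sum>l<nf. co l (frame K ! q) *\<^sub>R
          left_deriv K (frame K ! l) (?X k) x) + m k (frame K ! p) (frame K ! q) *\<^sub>R ?X k (x \<star> cinv uc p0)) =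
        word [q, p] f x + (\<Sum>k<nf. of_real (m k (frame K ! p) (frame K ! q)) * word [k] f x)"
      if pq: "p < nf" "q < nf" for p q
    proof -
      have inner: "(\<Sum>l<nf. co l (frame K ! q) *\<^sub>R left_deriv K (frame K ! l) (?X k) x) =
          left_deriv K (frame K ! q) (?X k) x" for k
      proof -
        have "(\<Sum>l<nf. co l (frame K ! q) *\<^sub>R left_deriv K (frame K ! l) (?X k) x) =
            (\<Sum>l<nf. if l = q then left_deriv K (frame K ! l) (?X k) x else 0)"
          using pq by (intro sum.cong) (auto simp: co_frame)
        then show ?thesis using pq by simp
      qed
      have "(\<Sum>k<nf. mc_form uc k p0 (frame K ! p) *\<^sub>R left_deriv K (frame K ! q) (?X k) x) =
          (\<Sum>k<nf. if k = p then left_deriv K (frame K ! q) (?X k) x else 0)"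
        using pq by (intro sum.cong) (auto simp: mc_form_p0 co_frame)
      also have "\<dots> = word [q, p] f x" using pq by simp
      finally show ?thesis unfolding inner sum.distrib by (simp add: p0_dom scaleR_conv_of_real)
    qed
    from symmetric_second_derivative[OF chart_dom_open[OF uc(1)] p0_dom(1) d1 d2 d2,
        of "frame K ! j" "frame K ! i", unfolded ev[OF ij] ev[OF ij(2,1)]]
    show ?thesis by (simp add: algebra_simps sum_subtractf)
  qed
  show ?thesis by (rule that[OF main])
qed

definition canonical :: "(nat \<Rightarrow> nat) \<Rightarrow> nat \<Rightarrow> nat list" where
  "canonical \<alpha> n = concat (map (\<lambda>i. replicate (\<alpha> i) i) [0..<n])"

lemma frame_deriv_word: "frame_deriv K \<alpha> = word (canonical \<alpha> nf)"
proof -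
  have rep: "foldr D (replicate m i) f = (D i ^^ m) f" for D :: "nat \<Rightarrow> ('g \<Rightarrow> complex) \<Rightarrow> 'g \<Rightarrow> complex" and i m f
    by (induction m) auto
  have "foldr D (concat (map (\<lambda>i. replicate (\<alpha> i) i) xs)) f = foldr (\<lambda>i. D i ^^ \<alpha> i) xs f"
    for D :: "nat \<Rightarrow> ('g \<Rightarrow> complex) \<Rightarrow> 'g \<Rightarrow> complex" and xs f
    by (induction xs) (auto simp: rep)
  then show ?thesis by (simp add: frame_deriv_def word_def canonical_def fun_eq_iff)
qed

lemma canonical_set: "set (canonical \<alpha> n) \<subseteq> {..<n}"
  by (auto simp: canonical_def)

end

lemma sorted_split: "sorted w \<Longrightarrow> w = filter (\<lambda>x. x < n) w @ filter (\<lambda>x. n \<le> x) w" for n :: nat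
proof (induction w)
  case (Cons x w)
  show ?case
  proof (cases "x < n")
    case False
    with Cons.prems have "\<forall>y\<in>set w. \<not> y < n" by auto
    then have "filter (\<lambda>x. x < n) w = []" by (simp add: filter_empty_conv)
    with Cons False show ?thesis by simp
  qed (use Cons in auto)
qed simp

context lie_calculus
begin

text \<open>In a sorted word the letters \<open>n\<close> stand at the end; their number becomes the
  value of the multi-index at \<open>n\<close>, and the rest is covered by induction.\<close>

lemma sorted_canonical: "sorted w \<Longrightarrow> set w \<subseteq> {..<n} \<Longrightarrow> \<exists>\<alpha>. w = canonical \<alpha> n"
proof (induction n arbitrary: w)
  case 0
  then show ?case by (simp add: canonical_def)
next
  case (Suc n)
  obtain \<alpha> where \<alpha>: "filter (\<lambda>x. x < n) w = canonical \<alpha> n"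
    using Suc.IH[of "filter (\<lambda>x. x < n) w"] Suc.prems(1) sorted_filter[of "\<lambda>x. x" w] by auto
  define k where "k = length (filter (\<lambda>x. n \<le> x) w)"
  have "\<forall>x\<in>set (filter (\<lambda>x. n \<le> x) w). x = n" using Suc.prems(2) by auto
  then have "filter (\<lambda>x. n \<le> x) w = replicate k n"
    unfolding k_def by (metis replicate_length_same)
  then have "w = canonical \<alpha> n @ replicate k n" using sorted_split[OF Suc.prems(1), of n] \<alpha> by simp
  also have "\<dots> = canonical (\<alpha>(n := k)) (Suc n)"
  proof -
    have "map (\<lambda>i. replicate ((\<alpha>(n := k)) i) i) [0..<n] = map (\<lambda>i. replicate (\<alpha> i) i) [0..<n]"
      by (rule map_cong) auto
    then show ?thesis
      unfolding canonical_def by (simp only: upt_Suc_append[OF le0] map_append concat_append) simp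
  qed
  finally show ?case by blast
qed

text \<open>The coefficients are chosen before \<open>f\<close> and \<open>x\<close>, so a bound on
  ordered monomials that is uniform in \<open>x\<close> or in a parameter of \<open>f\<close> passes
  to \<open>T\<close>.\<close>

definition ordered_comb :: "(('g \<Rightarrow> complex) \<Rightarrow> 'g \<Rightarrow> complex) \<Rightarrow> bool" where
  "ordered_comb T \<longleftrightarrow> (\<exists>L :: (complex \<times> (nat \<Rightarrow> nat)) list. \<forall>f x. smooth_fun K f \<longrightarrow>
     T f x = (\<Sum>(c, \<alpha>)\<leftarrow>L. c * frame_deriv K \<alpha> f x))"

lemma ordered_comb_add:
  assumes "ordered_comb S" "ordered_comb T"
  shows "ordered_comb (\<lambda>f x. S f x + T f x)"
proof -
  obtain L M where "\<And>f x. smooth_fun K f \<Longrightarrow> S f x = (\<Sum>(c, \<alpha>)\<leftarrow>L. c * frame_deriv K \<alpha> f x)"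
    "\<And>f x. smooth_fun K f \<Longrightarrow> T f x = (\<Sum>(c, \<alpha>)\<leftarrow>M. c * frame_deriv K \<alpha> f x)"
    using assms unfolding ordered_comb_def by blast
  then show ?thesis unfolding ordered_comb_def by (intro exI[of _ "L @ M"]) simp
qed

lemma ordered_comb_cmult:
  assumes "ordered_comb S"
  shows "ordered_comb (\<lambda>f x. c * S f x)"
proof -
  obtain L where L: "\<And>f x. smooth_fun K f \<Longrightarrow> S f x = (\<Sum>(c, \<alpha>)\<leftarrow>L. c * frame_deriv K \<alpha> f x)"
    using assms unfolding ordered_comb_def by blast
  have "c * (\<Sum>(c, \<alpha>)\<leftarrow>L. c * frame_deriv K \<alpha> f x) =
     (\<Sum>(c, \<alpha>)\<leftarrow>map (\<lambda>(d, \<alpha>). (c * d, \<alpha>)) L. c * frame_deriv K \<alpha> f x)" for f x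
    by (induction L) (auto simp: algebra_simps)
  with L show ?thesis unfolding ordered_comb_def
    by (intro exI[of _ "map (\<lambda>(d, \<alpha>). (c * d, \<alpha>)) L"]) simp
qed

lemma ordered_comb_sum:
  "finite I \<Longrightarrow> (\<And>i. i \<in> I \<Longrightarrow> ordered_comb (S i)) \<Longrightarrow> ordered_comb (\<lambda>f x. \<Sum>i\<in>I. S i f x)"
proof (induction I rule: finite_induct)
  case empty
  show ?case unfolding ordered_comb_def by (intro exI[of _ "[]"]) simp
qed (simp add: ordered_comb_add)

lemma ordered_comb_cong:
  "ordered_comb S \<Longrightarrow> (\<And>f x. smooth_fun K f \<Longrightarrow> T f x = S f x) \<Longrightarrow> ordered_comb T"
  unfolding ordered_comb_def by simp

lemma ordered_comb_sorted:
  assumes "sorted w" "set w \<subseteq> {..<nf}"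
  shows "ordered_comb (word w)"
proof -
  obtain \<alpha> where "w = canonical \<alpha> nf" using sorted_canonical[OF assms] by blast
  then show ?thesis unfolding ordered_comb_def
    by (intro exI[of _ "[(1, \<alpha>)]"]) (simp add: frame_deriv_word)
qed

text \<open>Poincare-Birkhoff-Witt: swapping adjacent fields changes a word by shorter words.\<close>

lemma ordered_comb_word: "set w \<subseteq> {..<nf} \<Longrightarrow> ordered_comb (word w)"
proof (induction "length w" arbitrary: w rule: less_induct)
  case less
  define n where "n = length w"
  have shorter: "ordered_comb (word v)" if "length v < n" "set v \<subseteq> {..<nf}" for v
    using less.hyps that by (simp add: n_def)
  have swap: "ordered_comb (word (u @ i # j # v))"
    if len: "length (u @ i # j # v) = n" and sub: "set (u @ i # j # v) \<subseteq> {..<nf}"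
      and O: "ordered_comb (word (u @ j # i # v))" for u v i j
  proof -
    have ij: "i < nf" "j < nf" and uv: "set u \<subseteq> {..<nf}" "set v \<subseteq> {..<nf}" using sub by auto
    obtain s :: "nat \<Rightarrow> real" where s: "\<And>f x. smooth_fun K f \<Longrightarrow>
        word [i, j] f x = word [j, i] f x + (\<Sum>k<nf. s k * word [k] f x)"
      using commutator[OF ij] by blast
    \<comment> \<open>The commutator replaces two letters by one, so these words fall under the
      induction on length.\<close>
    have "ordered_comb (word (u @ k # v))" if "k < nf" for k
      using that len sub by (intro shorter) auto
    then have "ordered_comb (\<lambda>f x. word (u @ j # i # v) f x + (\<Sum>k<nf. s k * word (u @ k # v) f x))"
      by (intro ordered_comb_add O ordered_comb_sum ordered_comb_cmult) (simp_all del: word_simps)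
    then show ?thesis
    proof (rule ordered_comb_cong)
      fix f x assume f: "smooth_fun K f"
      have g: "smooth_fun K (word v f)" by (rule smooth_word[OF f uv(2)])
      have "word (u @ i # j # v) f = word u (word [i, j] (word v f))" by (simp add: word_append)
      also have "word [i, j] (word v f) =
          (\<lambda>x. word [j, i] (word v f) x + (\<Sum>k<nf. s k * word [k] (word v f) x))"
        by (rule ext) (rule s[OF g])
      also have "word u \<dots> = (\<lambda>x. word u (word [j, i] (word v f)) x +
          word u (\<lambda>x. \<Sum>k<nf. s k * word [k] (word v f) x) x)"
        using ij uv g f by (intro word_add smooth_fun_sum smooth_fun_cmult smooth_word) auto
      also have "word u (\<lambda>x. \<Sum>k<nf. s k * word [k] (word v f) x) =
          (\<lambda>x. \<Sum>k<nf. s k * word u (word [k] (word v f)) x)"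
        using ij uv g f by (intro word_sum smooth_word) auto
      finally show "word (u @ i # j # v) f x =
          word (u @ j # i # v) f x + (\<Sum>k<nf. s k * word (u @ k # v) f x)"
        by (simp add: word_append)
    qed
  qed
  \<comment> \<open>Insertion sort read backwards: \<open>i\<close> moves from its sorted place to
    the front of \<open>v\<close>, with one swap for each smaller letter passed. The prefix
    \<open>u\<close> collects the letters already passed.\<close>
  have insert: "ordered_comb (word (u @ i # v))"
    if "length (u @ i # v) = n" "set (u @ i # v) \<subseteq> {..<nf}" "ordered_comb (word (u @ insort i v))" for u i v
    using that
  proof (induction v arbitrary: u)
    case (Cons j v)
    show ?case
    proof (cases "i \<le> j")
      case True
      then show ?thesis using Cons.prems(3) by (simp del: word_simps)
    next
      case False
      then have "ordered_comb (word ((u @ [j]) @ insort i v))" using Cons.prems(3) by (simp del: word_simps)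
      then have "ordered_comb (word ((u @ [j]) @ i # v))" using Cons.prems by (intro Cons.IH) (auto simp del: word_simps)
      then have O: "ordered_comb (word (u @ j # i # v))" by (simp del: word_simps)
      show ?thesis by (rule swap[OF _ _ O]) (use Cons.prems in auto)
    qed
  qed simp
  have sort: "ordered_comb (word (u @ v))"
    if "length (u @ v) = n" "set (u @ v) \<subseteq> {..<nf}" "ordered_comb (word (u @ sort v))" for u v
    using that
  proof (induction v arbitrary: u)
    case (Cons i v)
    have "ordered_comb (word (u @ i # sort v))" by (rule insert) (use Cons.prems in auto)
    then have "ordered_comb (word ((u @ [i]) @ v))" using Cons.prems by (intro Cons.IH) (simp_all del: word_simps)
    then show ?case by (simp del: word_simps)
  qed simp
  show ?case
    using sort[of "[]" w] less.prems ordered_comb_sorted[of "sort w"] by (simp add: n_def)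
qed

text \<open>The chart derivative of \<open>F w\<close> is a combination of the
  \<open>F (j # w)\<close> with smooth coefficients. The order of differentiability therefore rises
  for all words simultaneously, by induction over \<open>n\<close> with \<open>w\<close> arbitrary.
  Words are used instead of ordered monomials because this family is closed under one more
  derivative.\<close>

lemma smooth_of_has_left_derivs:
  assumes F: "\<And>w. set w \<subseteq> {..<nf} \<Longrightarrow> has_left_derivs (F w) (\<lambda>j. F (j # w))" and w: "set w \<subseteq> {..<nf}"
  shows "smooth_fun K (F w)"
proof (rule smooth_funI)
  fix c assume c: "c \<in> atlas K"
  have der: "((\<lambda>a. F w (cinv c a)) has_derivative (\<lambda>e. \<Sum>j<nf. mc_form c j a e *\<^sub>R F (j # w) (cinv c a))) (at a)"
    if "set w \<subseteq> {..<nf}" "a \<in> chart_dom c" for w a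
    using has_left_derivs_chart[OF F[OF that(1)] c that(2), of e1] by simp
  have "Ck_on n (\<lambda>a. F w (cinv c a)) (chart_dom c)" if "set w \<subseteq> {..<nf}" for n w
    using that
  proof (induction n arbitrary: w)
    case 0
    show ?case unfolding Ck_on.simps
      by (rule continuous_at_imp_continuous_on, intro ballI has_derivative_continuous[OF der[OF 0]])
  next
    case (Suc n)
    show ?case
    proof (rule Ck_on_SucI[OF chart_dom_open[OF c] der[OF Suc.prems]])
      fix v
      show "Ck_on n (\<lambda>a. \<Sum>j<nf. mc_form c j a v *\<^sub>R F (j # w) (cinv c a)) (chart_dom c)"
      proof (rule Ck_on_sum[OF chart_dom_open[OF c]], rule Ck_on_scaleR[OF chart_dom_open[OF c]])
        fix j assume j: "j \<in> {..<nf}"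
        then show "Ck_on n (\<lambda>a. mc_form c j a v) (chart_dom c)" using mc_form_smooth[OF c, of j v] by (simp add: Cinf_def)
        show "Ck_on n (\<lambda>a. F (j # w) (cinv c a)) (chart_dom c)" using Suc.prems j by (intro Suc.IH) auto
      qed
    qed
  qed
  then show "Cinf (\<lambda>a. F w (cinv c a)) (chart_dom c)" using w by (simp add: Cinf_def)
qed

end

section \<open>Differentiation under the integral sign\<close>

text \<open>Exhibits a derivative as a pointwise limit of difference quotients, which makes it
  measurable in a parameter. The first step \<open>d\<close> is free, so that all points used can be
  kept in a given ball.\<close>

lemma has_derivative_LIMSEQ:
  fixes H :: "'a::real_normed_vector \<Rightarrow> 'b::real_normed_vector"
  assumes H: "(H has_derivative D) (at a)" and "d > 0"
  shows "(\<lambda>n. (real (Suc n) / d) *\<^sub>R (H (a + (d / real (Suc n)) *\<^sub>R e) - H a)) \<longlonglongrightarrow> D e"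
proof -
  have "((\<lambda>t. a + t *\<^sub>R e) has_derivative (\<lambda>t. t *\<^sub>R e)) (at 0)"
    by (auto intro!: derivative_eq_intros)
  then have "((\<lambda>t. H (a + t *\<^sub>R e)) has_derivative (\<lambda>t. D (t *\<^sub>R e))) (at 0)"
    by (rule has_derivative_compose) (use H in simp)
  then have "((\<lambda>t. (1 / norm (t - 0)) *\<^sub>R (H (a + t *\<^sub>R e) - (H (a + 0 *\<^sub>R e) + D ((t - 0) *\<^sub>R e)))) \<longlongrightarrow> 0) (at 0)"
    unfolding has_derivative_within by blast
  moreover have "(\<lambda>n. d / real (Suc n)) \<longlonglongrightarrow> 0"
    using tendsto_mult_right_zero[OF LIMSEQ_inverse_real_of_nat, of d] by (simp add: divide_inverse)
  ultimately have "(\<lambda>n. (1 / norm (d / real (Suc n) - 0)) *\<^sub>R (H (a + (d / real (Suc n)) *\<^sub>R e) -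
      (H (a + 0 *\<^sub>R e) + D ((d / real (Suc n) - 0) *\<^sub>R e)))) \<longlonglongrightarrow> 0"
    unfolding tendsto_at_iff_sequentially comp_def
    by (elim allE[of _ "\<lambda>n. d / real (Suc n)"]) (use \<open>d > 0\<close> in auto)
  then have "(\<lambda>n. (real (Suc n) / d) *\<^sub>R (H (a + (d / real (Suc n)) *\<^sub>R e) - H a) - D e) \<longlonglongrightarrow> 0"
  proof (rule Lim_transform_eventually, intro always_eventually allI)
    fix n
    have p: "d / real (Suc n) > 0" using \<open>d > 0\<close> by simp
    have "D ((d / real (Suc n)) *\<^sub>R e) = (d / real (Suc n)) *\<^sub>R D e"
      by (rule linear_scale[OF has_derivative_linear[OF H]])
    then show "(1 / norm (d / real (Suc n) - 0)) *\<^sub>R (H (a + (d / real (Suc n)) *\<^sub>R e) -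
      (H (a + 0 *\<^sub>R e) + D ((d / real (Suc n) - 0) *\<^sub>R e))) =
      (real (Suc n) / d) *\<^sub>R (H (a + (d / real (Suc n)) *\<^sub>R e) - H a) - D e"
      using p \<open>d > 0\<close> by (simp add: scaleR_diff_right scaleR_add_right del: of_nat_Suc)
  qed
  then show ?thesis by (simp add: LIM_zero_iff)
qed

text \<open>\<open>B\<close> bounds the derivative on the whole ball, so by the mean value
  inequality the normalised remainder is at most \<open>2 * B t\<close>. Dominated convergence along
  sequences tending to \<open>a0\<close> then gives the derivative. Measurability of
  \<open>H'\<close> is derived from that of \<open>H\<close>.\<close>

lemma has_derivative_integral_dominated:
  fixes H :: "'t \<Rightarrow> 'a::euclidean_space \<Rightarrow> 'b::{banach, second_countable_topology}"
  assumes r: "0 < r"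
    and der: "\<And>t a. t \<in> space M \<Longrightarrow> a \<in> ball a0 r \<Longrightarrow> (H t has_derivative H' t a) (at a)"
    and bd: "\<And>t a e. t \<in> space M \<Longrightarrow> a \<in> ball a0 r \<Longrightarrow> norm (H' t a e) \<le> B t * norm e"
    and B: "integrable M B"
    and meas: "\<And>a. a \<in> ball a0 r \<Longrightarrow> (\<lambda>t. H t a) \<in> borel_measurable M"
    and int0: "integrable M (\<lambda>t. H t a0)"
  shows "integrable M (\<lambda>t. H' t a0 e)"
    and "((\<lambda>a. \<integral>t. H t a \<partial>M) has_derivative (\<lambda>e. \<integral>t. H' t a0 e \<partial>M)) (at a0)"
proof -
  have a0: "a0 \<in> ball a0 r" using r by simp
  have meas': "(\<lambda>t. H' t a0 e) \<in> borel_measurable M" for e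
  proof -
    \<comment> \<open>Keeps \<open>a0 + d *\<^sub>R e\<close> inside the ball; the summand 1 covers
      \<open>e = 0\<close>.\<close>
    define d where "d = (r / 2) / (1 + norm e)"
    have pos: "0 < 1 + norm e" by (simp add: add_pos_nonneg)
    then have d: "d > 0" using r by (simp add: d_def)
    have "d * norm e < r"
    proof -
      have "d * norm e \<le> d * (1 + norm e)" using d by simp
      also have "\<dots> = r / 2" using pos unfolding d_def by (metis less_irrefl nonzero_eq_divide_eq)
      finally show ?thesis using r by simp
    qed
    moreover have "(d / real (Suc n)) * norm e \<le> d * norm e" for n
      using d by (intro mult_right_mono) (auto simp: divide_simps)
    ultimately have "a0 + (d / real (Suc n)) *\<^sub>R e \<in> ball a0 r" for n
      using d by (auto simp: dist_norm intro: order_le_less_trans)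
    then show ?thesis
      by (intro borel_measurable_LIMSEQ_metric[OF _ has_derivative_LIMSEQ[OF der d]]
          borel_measurable_scaleR borel_measurable_diff borel_measurable_const meas a0)
  qed
  have int': "integrable M (\<lambda>t. H' t a0 e)" for e
    by (rule Bochner_Integration.integrable_bound[OF integrable_mult_left[OF B, of "norm e"] meas'])
      (intro AE_I2, use order_trans[OF bd[OF _ a0] abs_ge_self] in simp)
  then show "integrable M (\<lambda>t. H' t a0 e)" .
  have B0: "0 \<le> B t" if "t \<in> space M" for t
  proof -
    obtain b :: 'a where "b \<in> Basis" using nonempty_Basis by blast
    then show ?thesis using order_trans[OF norm_ge_zero bd[OF that a0, of b]] by simp
  qed
  have lip: "norm (H t a - H t a0) \<le> B t * norm (a - a0)" if "t \<in> space M" "a \<in> ball a0 r" for t a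
  proof (rule differentiable_bound[OF convex_ball _ _ that(2) a0])
    show "(H t has_derivative H' t x) (at x within ball a0 r)" if "x \<in> ball a0 r" for x
      using der[OF \<open>t \<in> space M\<close> that] by (rule has_derivative_at_withinI)
    show "onorm (H' t x) \<le> B t" if "x \<in> ball a0 r" for x
      using bd[OF \<open>t \<in> space M\<close> that] by (rule onorm_le)
  qed
  have int: "integrable M (\<lambda>t. H t a)" if "a \<in> ball a0 r" for a
  proof -
    have "integrable M (\<lambda>t. H t a - H t a0)"
    proof (rule Bochner_Integration.integrable_bound[OF integrable_mult_left[OF B, of "norm (a - a0)"]])
      show "(\<lambda>t. H t a - H t a0) \<in> borel_measurable M"
        by (intro borel_measurable_diff meas that a0)
      show "AE t in M. norm (H t a - H t a0) \<le> norm (B t * norm (a - a0))"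
        by (intro AE_I2) (use order_trans[OF lip[OF _ that] abs_ge_self] in simp)
    qed
    from Bochner_Integration.integrable_add[OF this int0] show ?thesis by simp
  qed
  have "((\<lambda>a. \<integral>t. H t a \<partial>M) has_derivative (\<lambda>e. \<integral>t. H' t a0 e \<partial>M)) (at a0 within ball a0 r)"
    unfolding has_derivative_within
  proof
    have lin: "linear (H' t a0)" if "t \<in> space M" for t
      using der[OF that a0] by (rule has_derivative_linear)
    show "bounded_linear (\<lambda>e. \<integral>t. H' t a0 e \<partial>M)"
    proof (rule bounded_linear_intro[where K = "\<integral>t. B t \<partial>M"])
      fix x y
      have "(\<integral>t. H' t a0 (x + y) \<partial>M) = (\<integral>t. H' t a0 x + H' t a0 y \<partial>M)"
        by (rule Bochner_Integration.integral_cong) (simp_all add: linear_add[OF lin])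
      then show "(\<integral>t. H' t a0 (x + y) \<partial>M) = (\<integral>t. H' t a0 x \<partial>M) + (\<integral>t. H' t a0 y \<partial>M)"
        using int' by simp
    next
      fix s x
      have "(\<integral>t. H' t a0 (s *\<^sub>R x) \<partial>M) = (\<integral>t. s *\<^sub>R H' t a0 x \<partial>M)"
        by (rule Bochner_Integration.integral_cong) (simp_all add: linear_scale[OF lin])
      then show "(\<integral>t. H' t a0 (s *\<^sub>R x) \<partial>M) = s *\<^sub>R (\<integral>t. H' t a0 x \<partial>M)"
        by simp
    next
      fix x
      have "norm (\<integral>t. H' t a0 x \<partial>M) \<le> (\<integral>t. B t * norm x \<partial>M)"
      proof (rule order_trans[OF integral_norm_bound])
        show "(\<integral>t. norm (H' t a0 x) \<partial>M) \<le> (\<integral>t. B t * norm x \<partial>M)"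
          by (rule integral_mono[OF integrable_norm[OF int'[of x]] integrable_mult_left[OF B]])
            (rule bd[OF _ a0])
      qed
      then show "norm (\<integral>t. H' t a0 x \<partial>M) \<le> norm x * (\<integral>t. B t \<partial>M)"
        by (simp add: mult.commute)
    qed
    show "((\<lambda>y. (1 / norm (y - a0)) *\<^sub>R ((\<integral>t. H t y \<partial>M) -
        ((\<integral>t. H t a0 \<partial>M) + (\<integral>t. H' t a0 (y - a0) \<partial>M)))) \<longlongrightarrow> 0) (at a0 within ball a0 r)"
      unfolding tendsto_at_iff_sequentially
    proof (intro allI impI)
      fix X assume X: "\<forall>i. X i \<in> ball a0 r - {a0}" "X \<longlonglongrightarrow> a0"
      define q where "q i t = (1 / norm (X i - a0)) *\<^sub>R (H t (X i) - (H t a0 + H' t a0 (X i - a0)))" for i t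
      have Xi: "X i \<in> ball a0 r" "X i \<noteq> a0" for i using X(1) by auto
      have "(\<lambda>i. \<integral>t. q i t \<partial>M) \<longlonglongrightarrow> (\<integral>t. 0 \<partial>M)"
      proof (rule integral_dominated_convergence[where w = "\<lambda>t. 2 * B t"])
        show "q i \<in> borel_measurable M" for i
          unfolding q_def
          by (intro borel_measurable_scaleR borel_measurable_diff borel_measurable_add borel_measurable_const
              meas meas' a0 Xi)
        show "integrable M (\<lambda>t. 2 * B t)" using B by simp
        show "AE t in M. (\<lambda>i. q i t) \<longlonglongrightarrow> 0"
        proof (rule AE_I2)
          fix t assume "t \<in> space M"
          from der[OF this a0]
          have "((\<lambda>y. (1 / norm (y - a0)) *\<^sub>R (H t y - (H t a0 + H' t a0 (y - a0)))) \<longlongrightarrow> 0) (at a0)"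
            unfolding has_derivative_within by blast
          then show "(\<lambda>i. q i t) \<longlonglongrightarrow> 0"
            unfolding q_def tendsto_at_iff_sequentially comp_def using X(2) Xi(2) by blast
        qed
        show "AE t in M. norm (q i t) \<le> 2 * B t" for i
        proof (rule AE_I2)
          fix t assume t: "t \<in> space M"
          have "norm (H t (X i) - (H t a0 + H' t a0 (X i - a0))) = norm ((H t (X i) - H t a0) - H' t a0 (X i - a0))"
            by (simp add: algebra_simps)
          also have "\<dots> \<le> B t * norm (X i - a0) + B t * norm (X i - a0)"
            by (rule norm_triangle_le_diff[OF add_mono[OF lip[OF t Xi(1)] bd[OF t a0]]])
          finally have "norm (q i t) \<le> (1 / norm (X i - a0)) * (2 * B t * norm (X i - a0))"
            unfolding q_def norm_scaleR by (intro mult_mono) auto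
          then show "norm (q i t) \<le> 2 * B t" using Xi(2)[of i] by simp
        qed
      qed simp
      moreover have "(\<integral>t. q i t \<partial>M) = (1 / norm (X i - a0)) *\<^sub>R ((\<integral>t. H t (X i) \<partial>M) -
          ((\<integral>t. H t a0 \<partial>M) + (\<integral>t. H' t a0 (X i - a0) \<partial>M)))" for i
        unfolding q_def using int[OF Xi(1)] int0 int' by simp
      ultimately show "((\<lambda>y. (1 / norm (y - a0)) *\<^sub>R ((\<integral>t. H t y \<partial>M) -
        ((\<integral>t. H t a0 \<partial>M) + (\<integral>t. H' t a0 (y - a0) \<partial>M)))) \<circ> X) \<longlonglongrightarrow> 0"
        by (simp add: comp_def)
    qed
  qed
  then show "((\<lambda>a. \<integral>t. H t a \<partial>M) has_derivative (\<lambda>e. \<integral>t. H' t a0 e \<partial>M)) (at a0)"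
    using at_within_open[OF a0 open_ball] by simp
qed

section \<open>Integrals of smooth functions on the group\<close>

context lie_calculus
begin

text \<open>By compactness of a small closed ball. Since translating the unit chart does not change
  the coefficients, this ball and this constant serve at every point of the group.\<close>

lemma mc_form_uc_bounded:
  obtains r C where "r > 0" "ball p0 r \<subseteq> chart_dom uc" "C \<ge> 0"
    "\<And>a e j. a \<in> ball p0 r \<Longrightarrow> j < nf \<Longrightarrow> \<bar>mc_form uc j a e\<bar> \<le> C * norm e"
proof -
  obtain r where r: "r > 0" "cball p0 r \<subseteq> chart_dom uc"
    using open_contains_cball chart_dom_open[OF uc(1)] p0_dom(1) by blast
  have "\<exists>B. \<forall>a\<in>cball p0 r. \<bar>mc_form uc j a b\<bar> \<le> B" if "j < nf" for j b
  proof -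
    have "continuous_on (cball p0 r) (\<lambda>a. mc_form uc j a b)"
      using Cinf_continuous[OF mc_form_smooth[OF uc(1) that]] r(2) continuous_on_subset by blast
    from compact_imp_bounded[OF compact_continuous_image[OF this compact_cball]]
    show ?thesis unfolding bounded_iff by auto
  qed
  then obtain B where B: "\<And>j b a. j < nf \<Longrightarrow> a \<in> cball p0 r \<Longrightarrow> \<bar>mc_form uc j a b\<bar> \<le> B j b"
    by metis
  define C where "C = (\<Sum>j<nf. \<Sum>b\<in>Basis. \<bar>B j b\<bar>)"
  show ?thesis
  proof
    show "r > 0" "C \<ge> 0" using r by (auto simp: C_def intro!: sum_nonneg)
    show "ball p0 r \<subseteq> chart_dom uc" using r ball_subset_cball by blast
    fix a e j assume a: "a \<in> ball p0 r" and j: "j < nf"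
    have a': "a \<in> cball p0 r" using a by simp
    have lin: "linear (mc_form uc j a)"
      using mc_form_bl[OF uc(1) _ j] r(2) a' by (simp add: subset_iff bounded_linear.linear)
    have "mc_form uc j a e = mc_form uc j a (\<Sum>b\<in>Basis. inner e b *\<^sub>R b)" by (simp add: euclidean_representation)
    also have "\<dots> = (\<Sum>b\<in>Basis. inner e b * mc_form uc j a b)"
      unfolding linear_sum[OF lin] linear_scale[OF lin] by simp
    also have "\<bar>\<dots>\<bar> \<le> (\<Sum>b\<in>Basis. \<bar>inner e b * mc_form uc j a b\<bar>)" by (rule sum_abs)
    also have "\<dots> \<le> (\<Sum>b\<in>Basis. norm e * \<bar>B j b\<bar>)"
    proof (rule sum_mono)
      fix b :: 'e assume "b \<in> Basis"
      then have "\<bar>inner e b\<bar> \<le> norm e" by (rule Basis_le_norm)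
      moreover have "\<bar>mc_form uc j a b\<bar> \<le> \<bar>B j b\<bar>" using B[OF j a', of b] by linarith
      ultimately show "\<bar>inner e b * mc_form uc j a b\<bar> \<le> norm e * \<bar>B j b\<bar>"
        unfolding abs_mult by (intro mult_mono) auto
    qed
    also have "\<dots> = (\<Sum>b\<in>Basis. \<bar>B j b\<bar>) * norm e" by (simp add: sum_distrib_left mult.commute)
    also have "\<dots> \<le> C * norm e"
    proof (rule mult_right_mono)
      show "(\<Sum>b\<in>Basis. \<bar>B j b\<bar>) \<le> C" unfolding C_def
        by (rule member_le_sum) (use j in \<open>auto intro!: sum_nonneg\<close>)
    qed simp
    finally show "\<bar>mc_form uc j a e\<bar> \<le> C * norm e" .
  qed
qed

text \<open>The integrals \<open>F w\<close> of the words satisfy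
  \<open>has_left_derivs (F w) (\<lambda>j. F (j # w))\<close>, where the bounds on the words
  \<open>j # w\<close> dominate the derivative of \<open>word w\<close>. This one relation yields
  both smoothness and the exchange of words with the integral.\<close>

lemma integral_smooth_word:
  fixes h :: "'t \<Rightarrow> 'g \<Rightarrow> complex"
  assumes sm: "\<And>t. t \<in> space M \<Longrightarrow> smooth_fun K (h t)"
    and bd: "\<And>w. set w \<subseteq> {..<nf} \<Longrightarrow>
        \<exists>B. integrable M B \<and> (\<forall>t\<in>space M. \<forall>x. norm (word w (h t) x) \<le> B t)"
    and meas: "\<And>w x. set w \<subseteq> {..<nf} \<Longrightarrow> (\<lambda>t. word w (h t) x) \<in> borel_measurable M"
  shows "smooth_fun K (\<lambda>x. \<integral>t. h t x \<partial>M)"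
    and "set w \<subseteq> {..<nf} \<Longrightarrow> word w (\<lambda>x. \<integral>t. h t x \<partial>M) = (\<lambda>x. \<integral>t. word w (h t) x \<partial>M)"
proof -
  define F where "F w x = (\<integral>t. word w (h t) x \<partial>M)" for w x
  obtain r C where r: "r > 0" "ball p0 r \<subseteq> chart_dom uc" "C \<ge> 0"
    "\<And>a e j. a \<in> ball p0 r \<Longrightarrow> j < nf \<Longrightarrow> \<bar>mc_form uc j a e\<bar> \<le> C * norm e"
    using mc_form_uc_bounded by metis
  obtain B where B: "\<And>w. set w \<subseteq> {..<nf} \<Longrightarrow> integrable M (B w)"
    "\<And>w t x. set w \<subseteq> {..<nf} \<Longrightarrow> t \<in> space M \<Longrightarrow> norm (word w (h t) x) \<le> B w t"
    using bd by metis
  have int: "integrable M (\<lambda>t. word w (h t) x)" if w: "set w \<subseteq> {..<nf}" for w x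
    by (rule Bochner_Integration.integrable_bound[OF B(1)[OF w] meas[OF w]], rule AE_I2)
      (use order_trans[OF B(2)[OF w] abs_ge_self] in simp)
  have F: "has_left_derivs (F w) (\<lambda>j. F (j # w))" if w: "set w \<subseteq> {..<nf}" for w
    unfolding has_left_derivs_def
  proof
    fix x
    have jw: "set (j # w) \<subseteq> {..<nf}" if "j < nf" for j using that w by simp
    define H' where "H' t b e = (\<Sum>j<nf. mc_form uc j b e *\<^sub>R word (j # w) (h t) (x \<star> cinv uc b))" for t b e
    have "((\<lambda>b. \<integral>t. word w (h t) (x \<star> cinv uc b) \<partial>M) has_derivative (\<lambda>e. \<integral>t. H' t p0 e \<partial>M)) (at p0)"
    proof (rule has_derivative_integral_dominated(2)[OF r(1)])
      fix t a assume t: "t \<in> space M" and a: "a \<in> ball p0 r"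
      show "((\<lambda>b. word w (h t) (x \<star> cinv uc b)) has_derivative H' t a) (at a)"
        unfolding H'_def word_simps
        by (rule has_left_derivs_chart[OF smooth_has_left_derivs[OF smooth_word[OF sm[OF t] w]] uc(1)]) (use a r in auto)
      fix e
      have "norm (H' t a e) \<le> (\<Sum>j<nf. norm (mc_form uc j a e *\<^sub>R word (j # w) (h t) (x \<star> cinv uc a)))"
        unfolding H'_def by (rule norm_sum)
      also have "\<dots> \<le> (\<Sum>j<nf. (C * norm e) * B (j # w) t)"
      proof (rule sum_mono)
        fix j assume "j \<in> {..<nf}"
        then have j: "j < nf" by simp
        show "norm (mc_form uc j a e *\<^sub>R word (j # w) (h t) (x \<star> cinv uc a)) \<le> (C * norm e) * B (j # w) t"
          unfolding norm_scaleR
          by (rule mult_mono[OF r(4)[OF a j] B(2)[OF jw[OF j] t]]) (use r in auto)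
      qed
      also have "\<dots> = (\<Sum>j<nf. C * B (j # w) t) * norm e"
        unfolding sum_distrib_right by (rule sum.cong) auto
      finally show "norm (H' t a e) \<le> (\<Sum>j<nf. C * B (j # w) t) * norm e" .
    next
      show "integrable M (\<lambda>t. \<Sum>j<nf. C * B (j # w) t)"
        using B(1) jw by (intro Bochner_Integration.integrable_sum integrable_mult_right) auto
    qed (use int[OF w] meas[OF w] in auto)
    moreover have "(\<integral>t. H' t p0 e \<partial>M) = (\<Sum>j<nf. co j e *\<^sub>R F (j # w) x)" for e
    proof -
      have "(\<integral>t. H' t p0 e \<partial>M) = (\<integral>t. (\<Sum>j<nf. co j e *\<^sub>R word (j # w) (h t) x) \<partial>M)"
        unfolding H'_def by (rule Bochner_Integration.integral_cong) (simp_all add: mc_form_p0 p0_dom del: word_simps)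
      also have "\<dots> = (\<Sum>j<nf. \<integral>t. co j e *\<^sub>R word (j # w) (h t) x \<partial>M)"
        using int[OF jw]
        by (intro Bochner_Integration.integral_sum integrable_scaleR_right) (simp_all del: word_simps)
      finally show ?thesis unfolding F_def integral_scaleR_right .
    qed
    ultimately show "((\<lambda>b. F w (x \<star> cinv uc b)) has_derivative (\<lambda>e. \<Sum>j<nf. co j e *\<^sub>R F (j # w) x)) (at p0)"
      unfolding F_def by simp
  qed
  have F0: "F [] = (\<lambda>x. \<integral>t. h t x \<partial>M)" by (simp add: F_def[abs_def])
  show "smooth_fun K (\<lambda>x. \<integral>t. h t x \<partial>M)"
    unfolding F0[symmetric] by (rule smooth_of_has_left_derivs[OF F]) auto
  show "word w (\<lambda>x. \<integral>t. h t x \<partial>M) = (\<lambda>x. \<integral>t. word w (h t) x \<partial>M)" if "set w \<subseteq> {..<nf}"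
  proof -
    have "word w (F []) = F w" using that
    proof (induction w)
      case (Cons j w)
      then have "word (j # w) (F []) = left_deriv K (frame K ! j) (F w)" by simp
      also have "\<dots> = F (j # w)" using Cons.prems by (intro has_left_derivs_left_deriv[OF F]) auto
      finally show ?case .
    qed simp
    then show ?thesis by (simp add: F0 F_def[abs_def])
  qed
qed

text \<open>The assumptions concern ordered monomials only, as in the symbol estimates. By
  \<open>ordered_comb_word\<close> they imply the same integrability and measurability for all
  words.\<close>

theorem integral_smooth:
  fixes h :: "'t \<Rightarrow> 'g \<Rightarrow> complex"
  assumes sm: "\<And>t. t \<in> space M \<Longrightarrow> smooth_fun K (h t)"
    and bd: "\<And>\<alpha>. \<exists>B. integrable M B \<and> (\<forall>t\<in>space M. \<forall>x. norm (frame_deriv K \<alpha> (h t) x) \<le> B t)"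
    and meas: "\<And>\<alpha> x. (\<lambda>t. frame_deriv K \<alpha> (h t) x) \<in> borel_measurable M"
  shows "smooth_fun K (\<lambda>x. \<integral>t. h t x \<partial>M)"
    and "frame_deriv K \<alpha> (\<lambda>x. \<integral>t. h t x \<partial>M) = (\<lambda>x. \<integral>t. frame_deriv K \<alpha> (h t) x \<partial>M)"
proof -
  have wd: "(\<exists>B. integrable M B \<and> (\<forall>t\<in>space M. \<forall>x. norm (word w (h t) x) \<le> B t)) \<and>
      (\<forall>x. (\<lambda>t. word w (h t) x) \<in> borel_measurable M)" if w: "set w \<subseteq> {..<nf}" for w
  proof -
    obtain L where L: "\<And>f x. smooth_fun K f \<Longrightarrow> word w f x = (\<Sum>(c, \<alpha>)\<leftarrow>L. c * frame_deriv K \<alpha> f x)"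
      using ordered_comb_word[OF w] unfolding ordered_comb_def by blast
    obtain B where B: "\<And>\<alpha>. integrable M (B \<alpha>)"
      "\<And>\<alpha> t x. t \<in> space M \<Longrightarrow> norm (frame_deriv K \<alpha> (h t) x) \<le> B \<alpha> t"
      using bd by metis
    have "integrable M (\<lambda>t. \<Sum>(c, \<alpha>)\<leftarrow>L. norm c * B \<alpha> t) \<and>
        (\<forall>t\<in>space M. \<forall>x. norm (\<Sum>(c, \<alpha>)\<leftarrow>L. c * frame_deriv K \<alpha> (h t) x) \<le> (\<Sum>(c, \<alpha>)\<leftarrow>L. norm c * B \<alpha> t)) \<and>
        (\<forall>x. (\<lambda>t. \<Sum>(c, \<alpha>)\<leftarrow>L. c * frame_deriv K \<alpha> (h t) x) \<in> borel_measurable M)"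
    proof (induction L)
      case (Cons p L)
      obtain c \<alpha> where p: "p = (c, \<alpha>)" by fastforce
      have "norm (c * frame_deriv K \<alpha> (h t) x) \<le> norm c * B \<alpha> t" if "t \<in> space M" for t x
        unfolding norm_mult by (intro mult_left_mono B that) simp
      then show ?case using Cons B(1) meas
        by (auto simp: p intro!: order_trans[OF norm_triangle_ineq] add_mono
            borel_measurable_add borel_measurable_times)
    qed simp
    moreover have "(\<lambda>t. word w (h t) x) \<in> borel_measurable M \<longleftrightarrow>
        (\<lambda>t. \<Sum>(c, \<alpha>)\<leftarrow>L. c * frame_deriv K \<alpha> (h t) x) \<in> borel_measurable M" for x
      by (rule measurable_cong) (rule L[OF sm])
    ultimately show ?thesis using L[OF sm] by auto
  qed
  show "smooth_fun K (\<lambda>x. \<integral>t. h t x \<partial>M)"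
    by (rule integral_smooth_word(1)[OF sm]) (use wd in auto)
  show "frame_deriv K \<alpha> (\<lambda>x. \<integral>t. h t x \<partial>M) = (\<lambda>x. \<integral>t. frame_deriv K \<alpha> (h t) x \<partial>M)"
    unfolding frame_deriv_word
    by (rule integral_smooth_word(2)[OF sm _ _ canonical_set]) (use wd in auto)
qed

end

section \<open>Representations\<close>

lemma mat_adjoint_entry:
  assumes "i < dim_col A" "j < dim_row A"
  shows "mat_adjoint A $$ (i, j) = cnj (A $$ (j, i))"
  using assms unfolding mat_adjoint_def by (simp add: mat_of_rows_index)

lemma mult_mat_entry:
  assumes "A \<in> carrier_mat n m" "B \<in> carrier_mat m k" "i < n" "j < k"
  shows "(A * B) $$ (i, j) = (\<Sum>p<m. A $$ (i, p) * B $$ (p, j))"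
  using assms by (auto simp: scalar_prod_def atLeast0LessThan intro!: sum.cong)

context lie_calculus
begin

abbreviation rdim where "rdim \<equiv> rep_dim K"

lemma rep_carrier: "representation K \<xi> \<Longrightarrow> \<xi> x \<in> carrier_mat (rdim \<xi>) (rdim \<xi>)"
  by (simp add: representation_def)

lemma rep_mult_entry:
  assumes "representation K \<xi>" "i < rdim \<xi>" "j < rdim \<xi>"
  shows "\<xi> (x \<star> y) $$ (i, j) = (\<Sum>k<rdim \<xi>. \<xi> x $$ (i, k) * \<xi> y $$ (k, j))"
proof -
  have "\<xi> (x \<star> y) = \<xi> x * \<xi> y" using assms by (simp add: representation_def)
  then show ?thesis using mult_mat_entry[OF rep_carrier rep_carrier] assms by simp
qed

lemma rep_one_entry:
  assumes "representation K \<xi>" "i < rdim \<xi>" "j < rdim \<xi>"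
  shows "\<xi> e1 $$ (i, j) = (if i = j then 1 else 0)"
proof -
  have "\<xi> e1 = 1\<^sub>m (rdim \<xi>)" using assms by (simp add: representation_def)
  then show ?thesis using assms by simp
qed

lemma rep_cont:
  assumes "representation K \<xi>" "i < rdim \<xi>" "j < rdim \<xi>"
  shows "continuous_on S (\<lambda>x. \<xi> x $$ (i, j))"
proof -
  have "continuous_on UNIV (\<lambda>x. \<xi> x $$ (i, j))" using assms by (simp add: representation_def)
  then show ?thesis by (rule continuous_on_subset) simp
qed

lemma dualD:
  assumes "\<xi> \<in> dual K"
  shows "unitary_rep K \<xi>" "irreducible_rep K \<xi>" "representation K \<xi>" "0 < rdim \<xi>"
  using assms setting unfolding calculus_setting_def unitary_dual_def irreducible_rep_def by blast+

text \<open>The adjoint is a left inverse of \<open>\<xi> x\<close> by assumption and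
  \<open>\<xi> (iv x)\<close> a right inverse, so the two agree.\<close>

lemma unitary_entry:
  assumes "unitary_rep K \<xi>" "i < rdim \<xi>" "j < rdim \<xi>"
  shows "cnj (\<xi> x $$ (j, i)) = \<xi> (iv x) $$ (i, j)"
proof -
  let ?d = "rdim \<xi>"
  have rep: "representation K \<xi>" and u: "mat_adjoint (\<xi> x) * \<xi> x = 1\<^sub>m ?d"
    using assms by (auto simp: unitary_rep_def)
  have c: "\<xi> y \<in> carrier_mat ?d ?d" for y by (rule rep_carrier[OF rep])
  have ac: "mat_adjoint (\<xi> x) \<in> carrier_mat ?d ?d"
    using c[of x] unfolding mat_adjoint_def by auto
  have "\<xi> x * \<xi> (iv x) = \<xi> (x \<star> iv x)" using rep by (simp add: representation_def del: mul_simps)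
  also have "\<dots> = 1\<^sub>m ?d" using rep by (simp add: representation_def)
  finally have inv: "\<xi> x * \<xi> (iv x) = 1\<^sub>m ?d" .
  have "mat_adjoint (\<xi> x) = mat_adjoint (\<xi> x) * (\<xi> x * \<xi> (iv x))" using ac inv by simp
  also have "\<dots> = (mat_adjoint (\<xi> x) * \<xi> x) * \<xi> (iv x)"
    using assoc_mult_mat[OF ac c c] by simp
  also have "\<dots> = \<xi> (iv x)" unfolding u by (rule left_mult_one_mat[OF c])
  finally show ?thesis using mat_adjoint_entry[of i "\<xi> x" j] c[of x] assms by simp
qed

lemma unitary_sum:
  assumes "unitary_rep K \<xi>" "j < rdim \<xi>" "l < rdim \<xi>"
  shows "(\<Sum>i<rdim \<xi>. \<xi> x $$ (i, j) * cnj (\<xi> x $$ (i, l))) = (if j = l then 1 else 0)"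
proof -
  have rep: "representation K \<xi>" using assms by (simp add: unitary_rep_def)
  have "(\<Sum>i<rdim \<xi>. \<xi> x $$ (i, j) * cnj (\<xi> x $$ (i, l))) = \<xi> (iv x \<star> x) $$ (l, j)"
    unfolding rep_mult_entry[OF rep assms(3,2)]
    by (rule sum.cong) (simp_all add: unitary_entry[OF assms(1,3)] mult.commute)
  then show ?thesis using rep_one_entry[OF rep assms(3,2)] by auto
qed

lemma eigenspace_subspace:
  assumes A: "A \<in> carrier_mat d d"
  shows "VectorSpace.subspace class_ring {v \<in> carrier_vec d. A *\<^sub>v v = (c::complex) \<cdot>\<^sub>v v}
    (module_vec TYPE(complex) d)"
proof -
  interpret vs: vec_space "TYPE(complex)" d .
  show ?thesis
    unfolding VectorSpace.subspace_def
  proof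
    show "vectorspace class_ring (module_vec TYPE(complex) d)" by (rule vs.vectorspace_axioms)
    show "submodule class_ring {v \<in> carrier_vec d. A *\<^sub>v v = c \<cdot>\<^sub>v v} (module_vec TYPE(complex) d)"
    proof (unfold_locales, goal_cases)
      case (2 v w)
      then show ?case using A
        by (auto simp: module_vec_simps mult_add_distrib_mat_vec smult_add_distrib_vec)
    next
      case (4 b v)
      then show ?case using A
        by (auto simp: module_vec_simps mult_mat_vec smult_smult_assoc mult.commute)
    qed (use A in \<open>auto simp: module_vec_simps\<close>)
  qed
qed

text \<open>Schur's lemma: over the complex numbers \<open>A\<close> has an eigenvector, and its
  eigenspace is invariant because \<open>A\<close> commutes with the representation; being nonzero
  it is the whole space.\<close>

lemma schur_scalar:
  assumes irr: "irreducible_rep K \<xi>" and A: "A \<in> carrier_mat (rdim \<xi>) (rdim \<xi>)"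
    and comm: "\<And>x. A * \<xi> x = \<xi> x * A"
  obtains c where "A = c \<cdot>\<^sub>m 1\<^sub>m (rdim \<xi>)"
proof -
  let ?d = "rdim \<xi>"
  have rep: "representation K \<xi>" and d: "0 < ?d" using irr by (auto simp: irreducible_rep_def)
  note X = rep_carrier[OF rep]
  obtain c v where v: "v \<in> carrier_vec ?d" "v \<noteq> 0\<^sub>v ?d" "A *\<^sub>v v = c \<cdot>\<^sub>v v"
    using spectrum_non_empty[OF A d] A unfolding spectrum_def eigenvalue_def eigenvector_def by auto
  define W where "W = {v \<in> carrier_vec ?d. A *\<^sub>v v = c \<cdot>\<^sub>v v}"
  have "VectorSpace.subspace class_ring W (module_vec TYPE(complex) ?d)"
    unfolding W_def by (rule eigenspace_subspace[OF A])
  moreover have "\<xi> x *\<^sub>v w \<in> W" if "w \<in> W" for x w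
  proof -
    have w: "w \<in> carrier_vec ?d" "A *\<^sub>v w = c \<cdot>\<^sub>v w" using that by (auto simp: W_def)
    have "A *\<^sub>v (\<xi> x *\<^sub>v w) = (A * \<xi> x) *\<^sub>v w" using assoc_mult_mat_vec[OF A X w(1)] by simp
    also have "\<dots> = \<xi> x *\<^sub>v (A *\<^sub>v w)" using assoc_mult_mat_vec[OF X A w(1)] comm by simp
    also have "\<dots> = c \<cdot>\<^sub>v (\<xi> x *\<^sub>v w)" using w mult_mat_vec[OF X w(1)] by simp
    finally show ?thesis using mult_mat_vec_carrier[OF X w(1)] by (simp add: W_def)
  qed
  ultimately have "W = {0\<^sub>v ?d} \<or> W = carrier_vec ?d"
    using irr unfolding irreducible_rep_def by blast
  then have W: "W = carrier_vec ?d" using v by (auto simp: W_def)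
  have "A = c \<cdot>\<^sub>m 1\<^sub>m ?d"
  proof (rule eq_matI)
    fix i j assume "i < dim_row (c \<cdot>\<^sub>m 1\<^sub>m ?d)" "j < dim_col (c \<cdot>\<^sub>m 1\<^sub>m ?d)"
    then have ij: "i < ?d" "j < ?d" by auto
    have "unit_vec ?d j \<in> W" using W by simp
    then have "(A *\<^sub>v unit_vec ?d j) = c \<cdot>\<^sub>v unit_vec ?d j" by (simp add: W_def)
    then have "vec_index (A *\<^sub>v unit_vec ?d j) i = vec_index (c \<cdot>\<^sub>v unit_vec ?d j) i" by simp
    then show "A $$ (i, j) = (c \<cdot>\<^sub>m 1\<^sub>m ?d) $$ (i, j)" using ij A by auto
  qed (use A in auto)
  then show ?thesis by (rule that)
qed

section \<open>Orthogonality of matrix coefficients\<close>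

lemma haar: "haar_measure K (haar K)" using setting by (simp add: calculus_setting_def)

lemma haar_sets [measurable_cong]: "sets (haar K) = sets borel" using haar by (simp add: haar_measure_def)

lemma haar_space [simp]: "space (haar K) = UNIV" using sets_eq_imp_space_eq[OF haar_sets] by simp

lemma haar_finite: "finite_measure (haar K)" and haar_UNIV: "measure (haar K) UNIV = 1"
  using haar by (auto intro!: finite_measureI simp: haar_measure_def measure_def)

lemma cont_measurable: "continuous_on UNIV f \<Longrightarrow> f \<in> borel_measurable (haar K)"
  using borel_measurable_continuous_onI measurable_cong_sets[OF haar_sets refl] by blast

lemma cont_integrable:
  fixes f :: "'g \<Rightarrow> complex"
  assumes f: "continuous_on UNIV f"
  shows "integrable (haar K) f"
proof -
  interpret finite_measure "haar K" by (rule haar_finite)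
  obtain B where "\<And>x. norm (f x) \<le> B"
    using compact_imp_bounded[OF compact_continuous_image[OF f compact_UNIV]] unfolding bounded_iff by auto
  then show ?thesis
    by (intro integrable_const_bound[where B = B] AE_I2 cont_measurable f)
qed

lemma haar_translate:
  fixes f :: "'g \<Rightarrow> complex"
  assumes f: "continuous_on UNIV f"
  shows "(\<integral>x. f (g \<star> x) \<partial>haar K) = (\<integral>x. f x \<partial>haar K)"
proof -
  have m: "(\<lambda>x. g \<star> x) \<in> measurable (haar K) (haar K)"
  proof -
    have "(\<lambda>x. g \<star> x) \<in> borel_measurable borel"
      by (intro borel_measurable_continuous_onI mul_cont2 continuous_intros)
    then show ?thesis using measurable_cong_sets[OF haar_sets haar_sets] by blast
  qed
  have "(\<integral>x. f x \<partial>haar K) = (\<integral>x. f x \<partial>distr (haar K) (haar K) (\<lambda>x. g \<star> x))"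
    using haar by (simp add: haar_measure_def)
  also have "\<dots> = (\<integral>x. f (g \<star> x) \<partial>haar K)"
    by (rule integral_distr[OF m cont_measurable[OF f]])
  finally show ?thesis by simp
qed

lemma cont_cnj: "continuous_on S f \<Longrightarrow> continuous_on S (\<lambda>x. cnj (f x))"
  by (intro continuous_intros)

text \<open>The substitution of \<open>g \<star> x\<close> for \<open>x\<close> moves
  \<open>g\<close> from one factor of the integrand to the other, where unitarity turns the
  conjugate of \<open>\<eta> (iv g)\<close> into \<open>\<eta> g\<close>.\<close>

lemma intertwine:
  assumes \<xi>: "unitary_rep K \<xi>" and \<eta>: "unitary_rep K \<eta>"
    and ij: "i < rdim \<xi>" "j < rdim \<xi>" and ml: "m < rdim \<eta>" "l < rdim \<eta>"
  shows "(\<Sum>p<rdim \<xi>. \<xi> g $$ (i, p) * (\<integral>x. \<xi> x $$ (p, j) * cnj (\<eta> x $$ (m, l)) \<partial>haar K)) =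
    (\<Sum>k<rdim \<eta>. (\<integral>x. \<xi> x $$ (i, j) * cnj (\<eta> x $$ (k, l)) \<partial>haar K) * \<eta> g $$ (k, m))"
proof -
  have rx: "representation K \<xi>" and ry: "representation K \<eta>" using \<xi> \<eta> by (auto simp: unitary_rep_def)
  note cont = rep_cont[OF rx, of _ _ UNIV] cont_cnj[OF rep_cont[OF ry, of _ _ UNIV]]
  have int: "integrable (haar K) (\<lambda>x. \<xi> x $$ (p, j) * cnj (\<eta> x $$ (k, l)))" if "p < rdim \<xi>" "k < rdim \<eta>" for p k
    by (intro cont_integrable continuous_on_mult cont that ij ml)
  have "(\<Sum>p<rdim \<xi>. \<xi> g $$ (i, p) * (\<integral>x. \<xi> x $$ (p, j) * cnj (\<eta> x $$ (m, l)) \<partial>haar K)) =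
      (\<integral>x. (\<Sum>p<rdim \<xi>. \<xi> g $$ (i, p) * (\<xi> x $$ (p, j) * cnj (\<eta> x $$ (m, l)))) \<partial>haar K)"
    using int ml by (subst Bochner_Integration.integral_sum) auto
  also have "\<dots> = (\<integral>x. \<xi> (g \<star> x) $$ (i, j) * cnj (\<eta> (iv g \<star> (g \<star> x)) $$ (m, l)) \<partial>haar K)"
    unfolding rep_mult_entry[OF rx ij] by (simp add: sum_distrib_right mult.assoc)
  also have "\<dots> = (\<integral>x. \<xi> x $$ (i, j) * cnj (\<eta> (iv g \<star> x) $$ (m, l)) \<partial>haar K)"
    by (rule haar_translate[of "\<lambda>x. \<xi> x $$ (i, j) * cnj (\<eta> (iv g \<star> x) $$ (m, l))"])
      (intro continuous_on_mult cont ij cont_cnj continuous_on_compose2[OF rep_cont[OF ry ml, of UNIV]]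
        mul_cont2 continuous_intros subset_UNIV)
  also have "\<dots> = (\<integral>x. (\<Sum>k<rdim \<eta>. (\<xi> x $$ (i, j) * cnj (\<eta> x $$ (k, l))) * \<eta> g $$ (k, m)) \<partial>haar K)"
  proof (rule Bochner_Integration.integral_cong[OF refl])
    fix x
    have "cnj (\<eta> (iv g \<star> x) $$ (m, l)) = (\<Sum>k<rdim \<eta>. cnj (\<eta> (iv g) $$ (m, k)) * cnj (\<eta> x $$ (k, l)))"
      unfolding rep_mult_entry[OF ry ml] by simp
    also have "\<dots> = (\<Sum>k<rdim \<eta>. \<eta> g $$ (k, m) * cnj (\<eta> x $$ (k, l)))"
      by (rule sum.cong[OF refl]) (simp add: unitary_entry[OF \<eta> _ ml(1)])
    finally show "\<xi> x $$ (i, j) * cnj (\<eta> (iv g \<star> x) $$ (m, l)) =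
        (\<Sum>k<rdim \<eta>. (\<xi> x $$ (i, j) * cnj (\<eta> x $$ (k, l))) * \<eta> g $$ (k, m))"
      by (simp add: sum_distrib_left mult_ac)
  qed
  also have "\<dots> = (\<Sum>k<rdim \<eta>. (\<integral>x. \<xi> x $$ (i, j) * cnj (\<eta> x $$ (k, l)) \<partial>haar K) * \<eta> g $$ (k, m))"
    using int ij by (subst Bochner_Integration.integral_sum) auto
  finally show ?thesis .
qed

text \<open>The average over the group of \<open>\<xi> x\<close> times the matrix unit with entry at
  (j, l) times the adjoint of \<open>\<eta> x\<close>.\<close>

definition coeff_int_mat where
  "coeff_int_mat \<xi> \<eta> j l = Matrix.mat (rdim \<xi>) (rdim \<eta>) (\<lambda>(i, k). \<integral>x. \<xi> x $$ (i, j) * cnj (\<eta> x $$ (k, l)) \<partial>haar K)"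

lemma coeff_int_mat_carrier: "coeff_int_mat \<xi> \<eta> j l \<in> carrier_mat (rdim \<xi>) (rdim \<eta>)"
  by (simp add: coeff_int_mat_def)

lemma coeff_int_mat_intertwine:
  assumes "unitary_rep K \<xi>" "unitary_rep K \<eta>" "j < rdim \<xi>" "l < rdim \<eta>"
  shows "coeff_int_mat \<xi> \<eta> j l * \<eta> g = \<xi> g * coeff_int_mat \<xi> \<eta> j l"
proof (rule eq_matI)
  have c: "\<xi> g \<in> carrier_mat (rdim \<xi>) (rdim \<xi>)" "\<eta> g \<in> carrier_mat (rdim \<eta>) (rdim \<eta>)"
    using assms by (auto simp: unitary_rep_def rep_carrier)
  show "dim_row (coeff_int_mat \<xi> \<eta> j l * \<eta> g) = dim_row (\<xi> g * coeff_int_mat \<xi> \<eta> j l)"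
    "dim_col (coeff_int_mat \<xi> \<eta> j l * \<eta> g) = dim_col (\<xi> g * coeff_int_mat \<xi> \<eta> j l)"
    using c by (auto simp: coeff_int_mat_def)
  fix i m assume "i < dim_row (\<xi> g * coeff_int_mat \<xi> \<eta> j l)" "m < dim_col (\<xi> g * coeff_int_mat \<xi> \<eta> j l)"
  then have im: "i < rdim \<xi>" "m < rdim \<eta>" using c by (auto simp: coeff_int_mat_def)
  show "(coeff_int_mat \<xi> \<eta> j l * \<eta> g) $$ (i, m) = (\<xi> g * coeff_int_mat \<xi> \<eta> j l) $$ (i, m)"
    unfolding mult_mat_entry[OF coeff_int_mat_carrier c(2) im] mult_mat_entry[OF c(1) coeff_int_mat_carrier im]
    using intertwine[OF assms(1,2) im(1) assms(3) im(2) assms(4), of g] im by (simp add: coeff_int_mat_def)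
qed

text \<open>The averaged matrix unit is a scalar matrix by Schur's lemma. Its trace is the integral
  of an entry of the identity matrix, by unitarity, and this determines the scalar.\<close>

lemma orth_same:
  assumes \<xi>: "\<xi> \<in> dual K" and "i < rdim \<xi>" "j < rdim \<xi>" "k < rdim \<xi>" "l < rdim \<xi>"
  shows "(\<integral>x. \<xi> x $$ (i, j) * cnj (\<xi> x $$ (k, l)) \<partial>haar K) = (if i = k \<and> j = l then 1 / rdim \<xi> else 0)"
proof -
  let ?d = "rdim \<xi>"
  interpret finite_measure "haar K" by (rule haar_finite)
  note u = dualD[OF \<xi>]
  obtain c where c: "coeff_int_mat \<xi> \<xi> j l = c \<cdot>\<^sub>m 1\<^sub>m ?d"
    using schur_scalar[OF u(2) coeff_int_mat_carrier coeff_int_mat_intertwine[OF u(1,1) assms(3,5)]] by blast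
  have ent: "(\<integral>x. \<xi> x $$ (i, j) * cnj (\<xi> x $$ (k, l)) \<partial>haar K) = (if i = k then c else 0)"
    if "i < ?d" "k < ?d" for i k
  proof -
    have "(\<integral>x. \<xi> x $$ (i, j) * cnj (\<xi> x $$ (k, l)) \<partial>haar K) = coeff_int_mat \<xi> \<xi> j l $$ (i, k)"
      using that by (simp add: coeff_int_mat_def)
    then show ?thesis unfolding c using that by simp
  qed
  have int: "integrable (haar K) (\<lambda>x. \<xi> x $$ (i, j) * cnj (\<xi> x $$ (i, l)))" if "i < ?d" for i
    by (intro cont_integrable continuous_on_mult cont_cnj rep_cont u that assms)
  have "of_nat ?d * c = (\<Sum>i<?d. \<integral>x. \<xi> x $$ (i, j) * cnj (\<xi> x $$ (i, l)) \<partial>haar K)"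
    by (simp add: ent)
  also have "\<dots> = (\<integral>x. (\<Sum>i<?d. \<xi> x $$ (i, j) * cnj (\<xi> x $$ (i, l))) \<partial>haar K)"
    using int by (subst Bochner_Integration.integral_sum) auto
  also have "\<dots> = (if j = l then 1 else 0)"
    unfolding unitary_sum[OF u(1) assms(3,5)] by (simp add: haar_UNIV)
  finally have "c = (if j = l then 1 / ?d else 0)"
    using u(4) by (auto simp: field_simps split: if_splits)
  then show ?thesis using ent[OF assms(2,4)] by auto
qed

text \<open>\<open>S\<close> is the adjoint of \<open>T\<close>, and both intertwine. By Schur's
  lemma \<open>T * S\<close> and \<open>S * T\<close> are scalar matrices, with the same scalar
  since \<open>T * S * T\<close> can be bracketed in two ways and \<open>T\<close> has a nonzero
  entry. The scalar is positive, as a diagonal entry of \<open>T * S\<close> is a sum of squares.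
  Hence \<open>T\<close> is invertible and the representations are equivalent, against the
  uniqueness of the representative in \<open>dual K\<close>.\<close>

lemma orth_diff:
  assumes \<xi>: "\<xi> \<in> dual K" and \<eta>: "\<eta> \<in> dual K" and ne: "\<xi> \<noteq> \<eta>"
    and ij: "i < rdim \<xi>" "j < rdim \<xi>" and kl: "k < rdim \<eta>" "l < rdim \<eta>"
  shows "(\<integral>x. \<xi> x $$ (i, j) * cnj (\<eta> x $$ (k, l)) \<partial>haar K) = 0"
proof (rule ccontr)
  assume nz: "(\<integral>x. \<xi> x $$ (i, j) * cnj (\<eta> x $$ (k, l)) \<partial>haar K) \<noteq> 0"
  let ?n = "rdim \<xi>" and ?m = "rdim \<eta>"
  note u = dualD[OF \<xi>] and v = dualD[OF \<eta>]
  define T where "T = coeff_int_mat \<xi> \<eta> j l"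
  define S where "S = coeff_int_mat \<eta> \<xi> l j"
  have T: "T \<in> carrier_mat ?n ?m" and S: "S \<in> carrier_mat ?m ?n"
    by (auto simp: T_def S_def coeff_int_mat_carrier)
  have X: "\<xi> x \<in> carrier_mat ?n ?n" and Y: "\<eta> x \<in> carrier_mat ?m ?m" for x
    using rep_carrier u v by auto
  have Ti: "T * \<eta> g = \<xi> g * T" and Si: "S * \<xi> g = \<eta> g * S" for g
    unfolding T_def S_def using coeff_int_mat_intertwine u v ij kl by auto
  have TS: "T * S \<in> carrier_mat ?n ?n" and ST: "S * T \<in> carrier_mat ?m ?m" using T S by auto
  have "T * S * \<xi> g = \<xi> g * (T * S)" for g
  proof -
    have "T * S * \<xi> g = T * (S * \<xi> g)" by (rule assoc_mult_mat[OF T S X])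
    also have "\<dots> = (T * \<eta> g) * S" unfolding Si by (rule assoc_mult_mat[OF T Y S, symmetric])
    also have "\<dots> = \<xi> g * (T * S)" unfolding Ti by (rule assoc_mult_mat[OF X T S])
    finally show ?thesis .
  qed
  from schur_scalar[OF u(2) TS this] obtain c where c: "T * S = c \<cdot>\<^sub>m 1\<^sub>m ?n" .
  have "S * T * \<eta> g = \<eta> g * (S * T)" for g
  proof -
    have "S * T * \<eta> g = S * (T * \<eta> g)" by (rule assoc_mult_mat[OF S T Y])
    also have "\<dots> = (S * \<xi> g) * T" unfolding Ti by (rule assoc_mult_mat[OF S X T, symmetric])
    also have "\<dots> = \<eta> g * (S * T)" unfolding Si by (rule assoc_mult_mat[OF Y S T])
    finally show ?thesis .
  qed
  from schur_scalar[OF v(2) ST this] obtain c' where c': "S * T = c' \<cdot>\<^sub>m 1\<^sub>m ?m" .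
  have conj: "S $$ (q, p) = cnj (T $$ (p, q))" if "p < ?n" "q < ?m" for p q
  proof -
    have "S $$ (q, p) = (\<integral>x. cnj (\<xi> x $$ (p, j) * cnj (\<eta> x $$ (q, l))) \<partial>haar K)"
      using that by (simp add: S_def coeff_int_mat_def mult.commute)
    also have "\<dots> = cnj (\<integral>x. \<xi> x $$ (p, j) * cnj (\<eta> x $$ (q, l)) \<partial>haar K)"
      by (rule Bochner_Integration.integral_cnj)
    finally show ?thesis using that by (simp add: T_def coeff_int_mat_def)
  qed
  have nzT: "T $$ (i, k) \<noteq> 0" using nz ij kl by (simp add: T_def coeff_int_mat_def)
  have "c \<cdot>\<^sub>m T = (T * S) * T" unfolding c by (simp add: mult_smult_assoc_mat[OF one_carrier_mat T] left_mult_one_mat[OF T])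
  also have "\<dots> = T * (S * T)" by (rule assoc_mult_mat[OF T S T])
  also have "\<dots> = c' \<cdot>\<^sub>m T" unfolding c' by (simp add: mult_smult_distrib[OF T one_carrier_mat] right_mult_one_mat[OF T])
  finally have "(c \<cdot>\<^sub>m T) $$ (i, k) = (c' \<cdot>\<^sub>m T) $$ (i, k)" by simp
  then have cc: "c = c'" using nzT T ij kl by auto
  have sq: "(T * S) $$ (p, p) = of_real (\<Sum>q<?m. (cmod (T $$ (p, q)))\<^sup>2)" if "p < ?n" for p
    unfolding mult_mat_entry[OF T S that that]
    by (simp add: conj[OF that] complex_norm_square[symmetric])
  have "0 < (cmod (T $$ (i, k)))\<^sup>2" using nzT by simp
  also have "\<dots> \<le> (\<Sum>q<?m. (cmod (T $$ (i, q)))\<^sup>2)" by (rule member_le_sum) (use kl in auto)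
  finally have pos: "0 < (\<Sum>q<?m. (cmod (T $$ (i, q)))\<^sup>2)" .
  have "(T * S) $$ (i, i) = c" unfolding c using ij by simp
  with sq[OF ij(1)] have "c = of_real (\<Sum>q<?m. (cmod (T $$ (i, q)))\<^sup>2)" by (simp only:)
  with pos have cnz: "c \<noteq> 0" by (metis less_irrefl of_real_eq_0_iff)
  \<comment> \<open>The traces of \<open>T * S\<close> and \<open>S * T\<close> agree, which forces
    equal dimensions.\<close>
  have "of_nat ?n * c = (\<Sum>p<?n. (T * S) $$ (p, p))"
  proof -
    have "(T * S) $$ (p, p) = c" if "p < ?n" for p unfolding c using that by simp
    then show ?thesis by simp
  qed
  also have "\<dots> = (\<Sum>p<?n. \<Sum>q<?m. T $$ (p, q) * S $$ (q, p))"
    by (rule sum.cong[OF refl], rule mult_mat_entry[OF T S]) auto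
  also have "\<dots> = (\<Sum>q<?m. \<Sum>p<?n. S $$ (q, p) * T $$ (p, q))"
    by (subst sum.swap) (simp add: mult.commute)
  also have "\<dots> = (\<Sum>q<?m. (S * T) $$ (q, q))"
    by (rule sum.cong[OF refl], rule mult_mat_entry[OF S T, symmetric]) auto
  also have "\<dots> = of_nat ?m * c'"
  proof -
    have "(S * T) $$ (p, p) = c'" if "p < ?m" for p unfolding c' using that by simp
    then show ?thesis by simp
  qed
  finally have nm: "?n = ?m" using cnz cc by simp
  have T': "T \<in> carrier_mat ?m ?m" and S': "S \<in> carrier_mat ?m ?m" using T S nm by auto
  have "invertible_mat T"
    unfolding invertible_mat_def inverts_mat_def
  proof (intro conjI exI)
    show "square_mat T" using T' by simp
    show "T * ((1 / c) \<cdot>\<^sub>m S) = 1\<^sub>m (dim_row T)"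
      using T' nm unfolding mult_smult_distrib[OF T' S'] c by (intro eq_matI) (use cnz in auto)
    show "((1 / c) \<cdot>\<^sub>m S) * T = 1\<^sub>m (dim_row ((1 / c) \<cdot>\<^sub>m S))"
      using S' unfolding mult_smult_assoc_mat[OF S' T'] c' by (intro eq_matI) (use cnz cc in auto)
  qed
  then have "equivalent_rep K \<eta> \<xi>"
    unfolding equivalent_rep_def using nm T' Ti by auto
  moreover have "equivalent_rep K \<xi> \<xi>"
    unfolding equivalent_rep_def
  proof (intro conjI bexI allI)
    show "invertible_mat (1\<^sub>m ?n :: complex mat)" unfolding invertible_mat_def inverts_mat_def
      by (intro conjI exI[of _ "1\<^sub>m ?n"]) auto
    show "1\<^sub>m ?n * \<xi> x = \<xi> x * 1\<^sub>m ?n" for x using X[of x] by simp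
  qed auto
  moreover have "\<exists>!\<zeta>. \<zeta> \<in> dual K \<and> equivalent_rep K \<zeta> \<xi>"
    using setting u unfolding calculus_setting_def unitary_dual_def by blast
  ultimately show False using \<xi> \<eta> ne by blast
qed

section \<open>Functions with finitely many Fourier modes\<close>

text \<open>Representative functions: their left translates span a space of finite dimension.\<close>

definition repfun :: "('g \<Rightarrow> complex) \<Rightarrow> bool" where
  "repfun f \<longleftrightarrow> (\<exists>L. (\<forall>(a, b)\<in>set L. continuous_on UNIV b) \<and>
     (\<forall>y x. f (y \<star> x) = (\<Sum>(a, b)\<leftarrow>L. a y * b x)))"

lemma repfun_continuous:
  assumes "repfun f"
  shows "continuous_on UNIV f"
proof -
  obtain L where L: "\<forall>(a, b)\<in>set L. continuous_on UNIV b"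
    "\<And>y x. f (y \<star> x) = (\<Sum>(a, b)\<leftarrow>L. a y * b x)"
    using assms unfolding repfun_def by blast
  have "continuous_on UNIV (\<lambda>x. \<Sum>(a, b)\<leftarrow>L. a e1 * b x)"
    using L(1) by (induction L) (auto intro!: continuous_intros)
  moreover have "f = (\<lambda>x. \<Sum>(a, b)\<leftarrow>L. a e1 * b x)" using L(2)[of e1] by auto
  ultimately show ?thesis by simp
qed

lemma repfun_const: "repfun (\<lambda>x. c)"
  unfolding repfun_def by (rule exI[of _ "[(\<lambda>x. c, \<lambda>x. 1)]"]) auto

lemma repfun_diff_const:
  assumes "repfun f"
  shows "repfun (\<lambda>x. f x - c)"
proof -
  obtain L where L: "\<forall>(a, b)\<in>set L. continuous_on UNIV b"
    "\<And>y x. f (y \<star> x) = (\<Sum>(a, b)\<leftarrow>L. a y * b x)"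
    using assms unfolding repfun_def by blast
  show ?thesis unfolding repfun_def
    using L by (intro exI[of _ "(\<lambda>x. - c, \<lambda>x. 1) # L"]) auto
qed

lemma repfun_cnj:
  assumes "repfun f"
  shows "repfun (\<lambda>x. cnj (f x))"
proof -
  obtain L where L: "\<forall>(a, b)\<in>set L. continuous_on UNIV b"
    "\<And>y x. f (y \<star> x) = (\<Sum>(a, b)\<leftarrow>L. a y * b x)"
    using assms unfolding repfun_def by blast
  have "cnj (\<Sum>(a, b)\<leftarrow>L. a y * b x) =
      (\<Sum>(a, b)\<leftarrow>map (\<lambda>(a, b). (\<lambda>x. cnj (a x), \<lambda>x. cnj (b x))) L. a y * b x)" for y x
    by (induction L) auto
  moreover have "\<forall>(a, b)\<in>set (map (\<lambda>(a, b). (\<lambda>x. cnj (a x), \<lambda>x. cnj (b x))) L). continuous_on UNIV b"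
    using L(1) by (auto intro!: cont_cnj)
  ultimately show ?thesis unfolding repfun_def using L(2)
    by (intro exI[of _ "map (\<lambda>(a, b). (\<lambda>x. cnj (a x), \<lambda>x. cnj (b x))) L"]) auto
qed

lemma repfun_mult:
  assumes "repfun f" "repfun g"
  shows "repfun (\<lambda>x. f x * g x)"
proof -
  obtain L where L: "\<forall>(a, b)\<in>set L. continuous_on UNIV b"
    "\<And>y x. f (y \<star> x) = (\<Sum>(a, b)\<leftarrow>L. a y * b x)"
    using assms unfolding repfun_def by blast
  obtain M where M: "\<forall>(a, b)\<in>set M. continuous_on UNIV b"
    "\<And>y x. g (y \<star> x) = (\<Sum>(a, b)\<leftarrow>M. a y * b x)"
    using assms unfolding repfun_def by blast
  define P :: "('g \<Rightarrow> complex) \<times> ('g \<Rightarrow> complex) \<Rightarrow> (('g \<Rightarrow> complex) \<times> ('g \<Rightarrow> complex)) list"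
    where "P p = map (\<lambda>q. (\<lambda>x. fst p x * fst q x, \<lambda>x. snd p x * snd q x)) M" for p
  have one: "(\<Sum>(a, b)\<leftarrow>P p. a y * b x) = fst p y * snd p x * (\<Sum>(a, b)\<leftarrow>M. a y * b x)" for p y x
    unfolding P_def by (induction M) (auto simp: algebra_simps)
  have "(\<Sum>(a, b)\<leftarrow>L. a y * b x) * (\<Sum>(a, b)\<leftarrow>M. a y * b x) =
      (\<Sum>(a, b)\<leftarrow>concat (map P L). a y * b x)" for y x
  proof (induction L)
    case (Cons p L)
    obtain a b where p: "p = (a, b)" by fastforce
    show ?case using Cons by (simp add: one p distrib_right)
  qed simp
  moreover have "\<forall>(a, b)\<in>set (concat (map P L)). continuous_on UNIV b"
    using L(1) M(1) by (fastforce simp: P_def intro!: continuous_on_mult)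
  ultimately show ?thesis unfolding repfun_def using L(2) M(2)
    by (intro exI[of _ "concat (map P L)"]) simp
qed

lemma repfun_prod: "finite I \<Longrightarrow> (\<And>i. i \<in> I \<Longrightarrow> repfun (f i)) \<Longrightarrow> repfun (\<lambda>x. \<Prod>i\<in>I. f i x)"
  by (induction I rule: finite_induct) (auto intro: repfun_const repfun_mult)

lemma repfun_power: "repfun f \<Longrightarrow> repfun (\<lambda>x. f x ^ n)"
  by (induction n) (auto intro: repfun_const repfun_mult)

lemma repfun_rep:
  assumes "representation K \<eta>" "i < rdim \<eta>" "j < rdim \<eta>"
  shows "repfun (\<lambda>x. \<eta> x $$ (i, j))"
  unfolding repfun_def
proof (intro exI conjI allI)
  let ?L = "map (\<lambda>k. (\<lambda>x. \<eta> x $$ (i, k), \<lambda>x. \<eta> x $$ (k, j))) [0..<rdim \<eta>]"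
  show "\<forall>(a, b)\<in>set ?L. continuous_on UNIV b" using assms by (auto intro!: rep_cont)
  show "\<eta> (y \<star> x) $$ (i, j) = (\<Sum>(a, b)\<leftarrow>?L. a y * b x)" for y x
    unfolding rep_mult_entry[OF assms]
    by (simp add: comp_def interv_sum_list_conv_sum_set_nat atLeast0LessThan)
qed

lemma repfun_q_power: "repfun (q_power K \<beta>)"
proof -
  have "repfun q" if q: "q \<in> set (diff_functions K)" for q
  proof -
    obtain \<eta> i j where \<eta>: "\<eta> \<in> set (diff_reps K)" "i < rdim \<eta>" "j < rdim \<eta>"
      "q = (\<lambda>x. (\<eta> x - 1\<^sub>m (rdim \<eta>)) $$ (i, j))"
      using q unfolding diff_functions_def by auto
    have rep: "representation K \<eta>"
      using setting \<eta>(1) by (auto simp: calculus_setting_def admissible_diff_reps_def)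
    have "q = (\<lambda>x. \<eta> x $$ (i, j) - 1\<^sub>m (rdim \<eta>) $$ (i, j))"
      unfolding \<eta>(4) using \<eta>(2,3) by (intro ext index_minus_mat(1)) auto
    then show ?thesis using repfun_diff_const[OF repfun_rep[OF rep \<eta>(2,3)]] by simp
  qed
  then show ?thesis unfolding q_power_def
    by (intro repfun_prod repfun_power) auto
qed

text \<open>Each \<xi> that occurs in the spectrum of \<open>f\<close> gives a function
  \<open>G \<xi>\<close>, obtained by integrating the translates of \<open>f\<close> against a
  matrix coefficient of \<xi>. It lies in the span of the finitely many first components of
  \<open>L\<close>. On the other hand \<open>G \<xi>\<close> is a combination of coefficients of
  \<xi>, so by orthogonality these functions are independent for different \<xi>. There are thus at
  most as many \<xi> as elements in the list.\<close>

lemma finite_spectrum: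
  assumes f: "repfun f"
  shows "finite {\<xi>\<in>dual K. \<exists>i<rdim \<xi>. \<exists>j<rdim \<xi>. (\<integral>x. f x * cnj (\<xi> x $$ (i, j)) \<partial>haar K) \<noteq> 0}"
    (is "finite ?S")
proof -
  interpret fs: vector_space "\<lambda>(c::complex) (f::'g \<Rightarrow> complex) x. c * f x"
    by unfold_locales (auto simp: fun_eq_iff algebra_simps)
  obtain L where L: "\<And>a b. (a, b) \<in> set L \<Longrightarrow> continuous_on UNIV b"
    "\<And>y x. f (y \<star> x) = (\<Sum>(a, b)\<leftarrow>L. a y * b x)"
    using f unfolding repfun_def by blast
  note cf = repfun_continuous[OF f]
  have "\<forall>\<xi>\<in>?S. \<exists>p. fst p < rdim \<xi> \<and> snd p < rdim \<xi> \<and>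
      (\<integral>x. f x * cnj (\<xi> x $$ p) \<partial>haar K) \<noteq> 0" by fastforce
  from bchoice[OF this] obtain p where "\<forall>\<xi>\<in>?S. fst (p \<xi>) < rdim \<xi> \<and> snd (p \<xi>) < rdim \<xi> \<and>
      (\<integral>x. f x * cnj (\<xi> x $$ p \<xi>) \<partial>haar K) \<noteq> 0" by (elim exE)
  then have p: "fst (p \<xi>) < rdim \<xi> \<and> snd (p \<xi>) < rdim \<xi> \<and>
      (\<integral>x. f x * cnj (\<xi> x $$ p \<xi>) \<partial>haar K) \<noteq> 0" if "\<xi> \<in> ?S" for \<xi>
    using that by (rule bspec)
  \<comment> \<open>After a translation of the integration variable, \<open>G \<xi> y\<close> is the
    integral of \<open>f (y \<star> x)\<close> against the conjugate of the coefficient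
    \<open>p \<xi>\<close> of \<xi>.\<close>
  define c where "c \<xi> r = (\<integral>x. f x * cnj (\<xi> x $$ (r, snd (p \<xi>))) \<partial>haar K)" for \<xi> r
  define G where "G \<xi> y = (\<Sum>r<rdim \<xi>. \<xi> y $$ (r, fst (p \<xi>)) * c \<xi> r)" for \<xi> y
  have G: "G \<xi> \<in> fs.span (fst ` set L)" if \<xi>: "\<xi> \<in> ?S" for \<xi>
  proof -
    have \<xi>D: "\<xi> \<in> dual K" using \<xi> by simp
    note u = dualD[OF \<xi>D]
    let ?i = "fst (p \<xi>)" and ?j = "snd (p \<xi>)"
    have ij: "?i < rdim \<xi>" "?j < rdim \<xi>" using p[OF \<xi>] by auto
    have ci: "continuous_on UNIV (\<lambda>x. cnj (\<xi> x $$ (r, ?j)))" if "r < rdim \<xi>" for r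
      by (intro cont_cnj rep_cont u that ij)
    have "G \<xi> y = (\<Sum>(a, b)\<leftarrow>L. a y * (\<integral>x. b x * cnj (\<xi> x $$ (?i, ?j)) \<partial>haar K))" for y
    proof -
      have "(\<integral>x. f (y \<star> x) * cnj (\<xi> x $$ (?i, ?j)) \<partial>haar K) =
          (\<integral>x. f (y \<star> x) * cnj (\<xi> (iv y \<star> (y \<star> x)) $$ (?i, ?j)) \<partial>haar K)" by simp
      also have "\<dots> = (\<integral>x. f x * cnj (\<xi> (iv y \<star> x) $$ (?i, ?j)) \<partial>haar K)"
        by (rule haar_translate[of "\<lambda>x. f x * cnj (\<xi> (iv y \<star> x) $$ (?i, ?j))"])
          (intro continuous_on_mult cf cont_cnj continuous_on_compose2[OF rep_cont[OF u(3) ij, of UNIV]]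
            mul_cont2 continuous_intros subset_UNIV)
      also have "\<dots> = (\<integral>x. (\<Sum>r<rdim \<xi>. \<xi> y $$ (r, ?i) * (f x * cnj (\<xi> x $$ (r, ?j)))) \<partial>haar K)"
      proof (rule Bochner_Integration.integral_cong[OF refl])
        fix x
        have "cnj (\<xi> (iv y \<star> x) $$ (?i, ?j)) = (\<Sum>r<rdim \<xi>. \<xi> y $$ (r, ?i) * cnj (\<xi> x $$ (r, ?j)))"
          unfolding rep_mult_entry[OF u(3) ij]
          by (simp add: unitary_entry[OF u(1) _ ij(1)])
        then show "f x * cnj (\<xi> (iv y \<star> x) $$ (?i, ?j)) =
            (\<Sum>r<rdim \<xi>. \<xi> y $$ (r, ?i) * (f x * cnj (\<xi> x $$ (r, ?j))))"
          by (simp add: sum_distrib_left mult_ac)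
      qed
      also have "\<dots> = G \<xi> y" unfolding G_def c_def
        by (subst Bochner_Integration.integral_sum)
          (auto intro!: integrable_mult_right cont_integrable continuous_on_mult cf ci)
      finally have "G \<xi> y = (\<integral>x. (\<Sum>(a, b)\<leftarrow>L. a y * b x) * cnj (\<xi> x $$ (?i, ?j)) \<partial>haar K)"
        unfolding L(2) by simp
      also have "\<dots> = (\<Sum>(a, b)\<leftarrow>L. a y * (\<integral>x. b x * cnj (\<xi> x $$ (?i, ?j)) \<partial>haar K)) \<and>
          continuous_on UNIV (\<lambda>x. \<Sum>(a, b)\<leftarrow>L. a y * b x)"
        using L(1)
      proof (induction L)
        case (Cons q L)
        obtain a b where q: "q = (a, b)" by fastforce
        have b: "continuous_on UNIV b" using Cons.prems by (auto simp: q)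
        have IH: "(\<integral>x. (\<Sum>(a, b)\<leftarrow>L. a y * b x) * cnj (\<xi> x $$ (?i, ?j)) \<partial>haar K) =
            (\<Sum>(a, b)\<leftarrow>L. a y * (\<integral>x. b x * cnj (\<xi> x $$ (?i, ?j)) \<partial>haar K))"
          "continuous_on UNIV (\<lambda>x. \<Sum>(a, b)\<leftarrow>L. a y * b x)"
          using Cons by auto
        have "integrable (haar K) (\<lambda>x. b x * cnj (\<xi> x $$ (?i, ?j)))"
          "integrable (haar K) (\<lambda>x. (\<Sum>(a, b)\<leftarrow>L. a y * b x) * cnj (\<xi> x $$ (?i, ?j)))"
          by (intro cont_integrable continuous_on_mult b IH(2) ci ij)+
        then have "(\<integral>x. a y * (b x * cnj (\<xi> x $$ (?i, ?j))) +
            (\<Sum>(a, b)\<leftarrow>L. a y * b x) * cnj (\<xi> x $$ (?i, ?j)) \<partial>haar K) =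
            a y * (\<integral>x. b x * cnj (\<xi> x $$ (?i, ?j)) \<partial>haar K) +
            (\<integral>x. (\<Sum>(a, b)\<leftarrow>L. a y * b x) * cnj (\<xi> x $$ (?i, ?j)) \<partial>haar K)"
          by (subst Bochner_Integration.integral_add) auto
        then show ?case using IH b by (auto simp: q distrib_right mult.assoc intro!: continuous_intros)
      qed simp
      finally show ?thesis by simp
    qed
    then have "G \<xi> = (\<lambda>y. \<Sum>(a, b)\<leftarrow>L. (\<integral>x. b x * cnj (\<xi> x $$ (?i, ?j)) \<partial>haar K) * a y)"
      by (simp add: fun_eq_iff mult.commute)
    also have "\<dots> \<in> fs.span (fst ` set L)"
    proof -
      have "(\<lambda>y. \<Sum>(a, b)\<leftarrow>M. h b * a y) \<in> fs.span (fst ` set M)" for M :: "(('g \<Rightarrow> complex) \<times> ('g \<Rightarrow> complex)) list" and h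
      proof (induction M)
        case Nil
        show ?case using fs.span_zero by (simp add: zero_fun_def)
      next
        case (Cons q M)
        obtain a b where q: "q = (a, b)" by fastforce
        have 1: "(\<lambda>y. h b * a y) \<in> fs.span (fst ` set (q # M))"
          by (intro fs.span_scale fs.span_base) (simp add: q)
        have 2: "(\<lambda>y. \<Sum>(a, b)\<leftarrow>M. h b * a y) \<in> fs.span (fst ` set (q # M))"
          by (rule subsetD[OF fs.span_mono Cons]) auto
        show ?case using fs.span_add[OF 1 2] by (simp add: q plus_fun_def)
      qed
      then show ?thesis .
    qed
    finally show ?thesis .
  qed
  \<comment> \<open>The diagonal coefficient at \<open>fst (p \<xi>)\<close> picks out of
    \<open>G \<xi>\<close> the Fourier coefficient of \<open>f\<close> that was chosen to be
    nonzero, and annihilates \<open>G \<eta>\<close> for other \<eta>.\<close>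
  define \<phi> where "\<phi> \<xi> h = (\<integral>y. h y * cnj (\<xi> y $$ (fst (p \<xi>), fst (p \<xi>))) \<partial>haar K)" for \<xi> h
  have Gcont: "continuous_on UNIV (G \<xi>)" if "\<xi> \<in> ?S" for \<xi>
    unfolding G_def using p[OF that] dualD[of \<xi>] that
    by (intro continuous_on_sum continuous_on_mult rep_cont continuous_on_const) auto
  have pairing: "\<phi> \<eta> (G \<xi>) = (if \<xi> = \<eta> then c \<xi> (fst (p \<xi>)) / rdim \<xi> else 0)"
    if \<xi>: "\<xi> \<in> ?S" and \<eta>: "\<eta> \<in> ?S" for \<xi> \<eta>
  proof -
    have D: "\<xi> \<in> dual K" "\<eta> \<in> dual K" using \<xi> \<eta> by auto
    have i: "fst (p \<xi>) < rdim \<xi>" "fst (p \<eta>) < rdim \<eta>" using p \<xi> \<eta> by auto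
    have int: "integrable (haar K) (\<lambda>y. \<xi> y $$ (r, fst (p \<xi>)) * cnj (\<eta> y $$ (fst (p \<eta>), fst (p \<eta>))))"
      if "r < rdim \<xi>" for r
      by (intro cont_integrable continuous_on_mult cont_cnj rep_cont dualD D that i)
    have "\<phi> \<eta> (G \<xi>) = (\<integral>y. (\<Sum>r<rdim \<xi>. c \<xi> r * (\<xi> y $$ (r, fst (p \<xi>)) *
        cnj (\<eta> y $$ (fst (p \<eta>), fst (p \<eta>))))) \<partial>haar K)"
      unfolding \<phi>_def G_def by (simp add: sum_distrib_left sum_distrib_right mult_ac)
    also have "\<dots> = (\<Sum>r<rdim \<xi>. c \<xi> r * (\<integral>y. \<xi> y $$ (r, fst (p \<xi>)) *
        cnj (\<eta> y $$ (fst (p \<eta>), fst (p \<eta>))) \<partial>haar K))"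
      using int by (subst Bochner_Integration.integral_sum) auto
    also have "\<dots> = (\<Sum>r<rdim \<xi>. if r = fst (p \<xi>) then (if \<xi> = \<eta> then c \<xi> r / rdim \<xi> else 0) else 0)"
    proof (rule sum.cong[OF refl])
      fix r assume "r \<in> {..<rdim \<xi>}"
      then have r: "r < rdim \<xi>" by simp
      show "c \<xi> r * (\<integral>y. \<xi> y $$ (r, fst (p \<xi>)) * cnj (\<eta> y $$ (fst (p \<eta>), fst (p \<eta>))) \<partial>haar K) =
          (if r = fst (p \<xi>) then (if \<xi> = \<eta> then c \<xi> r / rdim \<xi> else 0) else 0)"
        using orth_same[OF D(1) r i(1) i(1) i(1)] orth_diff[OF D _ r i(1) i(2) i(2)]
        by (cases "\<xi> = \<eta>") auto
    qed
    also have "\<dots> = (if \<xi> = \<eta> then c \<xi> (fst (p \<xi>)) / rdim \<xi> else 0)" using i by simp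
    finally show ?thesis .
  qed
  have nz: "c \<xi> (fst (p \<xi>)) / rdim \<xi> \<noteq> 0" if "\<xi> \<in> ?S" for \<xi>
    using p[OF that] dualD(4)[of \<xi>] that by (simp add: c_def)
  have inj: "inj_on G ?S"
  proof (rule inj_onI)
    fix \<xi> \<eta> assume *: "\<xi> \<in> ?S" "\<eta> \<in> ?S" "G \<xi> = G \<eta>"
    then have "\<phi> \<xi> (G \<eta>) \<noteq> 0" using pairing[OF *(1,1)] nz[OF *(1)] by simp
    then show "\<xi> = \<eta>" using pairing[OF *(2,1)] by (auto split: if_splits)
  qed
  have "fs.independent (G ` ?S)"
    unfolding fs.dependent_explicit
  proof clarify
    fix t k v assume t: "finite t" "t \<subseteq> G ` ?S" and sum0: "(\<Sum>v\<in>t. (\<lambda>x. k v * v x)) = 0"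
      and v: "v \<in> t" "k v \<noteq> 0"
    obtain \<xi> where \<xi>: "\<xi> \<in> ?S" "v = G \<xi>" using t v by blast
    let ?e = "\<lambda>y. cnj (\<xi> y $$ (fst (p \<xi>), fst (p \<xi>)))"
    have "integrable (haar K) (\<lambda>y. w y * ?e y)" if "w \<in> t" for w
      using that t p[OF \<xi>(1)] dualD[of \<xi>] \<xi>(1)
      by (auto intro!: cont_integrable continuous_on_mult cont_cnj rep_cont Gcont)
    then have "(\<Sum>w\<in>t. k w * \<phi> \<xi> w) = (\<integral>y. (\<Sum>w\<in>t. k w * (w y * ?e y)) \<partial>haar K)"
      unfolding \<phi>_def by (subst Bochner_Integration.integral_sum) auto
    also have "\<dots> = (\<integral>y. (\<Sum>w\<in>t. (\<lambda>x. k w * w x)) y * ?e y \<partial>haar K)"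
    proof -
      have "(\<Sum>w\<in>t. (\<lambda>x. k w * w x)) y = (\<Sum>w\<in>t. k w * w y)" for y
        using t(1) by (induction t rule: finite_induct) auto
      then show ?thesis by (simp add: sum_distrib_right mult.assoc)
    qed
    also have "\<dots> = 0" unfolding sum0 by simp
    finally have "(\<Sum>w\<in>t. k w * \<phi> \<xi> w) = 0" .
    moreover have "(\<Sum>w\<in>t. k w * \<phi> \<xi> w) = k v * \<phi> \<xi> v"
    proof -
      have "k w * \<phi> \<xi> w = 0" if w: "w \<in> t - {v}" for w
      proof -
        obtain \<eta> where "\<eta> \<in> ?S" "w = G \<eta>" "\<eta> \<noteq> \<xi>" using w t \<xi> by blast
        then show ?thesis using pairing[of \<eta> \<xi>] \<xi>(1) by simp
      qed
      then have "(\<Sum>w\<in>t - {v}. k w * \<phi> \<xi> w) = 0" by (intro sum.neutral) blast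
      then show ?thesis using sum.remove[OF t(1) v(1), of "\<lambda>w. k w * \<phi> \<xi> w"] by simp
    qed
    ultimately show False using v(2) \<xi> pairing[OF \<xi>(1,1)] nz[OF \<xi>(1)] by simp
  qed
  then have "finite (G ` ?S)"
    using fs.independent_span_bound[of "fst ` set L" "G ` ?S"] G by auto
  then show ?thesis using inj finite_imageD by blast
qed

text \<open>Up to the factor \<open>rdim \<eta>\<close>, the coefficient of the entry (l, k) of the
  symbol at \<eta> in the entry (i, j) of its difference at \<xi>. The indices of \<xi> appear
  reversed because the Fourier transform contains the adjoint.\<close>

definition dcoef where
  "dcoef q \<eta> k l \<xi> i j = (\<integral>x. \<eta> x $$ (k, l) * (q x * cnj (\<xi> x $$ (j, i))) \<partial>haar K)"

text \<open>\<open>linked q \<eta> \<xi>\<close> says that the value of a symbol at \<open>\<eta>\<close> may enter its difference \<open>\<Delta>\<^sub>q\<close> at \<open>\<xi>\<close>.\<close>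

definition linked where
  "linked q \<eta> \<xi> \<longleftrightarrow> (\<exists>k<rdim \<eta>. \<exists>l<rdim \<eta>. \<exists>i<rdim \<xi>. \<exists>j<rdim \<xi>. dcoef q \<eta> k l \<xi> i j \<noteq> 0)"

text \<open>The products of \<open>q\<close> with the coefficients of \<eta> are representative
  functions, so their spectra are finite. This bounds the set of \<xi> reached by an exceptional
  \<eta>.\<close>

lemma finite_linked_right:
  assumes q: "repfun q" and \<eta>: "\<eta> \<in> dual K"
  shows "finite {\<xi>\<in>dual K. linked q \<eta> \<xi>}"
proof (rule finite_subset)
  let ?T = "\<lambda>k l. {\<xi>\<in>dual K. \<exists>i<rdim \<xi>. \<exists>j<rdim \<xi>.
      (\<integral>x. (\<eta> x $$ (k, l) * q x) * cnj (\<xi> x $$ (i, j)) \<partial>haar K) \<noteq> 0}"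
  show "{\<xi>\<in>dual K. linked q \<eta> \<xi>} \<subseteq> (\<Union>k<rdim \<eta>. \<Union>l<rdim \<eta>. ?T k l)"
    unfolding linked_def dcoef_def by (auto simp: mult.assoc)
  show "finite (\<Union>k<rdim \<eta>. \<Union>l<rdim \<eta>. ?T k l)"
    by (intro finite_UN_I finite_lessThan finite_spectrum repfun_mult q repfun_rep dualD(3)[OF \<eta>]) auto
qed

text \<open>Conjugation exchanges the roles: \<open>dcoef\<close> is the conjugate of a Fourier
  coefficient at \<eta> of a coefficient of \<xi> times the conjugate of \<open>q\<close>. This
  makes a difference operator a finite sum.\<close>

lemma finite_linked_left:
  assumes q: "repfun q" and \<xi>: "\<xi> \<in> dual K"
  shows "finite {\<eta>\<in>dual K. linked q \<eta> \<xi>}"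
proof (rule finite_subset)
  let ?T = "\<lambda>i j. {\<eta>\<in>dual K. \<exists>k<rdim \<eta>. \<exists>l<rdim \<eta>.
      (\<integral>x. (\<xi> x $$ (j, i) * cnj (q x)) * cnj (\<eta> x $$ (k, l)) \<partial>haar K) \<noteq> 0}"
  have "dcoef q \<eta> k l \<xi> i j = cnj (\<integral>x. (\<xi> x $$ (j, i) * cnj (q x)) * cnj (\<eta> x $$ (k, l)) \<partial>haar K)"
    for \<eta> k l i j
    unfolding dcoef_def Bochner_Integration.integral_cnj[symmetric] by (simp add: mult_ac)
  then show "{\<eta>\<in>dual K. linked q \<eta> \<xi>} \<subseteq> (\<Union>i<rdim \<xi>. \<Union>j<rdim \<xi>. ?T i j)"
    unfolding linked_def by auto
  show "finite (\<Union>i<rdim \<xi>. \<Union>j<rdim \<xi>. ?T i j)"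
    by (intro finite_UN_I finite_lessThan finite_spectrum repfun_mult repfun_cnj q repfun_rep dualD(3)[OF \<xi>]) auto
qed

text \<open>Every summand of the inverse Fourier transform outside the linked \<eta> is zero after
  multiplication by \<open>q\<close> and pairing with a coefficient of \<xi>. The formula is finite,
  so it holds for every sequence of matrices of the right size, whatever its growth, and commutes
  with integrals and with derivatives in the group variable.\<close>

lemma diff_op_entry:
  assumes q: "repfun q" and \<xi>: "\<xi> \<in> dual K" and ij: "i < rdim \<xi>" "j < rdim \<xi>"
    and \<tau>: "\<And>\<eta>. \<eta> \<in> dual K \<Longrightarrow> \<tau> \<eta> \<in> carrier_mat (rdim \<eta>) (rdim \<eta>)"
  shows "diff_op K q \<tau> \<xi> $$ (i, j) = (\<Sum>\<eta>\<in>{\<eta>\<in>dual K. linked q \<eta> \<xi>}. \<Sum>k<rdim \<eta>. \<Sum>l<rdim \<eta>.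
    (of_nat (rdim \<eta>) * dcoef q \<eta> k l \<xi> i j) * \<tau> \<eta> $$ (l, k))"
proof -
  have c\<xi>: "\<xi> x \<in> carrier_mat (rdim \<xi>) (rdim \<xi>)" for x using rep_carrier dualD[OF \<xi>] by auto
  define t where "t \<eta> = (\<Sum>k<rdim \<eta>. \<Sum>l<rdim \<eta>. (of_nat (rdim \<eta>) * dcoef q \<eta> k l \<xi> i j) * \<tau> \<eta> $$ (l, k))" for \<eta>
  have summand: "of_nat (rdim \<eta>) * (\<integral>x. mat_trace (\<eta> x * \<tau> \<eta>) * (q x * mat_adjoint (\<xi> x) $$ (i, j)) \<partial>haar K) = t \<eta>"
    if \<eta>: "\<eta> \<in> dual K" for \<eta>
  proof -
    let ?n = "rdim \<eta>"
    have c\<eta>: "\<eta> x \<in> carrier_mat ?n ?n" for x using rep_carrier dualD[OF \<eta>] by auto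
    have tr: "mat_trace (\<eta> x * \<tau> \<eta>) = (\<Sum>k<?n. \<Sum>l<?n. \<eta> x $$ (k, l) * \<tau> \<eta> $$ (l, k))" for x
    proof -
      have "mat_trace (\<eta> x * \<tau> \<eta>) = (\<Sum>k<?n. (\<eta> x * \<tau> \<eta>) $$ (k, k))"
        using c\<eta>[of x] unfolding mat_trace_def diag_mat_def
        by (simp add: interv_sum_list_conv_sum_set_nat atLeast0LessThan)
      also have "\<dots> = (\<Sum>k<?n. \<Sum>l<?n. \<eta> x $$ (k, l) * \<tau> \<eta> $$ (l, k))"
        by (rule sum.cong[OF refl], rule mult_mat_entry[OF c\<eta> \<tau>[OF \<eta>]]) auto
      finally show ?thesis .
    qed
    have ad: "mat_adjoint (\<xi> x) $$ (i, j) = cnj (\<xi> x $$ (j, i))" for x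
      using mat_adjoint_entry[of i "\<xi> x" j] ij c\<xi>[of x] by simp
    have int: "integrable (haar K) (\<lambda>x. \<eta> x $$ (k, l) * (q x * cnj (\<xi> x $$ (j, i))))" if "k < ?n" "l < ?n" for k l
      by (intro cont_integrable continuous_on_mult cont_cnj rep_cont repfun_continuous q dualD \<xi> \<eta> that ij)
    have "(\<integral>x. mat_trace (\<eta> x * \<tau> \<eta>) * (q x * mat_adjoint (\<xi> x) $$ (i, j)) \<partial>haar K) =
        (\<integral>x. (\<Sum>k<?n. \<Sum>l<?n. \<tau> \<eta> $$ (l, k) * (\<eta> x $$ (k, l) * (q x * cnj (\<xi> x $$ (j, i))))) \<partial>haar K)"
      unfolding tr ad by (simp add: sum_distrib_left sum_distrib_right mult_ac)
    also have "\<dots> = (\<Sum>k<?n. \<integral>x. (\<Sum>l<?n. \<tau> \<eta> $$ (l, k) * (\<eta> x $$ (k, l) * (q x * cnj (\<xi> x $$ (j, i))))) \<partial>haar K)"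
      by (rule Bochner_Integration.integral_sum)
        (intro Bochner_Integration.integrable_sum integrable_mult_right int, auto)
    also have "\<dots> = (\<Sum>k<?n. \<Sum>l<?n. \<tau> \<eta> $$ (l, k) * dcoef q \<eta> k l \<xi> i j)"
    proof (rule sum.cong[OF refl])
      fix k assume "k \<in> {..<?n}"
      then have k: "k < ?n" by simp
      have "(\<integral>x. (\<Sum>l<?n. \<tau> \<eta> $$ (l, k) * (\<eta> x $$ (k, l) * (q x * cnj (\<xi> x $$ (j, i))))) \<partial>haar K) =
          (\<Sum>l<?n. \<integral>x. \<tau> \<eta> $$ (l, k) * (\<eta> x $$ (k, l) * (q x * cnj (\<xi> x $$ (j, i)))) \<partial>haar K)"
        by (rule Bochner_Integration.integral_sum) (intro integrable_mult_right int k, auto)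
      then show "(\<integral>x. (\<Sum>l<?n. \<tau> \<eta> $$ (l, k) * (\<eta> x $$ (k, l) * (q x * cnj (\<xi> x $$ (j, i))))) \<partial>haar K) =
          (\<Sum>l<?n. \<tau> \<eta> $$ (l, k) * dcoef q \<eta> k l \<xi> i j)"
        by (simp add: dcoef_def)
    qed
    finally show ?thesis by (simp add: t_def sum_distrib_left mult_ac)
  qed
  have "diff_op K q \<tau> \<xi> $$ (i, j) = (\<Sum>\<^sub>\<infinity>\<eta>\<in>dual K. t \<eta>)"
    unfolding diff_op_def dist_fourier_def dist_mult_def inv_fourier_def
    using ij by (simp add: summand cong: infsum_cong)
  also have "\<dots> = (\<Sum>\<^sub>\<infinity>\<eta>\<in>{\<eta>\<in>dual K. linked q \<eta> \<xi>}. t \<eta>)"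
  proof (rule infsum_cong_neutral)
    fix \<eta> assume "\<eta> \<in> dual K - {\<eta>\<in>dual K. linked q \<eta> \<xi>}"
    then have "dcoef q \<eta> k l \<xi> i j = 0" if "k < rdim \<eta>" "l < rdim \<eta>" for k l
      using that ij unfolding linked_def by blast
    then show "t \<eta> = 0" by (simp add: t_def)
  qed auto
  also have "\<dots> = (\<Sum>\<eta>\<in>{\<eta>\<in>dual K. linked q \<eta> \<xi>}. t \<eta>)"
    by (rule infsum_finite[OF finite_linked_left[OF q \<xi>]])
  finally show ?thesis unfolding t_def .
qed

lemma diff_op_dim: "dim_row (diff_op K q \<tau> \<xi>) = rdim \<xi>" "dim_col (diff_op K q \<tau> \<xi>) = rdim \<xi>"
  by (simp_all add: diff_op_def dist_fourier_def)

lemma q_power_0: "(\<And>i. \<beta> i = 0) \<Longrightarrow> q_power K \<beta> = (\<lambda>x. 1)"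
  by (auto simp: q_power_def)

text \<open>By orthogonality only \<xi> itself is linked to \<xi> when \<open>q\<close> is 1, and
  its coefficient cancels the dimension factor. Estimates of order zero in the differences are
  therefore estimates of the symbol itself.\<close>

lemma diff_op_one:
  assumes \<xi>: "\<xi> \<in> dual K"
    and \<tau>: "\<And>\<eta>. \<eta> \<in> dual K \<Longrightarrow> \<tau> \<eta> \<in> carrier_mat (rdim \<eta>) (rdim \<eta>)"
  shows "diff_op K (\<lambda>x. 1) \<tau> \<xi> = \<tau> \<xi>"
proof (rule eq_matI)
  show "dim_row (diff_op K (\<lambda>x. 1) \<tau> \<xi>) = dim_row (\<tau> \<xi>)" "dim_col (diff_op K (\<lambda>x. 1) \<tau> \<xi>) = dim_col (\<tau> \<xi>)"
    using \<tau>[OF \<xi>] by (simp_all add: diff_op_dim)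
  fix i j assume "i < dim_row (\<tau> \<xi>)" "j < dim_col (\<tau> \<xi>)"
  then have ij: "i < rdim \<xi>" "j < rdim \<xi>" using \<tau>[OF \<xi>] by auto
  have same: "dcoef (\<lambda>x. 1) \<xi> k l \<xi> i j = (if k = j \<and> l = i then 1 / rdim \<xi> else 0)"
    if "k < rdim \<xi>" "l < rdim \<xi>" "i < rdim \<xi>" "j < rdim \<xi>" for k l i j
    using orth_same[OF \<xi> that(1,2,4,3)] by (simp add: dcoef_def)
  have "{\<eta>\<in>dual K. linked (\<lambda>x. 1) \<eta> \<xi>} = {\<xi>}"
  proof (intro equalityI subsetI)
    fix \<eta> assume "\<eta> \<in> {\<eta>\<in>dual K. linked (\<lambda>x. 1) \<eta> \<xi>}"
    then show "\<eta> \<in> {\<xi>}" using orth_diff[OF _ \<xi>, of \<eta>] unfolding linked_def dcoef_def by auto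
  next
    fix \<eta> assume "\<eta> \<in> {\<xi>}"
    then show "\<eta> \<in> {\<eta>\<in>dual K. linked (\<lambda>x. 1) \<eta> \<xi>}"
      using same[OF ij(2,1) ij] ij \<xi> dualD(4)[OF \<xi>] unfolding linked_def by fastforce
  qed
  then have "diff_op K (\<lambda>x. 1) \<tau> \<xi> $$ (i, j) = (\<Sum>k<rdim \<xi>. \<Sum>l<rdim \<xi>.
      (of_nat (rdim \<xi>) * dcoef (\<lambda>x. 1) \<xi> k l \<xi> i j) * \<tau> \<xi> $$ (l, k))"
    using diff_op_entry[OF repfun_const \<xi> ij \<tau>] by simp
  also have "\<dots> = (\<Sum>k<rdim \<xi>. \<Sum>l<rdim \<xi>. if l = i then (if k = j then \<tau> \<xi> $$ (i, j) else 0) else 0)"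
    using ij dualD(4)[OF \<xi>] by (intro sum.cong refl) (auto simp: same)
  also have "\<dots> = \<tau> \<xi> $$ (i, j)" using ij by simp
  finally show "diff_op K (\<lambda>x. 1) \<tau> \<xi> $$ (i, j) = \<tau> \<xi> $$ (i, j)" .
qed

end

section \<open>Differentiability of continuous representations\<close>

text \<open>The squared positive part is continuously differentiable, which suffices as the profile
  of a bump function that is differentiated only once.\<close>

lemma max_square_derivative:
  "((\<lambda>s::real. (max 0 s)\<^sup>2) has_derivative (\<lambda>h. 2 * max 0 x * h)) (at x)"
  unfolding has_derivative_at_alt
proof (intro conjI allI impI)
  show "bounded_linear (\<lambda>h. 2 * max 0 x * h)" by (rule bounded_linear_mult_right)
  fix e :: real assume e: "0 < e"
  have q: "\<bar>(max 0 y)\<^sup>2 - (max 0 x)\<^sup>2 - 2 * max 0 x * (y - x)\<bar> \<le> \<bar>y - x\<bar> * \<bar>y - x\<bar>" for y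
  proof -
    consider "x \<ge> 0" "y \<ge> 0" | "x \<ge> 0" "y < 0" | "x < 0" "y \<ge> 0" | "x < 0" "y < 0" by linarith
    then show ?thesis
    proof cases
      case 1
      then have "(max 0 y)\<^sup>2 - (max 0 x)\<^sup>2 - 2 * max 0 x * (y - x) = (y - x) * (y - x)"
        by (simp add: power2_eq_square algebra_simps)
      then show ?thesis by (simp add: abs_mult)
    next
      case 2
      then have "(max 0 y)\<^sup>2 - (max 0 x)\<^sup>2 - 2 * max 0 x * (y - x) = x * x - 2 * (x * y)"
        by (simp add: power2_eq_square algebra_simps)
      moreover have "x * y \<le> 0" using 2 by (simp add: mult_nonneg_nonpos)
      moreover have "\<bar>y - x\<bar> * \<bar>y - x\<bar> = y * y - 2 * (x * y) + x * x"
        by (simp add: abs_mult_self_eq algebra_simps)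
      moreover have "0 \<le> x * x" "0 \<le> y * y" by simp_all
      ultimately show ?thesis by linarith
    next
      case 3
      have "y * y \<le> (y - x) * (y - x)" using 3 by (intro mult_mono) auto
      then show ?thesis using 3 by (simp add: power2_eq_square)
    qed (simp add: power2_eq_square)
  qed
  show "\<exists>d>0. \<forall>y. norm (y - x) < d \<longrightarrow>
      norm ((max 0 y)\<^sup>2 - (max 0 x)\<^sup>2 - 2 * max 0 x * (y - x)) \<le> e * norm (y - x)"
  proof (intro exI[of _ e] conjI e allI impI)
    fix y assume "norm (y - x) < e"
    then have "\<bar>y - x\<bar> * \<bar>y - x\<bar> \<le> e * \<bar>y - x\<bar>" by (intro mult_right_mono) auto
    with q[of y] show "norm ((max 0 y)\<^sup>2 - (max 0 x)\<^sup>2 - 2 * max 0 x * (y - x)) \<le> e * norm (y - x)"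
      by simp
  qed
qed

definition bumpf :: "'a::euclidean_space \<Rightarrow> real \<Rightarrow> 'a \<Rightarrow> real" where
  "bumpf p r b = (max 0 (r\<^sup>2 - inner (b - p) (b - p)))\<^sup>2"

lemma bumpf_nonneg: "0 \<le> bumpf p r b" by (simp add: bumpf_def)

lemma bumpf_outside: "0 < r \<Longrightarrow> r \<le> norm (b - p) \<Longrightarrow> bumpf p r b = 0"
  using power_mono[of r "norm (b - p)" 2] by (simp add: bumpf_def dot_square_norm)

text \<open>The derivative has size at most 4 times the positive part times
  \<open>norm (b - p)\<close> times \<open>norm w\<close>. Where the positive part is nonzero it is
  at most \<open>r\<^sup>2\<close>, and \<open>norm (b - p)\<close> is at most \<open>r\<close>;
  hence the factor \<open>4 * r ^ 3\<close>.\<close>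

lemma bumpf_derivative:
  fixes p b :: "'a::euclidean_space"
  assumes r: "0 < r"
  obtains D where "(bumpf p r has_derivative D) (at b)" "\<And>w::'a. \<bar>D w\<bar> \<le> 4 * r ^ 3 * norm w"
proof -
  let ?m = "max 0 (r\<^sup>2 - inner (b - p) (b - p))"
  have 1: "((\<lambda>b. r\<^sup>2 - inner (b - p) (b - p)) has_derivative (\<lambda>w. - 2 * inner (b - p) w)) (at b)"
    by (auto intro!: derivative_eq_intros simp: inner_commute)
  have D: "(bumpf p r has_derivative (\<lambda>w. 2 * ?m * (- 2 * inner (b - p) w))) (at b)"
    unfolding bumpf_def[abs_def] by (rule has_derivative_compose[OF 1 max_square_derivative])
  show ?thesis
  proof (rule that[OF D])
    fix w :: 'a
    have m: "?m \<le> r\<^sup>2" by simp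
    have "?m * norm (b - p) \<le> r\<^sup>2 * r"
    proof (cases "norm (b - p) \<le> r")
      case True
      then show ?thesis using m by (intro mult_mono) auto
    next
      case False
      then have "r\<^sup>2 \<le> inner (b - p) (b - p)"
        using power_mono[of r "norm (b - p)" 2] r by (simp add: dot_square_norm)
      then show ?thesis using r by (simp add: max_def)
    qed
    then have "?m * norm (b - p) * norm w \<le> r\<^sup>2 * r * norm w" by (rule mult_right_mono) simp
    moreover have "?m * \<bar>inner (b - p) w\<bar> \<le> ?m * (norm (b - p) * norm w)"
      by (intro mult_left_mono Cauchy_Schwarz_ineq2) simp
    ultimately have "?m * \<bar>inner (b - p) w\<bar> \<le> r\<^sup>2 * r * norm w" by (simp add: mult.assoc)
    then show "\<bar>2 * ?m * (- 2 * inner (b - p) w)\<bar> \<le> 4 * r ^ 3 * norm w"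
      by (simp add: abs_mult power2_eq_square power3_eq_cube)
  qed
qed

lemma has_derivative_partial1:
  fixes G :: "'a::euclidean_space \<times> 'b::euclidean_space \<Rightarrow> 'c::real_normed_vector"
  assumes "Cinf G W" "(x, y) \<in> W"
  shows "((\<lambda>x. G (x, y)) has_derivative (\<lambda>v. frechet_derivative G (at (x, y)) (v, 0))) (at x)"
proof -
  have "((\<lambda>x. (x, y)) has_derivative (\<lambda>v. (v, 0))) (at x)"
    by (intro derivative_intros)
  from has_derivative_compose[OF this Cinf_has_derivative[OF assms]] show ?thesis by simp
qed

section \<open>Bump functions at the unit and averages of representations\<close>

context lie_calculus
begin

definition bump :: "real \<Rightarrow> 'g \<Rightarrow> real" where
  "bump r g = (if g \<in> fst uc then bumpf p0 r (snd uc g) else 0)"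

lemma bump_nonneg: "0 \<le> bump r g" by (simp add: bump_def bumpf_nonneg)

lemma bump_support:
  assumes "0 < r" "bump r g \<noteq> 0"
  shows "g \<in> fst uc" "snd uc g \<in> ball p0 r"
  using assms bumpf_outside[of r "snd uc g" p0]
  by (auto simp: bump_def dist_norm norm_minus_commute not_less split: if_splits intro: leI)

text \<open>The chart image of a closed ball is compact, hence closed in the Hausdorff group. So the
  group is covered by two open sets: the chart domain, where the bump is given by coordinates, and
  one where it vanishes. This makes the extension by zero continuous.\<close>

lemma bump_vanish:
  assumes r: "0 < r" "cball p0 r \<subseteq> chart_dom uc"
  shows "open (- (cinv uc ` cball p0 r))" "g \<notin> cinv uc ` cball p0 r \<Longrightarrow> bump r g = 0"
    "fst uc \<union> - (cinv uc ` cball p0 r) = UNIV"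
proof -
  have "continuous_on (cball p0 r) (cinv uc)" using cinv_cont[OF uc(1)] r(2) continuous_on_subset by blast
  from compact_continuous_image[OF this compact_cball]
  show "open (- (cinv uc ` cball p0 r))" by (intro open_Compl compact_imp_closed)
  show "bump r g = 0" if "g \<notin> cinv uc ` cball p0 r"
  proof (rule ccontr)
    assume "bump r g \<noteq> 0"
    note s = bump_support[OF r(1) this]
    have "cinv uc (snd uc g) \<in> cinv uc ` cball p0 r" using s(2) by (intro imageI) auto
    then show False using that s(1) uc by simp
  qed
  show "fst uc \<union> - (cinv uc ` cball p0 r) = UNIV" using r(2) cinv_in_chart[OF uc(1)] by auto
qed

lemma bumpf_continuous: "0 < r \<Longrightarrow> continuous_on S (bumpf p r)"
  unfolding bumpf_def[abs_def] by (intro continuous_intros)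

lemma bump_continuous:
  assumes r: "0 < r" "cball p0 r \<subseteq> chart_dom uc"
  shows "continuous_on UNIV (bump r)"
proof -
  have "continuous_on (fst uc \<union> - (cinv uc ` cball p0 r)) (bump r)"
  proof (rule continuous_on_open_Un[OF chart_open[OF uc(1)] bump_vanish(1)[OF r]])
    have "continuous_on (fst uc) (\<lambda>g. bumpf p0 r (snd uc g))"
      by (rule continuous_on_compose2[OF bumpf_continuous[OF r(1)] chart_cont[OF uc(1)] subset_UNIV])
    then show "continuous_on (fst uc) (bump r)"
      by (rule continuous_on_eq) (simp add: bump_def)
    have "continuous_on (- (cinv uc ` cball p0 r)) (\<lambda>g. 0 :: real)" by simp
    then show "continuous_on (- (cinv uc ` cball p0 r)) (bump r)"
      by (rule continuous_on_eq) (simp add: bump_vanish(2)[OF r])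
  qed
  then show ?thesis by (simp only: bump_vanish(3)[OF r])
qed

text \<open>If \<open>g0\<close> lies in the unit chart, the bump is \<open>bumpf\<close> of the
  left quotient in coordinates, whose derivative is bounded near \<open>(p0, snd uc g0)\<close> by
  compactness. Otherwise \<open>iv (cinv uc a) \<star> g\<close> stays off the compact support for
  \<open>a\<close> near \<open>p0\<close> and \<open>g\<close> near \<open>g0\<close>, and the
  function is constantly zero there.\<close>

lemma bump_local:
  assumes r: "0 < r" "cball p0 r \<subseteq> chart_dom uc"
  shows "\<exists>W s L. open W \<and> g0 \<in> W \<and> 0 < s \<and> 0 \<le> L \<and> (\<forall>g\<in>W. \<forall>a\<in>ball p0 s.
    \<exists>D. ((\<lambda>a. bump r (iv (cinv uc a) \<star> g)) has_derivative D) (at a) \<and> (\<forall>e. \<bar>D e\<bar> \<le> L * norm e))"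
proof (cases "g0 \<in> fst uc")
  case True
  let ?q = "snd uc g0"
  have td: "(p0, ?q) \<in> left_div_dom uc" using True uc p0_dom by (simp add: left_div_dom_def chart_in_dom)
  obtain s where s: "0 < s" "cball (p0, ?q) s \<subseteq> left_div_dom uc"
    using open_contains_cball left_div_smooth(1)[OF uc(1)] td by blast
  have "\<exists>B. \<forall>z\<in>cball (p0, ?q) s. norm (frechet_derivative (left_div uc) (at z) (i, 0)) \<le> B" for i
  proof -
    have "continuous_on (cball (p0, ?q) s) (\<lambda>z. frechet_derivative (left_div uc) (at z) (i, 0))"
      by (rule continuous_on_subset[OF Cinf_continuous[OF Cinf_frechet[OF left_div_smooth(2)[OF uc(1)]]] s(2)])
    from compact_imp_bounded[OF compact_continuous_image[OF this compact_cball]]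
    show ?thesis unfolding bounded_iff by auto
  qed
  then obtain B where B: "\<And>i z. z \<in> cball (p0, ?q) s \<Longrightarrow> norm (frechet_derivative (left_div uc) (at z) (i, 0)) \<le> B i"
    by metis
  \<comment> \<open>The bound on the derivative of \<open>bumpf\<close> times a bound on the partial
    derivative of \<open>left_div uc\<close> in its first argument, summed over the basis
    directions.\<close>
  define L where "L = 4 * r ^ 3 * (\<Sum>i\<in>Basis. \<bar>B i\<bar>)"
  define W where "W = fst uc \<inter> snd uc -` ball ?q (s / 2)"
  show ?thesis
  proof (intro exI conjI)
    show "open W" unfolding W_def
      by (rule continuous_open_preimage[OF chart_cont[OF uc(1)] chart_open[OF uc(1)] open_ball])
    show "g0 \<in> W" using True s by (simp add: W_def)
    show "0 < s / 2" "0 \<le> L" using s r by (auto simp: L_def intro!: mult_nonneg_nonneg sum_nonneg)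
    show "\<forall>g\<in>W. \<forall>a\<in>ball p0 (s / 2). \<exists>D. ((\<lambda>a. bump r (iv (cinv uc a) \<star> g)) has_derivative D) (at a) \<and>
        (\<forall>e. \<bar>D e\<bar> \<le> L * norm e)"
    proof (intro ballI)
      fix g a assume g: "g \<in> W" and a: "a \<in> ball p0 (s / 2)"
      let ?b = "snd uc g"
      have near: "(a', ?b) \<in> cball (p0, ?q) s" if "a' \<in> ball p0 (s / 2)" for a'
      proof -
        have "dist (p0, ?q) (a', ?b) \<le> dist p0 a' + dist ?q ?b"
          unfolding dist_Pair_Pair by (rule sqrt_sum_squares_le_sum) auto
        moreover have "dist p0 a' < s / 2" "dist ?q ?b < s / 2" using that g s(1) by (simp_all add: W_def)
        ultimately have "dist (p0, ?q) (a', ?b) \<le> s" by linarith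
        then show ?thesis by (simp only: mem_cball)
      qed
      have gin: "g \<in> fst uc" using g by (simp add: W_def)
      have eq: "bumpf p0 r (left_div uc (a', ?b)) = bump r (iv (cinv uc a') \<star> g)" if "a' \<in> ball p0 (s / 2)" for a'
        using subsetD[OF s(2) near[OF that]] gin uc by (simp add: left_div_dom_def left_div_def bump_def)
      note d1 = has_derivative_partial1[OF left_div_smooth(2)[OF uc(1)] subsetD[OF s(2) near[OF a]]]
      let ?E = "\<lambda>v. frechet_derivative (left_div uc) (at (a, ?b)) (v, 0)"
      obtain D where D: "(bumpf p0 r has_derivative D) (at (left_div uc (a, ?b)))" "\<And>w. \<bar>D w\<bar> \<le> 4 * r ^ 3 * norm w"
        using bumpf_derivative[OF r(1)] by blast
      have "((\<lambda>a. bumpf p0 r (left_div uc (a, ?b))) has_derivative (\<lambda>v. D (?E v))) (at a)"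
        by (rule has_derivative_compose[OF d1 D(1)])
      then have 1: "((\<lambda>a. bump r (iv (cinv uc a) \<star> g)) has_derivative (\<lambda>v. D (?E v))) (at a)"
        by (rule has_derivative_transform_within_open[OF _ open_ball a eq])
      have 2: "\<bar>D (?E e)\<bar> \<le> L * norm e" for e
      proof -
        have "norm (?E e) = norm (\<Sum>i\<in>Basis. inner e i *\<^sub>R ?E i)"
          by (subst has_derivative_Basis_sum[OF d1]) simp
        also have "\<dots> \<le> (\<Sum>i\<in>Basis. norm e * \<bar>B i\<bar>)"
        proof (rule order_trans[OF norm_sum], rule sum_mono)
          fix i :: 'e assume "i \<in> Basis"
          then have "\<bar>inner e i\<bar> \<le> norm e" by (rule Basis_le_norm)
          moreover have "norm (?E i) \<le> \<bar>B i\<bar>" using B[OF near[OF a], of i] by linarith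
          ultimately show "norm (inner e i *\<^sub>R ?E i) \<le> norm e * \<bar>B i\<bar>"
            unfolding norm_scaleR by (intro mult_mono) auto
        qed
        finally have "norm (?E e) \<le> norm e * (\<Sum>i\<in>Basis. \<bar>B i\<bar>)" by (simp add: sum_distrib_left)
        then have "4 * r ^ 3 * norm (?E e) \<le> 4 * r ^ 3 * (norm e * (\<Sum>i\<in>Basis. \<bar>B i\<bar>))"
          using r by (intro mult_left_mono) auto
        also have "\<dots> = L * norm e" by (simp add: L_def mult_ac)
        finally show ?thesis using D(2)[of "?E e"] by linarith
      qed
      from 1 2 show "\<exists>D. ((\<lambda>a. bump r (iv (cinv uc a) \<star> g)) has_derivative D) (at a) \<and> (\<forall>e. \<bar>D e\<bar> \<le> L * norm e)"
        by blast
    qed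
  qed
next
  case False
  let ?N = "- (cinv uc ` cball p0 r)"
  have g0: "g0 \<in> ?N" using False bump_vanish(3)[OF r] by blast
  have cont: "continuous_on (chart_dom uc \<times> UNIV) (\<lambda>z. iv (cinv uc (fst z)) \<star> snd z)"
    by (intro mul_cont2 iv_cont2 continuous_on_compose2[OF cinv_cont[OF uc(1)]] continuous_intros) auto
  have "open (chart_dom uc \<times> UNIV \<inter> (\<lambda>z. iv (cinv uc (fst z)) \<star> snd z) -` ?N)"
    by (rule continuous_open_preimage[OF cont open_Times[OF chart_dom_open[OF uc(1)] open_UNIV] bump_vanish(1)[OF r]])
  moreover have "(p0, g0) \<in> chart_dom uc \<times> UNIV \<inter> (\<lambda>z. iv (cinv uc (fst z)) \<star> snd z) -` ?N"
    using g0 p0_dom by simp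
  ultimately obtain A W where AW: "open A" "open W" "(p0, g0) \<in> A \<times> W"
    "A \<times> W \<subseteq> chart_dom uc \<times> UNIV \<inter> (\<lambda>z. iv (cinv uc (fst z)) \<star> snd z) -` ?N"
    by (rule open_prod_elim)
  obtain s where s: "0 < s" "ball p0 s \<subseteq> A" using AW open_contains_ball by blast
  show ?thesis
  proof (intro exI conjI)
    show "open W" "g0 \<in> W" "0 < s" "(0::real) \<le> 0" using AW s by auto
    show "\<forall>g\<in>W. \<forall>a\<in>ball p0 s. \<exists>D. ((\<lambda>a. bump r (iv (cinv uc a) \<star> g)) has_derivative D) (at a) \<and>
        (\<forall>e. \<bar>D e\<bar> \<le> 0 * norm e)"
    proof (intro ballI)
      fix g a assume g: "g \<in> W" and a: "a \<in> ball p0 s"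
      have "bump r (iv (cinv uc a') \<star> g) = 0" if "a' \<in> ball p0 s" for a'
      proof (rule bump_vanish(2)[OF r])
        have "(a', g) \<in> A \<times> W" using that s g by auto
        then show "iv (cinv uc a') \<star> g \<notin> cinv uc ` cball p0 r" using subsetD[OF AW(4)] by fastforce
      qed
      then have "((\<lambda>a. bump r (iv (cinv uc a) \<star> g)) has_derivative (\<lambda>e. 0)) (at a)"
        by (intro has_derivative_transform_within_open[OF has_derivative_const[of 0] open_ball a]) simp
      then show "\<exists>D. ((\<lambda>a. bump r (iv (cinv uc a) \<star> g)) has_derivative D) (at a) \<and> (\<forall>e. \<bar>D e\<bar> \<le> 0 * norm e)"
        by (intro exI[of _ "\<lambda>e. 0"]) simp
    qed
  qed
qed

text \<open>Compactness of the group reduces the local radii and constants to finitely many, which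
  gives the domination required to differentiate an integral over the group.\<close>

lemma bump_uniform:
  assumes r: "0 < r" "cball p0 r \<subseteq> chart_dom uc"
  obtains s L where "0 < s" "0 \<le> L" "\<And>g a. a \<in> ball p0 s \<Longrightarrow>
    \<exists>D. ((\<lambda>a. bump r (iv (cinv uc a) \<star> g)) has_derivative D) (at a) \<and> (\<forall>e. \<bar>D e\<bar> \<le> L * norm e)"
proof -
  obtain W s L where W: "\<And>g0. open (W g0) \<and> g0 \<in> W g0 \<and> 0 < s g0 \<and> 0 \<le> L g0 \<and> (\<forall>g\<in>W g0. \<forall>a\<in>ball p0 (s g0).
    \<exists>D. ((\<lambda>a. bump r (iv (cinv uc a) \<star> g)) has_derivative D) (at a) \<and> (\<forall>e. \<bar>D e\<bar> \<le> L g0 * norm (e::'e)))"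
    using bump_local[OF r] by metis
  have "UNIV \<subseteq> (\<Union>g. W g)" using W by blast
  then obtain F where F: "finite F" "UNIV \<subseteq> (\<Union>g\<in>F. W g)"
    using compactE_image[OF compact_UNIV, of UNIV W] W by metis
  have Fne: "F \<noteq> {}" using F by auto
  show ?thesis
  proof
    show "0 < Min (s ` F)" using F(1) Fne W by simp
    show "0 \<le> (\<Sum>g\<in>F. L g)" using W by (simp add: sum_nonneg)
    fix g a assume a: "a \<in> ball p0 (Min (s ` F))"
    obtain g0 where g0: "g0 \<in> F" "g \<in> W g0" using F by blast
    have "Min (s ` F) \<le> s g0" using F g0 by simp
    then have "a \<in> ball p0 (s g0)" using a by simp
    then obtain D where D: "((\<lambda>a. bump r (iv (cinv uc a) \<star> g)) has_derivative D) (at a)"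
      "\<forall>e. \<bar>D e\<bar> \<le> L g0 * norm e" using W[of g0] g0 by blast
    have "L g0 \<le> (\<Sum>g\<in>F. L g)" using F g0 W by (intro member_le_sum) auto
    then have "\<bar>D e\<bar> \<le> (\<Sum>g\<in>F. L g) * norm e" for e
      using D(2) by (meson mult_right_mono norm_ge_zero order_trans)
    with D(1) show "\<exists>D. ((\<lambda>a. bump r (iv (cinv uc a) \<star> g)) has_derivative D) (at a) \<and>
        (\<forall>e. \<bar>D e\<bar> \<le> (\<Sum>g\<in>F. L g) * norm e)" by blast
  qed
qed

text \<open>Haar measure is given by invariance and total mass, so positivity comes from a covering:
  finitely many translates of the set where the bump is positive cover the group. Their sum has a
  positive minimum, and all its summands have the same integral.\<close>

lemma bump_integral_pos:
  assumes r: "0 < r" "cball p0 r \<subseteq> chart_dom uc"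
  shows "0 < (\<integral>y. bump r y \<partial>haar K)"
proof -
  interpret finite_measure "haar K" by (rule haar_finite)
  have c: "continuous_on UNIV (\<lambda>y. bump r (iv g \<star> y))" for g
    by (rule continuous_on_compose2[OF bump_continuous[OF r]]) (auto intro!: mul_cont2 continuous_intros)
  define V where "V g = {y. 0 < bump r (iv g \<star> y)}" for g
  have oV: "open (V g)" for g unfolding V_def using open_Collect_less[OF continuous_on_const c] by simp
  have "bump r e1 > 0" using uc r by (simp add: bump_def bumpf_def)
  then have "y \<in> V y" for y by (simp add: V_def)
  then have "UNIV \<subseteq> (\<Union>g. V g)" by blast
  then obtain F where F: "finite F" "UNIV \<subseteq> (\<Union>g\<in>F. V g)"
    using compactE_image[OF compact_UNIV, of UNIV V] oV by metis
  define S where "S y = (\<Sum>g\<in>F. bump r (iv g \<star> y))" for y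
  have Sc: "continuous_on UNIV S" unfolding S_def using c by (intro continuous_on_sum) auto
  have Spos: "0 < S y" for y
  proof -
    obtain g where g: "g \<in> F" "y \<in> V g" using F by blast
    have "0 < bump r (iv g \<star> y)" using g by (simp add: V_def)
    also have "\<dots> \<le> S y" unfolding S_def by (rule member_le_sum) (use F g bump_nonneg in auto)
    finally show ?thesis .
  qed
  obtain y0 where y0: "\<And>y. S y0 \<le> S y" using continuous_attains_inf[OF compact_UNIV _ Sc] by auto
  have int: "integrable (haar K) (\<lambda>y. bump r (iv g \<star> y))" for g
  proof -
    have "integrable (haar K) (\<lambda>y. complex_of_real (bump r (iv g \<star> y)))"
      by (intro cont_integrable continuous_on_of_real c)
    from integrable_Re[OF this] show ?thesis by simp
  qed
  have tr: "(\<integral>y. bump r (iv g \<star> y) \<partial>haar K) = (\<integral>y. bump r y \<partial>haar K)" for g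
  proof -
    have "(\<integral>y. complex_of_real (bump r (iv g \<star> y)) \<partial>haar K) = (\<integral>y. complex_of_real (bump r y) \<partial>haar K)"
      by (rule haar_translate[of "\<lambda>y. complex_of_real (bump r y)"])
        (intro continuous_on_of_real bump_continuous r)
    then show ?thesis by simp
  qed
  have "S y0 = (\<integral>y. S y0 \<partial>haar K)" by (simp add: haar_UNIV)
  also have "\<dots> \<le> (\<integral>y. S y \<partial>haar K)"
    using y0 int by (intro integral_mono) (auto simp: S_def)
  also have "\<dots> = real (card F) * (\<integral>y. bump r y \<partial>haar K)"
    unfolding S_def using int by (simp add: Bochner_Integration.integral_sum tr)
  finally have "0 < real (card F) * (\<integral>y. bump r y \<partial>haar K)" using Spos[of y0] by simp
  then show ?thesis by (simp add: zero_less_mult_iff)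
qed

text \<open>Translation invariance rewrites the sum as the integral of
  \<open>bump r (iv (cinv uc a) \<star> y)\<close> times the entry (i, j) of \<open>\<xi> y\<close>,
  in which \<open>a\<close> occurs in the bump only. The derivative is dominated by the constant
  \<open>L * C\<close>.\<close>

lemma rep_bump_derivative:
  assumes rep: "representation K \<xi>" and ij: "i < rdim \<xi>" "j < rdim \<xi>"
    and r: "0 < r" "cball p0 r \<subseteq> chart_dom uc"
  obtains D where "((\<lambda>a. \<Sum>k<rdim \<xi>. \<xi> (cinv uc a) $$ (i, k) *
      (\<integral>y. bump r y * \<xi> y $$ (k, j) \<partial>haar K)) has_derivative D) (at p0)"
proof -
  obtain s L where s: "0 < s" "0 \<le> L" "\<And>g a. a \<in> ball p0 s \<Longrightarrow>
    \<exists>D. ((\<lambda>a. bump r (iv (cinv uc a) \<star> g)) has_derivative D) (at a) \<and> (\<forall>e. \<bar>D e\<bar> \<le> L * norm (e::'e))"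
    using bump_uniform[OF r] by metis
  define H' where "H' g a = (SOME D. ((\<lambda>a. bump r (iv (cinv uc a) \<star> g)) has_derivative D) (at a) \<and>
      (\<forall>e. \<bar>D e\<bar> \<le> L * norm e))" for g a
  have H': "((\<lambda>a. bump r (iv (cinv uc a) \<star> g)) has_derivative H' g a) (at a)"
    "\<bar>H' g a e\<bar> \<le> L * norm e" if "a \<in> ball p0 s" for g a e
    using someI_ex[OF s(3)[OF that, of g]] unfolding H'_def by blast+
  have xc: "continuous_on UNIV (\<lambda>y. \<xi> y $$ (k, j))" if "k < rdim \<xi>" for k by (rule rep_cont[OF rep that ij(2)])
  obtain C where C: "\<And>y. norm (\<xi> y $$ (i, j)) \<le> C"
    using compact_imp_bounded[OF compact_continuous_image[OF xc[OF ij(1)] compact_UNIV]] unfolding bounded_iff by auto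
  have C0: "0 \<le> C" using order_trans[OF norm_ge_zero C] .
  have bc: "continuous_on UNIV (\<lambda>y. complex_of_real (bump r (x \<star> y)))" for x
    by (intro continuous_on_of_real continuous_on_compose2[OF bump_continuous[OF r]] mul_cont2 continuous_intros) auto
  have "((\<lambda>a. \<integral>y. of_real (bump r (iv (cinv uc a) \<star> y)) * \<xi> y $$ (i, j) \<partial>haar K) has_derivative
      (\<lambda>e. \<integral>y. of_real (H' y p0 e) * \<xi> y $$ (i, j) \<partial>haar K)) (at p0)"
  proof (rule has_derivative_integral_dominated(2)[OF s(1), where B = "\<lambda>y. L * C"])
    fix y a assume a: "a \<in> ball p0 s"
    show "((\<lambda>a. complex_of_real (bump r (iv (cinv uc a) \<star> y)) * \<xi> y $$ (i, j)) has_derivative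
        (\<lambda>e. of_real (H' y a e) * \<xi> y $$ (i, j))) (at a)"
      by (intro has_derivative_mult_left has_derivative_of_real H' a)
    fix e
    have "norm (of_real (H' y a e) * \<xi> y $$ (i, j)) \<le> (L * norm e) * C"
      unfolding norm_mult norm_of_real using s(2) by (intro mult_mono H'(2) a C) auto
    then show "norm (of_real (H' y a e) * \<xi> y $$ (i, j)) \<le> L * C * norm e" by (simp add: mult_ac)
  next
    interpret finite_measure "haar K" by (rule haar_finite)
    show "integrable (haar K) (\<lambda>y. L * C)" by simp
    show "(\<lambda>y. complex_of_real (bump r (iv (cinv uc a) \<star> y)) * \<xi> y $$ (i, j)) \<in> borel_measurable (haar K)" for a
      by (intro cont_measurable continuous_on_mult bc xc ij)
    show "integrable (haar K) (\<lambda>y. complex_of_real (bump r (iv (cinv uc p0) \<star> y)) * \<xi> y $$ (i, j))"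
      by (intro cont_integrable continuous_on_mult bc xc ij)
  qed
  moreover have "(\<integral>y. of_real (bump r (iv (cinv uc a) \<star> y)) * \<xi> y $$ (i, j) \<partial>haar K) =
      (\<Sum>k<rdim \<xi>. \<xi> (cinv uc a) $$ (i, k) * (\<integral>y. bump r y * \<xi> y $$ (k, j) \<partial>haar K))" for a
  proof -
    let ?u = "cinv uc a"
    have c1: "continuous_on UNIV (\<lambda>y. complex_of_real (bump r y))" using bc[of e1] by simp
    have "(\<integral>y. of_real (bump r (iv ?u \<star> y)) * \<xi> y $$ (i, j) \<partial>haar K) =
        (\<integral>y. of_real (bump r (iv ?u \<star> y)) * \<xi> (?u \<star> (iv ?u \<star> y)) $$ (i, j) \<partial>haar K)" by simp
    also have "\<dots> = (\<integral>y. of_real (bump r y) * \<xi> (?u \<star> y) $$ (i, j) \<partial>haar K)"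
      by (rule haar_translate[of "\<lambda>y. of_real (bump r y) * \<xi> (?u \<star> y) $$ (i, j)"])
        (intro continuous_on_mult c1 continuous_on_compose2[OF rep_cont[OF rep ij, of UNIV]]
            mul_cont2 continuous_intros subset_UNIV)
    also have "\<dots> = (\<integral>y. (\<Sum>k<rdim \<xi>. \<xi> ?u $$ (i, k) * (of_real (bump r y) * \<xi> y $$ (k, j))) \<partial>haar K)"
      unfolding rep_mult_entry[OF rep ij] by (simp add: sum_distrib_left mult_ac)
    also have "\<dots> = (\<Sum>k<rdim \<xi>. \<integral>y. \<xi> ?u $$ (i, k) * (of_real (bump r y) * \<xi> y $$ (k, j)) \<partial>haar K)"
      by (rule Bochner_Integration.integral_sum)
        (intro integrable_mult_right cont_integrable continuous_on_mult c1 xc, simp)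
    finally show ?thesis by simp
  qed
  ultimately show ?thesis using that by simp
qed

text \<open>Averaging \<open>\<xi>\<close> against a bump function gives \<open>x \<mapsto> \<xi>(x) A\<close>, which is differentiable because the derivative
  can be put on the bump function. For small support \<open>A\<close> is close to a positive multiple of the identity,
  hence invertible.\<close>

lemma rep_derivative_unit:
  assumes rep: "representation K \<xi>" and ij: "i < rdim \<xi>" "j < rdim \<xi>"
  obtains D where "((\<lambda>a. \<xi> (cinv uc a) $$ (i, j)) has_derivative D) (at p0)"
proof -
  let ?d = "rdim \<xi>"
  have d: "0 < ?d" using ij by simp
  \<comment> \<open>The averaged matrix \<open>A\<close> then differs from \<open>c\<close> times
    the identity by at most \<open>c * \<epsilon>\<close> in each entry, hence by at most
    \<open>c / 2\<close> in the sum over a row.\<close>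
  define \<epsilon> where "\<epsilon> = 1 / (2 * real ?d)"
  have \<epsilon>: "0 < \<epsilon>" using d by (simp add: \<epsilon>_def)
  have ex: "\<exists>r>0. r \<le> r0 \<and> (\<forall>a\<in>ball p0 r. \<forall>k<?d. \<forall>l<?d. norm (\<xi> (cinv uc a) $$ (k, l) - (if k = l then 1 else 0)) \<le> \<epsilon>)"
    if r0: "0 < r0" "ball p0 r0 \<subseteq> chart_dom uc" for r0
  proof -
    have "\<forall>\<^sub>F a in nhds p0. norm (\<xi> (cinv uc a) $$ (k, l) - (if k = l then 1 else 0)) < \<epsilon>"
      if kl: "k < ?d" "l < ?d" for k l
    proof -
      have "continuous_on (chart_dom uc) (\<lambda>a. \<xi> (cinv uc a) $$ (k, l))"
        by (rule continuous_on_compose2[OF rep_cont[OF rep kl, of UNIV] cinv_cont[OF uc(1)] subset_UNIV])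
      then have "isCont (\<lambda>a. \<xi> (cinv uc a) $$ (k, l)) p0"
        using chart_dom_open[OF uc(1)] p0_dom(1) by (simp add: continuous_on_eq_continuous_at)
      then have "((\<lambda>a. \<xi> (cinv uc a) $$ (k, l)) \<longlongrightarrow> \<xi> (cinv uc p0) $$ (k, l)) (nhds p0)"
        unfolding isCont_def tendsto_at_iff_tendsto_nhds[of "\<lambda>a. \<xi> (cinv uc a) $$ (k, l)" p0] .
      from tendstoD[OF this \<epsilon>] show ?thesis
        unfolding p0_dom(2) rep_one_entry[OF rep kl] dist_norm .
    qed
    then have "\<forall>\<^sub>F a in nhds p0. \<forall>k\<in>{..<?d}. \<forall>l\<in>{..<?d}. norm (\<xi> (cinv uc a) $$ (k, l) - (if k = l then 1 else 0)) < \<epsilon>"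
      by (intro eventually_ball_finite finite_lessThan ballI) (simp only: lessThan_iff)
    then obtain s where s: "0 < s" "\<And>a. dist a p0 < s \<Longrightarrow> \<forall>k\<in>{..<?d}. \<forall>l\<in>{..<?d}.
        norm (\<xi> (cinv uc a) $$ (k, l) - (if k = l then 1 else 0)) < \<epsilon>"
      unfolding eventually_nhds_metric by blast
    show ?thesis
    proof (intro exI conjI ballI allI impI)
      show "0 < min r0 s" "min r0 s \<le> r0" using s r0 by auto
      fix a k l assume "a \<in> ball p0 (min r0 s)" "k < ?d" "l < ?d"
      then have "norm (\<xi> (cinv uc a) $$ (k, l) - (if k = l then 1 else 0)) < \<epsilon>"
        using s(2)[of a] by (auto simp: dist_commute)
      then show "norm (\<xi> (cinv uc a) $$ (k, l) - (if k = l then 1 else 0)) \<le> \<epsilon>" by simp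
    qed
  qed
  obtain r0 where r0: "0 < r0" "cball p0 r0 \<subseteq> chart_dom uc"
    using open_contains_cball chart_dom_open[OF uc(1)] p0_dom(1) by blast
  have "ball p0 r0 \<subseteq> chart_dom uc" using r0 ball_subset_cball by blast
  from ex[OF r0(1) this] obtain r where r: "0 < r" "r \<le> r0" and near: "\<forall>a\<in>ball p0 r. \<forall>k<?d. \<forall>l<?d.
      norm (\<xi> (cinv uc a) $$ (k, l) - (if k = l then 1 else 0)) \<le> \<epsilon>" by (elim exE conjE)
  have rdm: "cball p0 r \<subseteq> chart_dom uc" using r r0 by (auto simp: subset_iff)
  define c where "c = (\<integral>y. bump r y \<partial>haar K)"
  have c: "0 < c" unfolding c_def by (rule bump_integral_pos[OF r(1) rdm])
  define A where "A = Matrix.mat ?d ?d (\<lambda>(k, l). \<integral>y. bump r y * \<xi> y $$ (k, l) \<partial>haar K)"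
  have A: "A \<in> carrier_mat ?d ?d" by (simp add: A_def)
  have bc: "continuous_on UNIV (\<lambda>y. complex_of_real (bump r y))"
    by (intro continuous_on_of_real bump_continuous r rdm)
  have bi: "integrable (haar K) (\<lambda>y. complex_of_real (bump r y))" by (rule cont_integrable[OF bc])
  have bi': "integrable (haar K) (bump r)" using integrable_Re[OF bi] by simp
  have Anear: "norm (A $$ (k, l) - (if k = l then of_real c else 0)) \<le> c * \<epsilon>" if kl: "k < ?d" "l < ?d" for k l
  proof -
    have int: "integrable (haar K) (\<lambda>y. complex_of_real (bump r y) * \<xi> y $$ (k, l))"
      by (intro cont_integrable continuous_on_mult bc rep_cont[OF rep kl])
    have int2: "integrable (haar K) (\<lambda>y. complex_of_real (bump r y) * (\<xi> y $$ (k, l) - (if k = l then 1 else 0)))"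
      by (intro cont_integrable continuous_on_mult continuous_on_diff continuous_on_const bc rep_cont[OF rep kl])
    have "A $$ (k, l) - (if k = l then of_real c else 0) =
        (\<integral>y. of_real (bump r y) * \<xi> y $$ (k, l) \<partial>haar K) - (\<integral>y. of_real (bump r y) * (if k = l then 1 else 0) \<partial>haar K)"
      using kl by (simp add: A_def c_def)
    also have "\<dots> = (\<integral>y. of_real (bump r y) * (\<xi> y $$ (k, l) - (if k = l then 1 else 0)) \<partial>haar K)"
      using int bi by (subst Bochner_Integration.integral_diff[symmetric]) (auto simp: right_diff_distrib)
    also have "norm \<dots> \<le> (\<integral>y. norm (of_real (bump r y) * (\<xi> y $$ (k, l) - (if k = l then 1 else 0))) \<partial>haar K)"
      by (rule integral_norm_bound)
    also have "\<dots> \<le> (\<integral>y. bump r y * \<epsilon> \<partial>haar K)"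
    proof (rule integral_mono[OF integrable_norm[OF int2]])
      show "integrable (haar K) (\<lambda>y. bump r y * \<epsilon>)" using bi' by simp
      fix y
      show "norm (of_real (bump r y) * (\<xi> y $$ (k, l) - (if k = l then 1 else 0))) \<le> bump r y * \<epsilon>"
      proof (cases "bump r y = 0")
        case False
        note sup = bump_support[OF r(1) False]
        have "norm (\<xi> y $$ (k, l) - (if k = l then 1 else 0)) \<le> \<epsilon>"
          using near[rule_format, OF sup(2) kl] sup(1) uc by simp
        then show ?thesis using bump_nonneg[of r y] by (simp add: norm_mult mult_left_mono)
      qed simp
    qed
    also have "\<dots> = c * \<epsilon>" by (simp add: c_def)
    finally show ?thesis .
  qed
  have "det A \<noteq> 0"
  proof
    assume "det A = 0"
    then obtain v where v: "v \<in> carrier_vec ?d" "v \<noteq> 0\<^sub>v ?d" "A *\<^sub>v v = 0\<^sub>v ?d"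
      using det_0_iff_vec_prod_zero[OF A] by blast
    \<comment> \<open>Diagonal dominance: in the row of a largest component of the null vector, the
      diagonal term \<open>c * n k\<close> would be at most half of itself.\<close>
    define n where "n k = norm (vec_index v k)" for k
      have n0: "0 \<le> n l" for l by (simp add: n_def)
    obtain k where k: "k < ?d" "\<And>l. l < ?d \<Longrightarrow> n l \<le> n k"
    proof -
      have "Max (n ` {..<?d}) \<in> n ` {..<?d}" using d by (intro Max_in) auto
      then obtain k where k: "k < ?d" "n k = Max (n ` {..<?d})" by (metis (no_types, lifting) imageE lessThan_iff)
      have "n l \<le> n k" if "l < ?d" for l unfolding k(2) by (rule Max_ge) (use that in auto)
      with k that show ?thesis by blast
    qed
    have "0 < n k"
    proof (rule ccontr)
      assume "\<not> 0 < n k"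
      then have "n l \<le> 0" if "l < ?d" for l using k(2)[OF that] by linarith
      then have "vec_index v l = 0" if "l < ?d" for l using that by (simp add: n_def)
      then have "v = 0\<^sub>v ?d" using v(1) by (intro eq_vecI) auto
      then show False using v by simp
    qed
    have "(\<Sum>l<?d. A $$ (k, l) * vec_index v l) = vec_index (A *\<^sub>v v) k"
      using A v(1) k(1) by (auto simp: scalar_prod_def atLeast0LessThan intro!: sum.cong)
    also have "\<dots> = 0" using v k by simp
    finally have s0: "(\<Sum>l<?d. A $$ (k, l) * vec_index v l) = 0" .
    have "of_real c * vec_index v k = (\<Sum>l<?d. (if k = l then of_real c else 0) * vec_index v l)"
      using k by (simp add: if_distrib[of "\<lambda>z. z * _"] cong: if_cong)
    also have "\<dots> = - (\<Sum>l<?d. (A $$ (k, l) - (if k = l then of_real c else 0)) * vec_index v l)"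
      using s0 by (simp add: left_diff_distrib sum_subtractf)
    finally have "norm (of_real c * vec_index v k) \<le>
        (\<Sum>l<?d. norm ((A $$ (k, l) - (if k = l then of_real c else 0)) * vec_index v l))"
      by (simp only: norm_minus_cancel norm_sum)
    also have "\<dots> \<le> (\<Sum>l<?d. (c * \<epsilon>) * n k)"
    proof (rule sum_mono)
      fix l assume "l \<in> {..<?d}"
      then show "norm ((A $$ (k, l) - (if k = l then of_real c else 0)) * vec_index v l) \<le> (c * \<epsilon>) * n k"
        unfolding norm_mult using c \<epsilon> k by (intro mult_mono Anear) (auto simp: n_def[symmetric] n0)
    qed
    also have "\<dots> = c * n k / 2" using d by (simp add: \<epsilon>_def)
    finally have "c * n k \<le> c * n k / 2" using c by (simp add: norm_mult n_def)
    then show False using c \<open>0 < n k\<close> by simp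
  qed
  then obtain B where B: "B \<in> carrier_mat ?d ?d" "A * B = 1\<^sub>m ?d"
    using det_non_zero_imp_unit[OF A] unfolding Units_def ring_mat_def by auto
  let ?F = "\<lambda>j a. \<Sum>k<?d. \<xi> (cinv uc a) $$ (i, k) * (\<integral>y. bump r y * \<xi> y $$ (k, j) \<partial>haar K)"
  define D where "D j = (SOME D. (?F j has_derivative D) (at p0))" for j
  have D: "(?F j has_derivative D j) (at p0)" if l: "j < ?d" for j
  proof -
    obtain D0 where "(?F j has_derivative D0) (at p0)"
      using rep_bump_derivative[OF rep ij(1) l r(1) rdm] .
    then show ?thesis unfolding D_def by (rule someI[of "\<lambda>D. (?F j has_derivative D) (at p0)"])
  qed
  \<comment> \<open>Multiplying the differentiable averages by the constant inverse of
    \<open>A\<close> recovers the representation.\<close>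
  have "((\<lambda>a. \<Sum>l<?d. (\<Sum>k<?d. \<xi> (cinv uc a) $$ (i, k) * (\<integral>y. bump r y * \<xi> y $$ (k, l) \<partial>haar K)) * B $$ (l, j))
      has_derivative (\<lambda>e. \<Sum>l<?d. D l e * B $$ (l, j))) (at p0)"
    by (intro has_derivative_sum has_derivative_mult_left D) auto
  moreover have "(\<Sum>l<?d. (\<Sum>k<?d. \<xi> x $$ (i, k) * (\<integral>y. bump r y * \<xi> y $$ (k, l) \<partial>haar K)) * B $$ (l, j)) =
      \<xi> x $$ (i, j)" for x
  proof -
    have "(\<Sum>l<?d. (\<Sum>k<?d. \<xi> x $$ (i, k) * (\<integral>y. bump r y * \<xi> y $$ (k, l) \<partial>haar K)) * B $$ (l, j)) =
        (\<Sum>l<?d. \<Sum>k<?d. \<xi> x $$ (i, k) * (A $$ (k, l) * B $$ (l, j)))"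
      by (simp add: A_def sum_distrib_right mult.assoc)
    also have "\<dots> = (\<Sum>k<?d. \<xi> x $$ (i, k) * (\<Sum>l<?d. A $$ (k, l) * B $$ (l, j)))"
      by (subst sum.swap) (simp add: sum_distrib_left)
    also have "\<dots> = (\<Sum>k<?d. \<xi> x $$ (i, k) * (A * B) $$ (k, j))"
      by (rule sum.cong[OF refl]) (simp add: mult_mat_entry[OF A B(1) _ ij(2)])
    also have "\<dots> = (\<Sum>k<?d. if k = j then \<xi> x $$ (i, k) else 0)"
      unfolding B(2) using ij by (intro sum.cong) auto
    finally show ?thesis using ij by simp
  qed
  ultimately show ?thesis using that by simp
qed

section \<open>The eigenvalues of the Laplacian\<close>

text \<open>The entries of the derived representation of the Lie algebra, with tangent vectors at
  the unit read in the unit chart.\<close>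

definition rep_der where
  "rep_der \<xi> i j = (SOME D. ((\<lambda>a. \<xi> (cinv uc a) $$ (i, j)) has_derivative D) (at p0))"

lemma rep_der:
  assumes "representation K \<xi>" "i < rdim \<xi>" "j < rdim \<xi>"
  shows "((\<lambda>a. \<xi> (cinv uc a) $$ (i, j)) has_derivative rep_der \<xi> i j) (at p0)"
proof -
  have "\<exists>D. ((\<lambda>a. \<xi> (cinv uc a) $$ (i, j)) has_derivative D) (at p0)"
    using rep_derivative_unit[OF assms] by metis
  from someI_ex[OF this] show ?thesis unfolding rep_der_def .
qed

text \<open>With weights \<open>c\<close> the result has again the form of the argument, so the rule
  can be applied twice, as the Laplacian requires.\<close>

lemma left_deriv_rep:
  assumes rep: "representation K \<xi>" and ij: "i < rdim \<xi>" and v: "v \<in> model K"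
  shows "left_deriv K v (\<lambda>x. \<Sum>k<rdim \<xi>. \<xi> x $$ (i, k) * c k) x =
    (\<Sum>k<rdim \<xi>. \<Sum>l<rdim \<xi>. \<xi> x $$ (i, l) * rep_der \<xi> l k v * c k)"
proof (rule left_deriv_eq[OF v])
  have "((\<lambda>b. \<Sum>k<rdim \<xi>. (\<Sum>l<rdim \<xi>. \<xi> x $$ (i, l) * \<xi> (cinv uc b) $$ (l, k)) * c k) has_derivative
      (\<lambda>v. \<Sum>k<rdim \<xi>. (\<Sum>l<rdim \<xi>. \<xi> x $$ (i, l) * rep_der \<xi> l k v) * c k)) (at p0)"
    by (intro has_derivative_sum has_derivative_mult_left has_derivative_mult_right rep_der rep) auto
  moreover have "(\<Sum>k<rdim \<xi>. \<xi> (x \<star> y) $$ (i, k) * c k) =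
      (\<Sum>k<rdim \<xi>. (\<Sum>l<rdim \<xi>. \<xi> x $$ (i, l) * \<xi> y $$ (l, k)) * c k)" for y
    by (rule sum.cong[OF refl]) (simp add: rep_mult_entry[OF rep ij])
  ultimately show "((\<lambda>b. \<Sum>k<rdim \<xi>. \<xi> (x \<star> cinv uc b) $$ (i, k) * c k) has_derivative
      (\<lambda>v. \<Sum>k<rdim \<xi>. \<Sum>l<rdim \<xi>. \<xi> x $$ (i, l) * rep_der \<xi> l k v * c k)) (at p0)"
    by (simp add: sum_distrib_right)
qed

section \<open>The adjoint action and the Casimir matrix\<close>

abbreviation no where "no \<equiv> length (onb K)"

lemma onb: "basis_list (model K) (onb K)"
  and onb_orthonormal: "i < no \<Longrightarrow> j < no \<Longrightarrow> metric K (onb K ! i) (onb K ! j) = (if i = j then 1 else 0)"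
  and metric: "invariant_inner K (metric K)"
  using setting by (auto simp: calculus_setting_def orthonormal_basis_list_def)

lemma onb_model: "i < no \<Longrightarrow> onb K ! i \<in> model K"
  using onb unfolding basis_list_def by (metis nth_mem real_vector.span_base)

text \<open>The Laplacian maps \<open>\<xi>\<close> to \<open>x \<mapsto> \<xi>(x) casimir \<xi>\<close>.\<close>

definition casimir where
  "casimir \<xi> = Matrix.mat (rdim \<xi>) (rdim \<xi>) (\<lambda>(i, j). \<Sum>m<no. \<Sum>k<rdim \<xi>.
     rep_der \<xi> i k (onb K ! m) * rep_der \<xi> k j (onb K ! m))"

lemma laplacian_rep:
  assumes rep: "representation K \<xi>" and ij: "i < rdim \<xi>" "j < rdim \<xi>"
  shows "laplacian K (\<lambda>x. \<xi> x $$ (i, j)) x = (\<Sum>l<rdim \<xi>. \<xi> x $$ (i, l) * casimir \<xi> $$ (l, j))"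
proof -
  let ?d = "rdim \<xi>"
  have first: "left_deriv K v (\<lambda>x. \<xi> x $$ (i, j)) = (\<lambda>x. \<Sum>l<?d. \<xi> x $$ (i, l) * rep_der \<xi> l j v)"
    if v: "v \<in> model K" for v
  proof
    fix x
    have "(\<lambda>x. \<xi> x $$ (i, j)) = (\<lambda>x. \<Sum>k<?d. \<xi> x $$ (i, k) * (if k = j then 1 else 0))"
      using ij by (simp add: if_distrib cong: if_cong)
    then have "left_deriv K v (\<lambda>x. \<xi> x $$ (i, j)) x =
        (\<Sum>k<?d. \<Sum>l<?d. \<xi> x $$ (i, l) * rep_der \<xi> l k v * (if k = j then 1 else 0))"
      using left_deriv_rep[OF rep ij(1) v, of "\<lambda>k. if k = j then 1 else 0" x] by simp
    also have "\<dots> = (\<Sum>k<?d. if k = j then (\<Sum>l<?d. \<xi> x $$ (i, l) * rep_der \<xi> l k v) else 0)"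
      by (rule sum.cong) auto
    finally show "left_deriv K v (\<lambda>x. \<xi> x $$ (i, j)) x = (\<Sum>l<?d. \<xi> x $$ (i, l) * rep_der \<xi> l j v)"
      using ij by simp
  qed
  have second: "left_deriv K v (left_deriv K v (\<lambda>x. \<xi> x $$ (i, j))) x =
      (\<Sum>l<?d. \<xi> x $$ (i, l) * (\<Sum>k<?d. rep_der \<xi> l k v * rep_der \<xi> k j v))" if v: "v \<in> model K" for v
    unfolding first[OF v] left_deriv_rep[OF rep ij(1) v]
    by (subst sum.swap) (simp add: sum_distrib_left mult.assoc)
  have "laplacian K (\<lambda>x. \<xi> x $$ (i, j)) x =
      (\<Sum>m<no. left_deriv K (onb K ! m) (left_deriv K (onb K ! m) (\<lambda>x. \<xi> x $$ (i, j))) x)"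
    unfolding laplacian_def by (simp add: sum_list_sum_nth atLeast0LessThan)
  also have "\<dots> = (\<Sum>m<no. \<Sum>l<?d. \<xi> x $$ (i, l) *
      (\<Sum>k<?d. rep_der \<xi> l k (onb K ! m) * rep_der \<xi> k j (onb K ! m)))"
    by (rule sum.cong[OF refl]) (simp add: second onb_model)
  also have "\<dots> = (\<Sum>l<?d. \<xi> x $$ (i, l) * casimir \<xi> $$ (l, j))"
    by (subst sum.swap) (use ij in \<open>simp add: casimir_def sum_distrib_left\<close>)
  finally show ?thesis .
qed

text \<open>Conjugation by \<open>g\<close>, read in the unit chart, has a derivative
  \<open>L\<close> at \<open>p0\<close>. Its values in the chart lie in \<open>model K\<close>,
  where \<open>pr\<close> is the identity, so the same holds for those of \<open>L\<close>. The
  second part differentiates the multiplicativity of the representation along this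
  conjugation.\<close>

lemma Ad_properties:
  assumes v: "v \<in> model K"
  shows "Ad K g v \<in> model K"
    and "representation K \<xi> \<Longrightarrow> i < rdim \<xi> \<Longrightarrow> j < rdim \<xi> \<Longrightarrow>
      rep_der \<xi> i j (Ad K g v) = (\<Sum>k<rdim \<xi>. \<Sum>l<rdim \<xi>. \<xi> g $$ (i, k) * rep_der \<xi> k l v * \<xi> (iv g) $$ (l, j))"
proof -
  define X where "X b = g \<star> cinv uc b \<star> iv g" for b
  have X: "gsmooth (chart_dom uc) X" unfolding X_def
    by (intro gsmooth_mul gsmooth_const gsmooth_cinv chart_dom_open uc)
  have X0: "X p0 = e1" by (simp add: X_def p0_dom)
  let ?W = "chart_dom uc \<inter> X -` fst uc"
  have W: "open ?W" "p0 \<in> ?W" using gsmoothD(4)[OF X chart_open[OF uc(1)]] X0 p0_dom uc by auto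
  define L where "L = frechet_derivative (\<lambda>b. snd uc (X b)) (at p0)"
  have L: "((\<lambda>b. snd uc (X b)) has_derivative L) (at p0)"
    unfolding L_def by (rule Cinf_has_derivative[OF gsmoothD(3)[OF X uc(1)] W(2)])
  have line: "((\<lambda>t. p0 + t *\<^sub>R v) has_derivative (\<lambda>t. t *\<^sub>R v)) (at 0)"
    by (auto intro!: derivative_eq_intros)
  have L': "((\<lambda>b. snd uc (X b)) has_derivative L) (at (p0 + 0 *\<^sub>R v))" using L by simp
  have "((\<lambda>t. snd uc (X (p0 + t *\<^sub>R v))) has_vector_derivative L v) (at 0)"
    using has_derivative_compose[OF line L']
    unfolding has_vector_derivative_def linear_scale[OF has_derivative_linear[OF L]] .
  then have Ad: "Ad K g v = L v"
    unfolding Ad_def unit_curve_cinv[OF v] X_def by (rule vector_derivative_at)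
  have "((\<lambda>b. pr (snd uc (X b))) has_derivative (\<lambda>e. pr (L e))) (at p0)"
    by (rule has_derivative_compose[OF L bounded_linear_imp_has_derivative[OF pr_bl]])
  then have "((\<lambda>b. snd uc (X b)) has_derivative (\<lambda>e. pr (L e))) (at p0)"
    by (rule has_derivative_transform_within_open[OF _ W]) (simp add: uc)
  from has_derivative_unique[OF this L] have "pr (L v) = L v" by metis
  then show "Ad K g v \<in> model K" unfolding Ad using pr_model by metis
  assume rep: "representation K \<xi>" and ij: "i < rdim \<xi>" "j < rdim \<xi>"
  have r: "((\<lambda>a. \<xi> (cinv uc a) $$ (i, j)) has_derivative rep_der \<xi> i j) (at (snd uc (X p0)))"
    unfolding X0 by (rule rep_der[OF rep ij])
  have "((\<lambda>b. \<xi> (cinv uc (snd uc (X b))) $$ (i, j)) has_derivative (\<lambda>e. rep_der \<xi> i j (L e))) (at p0)"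
    by (rule has_derivative_compose[OF L r])
  then have 1: "((\<lambda>b. \<xi> (X b) $$ (i, j)) has_derivative (\<lambda>e. rep_der \<xi> i j (L e))) (at p0)"
    by (rule has_derivative_transform_within_open[OF _ W]) (simp add: uc)
  have "\<xi> (X b) $$ (i, j) = (\<Sum>k<rdim \<xi>. \<Sum>l<rdim \<xi>. \<xi> g $$ (i, k) * \<xi> (cinv uc b) $$ (k, l) * \<xi> (iv g) $$ (l, j))" for b
  proof -
    have "\<xi> (X b) $$ (i, j) = (\<Sum>l<rdim \<xi>. \<xi> (g \<star> cinv uc b) $$ (i, l) * \<xi> (iv g) $$ (l, j))"
      unfolding X_def by (rule rep_mult_entry[OF rep ij])
    also have "\<dots> = (\<Sum>l<rdim \<xi>. \<Sum>k<rdim \<xi>. \<xi> g $$ (i, k) * \<xi> (cinv uc b) $$ (k, l) * \<xi> (iv g) $$ (l, j))"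
      by (rule sum.cong[OF refl]) (simp add: rep_mult_entry[OF rep ij(1)] sum_distrib_right)
    finally show ?thesis by (subst sum.swap)
  qed
  then have 2: "((\<lambda>b. \<xi> (X b) $$ (i, j)) has_derivative
      (\<lambda>e. \<Sum>k<rdim \<xi>. \<Sum>l<rdim \<xi>. \<xi> g $$ (i, k) * rep_der \<xi> k l e * \<xi> (iv g) $$ (l, j))) (at p0)"
    by (simp only:) (intro has_derivative_sum has_derivative_mult_left has_derivative_mult_right rep_der rep, auto)
  show "rep_der \<xi> i j (Ad K g v) = (\<Sum>k<rdim \<xi>. \<Sum>l<rdim \<xi>. \<xi> g $$ (i, k) * rep_der \<xi> k l v * \<xi> (iv g) $$ (l, j))"
    unfolding Ad using has_derivative_unique[OF 1 2] by metis
qed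

lemma rep_der_linear: "representation K \<xi> \<Longrightarrow> i < rdim \<xi> \<Longrightarrow> j < rdim \<xi> \<Longrightarrow> linear (rep_der \<xi> i j)"
  by (rule has_derivative_linear[OF rep_der])

lemma metric_sum:
  assumes "finite I" "\<And>i. i \<in> I \<Longrightarrow> u i \<in> model K" "w \<in> model K"
  shows "metric K (\<Sum>i\<in>I. c i *\<^sub>R u i) w = (\<Sum>i\<in>I. c i * metric K (u i) w)"
  using assms(1,2)
proof (induction I rule: finite_induct)
  case empty
  have "\<forall>u\<in>model K. \<forall>v\<in>model K. \<forall>w\<in>model K. \<forall>r. metric K (r *\<^sub>R u + v) w = r * metric K u w + metric K v w"
    using metric by (simp add: invariant_inner_def)
  from this[rule_format, of 0 0 w 1] real_vector.subspace_0[OF sub_model] assms(3)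
  show ?case by simp
next
  case (insert i I)
  have "(\<Sum>i\<in>I. c i *\<^sub>R u i) \<in> model K"
    using insert by (intro real_vector.subspace_sum real_vector.subspace_scale sub_model) auto
  then show ?case using insert assms(3) metric by (simp add: invariant_inner_def)
qed

text \<open>Invariance of the metric makes the columns of the matrix \<open>R\<close> of
  \<open>Ad K g\<close> orthonormal. The Casimir matrix needs orthonormal rows, which follow because
  a left inverse of a square matrix is a right inverse.\<close>

lemma Ad_orthogonal:
  obtains R where "\<And>i. i < no \<Longrightarrow> Ad K g (onb K ! i) = (\<Sum>j<no. R j i *\<^sub>R onb K ! j)"
    "\<And>j k. j < no \<Longrightarrow> k < no \<Longrightarrow> (\<Sum>i<no. R j i * R k i) = (if j = k then 1 else 0 :: real)"
proof -
  define R where "R j i = dual_basis (onb K) j (Ad K g (onb K ! i))" for i j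
  have exp: "Ad K g (onb K ! i) = (\<Sum>j<no. R j i *\<^sub>R onb K ! j)" if "i < no" for i
    unfolding R_def using dual_basis_expand[OF onb Ad_properties(1)[OF onb_model[OF that]]] by simp
  have sym: "metric K u v = metric K v u" if "u \<in> model K" "v \<in> model K" for u v
    using metric that by (simp add: invariant_inner_def)
  have RR: "(\<Sum>j<no. R j i * R j k) = (if i = k then 1 else 0)" if ik: "i < no" "k < no" for i k
  proof -
    have Am: "Ad K g (onb K ! k) \<in> model K" if "k < no" for k by (rule Ad_properties(1)[OF onb_model[OF that]])
    have pair: "metric K (onb K ! j) (Ad K g (onb K ! k)) = R j k" if j: "j < no" for j
    proof -
      have "metric K (onb K ! j) (Ad K g (onb K ! k)) = metric K (Ad K g (onb K ! k)) (onb K ! j)"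
        by (rule sym[OF onb_model[OF j] Am[OF ik(2)]])
      also have "\<dots> = (\<Sum>l<no. R l k * metric K (onb K ! l) (onb K ! j))"
        unfolding exp[OF ik(2)] by (rule metric_sum) (auto intro: onb_model j)
      also have "\<dots> = (\<Sum>l<no. if l = j then R l k else 0)"
        by (rule sum.cong[OF refl]) (simp add: onb_orthonormal j)
      finally show ?thesis using j by simp
    qed
    have "(if i = k then 1 else 0) = metric K (onb K ! i) (onb K ! k)" using onb_orthonormal ik by simp
    also have "\<dots> = metric K (Ad K g (onb K ! i)) (Ad K g (onb K ! k))"
      using metric onb_model ik by (simp add: invariant_inner_def)
    also have "\<dots> = (\<Sum>j<no. R j i * metric K (onb K ! j) (Ad K g (onb K ! k)))"
      by (subst exp[OF ik(1)], rule metric_sum) (auto intro: onb_model Am ik)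
    also have "\<dots> = (\<Sum>j<no. R j i * R j k)" by (rule sum.cong[OF refl]) (simp add: pair)
    finally show ?thesis by simp
  qed
  define A where "A = Matrix.mat no no (\<lambda>(i, j). R j i)"
  define B where "B = Matrix.mat no no (\<lambda>(j, i). R j i)"
  have AB: "A \<in> carrier_mat no no" "B \<in> carrier_mat no no" by (auto simp: A_def B_def)
  have "A * B = 1\<^sub>m no"
  proof (rule eq_matI)
    fix i k assume "i < dim_row (1\<^sub>m no :: real mat)" "k < dim_col (1\<^sub>m no :: real mat)"
    then have ik: "i < no" "k < no" by auto
    show "(A * B) $$ (i, k) = 1\<^sub>m no $$ (i, k)"
      unfolding mult_mat_entry[OF AB ik] using RR[OF ik] ik by (simp add: A_def B_def)
  qed (use AB in auto)
  then have BA: "B * A = 1\<^sub>m no" by (rule mat_mult_left_right_inverse[OF AB])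
  have "(\<Sum>i<no. R j i * R k i) = (if j = k then 1 else 0)" if jk: "j < no" "k < no" for j k
  proof -
    have "(\<Sum>i<no. R j i * R k i) = (B * A) $$ (j, k)"
      unfolding mult_mat_entry[OF AB(2,1) jk] using jk by (simp add: A_def B_def)
    then show ?thesis unfolding BA using jk by simp
  qed
  with exp show ?thesis by (rule that)
qed

lemma casimir_carrier: "casimir \<xi> \<in> carrier_mat (rdim \<xi>) (rdim \<xi>)" by (simp add: casimir_def)

text \<open>The Casimir matrix is a sum of squares over an orthonormal basis. Applying
  \<open>Ad K g\<close> to the basis conjugates every square by \<open>\<xi> g\<close>, while the
  sum is unchanged because the transition matrix is orthogonal.\<close>

lemma casimir_commute:
  assumes rep: "representation K \<xi>"
  shows "casimir \<xi> * \<xi> g = \<xi> g * casimir \<xi>"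
proof -
  let ?d = "rdim \<xi>"
  define M where "M v = Matrix.mat ?d ?d (\<lambda>(i, j). rep_der \<xi> i j v)" for v
  have M: "M v \<in> carrier_mat ?d ?d" for v by (simp add: M_def)
  note X = rep_carrier[OF rep]
  have AdM: "M (Ad K g v) = \<xi> g * M v * \<xi> (iv g)" if v: "v \<in> model K" for v
  proof (rule eq_matI)
    fix i j assume "i < dim_row (\<xi> g * M v * \<xi> (iv g))" "j < dim_col (\<xi> g * M v * \<xi> (iv g))"
    then have ij: "i < ?d" "j < ?d" using X[of g] X[of "iv g"] by auto
    have "(\<xi> g * M v * \<xi> (iv g)) $$ (i, j) = (\<Sum>l<?d. (\<Sum>k<?d. \<xi> g $$ (i, k) * rep_der \<xi> k l v) * \<xi> (iv g) $$ (l, j))"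
      unfolding mult_mat_entry[OF mult_carrier_mat[OF X M] X ij]
      by (rule sum.cong[OF refl]) (simp add: mult_mat_entry[OF X M ij(1)], simp add: M_def)
    also have "\<dots> = rep_der \<xi> i j (Ad K g v)"
      unfolding Ad_properties(2)[OF v rep ij] sum_distrib_right by (rule sum.swap)
    finally show "M (Ad K g v) $$ (i, j) = (\<xi> g * M v * \<xi> (iv g)) $$ (i, j)" using ij by (simp add: M_def)
  qed (use X[of g] X[of "iv g"] in \<open>auto simp: M_def\<close>)
  have gg: "\<xi> (iv g) * \<xi> g = 1\<^sub>m ?d"
  proof -
    have "\<xi> (iv g) * \<xi> g = \<xi> (iv g \<star> g)" using rep by (simp add: representation_def del: mul_simps)
    then show ?thesis using rep by (simp add: representation_def)
  qed
  have sq: "M (Ad K g v) * M (Ad K g v) = \<xi> g * (M v * M v) * \<xi> (iv g)" if v: "v \<in> model K" for v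
  proof -
    note [simp] = mult_carrier_mat[OF X M] mult_carrier_mat[OF M X] mult_carrier_mat[OF M M] mult_carrier_mat[OF X X]
    have "M (Ad K g v) * M (Ad K g v) = (\<xi> g * M v) * (\<xi> (iv g) * (\<xi> g * (M v * \<xi> (iv g))))"
      unfolding AdM[OF v] using assoc_mult_mat[OF X M X] assoc_mult_mat[OF mult_carrier_mat[OF X M] X mult_carrier_mat[OF X mult_carrier_mat[OF M X]]]
      by simp
    also have "\<xi> (iv g) * (\<xi> g * (M v * \<xi> (iv g))) = M v * \<xi> (iv g)"
      using assoc_mult_mat[OF X X mult_carrier_mat[OF M X], symmetric] gg left_mult_one_mat[OF mult_carrier_mat[OF M X]]
      by simp
    also have "(\<xi> g * M v) * (M v * \<xi> (iv g)) = \<xi> g * (M v * M v) * \<xi> (iv g)"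
      using assoc_mult_mat[OF mult_carrier_mat[OF X M] M X] assoc_mult_mat[OF X M M] by simp
    finally show ?thesis .
  qed
  have Qent: "casimir \<xi> $$ (i, j) = (\<Sum>m<no. (M (onb K ! m) * M (onb K ! m)) $$ (i, j))"
    if "i < ?d" "j < ?d" for i j
    using that by (simp add: casimir_def mult_mat_entry[OF M M]) (simp add: M_def)
  obtain R where R: "\<And>i. i < no \<Longrightarrow> Ad K g (onb K ! i) = (\<Sum>j<no. R j i *\<^sub>R onb K ! j)"
    "\<And>j k. j < no \<Longrightarrow> k < no \<Longrightarrow> (\<Sum>i<no. R j i * R k i) = (if j = k then 1 else 0 :: real)"
    using Ad_orthogonal by blast
  \<comment> \<open>Expanding both factors in the basis, the sum over \<open>m\<close> of
    \<open>R a m * R b m\<close> leaves only the terms with equal \<open>a\<close> and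
    \<open>b\<close>.\<close>
  have inv: "(\<Sum>m<no. (M (Ad K g (onb K ! m)) * M (Ad K g (onb K ! m))) $$ (i, j)) = casimir \<xi> $$ (i, j)"
    if ij: "i < ?d" "j < ?d" for i j
  proof -
    have rR: "rep_der \<xi> p q (Ad K g (onb K ! m)) = (\<Sum>a<no. R a m *\<^sub>R rep_der \<xi> p q (onb K ! a))"
      if "m < no" "p < ?d" "q < ?d" for m p q
      unfolding R(1)[OF that(1)] linear_sum[OF rep_der_linear[OF rep that(2,3)]]
        linear_scale[OF rep_der_linear[OF rep that(2,3)]] ..
    have "(\<Sum>m<no. (M (Ad K g (onb K ! m)) * M (Ad K g (onb K ! m))) $$ (i, j)) =
        (\<Sum>m<no. \<Sum>k<?d. (\<Sum>a<no. R a m *\<^sub>R rep_der \<xi> i k (onb K ! a)) * (\<Sum>b<no. R b m *\<^sub>R rep_der \<xi> k j (onb K ! b)))"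
      using ij by (intro sum.cong refl) (simp add: mult_mat_entry[OF M M], simp add: M_def rR)
    also have "\<dots> = (\<Sum>m<no. \<Sum>k<?d. \<Sum>a<no. \<Sum>b<no. (R a m * R b m) *\<^sub>R (rep_der \<xi> i k (onb K ! a) * rep_der \<xi> k j (onb K ! b)))"
      unfolding sum_product by (intro sum.cong refl) (simp add: mult.commute)
    also have "\<dots> = (\<Sum>k<?d. \<Sum>m<no. \<Sum>a<no. \<Sum>b<no. (R a m * R b m) *\<^sub>R (rep_der \<xi> i k (onb K ! a) * rep_der \<xi> k j (onb K ! b)))"
      by (rule sum.swap)
    also have "\<dots> = (\<Sum>k<?d. \<Sum>a<no. \<Sum>m<no. \<Sum>b<no. (R a m * R b m) *\<^sub>R (rep_der \<xi> i k (onb K ! a) * rep_der \<xi> k j (onb K ! b)))"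
      by (rule sum.cong[OF refl], rule sum.swap)
    also have "\<dots> = (\<Sum>k<?d. \<Sum>a<no. \<Sum>b<no. \<Sum>m<no. (R a m * R b m) *\<^sub>R (rep_der \<xi> i k (onb K ! a) * rep_der \<xi> k j (onb K ! b)))"
      by (rule sum.cong[OF refl], rule sum.cong[OF refl], rule sum.swap)
    also have "\<dots> = (\<Sum>k<?d. \<Sum>a<no. \<Sum>b<no. if b = a then rep_der \<xi> i k (onb K ! a) * rep_der \<xi> k j (onb K ! b) else 0)"
      by (intro sum.cong refl) (simp add: R(2) flip: scaleR_sum_left)
    also have "\<dots> = (\<Sum>k<?d. \<Sum>a<no. rep_der \<xi> i k (onb K ! a) * rep_der \<xi> k j (onb K ! a))" by simp
    also have "\<dots> = casimir \<xi> $$ (i, j)" using ij by (subst sum.swap) (simp add: casimir_def)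
    finally show ?thesis .
  qed
  have QX: "casimir \<xi> = \<xi> g * casimir \<xi> * \<xi> (iv g)"
  proof (rule eq_matI)
    fix i j assume "i < dim_row (\<xi> g * casimir \<xi> * \<xi> (iv g))" "j < dim_col (\<xi> g * casimir \<xi> * \<xi> (iv g))"
    then have ij: "i < ?d" "j < ?d" using X[of g] X[of "iv g"] by auto
    have ent: "(\<xi> g * Y * \<xi> (iv g)) $$ (i, j) = (\<Sum>l<?d. \<Sum>k<?d. \<xi> g $$ (i, k) * Y $$ (k, l) * \<xi> (iv g) $$ (l, j))"
      if Y: "Y \<in> carrier_mat ?d ?d" for Y
      unfolding mult_mat_entry[OF mult_carrier_mat[OF X Y] X ij]
      by (rule sum.cong[OF refl]) (simp add: mult_mat_entry[OF X Y ij(1)] sum_distrib_right)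
    have "casimir \<xi> $$ (i, j) = (\<Sum>m<no. (\<xi> g * (M (onb K ! m) * M (onb K ! m)) * \<xi> (iv g)) $$ (i, j))"
      unfolding inv[OF ij, symmetric] by (rule sum.cong[OF refl]) (simp add: sq onb_model)
    also have "\<dots> = (\<Sum>m<no. \<Sum>l<?d. \<Sum>k<?d. \<xi> g $$ (i, k) * (M (onb K ! m) * M (onb K ! m)) $$ (k, l) * \<xi> (iv g) $$ (l, j))"
      by (rule sum.cong[OF refl], rule ent[OF mult_carrier_mat[OF M M]])
    also have "\<dots> = (\<Sum>l<?d. \<Sum>k<?d. \<Sum>m<no. \<xi> g $$ (i, k) * (M (onb K ! m) * M (onb K ! m)) $$ (k, l) * \<xi> (iv g) $$ (l, j))"
      by (subst sum.swap, rule sum.cong[OF refl], rule sum.swap)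
    also have "\<dots> = (\<Sum>l<?d. \<Sum>k<?d. \<xi> g $$ (i, k) * casimir \<xi> $$ (k, l) * \<xi> (iv g) $$ (l, j))"
      by (intro sum.cong refl) (simp add: Qent sum_distrib_left sum_distrib_right)
    also have "\<dots> = (\<xi> g * casimir \<xi> * \<xi> (iv g)) $$ (i, j)" by (rule ent[OF casimir_carrier, symmetric])
    finally show "casimir \<xi> $$ (i, j) = (\<xi> g * casimir \<xi> * \<xi> (iv g)) $$ (i, j)" .
  qed (use X[of g] X[of "iv g"] in \<open>auto simp: casimir_def\<close>)
  have "casimir \<xi> * \<xi> g = (\<xi> g * casimir \<xi>) * (\<xi> (iv g) * \<xi> g)"
    by (subst QX, rule assoc_mult_mat[OF mult_carrier_mat[OF X casimir_carrier] X X])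
  then show ?thesis unfolding gg by (simp add: right_mult_one_mat[OF mult_carrier_mat[OF X casimir_carrier]])
qed

text \<open>Differentiates the unitarity relation at the unit, where the representation is the
  identity matrix.\<close>

lemma rep_der_skew:
  assumes u: "unitary_rep K \<xi>" and ij: "i < rdim \<xi>" "j < rdim \<xi>"
  shows "rep_der \<xi> i j v = - cnj (rep_der \<xi> j i v)"
proof -
  let ?d = "rdim \<xi>"
  have rep: "representation K \<xi>" using u by (simp add: unitary_rep_def)
  have cn: "((\<lambda>a. cnj (\<xi> (cinv uc a) $$ (k, l))) has_derivative (\<lambda>v. cnj (rep_der \<xi> k l v))) (at p0)"
    if "k < ?d" "l < ?d" for k l
    by (rule has_derivative_compose[OF rep_der[OF rep that] bounded_linear_imp_has_derivative[OF bounded_linear_cnj]])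
  have 1: "((\<lambda>a. \<Sum>k<?d. \<xi> (cinv uc a) $$ (k, j) * cnj (\<xi> (cinv uc a) $$ (k, i))) has_derivative
     (\<lambda>v. \<Sum>k<?d. \<xi> (cinv uc p0) $$ (k, j) * cnj (rep_der \<xi> k i v) + rep_der \<xi> k j v * cnj (\<xi> (cinv uc p0) $$ (k, i)))) (at p0)"
    by (intro has_derivative_sum has_derivative_mult cn rep_der rep ij) auto
  have 2: "((\<lambda>a. \<Sum>k<?d. \<xi> (cinv uc a) $$ (k, j) * cnj (\<xi> (cinv uc a) $$ (k, i))) has_derivative (\<lambda>v. 0)) (at p0)"
    unfolding unitary_sum[OF u ij(2,1)] by (rule has_derivative_const)
  from fun_cong[OF has_derivative_unique[OF 1 2], of v] have "(\<Sum>k<?d. \<xi> (cinv uc p0) $$ (k, j) * cnj (rep_der \<xi> k i v) + rep_der \<xi> k j v * cnj (\<xi> (cinv uc p0) $$ (k, i))) = 0" .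
  also have "(\<Sum>k<?d. \<xi> (cinv uc p0) $$ (k, j) * cnj (rep_der \<xi> k i v) + rep_der \<xi> k j v * cnj (\<xi> (cinv uc p0) $$ (k, i))) =
      (\<Sum>k<?d. (if k = j then cnj (rep_der \<xi> k i v) else 0) + (if k = i then rep_der \<xi> k j v else 0))"
    by (rule sum.cong[OF refl]) (simp add: p0_dom rep_one_entry[OF rep] ij)
  also have "\<dots> = cnj (rep_der \<xi> j i v) + rep_der \<xi> i j v" using ij by (simp add: sum.distrib)
  finally show ?thesis by (simp add: add_eq_0_iff)
qed

text \<open>By Schur's lemma the Laplacian acts on the coefficients as a scalar, and skewness makes
  the trace of the Casimir matrix minus a sum of squares. So the eigenvalue of one minus the
  Laplacian is \<open>1 + s\<close> with nonnegative \<open>s\<close>. The description of the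
  bracket is unique because the entry (0, 0) at the unit is 1.\<close>

theorem bracket_ge_1:
  assumes \<xi>: "\<xi> \<in> dual K"
  shows "1 \<le> bracket K \<xi>"
proof -
  let ?d = "rdim \<xi>"
  note u = dualD[OF \<xi>]
  obtain q where q: "casimir \<xi> = q \<cdot>\<^sub>m 1\<^sub>m ?d"
    using schur_scalar[OF u(2) casimir_carrier casimir_commute[OF u(3)]] by blast
  \<comment> \<open>Minus the normalised trace of the Casimir matrix, that is, minus its single
    eigenvalue.\<close>
  define s where "s = (\<Sum>i<?d. \<Sum>m<no. \<Sum>k<?d. (cmod (rep_der \<xi> i k (onb K ! m)))\<^sup>2) / ?d"
  have s: "0 \<le> s" unfolding s_def by (intro divide_nonneg_nonneg sum_nonneg) auto
  have "of_nat ?d * q = (\<Sum>i<?d. casimir \<xi> $$ (i, i))"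
  proof -
    have "casimir \<xi> $$ (i, i) = q" if "i < ?d" for i unfolding q using that by simp
    then show ?thesis by simp
  qed
  also have "\<dots> = (\<Sum>i<?d. \<Sum>m<no. \<Sum>k<?d. - of_real ((cmod (rep_der \<xi> i k (onb K ! m)))\<^sup>2))"
  proof (rule sum.cong[OF refl])
    fix i assume "i \<in> {..<?d}"
    then have i: "i < ?d" by simp
    have "rep_der \<xi> i k v * rep_der \<xi> k i v = - of_real ((cmod (rep_der \<xi> i k v))\<^sup>2)" if "k < ?d" for k v
      unfolding rep_der_skew[OF u(1) that i] complex_norm_square by simp
    then show "casimir \<xi> $$ (i, i) = (\<Sum>m<no. \<Sum>k<?d. - of_real ((cmod (rep_der \<xi> i k (onb K ! m)))\<^sup>2))"
      using i by (simp add: casimir_def)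
  qed
  also have "\<dots> = of_nat ?d * - of_real s" using u(4) by (simp add: s_def sum_negf)
  finally have "of_nat ?d * q = of_nat ?d * - of_real s" .
  then have qs: "q = - of_real s" using u(4) by (metis mult_left_cancel of_nat_eq_0_iff less_irrefl)
  have lap: "\<xi> x $$ (i, j) - laplacian K (\<lambda>y. \<xi> y $$ (i, j)) x = of_real (1 + s) * \<xi> x $$ (i, j)"
    if ij: "i < ?d" "j < ?d" for i j x
  proof -
    have "laplacian K (\<lambda>y. \<xi> y $$ (i, j)) x = (\<Sum>l<?d. if l = j then \<xi> x $$ (i, l) * q else 0)"
      unfolding laplacian_rep[OF u(3) ij] q using ij by (intro sum.cong) auto
    then show ?thesis using ij by (simp add: qs algebra_simps)
  qed
  have "bracket K \<xi> = sqrt (1 + s)"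
    unfolding bracket_def
  proof (rule the_equality)
    show "0 \<le> sqrt (1 + s) \<and> (\<forall>i<?d. \<forall>j<?d. \<forall>x. \<xi> x $$ (i, j) - laplacian K (\<lambda>y. \<xi> y $$ (i, j)) x =
        complex_of_real ((sqrt (1 + s))\<^sup>2) * \<xi> x $$ (i, j))"
      using s lap by simp
    fix c assume c: "0 \<le> c \<and> (\<forall>i<?d. \<forall>j<?d. \<forall>x. \<xi> x $$ (i, j) - laplacian K (\<lambda>y. \<xi> y $$ (i, j)) x =
        complex_of_real (c\<^sup>2) * \<xi> x $$ (i, j))"
    then have "of_real (1 + s) * \<xi> e1 $$ (0, 0) = complex_of_real (c\<^sup>2) * \<xi> e1 $$ (0, 0)"
      using lap[OF u(4,4), of e1] u(4) by metis
    then have "complex_of_real (1 + s) = complex_of_real (c\<^sup>2)"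
      using rep_one_entry[OF u(3) u(4) u(4)] by simp
    then have "1 + s = c\<^sup>2" by (simp only: of_real_eq_iff)
    then show "c = sqrt (1 + s)" using c by (simp add: real_sqrt_unique)
  qed
  then show ?thesis using s by simp
qed

end

section \<open>Operator norms\<close>

lemma vec_norm2_mult:
  assumes "A \<in> carrier_mat n n" "v \<in> carrier_vec n"
  shows "vec_norm2 (A *\<^sub>v v) = L2_set (\<lambda>i. cmod (\<Sum>j<n. A $$ (i, j) * vec_index v j)) {..<n}"
  unfolding vec_norm2_def using assms
  by (intro L2_set_cong) (auto simp: scalar_prod_def atLeast0LessThan intro!: arg_cong[of _ _ cmod] sum.cong)

text \<open>A crude bound whose constant grows with the dimension. It shows that the supremum
  defining \<open>op_norm\<close> is over a bounded set, and is used for estimates only at a single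
  representation.\<close>

lemma vec_norm2_mult_le:
  assumes A: "A \<in> carrier_mat n n" and v: "v \<in> carrier_vec n" "vec_norm2 v \<le> 1"
  shows "vec_norm2 (A *\<^sub>v v) \<le> (\<Sum>i<n. \<Sum>j<n. cmod (A $$ (i, j)))"
proof -
  have "vec_norm2 (A *\<^sub>v v) \<le> (\<Sum>i<n. cmod (\<Sum>j<n. A $$ (i, j) * vec_index v j))"
    unfolding vec_norm2_mult[OF A v(1)] by (rule L2_set_le_sum) auto
  also have "\<dots> \<le> (\<Sum>i<n. \<Sum>j<n. cmod (A $$ (i, j)))"
  proof (rule sum_mono, rule order_trans[OF norm_sum], rule sum_mono)
    fix i j assume "j \<in> {..<n}"
    then have "cmod (vec_index v j) \<le> vec_norm2 v"
      unfolding vec_norm2_def using v(1) by (intro member_le_L2_set) auto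
    then have "cmod (vec_index v j) \<le> 1" using v(2) by linarith
    then show "cmod (A $$ (i, j) * vec_index v j) \<le> cmod (A $$ (i, j))"
      unfolding norm_mult by (rule mult_left_le) simp
  qed
  finally show ?thesis .
qed

lemma op_norm_upper:
  assumes A: "A \<in> carrier_mat n n" and v: "v \<in> carrier_vec n" "vec_norm2 v \<le> 1"
  shows "vec_norm2 (A *\<^sub>v v) \<le> op_norm A"
  unfolding op_norm_def
  by (rule cSUP_upper) (use A v vec_norm2_mult_le[OF A] in \<open>auto intro!: bdd_aboveI2\<close>)

lemma op_norm_least:
  assumes A: "A \<in> carrier_mat n n"
    and le: "\<And>v. v \<in> carrier_vec n \<Longrightarrow> vec_norm2 v \<le> 1 \<Longrightarrow> vec_norm2 (A *\<^sub>v v) \<le> C"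
  shows "op_norm A \<le> C"
  unfolding op_norm_def
proof (rule cSUP_least)
  have "0\<^sub>v (dim_col A) \<in> {v \<in> carrier_vec (dim_col A). vec_norm2 v \<le> 1}"
    by (simp add: vec_norm2_def L2_set_def)
  then show "{v \<in> carrier_vec (dim_col A). vec_norm2 v \<le> 1} \<noteq> {}" by blast
qed (use A le in auto)

lemma op_norm_le_sum:
  assumes "A \<in> carrier_mat n n"
  shows "op_norm A \<le> (\<Sum>i<n. \<Sum>j<n. cmod (A $$ (i, j)))"
  by (rule op_norm_least[OF assms vec_norm2_mult_le[OF assms]])

lemma op_norm_nonneg:
  assumes "A \<in> carrier_mat n n"
  shows "0 \<le> op_norm A"
proof -
  have "0 \<le> vec_norm2 (A *\<^sub>v 0\<^sub>v n)" by (simp add: vec_norm2_def L2_set_nonneg)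
  also have "\<dots> \<le> op_norm A" by (rule op_norm_upper[OF assms]) (auto simp: vec_norm2_def L2_set_def)
  finally show ?thesis .
qed

lemma op_norm_entry:
  assumes A: "A \<in> carrier_mat n n" and ij: "i < n" "j < n"
  shows "cmod (A $$ (i, j)) \<le> op_norm A"
proof -
  have u: "vec_norm2 (unit_vec n j :: complex vec) \<le> 1"
  proof -
    have "(\<Sum>i<n. (cmod (vec_index (unit_vec n j) i))\<^sup>2) = (\<Sum>i<n. if i = j then 1 else 0)"
      by (rule sum.cong) (auto simp: unit_vec_def)
    then show ?thesis using ij by (simp add: vec_norm2_def L2_set_def)
  qed
  have "cmod (A $$ (i, j)) = cmod (vec_index (A *\<^sub>v unit_vec n j) i)" using A ij by simp
  also have "\<dots> \<le> vec_norm2 (A *\<^sub>v unit_vec n j)"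
    unfolding vec_norm2_def using A ij by (intro member_le_L2_set) auto
  also have "\<dots> \<le> op_norm A" by (rule op_norm_upper[OF A _ u]) simp
  finally show ?thesis .
qed

text \<open>The pairing with a fixed vector avoids the measurability of the operator norm and a constant depending on
  the dimension.\<close>

lemma op_norm_integral:
  fixes a :: "'t \<Rightarrow> nat \<Rightarrow> nat \<Rightarrow> complex"
  assumes int: "\<And>i j. i < n \<Longrightarrow> j < n \<Longrightarrow> integrable M (\<lambda>t. a t i j)"
    and B: "integrable M B"
    and le: "\<And>t. t \<in> space M \<Longrightarrow> op_norm (Matrix.mat n n (\<lambda>(i, j). a t i j)) \<le> B t"
  shows "op_norm (Matrix.mat n n (\<lambda>(i, j). \<integral>t. a t i j \<partial>M)) \<le> (\<integral>t. B t \<partial>M)"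
proof (rule op_norm_least)
  let ?A = "Matrix.mat n n (\<lambda>(i, j). \<integral>t. a t i j \<partial>M)"
  let ?At = "\<lambda>t. Matrix.mat n n (\<lambda>(i, j). a t i j)"
  fix v :: "complex vec" assume v: "v \<in> carrier_vec n" "vec_norm2 v \<le> 1"
  define W where "W t i = (\<Sum>j<n. a t i j * vec_index v j)" for t i
  define w where "w i = (\<integral>t. W t i \<partial>M)" for i
  have Wint: "integrable M (\<lambda>t. W t i)" if "i < n" for i
    unfolding W_def using int that by (intro Bochner_Integration.integrable_sum integrable_mult_left) auto
  have w: "w i = (\<Sum>j<n. (\<integral>t. a t i j \<partial>M) * vec_index v j)" if "i < n" for i
    unfolding w_def W_def using int that by (subst Bochner_Integration.integral_sum) auto
  define N where "N = L2_set (\<lambda>i. cmod (w i)) {..<n}"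
  have Av: "vec_norm2 (?A *\<^sub>v v) = N"
  proof -
    have "vec_norm2 (?A *\<^sub>v v) = L2_set (\<lambda>i. cmod (\<Sum>j<n. ?A $$ (i, j) * vec_index v j)) {..<n}"
      by (rule vec_norm2_mult[OF _ v(1)]) simp
    also have "\<dots> = N" unfolding N_def by (rule L2_set_cong) (auto simp: w intro!: sum.cong)
    finally show ?thesis .
  qed
  have Wt: "L2_set (\<lambda>i. cmod (W t i)) {..<n} \<le> B t" if "t \<in> space M" for t
  proof -
    have "vec_norm2 (?At t *\<^sub>v v) = L2_set (\<lambda>i. cmod (\<Sum>j<n. ?At t $$ (i, j) * vec_index v j)) {..<n}"
      by (rule vec_norm2_mult[OF _ v(1)]) simp
    also have "\<dots> = L2_set (\<lambda>i. cmod (W t i)) {..<n}"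
      unfolding W_def by (rule L2_set_cong) (auto intro!: sum.cong)
    finally show ?thesis using op_norm_upper[of "?At t" n v] v le[OF that] by simp
  qed
  \<comment> \<open>The image vector \<open>w\<close> is paired with itself and one factor is
    written as an integral. Cauchy-Schwarz under the integral bounds the result by \<open>N\<close>
    times the integral of \<open>B\<close>, and one factor \<open>N\<close> cancels.\<close>
  have "complex_of_real (N\<^sup>2) = (\<Sum>i<n. cnj (w i) * w i)"
  proof -
    have "N\<^sup>2 = (\<Sum>i<n. (cmod (w i))\<^sup>2)" unfolding N_def L2_set_def by (simp add: sum_nonneg)
    then show ?thesis by (simp add: complex_norm_square mult.commute del: of_real_power)
  qed
  also have "\<dots> = (\<Sum>i<n. \<integral>t. cnj (w i) * W t i \<partial>M)" unfolding w_def by simp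
  also have "\<dots> = (\<integral>t. (\<Sum>i<n. cnj (w i) * W t i) \<partial>M)"
    by (rule Bochner_Integration.integral_sum[symmetric]) (use Wint in auto)
  finally have eq: "complex_of_real (N\<^sup>2) = (\<integral>t. (\<Sum>i<n. cnj (w i) * W t i) \<partial>M)" .
  have "N\<^sup>2 = cmod (complex_of_real (N\<^sup>2))" by (simp add: norm_power)
  also have "\<dots> \<le> (\<integral>t. cmod (\<Sum>i<n. cnj (w i) * W t i) \<partial>M)" unfolding eq by (rule integral_norm_bound)
  also have "\<dots> \<le> (\<integral>t. N * B t \<partial>M)"
  proof (rule integral_mono)
    show "integrable M (\<lambda>t. cmod (\<Sum>i<n. cnj (w i) * W t i))"
      using Wint by (intro integrable_norm Bochner_Integration.integrable_sum integrable_mult_right) auto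
    show "integrable M (\<lambda>t. N * B t)" using B by simp
    fix t assume t: "t \<in> space M"
    have "cmod (\<Sum>i<n. cnj (w i) * W t i) \<le> (\<Sum>i<n. \<bar>cmod (w i)\<bar> * \<bar>cmod (W t i)\<bar>)"
      by (rule order_trans[OF norm_sum]) (simp add: norm_mult)
    also have "\<dots> \<le> N * L2_set (\<lambda>i. cmod (W t i)) {..<n}" unfolding N_def by (rule L2_set_mult_ineq)
    also have "\<dots> \<le> N * B t" by (rule mult_left_mono[OF Wt[OF t]]) (simp add: N_def L2_set_nonneg)
    finally show "cmod (\<Sum>i<n. cnj (w i) * W t i) \<le> N * B t" .
  qed
  finally have "N * N \<le> N * (\<integral>t. B t \<partial>M)" by (simp add: power2_eq_square)
  moreover have "0 \<le> (\<integral>t. B t \<partial>M)"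
    by (rule integral_nonneg_AE, rule AE_I2, rule order_trans[OF _ le], rule op_norm_nonneg) auto
  ultimately have "N \<le> (\<integral>t. B t \<partial>M)"
    by (cases "N > 0") auto
  then show "vec_norm2 (?A *\<^sub>v v) \<le> (\<integral>t. B t \<partial>M)" by (simp add: Av)
qed simp

lemma op_norm_cmult:
  fixes a :: "nat \<Rightarrow> nat \<Rightarrow> complex"
  shows "op_norm (Matrix.mat n n (\<lambda>(i, j). c * a i j)) \<le> cmod c * op_norm (Matrix.mat n n (\<lambda>(i, j). a i j))"
proof (rule op_norm_least)
  let ?C = "Matrix.mat n n (\<lambda>(i, j). c * a i j)" and ?A = "Matrix.mat n n (\<lambda>(i, j). a i j)"
  fix v :: "complex vec" assume v: "v \<in> carrier_vec n" "vec_norm2 v \<le> 1"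
  have "vec_norm2 (?C *\<^sub>v v) = L2_set (\<lambda>i. cmod (\<Sum>j<n. ?C $$ (i, j) * vec_index v j)) {..<n}"
    by (rule vec_norm2_mult[OF _ v(1)]) simp
  also have "\<dots> = L2_set (\<lambda>i. cmod c * cmod (\<Sum>j<n. ?A $$ (i, j) * vec_index v j)) {..<n}"
    by (rule L2_set_cong) (auto simp: mult.assoc simp flip: norm_mult sum_distrib_left)
  also have "\<dots> = cmod c * vec_norm2 (?A *\<^sub>v v)"
    unfolding vec_norm2_mult[OF mat_carrier v(1)] by (simp add: L2_set_right_distrib)
  also have "\<dots> \<le> cmod c * op_norm ?A" by (rule mult_left_mono[OF op_norm_upper[OF mat_carrier v]]) simp
  finally show "vec_norm2 (?C *\<^sub>v v) \<le> cmod c * op_norm ?A" .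
qed simp

lemma op_norm_add:
  fixes a b :: "nat \<Rightarrow> nat \<Rightarrow> complex"
  shows "op_norm (Matrix.mat n n (\<lambda>(i, j). a i j + b i j)) \<le>
    op_norm (Matrix.mat n n (\<lambda>(i, j). a i j)) + op_norm (Matrix.mat n n (\<lambda>(i, j). b i j))"
proof (rule op_norm_least)
  let ?C = "Matrix.mat n n (\<lambda>(i, j). a i j + b i j)" and ?A = "Matrix.mat n n (\<lambda>(i, j). a i j)"
    and ?B = "Matrix.mat n n (\<lambda>(i, j). b i j)"
  fix v :: "complex vec" assume v: "v \<in> carrier_vec n" "vec_norm2 v \<le> 1"
  have "vec_norm2 (?C *\<^sub>v v) = L2_set (\<lambda>i. cmod (\<Sum>j<n. ?C $$ (i, j) * vec_index v j)) {..<n}"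
    by (rule vec_norm2_mult[OF _ v(1)]) simp
  also have "\<dots> \<le> L2_set (\<lambda>i. cmod (\<Sum>j<n. ?A $$ (i, j) * vec_index v j) +
      cmod (\<Sum>j<n. ?B $$ (i, j) * vec_index v j)) {..<n}"
  proof (rule L2_set_mono)
    fix i assume "i \<in> {..<n}"
    then have "(\<Sum>j<n. ?C $$ (i, j) * vec_index v j) =
        (\<Sum>j<n. ?A $$ (i, j) * vec_index v j) + (\<Sum>j<n. ?B $$ (i, j) * vec_index v j)"
      by (simp add: distrib_right sum.distrib)
    then show "cmod (\<Sum>j<n. ?C $$ (i, j) * vec_index v j) \<le>
        cmod (\<Sum>j<n. ?A $$ (i, j) * vec_index v j) + cmod (\<Sum>j<n. ?B $$ (i, j) * vec_index v j)"
      by (simp only: norm_triangle_ineq)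
  qed simp
  also have "\<dots> \<le> vec_norm2 (?A *\<^sub>v v) + vec_norm2 (?B *\<^sub>v v)"
    unfolding vec_norm2_mult[OF mat_carrier v(1)] by (rule L2_set_triangle_ineq)
  also have "\<dots> \<le> op_norm ?A + op_norm ?B"
    by (intro add_mono op_norm_upper[OF mat_carrier v])
  finally show "vec_norm2 (?C *\<^sub>v v) \<le> op_norm ?A + op_norm ?B" .
qed simp

section \<open>The contour\<close>

lemma integrable_of_nn_bound:
  fixes f :: "'t \<Rightarrow> real"
  assumes "f \<in> borel_measurable M" "\<And>t. 0 \<le> f t" "(\<integral>\<^sup>+t. ennreal (f t) \<partial>M) \<le> ennreal C" "0 \<le> C"
  shows "integrable M f" "(\<integral>t. f t \<partial>M) \<le> C"
proof -
  show i: "integrable M f"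
    using assms by (intro integrableI_nonneg) (auto intro: order_le_less_trans)
  have "ennreal (\<integral>t. f t \<partial>M) \<le> ennreal C"
    using nn_integral_eq_integral[OF i] assms by simp
  then show "(\<integral>t. f t \<partial>M) \<le> C" using assms(4) by (simp add: ennreal_le_iff)
qed

lemma ray_constant_nonneg: "- 1 < s \<Longrightarrow> s < 0 \<Longrightarrow> 0 \<le> 1 / (s + 1) - 1 / (s::real)"
proof -
  assume s: "- 1 < s" "s < 0"
  have "0 \<le> 1 / (s + 1)" "1 / s \<le> 0" using s by (simp_all add: divide_le_0_iff)
  then show "0 \<le> 1 / (s + 1) - 1 / s" by linarith
qed

text \<open>The integral is split at \<open>T = b powr m\<close>, where
  \<open>r powr (1 / m)\<close> equals \<open>b\<close>. Below \<open>T\<close> the summand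
  \<open>r powr (1 / m)\<close> is dropped, above it \<open>b\<close> is. The remaining powers of
  \<open>r\<close> are integrable at 0 because \<open>s\<close> exceeds -1 and at infinity because
  \<open>s\<close> is negative, and they contribute \<open>1 / (s + 1)\<close> and
  \<open>- 1 / s\<close> times \<open>b powr (m * s)\<close>. Extending the lower range to 0 makes
  the constant independent of \<epsilon>.\<close>

lemma ray_integral:
  assumes m: "0 < m" and s: "-1 < s" "s < 0" and b: "(1::real) \<le> b" and \<epsilon>: "0 < \<epsilon>"
  defines "f \<equiv> \<lambda>r. indicator {\<epsilon>..} r * (r powr s * (r powr (1 / m) + b) powr (- m))"
  shows "integrable lborel f" "(\<integral>r. f r \<partial>lborel) \<le> (1 / (s + 1) - 1 / s) * b powr (m * s)"
proof -
  define T where "T = b powr m"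
  have b0: "0 < b" using b by simp
  have T: "0 < T" using b0 by (simp add: T_def)
  define I where "I = (1 / (s + 1) - 1 / s) * b powr (m * s)"
  have I0: "0 \<le> I" unfolding I_def using ray_constant_nonneg[OF s] by simp
  have "continuous_on {\<epsilon>..} (\<lambda>r. r powr s * (r powr (1 / m) + b) powr (- m))"
    using \<epsilon> b0 by (intro continuous_intros) (auto simp: add_nonneg_eq_0_iff)
  from borel_measurable_continuous_on_indicator[OF _ this]
  have meas: "f \<in> borel_measurable lborel" unfolding f_def by simp
  have nonneg: "0 \<le> f r" for r by (simp add: f_def)
  have i1: "((\<lambda>r. r powr s * b powr (- m)) has_integral (T powr (s + 1) / (s + 1) * b powr (- m))) {0..T}"
    using T s by (intro has_integral_mult_left has_integral_powr_from_0) auto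
  have i2: "((\<lambda>r. r powr (s - 1)) has_integral - (T powr (s - 1 + 1)) / (s - 1 + 1)) {T..}"
    using T s by (intro has_integral_powr_to_inf) auto
  have sum: "T powr (s + 1) / (s + 1) * b powr (- m) + (- (T powr (s - 1 + 1)) / (s - 1 + 1)) = I"
    unfolding T_def I_def powr_powr using b0
    by (simp add: left_diff_distrib distrib_left powr_add[symmetric] algebra_simps)
  have "(\<integral>\<^sup>+r. ennreal (f r) \<partial>lborel) \<le>
      (\<integral>\<^sup>+r. ennreal (r powr s * b powr (- m)) * indicator {0..T} r + ennreal (r powr (s - 1)) * indicator {T..} r \<partial>lborel)"
  proof (rule nn_integral_mono)
    fix r :: real
    consider "r < \<epsilon>" | "\<epsilon> \<le> r" "r \<le> T" | "\<epsilon> \<le> r" "T < r" by linarith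
    then show "ennreal (f r) \<le> ennreal (r powr s * b powr (- m)) * indicator {0..T} r + ennreal (r powr (s - 1)) * indicator {T..} r"
    proof cases
      case 1
      then show ?thesis by (simp add: f_def)
    next
      case 2
      have "(r powr (1 / m) + b) powr (- m) \<le> b powr (- m)"
        using b0 m by (intro powr_mono2') auto
      then have "f r \<le> r powr s * b powr (- m)" using 2 by (simp add: f_def mult_left_mono)
      then have "ennreal (f r) \<le> ennreal (r powr s * b powr (- m)) * indicator {0..T} r"
        using 2 \<epsilon> by (simp add: ennreal_leI)
      then show ?thesis by (rule order_trans) simp
    next
      case 3
      have r0: "0 < r" using 3 \<epsilon> by simp
      have "(r powr (1 / m) + b) powr (- m) \<le> (r powr (1 / m)) powr (- m)"
        using b0 m r0 by (intro powr_mono2') auto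
      also have "\<dots> = r powr (- 1)" using m by (simp add: powr_powr)
      finally have "r powr s * (r powr (1 / m) + b) powr (- m) \<le> r powr s * r powr (- 1)"
        by (intro mult_left_mono) auto
      also have "\<dots> = r powr (s - 1)" by (simp only: powr_add[symmetric]) simp
      finally have "f r \<le> r powr (s - 1)" using 3 by (simp add: f_def)
      then have "ennreal (f r) \<le> ennreal (r powr (s - 1)) * indicator {T..} r"
        using 3 by (simp add: ennreal_leI)
      then show ?thesis by (rule order_trans) simp
    qed
  qed
  also have "\<dots> = (\<integral>\<^sup>+r. ennreal (r powr s * b powr (- m)) * indicator {0..T} r \<partial>lborel) +
      (\<integral>\<^sup>+r. ennreal (r powr (s - 1)) * indicator {T..} r \<partial>lborel)"
    by (rule nn_integral_add) measurable
  also have "\<dots> = ennreal (T powr (s + 1) / (s + 1) * b powr (- m)) + ennreal (- (T powr (s - 1 + 1)) / (s - 1 + 1))"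
    using nn_integral_has_integral_lebesgue'[OF _ i1] nn_integral_has_integral_lebesgue'[OF _ i2] by simp
  also have "\<dots> = ennreal I"
    unfolding sum[symmetric] using T s by (intro ennreal_plus[symmetric]) (auto simp: divide_nonneg_neg)
  finally have le: "(\<integral>\<^sup>+r. ennreal (f r) \<partial>lborel) \<le> ennreal I" .
  show "integrable lborel f" "(\<integral>r. f r \<partial>lborel) \<le> (1 / (s + 1) - 1 / s) * b powr (m * s)"
    using integrable_of_nn_bound[OF meas nonneg le I0] by (auto simp: I_def)
qed

text \<open>Bounds the contour integrand for a parametrix entry, up to a constant; \<open>b\<close>
  stands for the bracket of the representation.\<close>

definition weight :: "real \<Rightarrow> (real \<Rightarrow> complex) \<Rightarrow> (real \<Rightarrow> complex) \<Rightarrow> real \<Rightarrow> real \<Rightarrow> real" where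
  "weight m \<phi> \<gamma> b t = cmod (\<phi> t) * (cmod (\<gamma> t) powr (1 / m) + b) powr (- m)"

text \<open>Treats the two rays and the circle alike: \<open>\<gamma>\<close> runs along the piece,
  and \<open>\<phi>\<close> is the boundary value of the function times the velocity of
  \<open>\<gamma>\<close>. The constant is chosen before \<open>b\<close>, so that it serves for all
  representations.\<close>

definition admissible_arc ::
    "complex set \<Rightarrow> real \<Rightarrow> real \<Rightarrow> real set \<Rightarrow> (real \<Rightarrow> complex) \<Rightarrow> (real \<Rightarrow> complex) \<Rightarrow> bool" where
  "admissible_arc S m s A \<phi> \<gamma> \<longleftrightarrow> A \<in> sets borel \<and> continuous_on A \<phi> \<and> continuous_on A \<gamma> \<and> \<gamma> ` A \<subseteq> S \<and>
     (\<exists>C\<ge>0. \<forall>b\<ge>1. integrable lborel (\<lambda>t. indicator A t * weight m \<phi> \<gamma> b t) \<and>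
        (\<integral>t. indicator A t * weight m \<phi> \<gamma> b t \<partial>lborel) \<le> C * b powr (m * s))"

lemma weight_measurable:
  assumes "A \<in> sets borel" "continuous_on A \<phi>" "continuous_on A \<gamma>" "1 \<le> b"
    "\<And>t. t \<in> A \<Longrightarrow> 0 < cmod (\<gamma> t)"
  shows "(\<lambda>t. indicator A t * weight m \<phi> \<gamma> b t) \<in> borel_measurable lborel"
proof -
  have "continuous_on A (weight m \<phi> \<gamma> b)"
    unfolding weight_def[abs_def]
  proof (intro continuous_intros assms ballI)
    fix t assume "t \<in> A"
    then show "cmod (\<gamma> t) powr (1 / m) + b \<noteq> 0" using assms(4) by (simp add: add_nonneg_eq_0_iff)
  qed (use assms(5) in fastforce)
  from borel_measurable_continuous_on_indicator[OF assms(1) this] show ?thesis by simp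
qed

lemma admissible_ray:
  assumes m: "0 < m" and s: "-1 < s" "s < 0" and \<epsilon>: "0 < \<epsilon>"
    and \<phi>: "continuous_on {\<epsilon>..} \<phi>" "\<And>r. \<epsilon> \<le> r \<Longrightarrow> cmod (\<phi> r) \<le> C * r powr s"
    and S: "\<And>r. \<epsilon> \<le> r \<Longrightarrow> rcis r \<theta> \<in> S"
  shows "admissible_arc S m s {\<epsilon>..} \<phi> (\<lambda>r. rcis r \<theta>)"
proof -
  have C0: "0 \<le> C"
  proof -
    have "0 \<le> C * \<epsilon> powr s" using order_trans[OF norm_ge_zero \<phi>(2)[of \<epsilon>]] by simp
    then show ?thesis using \<epsilon> by (simp add: zero_le_mult_iff)
  qed
  have cont: "continuous_on {\<epsilon>..} (\<lambda>r. rcis r \<theta>)" unfolding rcis_def by (intro continuous_intros)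
  have main: "integrable lborel (\<lambda>t. indicator {\<epsilon>..} t * weight m \<phi> (\<lambda>r. rcis r \<theta>) b t) \<and>
      (\<integral>t. indicator {\<epsilon>..} t * weight m \<phi> (\<lambda>r. rcis r \<theta>) b t \<partial>lborel) \<le> (C * (1 / (s + 1) - 1 / s)) * b powr (m * s)"
    if b: "1 \<le> b" for b
  proof -
    let ?f = "\<lambda>r. indicator {\<epsilon>..} r * (r powr s * (r powr (1 / m) + b) powr (- m))"
    note R = ray_integral[OF m s b \<epsilon>]
    have le: "indicator {\<epsilon>..} t * weight m \<phi> (\<lambda>r. rcis r \<theta>) b t \<le> C * ?f t" for t
    proof (cases "\<epsilon> \<le> t")
      case True
      then have "weight m \<phi> (\<lambda>r. rcis r \<theta>) b t \<le> (C * t powr s) * (t powr (1 / m) + b) powr (- m)"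
        unfolding weight_def using \<epsilon> \<phi>(2)[OF True] by (auto intro!: mult_right_mono)
      then show ?thesis using True by (simp add: mult.assoc)
    qed simp
    have meas: "(\<lambda>t. indicator {\<epsilon>..} t * weight m \<phi> (\<lambda>r. rcis r \<theta>) b t) \<in> borel_measurable lborel"
      by (rule weight_measurable[OF _ \<phi>(1) cont b]) (use \<epsilon> in auto)
    have nonneg: "0 \<le> indicator {\<epsilon>..} t * weight m \<phi> (\<lambda>r. rcis r \<theta>) b t" for t by (simp add: weight_def)
    have int: "integrable lborel (\<lambda>t. indicator {\<epsilon>..} t * weight m \<phi> (\<lambda>r. rcis r \<theta>) b t)"
      by (rule Bochner_Integration.integrable_bound[OF integrable_mult_right[OF R(1), of C] meas])
        (intro AE_I2, use le nonneg order_trans[OF le abs_ge_self] in simp)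
    have "(\<integral>t. indicator {\<epsilon>..} t * weight m \<phi> (\<lambda>r. rcis r \<theta>) b t \<partial>lborel) \<le> (\<integral>t. C * ?f t \<partial>lborel)"
      by (rule integral_mono[OF int integrable_mult_right[OF R(1)] le])
    also have "\<dots> \<le> C * ((1 / (s + 1) - 1 / s) * b powr (m * s))"
      using R(2) C0 by (simp add: mult_left_mono)
    finally show ?thesis using int by (simp add: mult.assoc)
  qed
  have "0 \<le> C * (1 / (s + 1) - 1 / s)" using C0 ray_constant_nonneg[OF s] by (rule mult_nonneg_nonneg)
  then show ?thesis unfolding admissible_arc_def using \<phi>(1) cont S main by (intro conjI) auto
qed

text \<open>On a compact arc the weight is of order \<open>b powr (- m)\<close>. Since
  \<open>b\<close> is at least 1 and \<open>s\<close> exceeds -1, this is at most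
  \<open>b powr (m * s)\<close>.\<close>

lemma admissible_circle:
  assumes m: "0 < m" and s: "-1 < s" and \<epsilon>: "0 < \<epsilon>"
    and \<phi>: "continuous_on {c..d} \<phi>" and S: "cball 0 \<epsilon> \<subseteq> S"
  shows "admissible_arc S m s {c..d} \<phi> (\<lambda>\<theta>. rcis \<epsilon> \<theta>)"
proof -
  obtain C where "\<forall>x\<in>\<phi> ` {c..d}. cmod x \<le> C"
    using compact_imp_bounded[OF compact_continuous_image[OF \<phi> compact_Icc]] unfolding bounded_iff by blast
  then have C: "cmod (\<phi> t) \<le> C" if "t \<in> {c..d}" for t using that by blast
  define C' where "C' = max C 0"
  have C': "0 \<le> C'" "\<And>t. t \<in> {c..d} \<Longrightarrow> cmod (\<phi> t) \<le> C'" using C unfolding C'_def by fastforce+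
  have cont: "continuous_on {c..d} (\<lambda>\<theta>. rcis \<epsilon> \<theta>)"
    unfolding rcis_def cis_conv_exp by (intro continuous_intros)
  have main: "integrable lborel (\<lambda>t. indicator {c..d} t * weight m \<phi> (\<lambda>\<theta>. rcis \<epsilon> \<theta>) b t) \<and>
      (\<integral>t. indicator {c..d} t * weight m \<phi> (\<lambda>\<theta>. rcis \<epsilon> \<theta>) b t \<partial>lborel) \<le> (C' * measure lborel {c..d}) * b powr (m * s)"
    if b: "1 \<le> b" for b
  proof -
    have "(\<epsilon> powr (1 / m) + b) powr (- m) \<le> b powr (- m)" using b m by (intro powr_mono2') auto
    also have "\<dots> \<le> b powr (m * s)"
    proof (rule powr_mono[OF _ b])
      have "m * (- 1) \<le> m * s" using m s by (intro mult_left_mono) auto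
      then show "- m \<le> m * s" by simp
    qed
    finally have w: "(\<epsilon> powr (1 / m) + b) powr (- m) \<le> b powr (m * s)" .
    have le: "indicator {c..d} t * weight m \<phi> (\<lambda>\<theta>. rcis \<epsilon> \<theta>) b t \<le> (C' * b powr (m * s)) * indicator {c..d} t" for t
    proof (cases "t \<in> {c..d}")
      case True
      have "weight m \<phi> (\<lambda>\<theta>. rcis \<epsilon> \<theta>) b t \<le> C' * b powr (m * s)"
        unfolding weight_def using \<epsilon> C' True w by (intro mult_mono) auto
      then show ?thesis using True by simp
    qed simp
    have i: "integrable lborel (\<lambda>t. (C' * b powr (m * s)) * indicator {c..d} t :: real)"
      by (intro integrable_mult_right integrable_real_indicator) (auto simp: emeasure_lborel_Icc_eq)
    have meas: "(\<lambda>t. indicator {c..d} t * weight m \<phi> (\<lambda>\<theta>. rcis \<epsilon> \<theta>) b t) \<in> borel_measurable lborel"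
      by (rule weight_measurable[OF _ \<phi> cont b]) (use \<epsilon> in auto)
    have int: "integrable lborel (\<lambda>t. indicator {c..d} t * weight m \<phi> (\<lambda>\<theta>. rcis \<epsilon> \<theta>) b t)"
      by (rule Bochner_Integration.integrable_bound[OF i meas])
        (intro AE_I2, use order_trans[OF le abs_ge_self] in \<open>simp add: weight_def\<close>)
    have "(\<integral>t. indicator {c..d} t * weight m \<phi> (\<lambda>\<theta>. rcis \<epsilon> \<theta>) b t \<partial>lborel) \<le>
        (\<integral>t. (C' * b powr (m * s)) * indicator {c..d} t \<partial>lborel)"
      by (rule integral_mono[OF int i le])
    also have "\<dots> = (C' * measure lborel {c..d}) * b powr (m * s)" by simp
    finally show ?thesis using int by simp
  qed
  have sub: "(\<lambda>\<theta>. rcis \<epsilon> \<theta>) ` {c..d} \<subseteq> S" using S \<epsilon> by (auto intro!: subsetD[OF S])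
  have nn: "0 \<le> C' * measure lborel {c..d}" using C' by simp
  show ?thesis unfolding admissible_arc_def
  proof (intro conjI)
    show "\<exists>C\<ge>0. \<forall>b\<ge>1. integrable lborel (\<lambda>t. indicator {c..d} t * weight m \<phi> (\<lambda>\<theta>. rcis \<epsilon> \<theta>) b t) \<and>
        (\<integral>t. indicator {c..d} t * weight m \<phi> (\<lambda>\<theta>. rcis \<epsilon> \<theta>) b t \<partial>lborel) \<le> C * b powr (m * s)"
      using nn main by blast
  qed (use \<phi> cont sub in auto)
qed

text \<open>Equal points have angles differing by a multiple of the full turn, but here the
  difference lies strictly between zero and one turn.\<close>

lemma not_in_sector_disc:
  assumes "\<epsilon> < r" "0 < \<epsilon>" "\<theta>2 < \<theta>" "\<theta> < \<theta>1 + 2 * pi"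
  shows "rcis r \<theta> \<notin> sector_disc \<theta>1 \<theta>2 \<epsilon>"
proof
  assume "rcis r \<theta> \<in> sector_disc \<theta>1 \<theta>2 \<epsilon>"
  then have "rcis r \<theta> \<in> sector \<theta>1 \<theta>2" using assms by (auto simp: sector_disc_def)
  then obtain r' \<theta>' where e: "rcis r \<theta> = rcis r' \<theta>'" "0 \<le> r'" "\<theta>1 \<le> \<theta>'" "\<theta>' \<le> \<theta>2"
    unfolding sector_def by blast
  have "cmod (rcis r \<theta>) = cmod (rcis r' \<theta>')" using e(1) by simp
  then have "r = r'" using e(2) assms by simp
  then have "cis \<theta> = cis \<theta>'" using e(1) assms by (simp add: rcis_def)
  then have "cis (\<theta> - \<theta>') = 1" by (simp add: cis_divide[symmetric])
  then have "cos (\<theta> - \<theta>') = 1" by (metis Re_complex_of_real cis.simps(1) of_real_1)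
  then obtain k :: int where k: "\<theta> - \<theta>' = of_int k * 2 * pi" using cos_one_2pi_int by blast
  have "0 < \<theta> - \<theta>'" "\<theta> - \<theta>' < 2 * pi" using e(3,4) assms by linarith+
  then have "0 < of_int k * (2 * pi)" "of_int k * (2 * pi) < 1 * (2 * pi)" unfolding k by simp_all
  then have "0 < (of_int k :: real)" "(of_int k :: real) < 1"
    using pi_gt_zero by (simp_all only: mult_less_cancel_right zero_less_mult_iff) auto
  then show False by simp
qed

text \<open>The bound passes by continuity from the open strip of polar coordinates to its closure.
  The opening condition on the angles keeps the strip nonempty, so that its closure contains both
  boundary rays and the circle.\<close>

lemma boundary_bound:
  assumes bd: "boundary_extension \<theta>1 \<theta>2 \<epsilon> F Fb" and "0 < \<epsilon>" "\<theta>2 - \<theta>1 < 2 * pi"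
    and C: "\<forall>z\<in>- sector_disc \<theta>1 \<theta>2 \<epsilon>. cmod (F z) \<le> C * cmod z powr s"
    and r: "\<epsilon> \<le> r" "\<theta>2 \<le> \<theta>" "\<theta> \<le> \<theta>1 + 2 * pi"
  shows "cmod (Fb r \<theta>) \<le> C * r powr s"
proof -
  let ?X = "{\<epsilon><..} \<times> {\<theta>2<..<\<theta>1 + 2 * pi}"
  have cl: "closure ?X = {\<epsilon>..} \<times> {\<theta>2..\<theta>1 + 2 * pi}"
    using assms(3) by (simp add: closure_Times)
  have "(\<lambda>(r, \<theta>). cmod (Fb r \<theta>) - C * r powr s) (r, \<theta>) \<le> 0"
  proof (rule continuous_le_on_closure[where S = ?X])
    have c: "continuous_on ({\<epsilon>..} \<times> {\<theta>2..\<theta>1 + 2 * pi}) (\<lambda>z. Fb (fst z) (snd z))"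
      using bd by (simp add: boundary_extension_def case_prod_unfold)
    show "continuous_on (closure ?X) (\<lambda>(r, \<theta>). cmod (Fb r \<theta>) - C * r powr s)"
      unfolding cl case_prod_unfold using \<open>0 < \<epsilon>\<close> by (intro continuous_intros c) auto
    show "(r, \<theta>) \<in> closure ?X" unfolding cl using r by simp
    fix x assume x: "x \<in> ?X"
    obtain r' \<theta>' where x': "x = (r', \<theta>')" by fastforce
    have 1: "\<epsilon> < r'" "\<theta>2 < \<theta>'" "\<theta>' < \<theta>1 + 2 * pi" using x x' by auto
    have "Fb r' \<theta>' = F (rcis r' \<theta>')" using bd 1 by (simp add: boundary_extension_def)
    moreover have "cmod (F (rcis r' \<theta>')) \<le> C * cmod (rcis r' \<theta>') powr s"
      using C not_in_sector_disc[OF 1(1) \<open>0 < \<epsilon>\<close> 1(2,3)] by blast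
    ultimately show "(\<lambda>(r, \<theta>). cmod (Fb r \<theta>) - C * r powr s) x \<le> 0"
      using 1 \<open>0 < \<epsilon>\<close> by (simp add: x')
  qed
  then show ?thesis by simp
qed

definition arc_integral :: "real set \<Rightarrow> (real \<Rightarrow> complex) \<Rightarrow> (real \<Rightarrow> complex) \<Rightarrow> (complex \<Rightarrow> complex) \<Rightarrow> complex" where
  "arc_integral A \<phi> \<gamma> g = (\<integral>t. indicator A t *\<^sub>R (\<phi> t * g (\<gamma> t)) \<partial>lborel)"

lemma contour_int_arcs:
  "contour_int \<theta>1 \<theta>2 \<epsilon> Fb g =
     - arc_integral {\<epsilon>..} (\<lambda>r. Fb r \<theta>2 * cis \<theta>2) (\<lambda>r. rcis r \<theta>2) g
     + arc_integral {\<theta>2..\<theta>1 + 2 * pi} (\<lambda>\<theta>. Fb \<epsilon> \<theta> * (\<i> * rcis \<epsilon> \<theta>)) (\<lambda>\<theta>. rcis \<epsilon> \<theta>) g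
     + arc_integral {\<epsilon>..} (\<lambda>r. Fb r (\<theta>1 + 2 * pi) * cis (\<theta>1 + 2 * pi)) (\<lambda>r. rcis r (\<theta>1 + 2 * pi)) g"
  unfolding contour_int_def arc_integral_def set_lebesgue_integral_def by (simp add: mult_ac)

lemma arc_measurable:
  assumes "admissible_arc S m s A \<phi> \<gamma>" "continuous_on S g"
  shows "(\<lambda>t. indicator A t *\<^sub>R (\<phi> t * g (\<gamma> t))) \<in> borel_measurable lborel"
proof -
  have a: "A \<in> sets borel" "continuous_on A \<phi>" "continuous_on A \<gamma>" "\<gamma> ` A \<subseteq> S"
    using assms(1) by (auto simp: admissible_arc_def)
  have "continuous_on A (\<lambda>t. \<phi> t * g (\<gamma> t))"
    by (intro continuous_on_mult a continuous_on_compose2[OF assms(2) a(3,4)])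
  from borel_measurable_continuous_on_indicator[OF a(1) this] show ?thesis by simp
qed

lemma arc_integrand_bound:
  assumes "admissible_arc S m s A \<phi> \<gamma>"
    "\<And>z. z \<in> S \<Longrightarrow> cmod (g z) \<le> C * (cmod z powr (1 / m) + b) powr (- m)"
  shows "cmod (indicator A t *\<^sub>R (\<phi> t * g (\<gamma> t))) \<le> C * (indicator A t * weight m \<phi> \<gamma> b t)"
proof (cases "t \<in> A")
  case True
  then have "\<gamma> t \<in> S" using assms(1) by (auto simp: admissible_arc_def)
  then have "cmod (\<phi> t) * cmod (g (\<gamma> t)) \<le> cmod (\<phi> t) * (C * (cmod (\<gamma> t) powr (1 / m) + b) powr (- m))"
    by (intro mult_left_mono assms(2)) auto
  then show ?thesis using True by (simp add: weight_def norm_mult mult_ac)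
qed simp

lemma arc_integrable:
  assumes arc: "admissible_arc S m s A \<phi> \<gamma>" and g: "continuous_on S g"
    "\<And>z. z \<in> S \<Longrightarrow> cmod (g z) \<le> C * (cmod z powr (1 / m) + b) powr (- m)" and b: "1 \<le> b"
  shows "integrable lborel (\<lambda>t. indicator A t *\<^sub>R (\<phi> t * g (\<gamma> t)))"
proof -
  have i: "integrable lborel (\<lambda>t. C * (indicator A t * weight m \<phi> \<gamma> b t))"
    using arc b unfolding admissible_arc_def by (intro integrable_mult_right) auto
  show ?thesis
    by (rule Bochner_Integration.integrable_bound[OF i arc_measurable[OF arc g(1)]])
      (intro AE_I2, use order_trans[OF arc_integrand_bound[OF arc g(2)] abs_ge_self] in simp)
qed

text \<open>Each term has its own \<open>b i\<close>, since the terms of a difference operator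
  belong to different representations.\<close>

lemma arc_integral_sum:
  assumes arc: "admissible_arc S m s A \<phi> \<gamma>" and b: "\<And>i. i \<in> I \<Longrightarrow> 1 \<le> b i"
    and g: "\<And>i. i \<in> I \<Longrightarrow> continuous_on S (g i)"
    "\<And>i. i \<in> I \<Longrightarrow> \<exists>C. \<forall>z\<in>S. cmod (g i z) \<le> C * (cmod z powr (1 / m) + b i) powr (- m)"
  shows "arc_integral A \<phi> \<gamma> (\<lambda>z. \<Sum>i\<in>I. c i * g i z) = (\<Sum>i\<in>I. c i * arc_integral A \<phi> \<gamma> (g i))"
proof -
  have int: "integrable lborel (\<lambda>t. indicator A t *\<^sub>R (\<phi> t * g i (\<gamma> t)))" if i: "i \<in> I" for i
  proof -
    obtain C where "\<forall>z\<in>S. cmod (g i z) \<le> C * (cmod z powr (1 / m) + b i) powr (- m)" using g(2)[OF i] by blast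
    then show ?thesis by (intro arc_integrable[OF arc g(1)[OF i] _ b[OF i]]) auto
  qed
  have "arc_integral A \<phi> \<gamma> (\<lambda>z. \<Sum>i\<in>I. c i * g i z) =
      (\<integral>t. (\<Sum>i\<in>I. c i * (indicator A t *\<^sub>R (\<phi> t * g i (\<gamma> t)))) \<partial>lborel)"
    unfolding arc_integral_def
    by (intro Bochner_Integration.integral_cong refl) (simp add: sum_distrib_left scaleR_sum_right mult_ac)
  also have "\<dots> = (\<Sum>i\<in>I. \<integral>t. c i * (indicator A t *\<^sub>R (\<phi> t * g i (\<gamma> t))) \<partial>lborel)"
    using int by (intro Bochner_Integration.integral_sum integrable_mult_right)
  finally show ?thesis by (simp only: arc_integral_def integral_mult_right_zero)
qed

section \<open>Symbols integrated along the arcs\<close>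

context lie_calculus
begin

lemma frame_deriv_cmult: "smooth_fun K f \<Longrightarrow> frame_deriv K \<alpha> (\<lambda>x. c * f x) = (\<lambda>x. c * frame_deriv K \<alpha> f x)"
  unfolding frame_deriv_word by (rule word_cmult[OF _ canonical_set])

lemma frame_deriv_add:
  "smooth_fun K f \<Longrightarrow> smooth_fun K g \<Longrightarrow> frame_deriv K \<alpha> (\<lambda>x. f x + g x) = (\<lambda>x. frame_deriv K \<alpha> f x + frame_deriv K \<alpha> g x)"
  unfolding frame_deriv_word by (rule word_add[OF _ _ canonical_set])

lemma smooth_frame_deriv: "smooth_fun K f \<Longrightarrow> smooth_fun K (frame_deriv K \<alpha> f)"
  unfolding frame_deriv_word by (rule smooth_word[OF _ canonical_set])

text \<open>Applies \<open>integral_smooth\<close> on the whole line to the integrand cut off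
  outside \<open>A\<close>. The cut-off is essential for smoothness in \<open>x\<close> too: outside
  \<open>A\<close> the curve may leave \<open>S\<close>, where nothing is known about
  \<open>h\<close>.\<close>

lemma arc_smooth:
  fixes h :: "complex \<Rightarrow> 'g \<Rightarrow> complex"
  assumes arc: "admissible_arc S m s A \<phi> \<gamma>" and b: "1 \<le> b"
    and sm: "\<And>z. z \<in> S \<Longrightarrow> smooth_fun K (h z)"
    and cont: "\<And>\<alpha> x. continuous_on S (\<lambda>z. frame_deriv K \<alpha> (h z) x)"
    and bd: "\<And>\<alpha>. \<exists>C. \<forall>z\<in>S. \<forall>x. cmod (frame_deriv K \<alpha> (h z) x) \<le> C * (cmod z powr (1 / m) + b) powr (- m)"
  shows "smooth_fun K (\<lambda>x. arc_integral A \<phi> \<gamma> (\<lambda>z. h z x))"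
    and "frame_deriv K \<alpha> (\<lambda>x. arc_integral A \<phi> \<gamma> (\<lambda>z. h z x)) = (\<lambda>x. arc_integral A \<phi> \<gamma> (\<lambda>z. frame_deriv K \<alpha> (h z) x))"
proof -
  define H where "H t x = indicator A t *\<^sub>R (\<phi> t * h (\<gamma> t) x)" for t x
  have HC: "H t = (\<lambda>x. (indicator A t * \<phi> t) * h (\<gamma> t) x)" for t
    unfolding H_def by (cases "t \<in> A") auto
  have in_S: "\<gamma> t \<in> S" if "t \<in> A" for t using arc that by (auto simp: admissible_arc_def)
  have smH: "smooth_fun K (H t)" for t
    unfolding HC using smooth_fun_cmult[OF sm[OF in_S]] by (cases "t \<in> A") auto
  have fH: "frame_deriv K \<alpha> (H t) x = indicator A t *\<^sub>R (\<phi> t * frame_deriv K \<alpha> (h (\<gamma> t)) x)" for \<alpha> t x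
  proof (cases "t \<in> A")
    case True
    then show ?thesis unfolding HC using frame_deriv_cmult[OF sm[OF in_S[OF True]]] by simp
  next
    case False
    then have "H t = (\<lambda>x. 0 * 0)" by (simp add: HC)
    then show ?thesis using frame_deriv_cmult[of "\<lambda>x. 0" \<alpha> 0] False by simp
  qed
  have "\<exists>B. integrable lborel B \<and> (\<forall>t\<in>space lborel. \<forall>x. norm (frame_deriv K \<alpha> (H t) x) \<le> B t)" for \<alpha>
  proof -
    obtain C where C: "\<And>z x. z \<in> S \<Longrightarrow> cmod (frame_deriv K \<alpha> (h z) x) \<le> C * (cmod z powr (1 / m) + b) powr (- m)"
      using bd by blast
    have "integrable lborel (\<lambda>t. C * (indicator A t * weight m \<phi> \<gamma> b t))"
      using arc b unfolding admissible_arc_def by (intro integrable_mult_right) auto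
    moreover have "norm (frame_deriv K \<alpha> (H t) x) \<le> C * (indicator A t * weight m \<phi> \<gamma> b t)" for t x
      unfolding fH by (rule arc_integrand_bound[OF arc C])
    ultimately show ?thesis by blast
  qed
  moreover have "(\<lambda>t. frame_deriv K \<alpha> (H t) x) \<in> borel_measurable lborel" for \<alpha> x
    unfolding fH by (rule arc_measurable[OF arc cont])
  ultimately have "smooth_fun K (\<lambda>x. \<integral>t. H t x \<partial>lborel)"
    "frame_deriv K \<alpha> (\<lambda>x. \<integral>t. H t x \<partial>lborel) = (\<lambda>x. \<integral>t. frame_deriv K \<alpha> (H t) x \<partial>lborel)"
    using integral_smooth[of lborel H] smH by blast+
  then show "smooth_fun K (\<lambda>x. arc_integral A \<phi> \<gamma> (\<lambda>z. h z x))"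
    "frame_deriv K \<alpha> (\<lambda>x. arc_integral A \<phi> \<gamma> (\<lambda>z. h z x)) = (\<lambda>x. arc_integral A \<phi> \<gamma> (\<lambda>z. frame_deriv K \<alpha> (h z) x))"
    unfolding fH by (simp_all add: H_def arc_integral_def)
qed

text \<open>\<open>C0\<close> is chosen before the matrix size \<open>n\<close>, the entries and
  \<open>b\<close>, hence is the same for all representations.\<close>

definition arc_op_bound ::
    "complex set \<Rightarrow> real \<Rightarrow> real \<Rightarrow> real set \<Rightarrow> (real \<Rightarrow> complex) \<Rightarrow> (real \<Rightarrow> complex) \<Rightarrow> real \<Rightarrow> bool" where
  "arc_op_bound S m s A \<phi> \<gamma> C0 \<longleftrightarrow> 0 \<le> C0 \<and> (\<forall>n a C b. 1 \<le> b \<longrightarrow> 0 \<le> C \<longrightarrow>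
     (\<forall>i<n. \<forall>j<n. continuous_on S (\<lambda>z. a z i j)) \<longrightarrow>
     (\<forall>z\<in>S. op_norm (Matrix.mat n n (\<lambda>(i, j). a z i j)) \<le> C * (cmod z powr (1 / m) + b) powr (- m)) \<longrightarrow>
     op_norm (Matrix.mat n n (\<lambda>(i, j). arc_integral A \<phi> \<gamma> (\<lambda>z. a z i j))) \<le> C0 * C * b powr (m * s))"

lemma arc_op_boundD:
  assumes "arc_op_bound S m s A \<phi> \<gamma> C0" "1 \<le> b" "0 \<le> C"
    "\<And>i j. i < n \<Longrightarrow> j < n \<Longrightarrow> continuous_on S (\<lambda>z. a z i j)"
    "\<And>z. z \<in> S \<Longrightarrow> op_norm (Matrix.mat n n (\<lambda>(i, j). a z i j)) \<le> C * (cmod z powr (1 / m) + b) powr (- m)"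
  shows "op_norm (Matrix.mat n n (\<lambda>(i, j). arc_integral A \<phi> \<gamma> (\<lambda>z. a z i j))) \<le> C0 * C * b powr (m * s)"
  using assms unfolding arc_op_bound_def by blast

lemma arc_op_bound:
  assumes arc: "admissible_arc S m s A \<phi> \<gamma>"
  shows "\<exists>C0. arc_op_bound S m s A \<phi> \<gamma> C0"
proof -
  obtain C0 where C0: "0 \<le> C0" "\<And>b. 1 \<le> b \<Longrightarrow> integrable lborel (\<lambda>t. indicator A t * weight m \<phi> \<gamma> b t)"
    "\<And>b. 1 \<le> b \<Longrightarrow> (\<integral>t. indicator A t * weight m \<phi> \<gamma> b t \<partial>lborel) \<le> C0 * b powr (m * s)"
    using arc unfolding admissible_arc_def by blast
  show ?thesis unfolding arc_op_bound_def
  proof (intro exI[of _ C0] conjI C0(1) allI impI)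
    fix n a C and b :: real
    assume b: "1 \<le> b" and C: "0 \<le> C"
      and cont': "\<forall>i<n. \<forall>j<n. continuous_on S (\<lambda>z. a z i j)"
      and le': "\<forall>z\<in>S. op_norm (Matrix.mat n n (\<lambda>(i, j). a z i j)) \<le> C * (cmod z powr (1 / m) + b) powr (- m)"
    note cont = cont'[rule_format] and le = le'[rule_format]
    have ent: "cmod (a z i j) \<le> C * (cmod z powr (1 / m) + b) powr (- m)" if "z \<in> S" "i < n" "j < n" for z i j
      using op_norm_entry[of "Matrix.mat n n (\<lambda>(i, j). a z i j)" n i j] le[OF that(1)] that by simp
    have "op_norm (Matrix.mat n n (\<lambda>(i, j). arc_integral A \<phi> \<gamma> (\<lambda>z. a z i j))) \<le>
        (\<integral>t. C * (indicator A t * weight m \<phi> \<gamma> b t) \<partial>lborel)"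
      unfolding arc_integral_def
    proof (rule op_norm_integral)
      show "integrable lborel (\<lambda>t. indicator A t *\<^sub>R (\<phi> t * a (\<gamma> t) i j))" if "i < n" "j < n" for i j
        by (rule arc_integrable[OF arc cont[OF that] ent[OF _ that] b])
      show "integrable lborel (\<lambda>t. C * (indicator A t * weight m \<phi> \<gamma> b t))"
        using C0(2)[OF b] by (rule integrable_mult_right)
      fix t
      show "op_norm (Matrix.mat n n (\<lambda>(i, j). indicator A t *\<^sub>R (\<phi> t * a (\<gamma> t) i j))) \<le> C * (indicator A t * weight m \<phi> \<gamma> b t)"
      proof (cases "t \<in> A")
        case True
        then have tS: "\<gamma> t \<in> S" using arc by (auto simp: admissible_arc_def)
        have "op_norm (Matrix.mat n n (\<lambda>(i, j). \<phi> t * a (\<gamma> t) i j)) \<le>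
            cmod (\<phi> t) * op_norm (Matrix.mat n n (\<lambda>(i, j). a (\<gamma> t) i j))" by (rule op_norm_cmult)
        also have "\<dots> \<le> cmod (\<phi> t) * (C * (cmod (\<gamma> t) powr (1 / m) + b) powr (- m))"
          by (rule mult_left_mono[OF le[OF tS]]) simp
        finally show ?thesis using True by (simp add: weight_def mult_ac)
      next
        case False
        have "op_norm (Matrix.mat n n (\<lambda>(i, j). 0 :: complex)) \<le> 0"
          using op_norm_le_sum[of "Matrix.mat n n (\<lambda>(i, j). 0 :: complex)" n] by simp
        then show ?thesis using False by simp
      qed
    qed
    also have "\<dots> = C * (\<integral>t. indicator A t * weight m \<phi> \<gamma> b t \<partial>lborel)" by simp
    also have "\<dots> \<le> C * (C0 * b powr (m * s))" by (rule mult_left_mono[OF C0(3)[OF b] C])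
    finally show "op_norm (Matrix.mat n n (\<lambda>(i, j). arc_integral A \<phi> \<gamma> (\<lambda>z. a z i j))) \<le> C0 * C * b powr (m * s)"
      by (simp add: mult_ac)
  qed
qed

lemma smooth_diff_op:
  assumes q: "repfun q" and \<xi>: "\<xi> \<in> dual K" and ij: "i < rdim \<xi>" "j < rdim \<xi>"
    and \<tau>: "\<And>\<eta>. \<eta> \<in> dual K \<Longrightarrow> smooth_mat_fun K (rdim \<eta>) (\<lambda>y. \<tau> y \<eta>)"
  shows "smooth_fun K (\<lambda>y. diff_op K q (\<tau> y) \<xi> $$ (i, j))"
proof -
  have c: "\<tau> y \<eta> \<in> carrier_mat (rdim \<eta>) (rdim \<eta>)" if "\<eta> \<in> dual K" for y \<eta>
    using \<tau>[OF that] by (simp add: smooth_mat_fun_def)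
  have eq: "diff_op K q (\<tau> y) \<xi> $$ (i, j) = (\<Sum>\<eta>\<in>{\<eta>\<in>dual K. linked q \<eta> \<xi>}. \<Sum>k<rdim \<eta>. \<Sum>l<rdim \<eta>.
      (of_nat (rdim \<eta>) * dcoef q \<eta> k l \<xi> i j) * \<tau> y \<eta> $$ (l, k))" for y
    by (rule diff_op_entry[OF q \<xi> ij c])
  show ?thesis
    unfolding eq using \<tau>
    by (intro smooth_fun_sum smooth_fun_cmult) (auto simp: smooth_mat_fun_def)
qed

lemma symbol_deriv_mat:
  "symbol_deriv K \<alpha> \<beta> \<sigma> x \<xi> = Matrix.mat (rdim \<xi>) (rdim \<xi>)
     (\<lambda>(i, j). frame_deriv K \<alpha> (\<lambda>y. diff_op K (q_power K \<beta>) (\<sigma> y) \<xi> $$ (i, j)) x)"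
  by (simp add: symbol_deriv_def mat_deriv_def diff_op_dim)

lemma smooth_fun_bounded:
  assumes "smooth_fun K f"
  shows "\<exists>B. \<forall>x. cmod (f x) \<le> B"
  using compact_imp_bounded[OF compact_continuous_image[OF smooth_fun_continuous[OF assms] compact_UNIV]]
  unfolding bounded_iff by auto

text \<open>By compactness of the group. The bound depends on \<xi> and carries no decay, which is
  enough for finitely many representations.\<close>

lemma symbol_deriv_bounded:
  assumes \<xi>: "\<xi> \<in> dual K" and \<sigma>: "\<And>\<eta>. \<eta> \<in> dual K \<Longrightarrow> smooth_mat_fun K (rdim \<eta>) (\<lambda>y. \<sigma> y \<eta>)"
  shows "\<exists>B. \<forall>x. op_norm (symbol_deriv K \<alpha> \<beta> \<sigma> x \<xi>) \<le> B"
proof -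
  let ?d = "rdim \<xi>"
  let ?f = "\<lambda>i j. frame_deriv K \<alpha> (\<lambda>y. diff_op K (q_power K \<beta>) (\<sigma> y) \<xi> $$ (i, j))"
  have "\<exists>B. \<forall>x. cmod (?f i j x) \<le> B" if "i < ?d" "j < ?d" for i j
    by (rule smooth_fun_bounded[OF smooth_frame_deriv[OF smooth_diff_op[OF repfun_q_power \<xi> that \<sigma>]]])
  then obtain B where B: "\<And>i j x. i < ?d \<Longrightarrow> j < ?d \<Longrightarrow> cmod (?f i j x) \<le> B i j" by metis
  have "op_norm (symbol_deriv K \<alpha> \<beta> \<sigma> x \<xi>) \<le> (\<Sum>i<?d. \<Sum>j<?d. B i j)" for x
  proof -
    have "op_norm (symbol_deriv K \<alpha> \<beta> \<sigma> x \<xi>) \<le> (\<Sum>i<?d. \<Sum>j<?d. cmod (symbol_deriv K \<alpha> \<beta> \<sigma> x \<xi> $$ (i, j)))"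
      by (rule op_norm_le_sum) (simp add: symbol_deriv_mat)
    also have "\<dots> \<le> (\<Sum>i<?d. \<Sum>j<?d. B i j)"
      by (intro sum_mono) (auto simp: symbol_deriv_mat intro!: B)
    finally show ?thesis .
  qed
  then show ?thesis by blast
qed

end

section \<open>The order of the symbol of F(A)\<close>

theorem corollary4p4:
  fixes K :: "('g::t2_space, 'e::euclidean_space) calculus_data"
    and m \<rho> \<delta> s \<theta>1 \<theta>2 \<epsilon> :: real
    and \<sigma>A \<sigma>F :: "'g symbol"
    and P :: "complex \<Rightarrow> 'g symbol"
    and E :: "'g rep set"
    and F :: "complex \<Rightarrow> complex"
    and Fb :: "real \<Rightarrow> real \<Rightarrow> complex"
  assumes setting: "calculus_setting K"
    and orders: "0 \<le> \<delta>" "\<delta> < \<rho>" "\<rho> \<le> 1" "0 < m"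
    and angles: "\<theta>1 \<le> \<theta>2" "\<theta>2 - \<theta>1 < 2 * pi"
    and symbol: "\<sigma>A \<in> symbol_class K m \<rho> \<delta>"
    and elliptic: "parameter_elliptic K m \<sigma>A (sector \<theta>1 \<theta>2)"
    and epsilon: "0 < \<epsilon>" "parameter_elliptic K m \<sigma>A (sector_disc \<theta>1 \<theta>2 \<epsilon>)"
    and exceptional: "finite E"
    and parametrix: "parametrix K m \<rho> \<delta> (sector_disc \<theta>1 \<theta>2 \<epsilon>) E \<sigma>A P"
    and analytic: "F analytic_on (- sector_disc \<theta>1 \<theta>2 \<epsilon>)"
    and boundary: "boundary_extension \<theta>1 \<theta>2 \<epsilon> F Fb"
    and decay: "-1 < s" "s < 0" "\<exists>C. \<forall>z\<in>- sector_disc \<theta>1 \<theta>2 \<epsilon>. cmod (F z) \<le> C * cmod z powr s"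
    and sigmaF: "\<forall>\<xi>\<in>dual K - E. \<forall>x. \<sigma>F x \<xi> = function_symbol K \<theta>1 \<theta>2 \<epsilon> Fb P x \<xi>"
    and sigmaF_exceptional: "\<forall>\<xi>\<in>dual K \<inter> E. smooth_mat_fun K (rep_dim K \<xi>) (\<lambda>x. \<sigma>F x \<xi>)"
  shows "\<sigma>F \<in> symbol_class K (m * s) \<rho> \<delta>"
proof -
  interpret lie_calculus K by unfold_locales (rule setting)
  define S where "S = sector_disc \<theta>1 \<theta>2 \<epsilon>"
  define A2 where "A2 = {\<theta>2..\<theta>1 + 2 * pi}"
  \<comment> \<open>Boundary values times the velocities of the three curves \<open>c1\<close>,
    \<open>c2\<close>, \<open>c3\<close>; the sign of the incoming ray is kept for
    \<open>J\<close>.\<close>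
  define f1 where "f1 r = Fb r \<theta>2 * cis \<theta>2" for r
  define f2 where "f2 \<theta> = Fb \<epsilon> \<theta> * (\<i> * rcis \<epsilon> \<theta>)" for \<theta>
  define f3 where "f3 r = Fb r (\<theta>1 + 2 * pi) * cis (\<theta>1 + 2 * pi)" for r
  define c1 where "c1 r = rcis r \<theta>2" for r
  define c2 where "c2 \<theta> = rcis \<epsilon> \<theta>" for \<theta>
  define c3 where "c3 r = rcis r (\<theta>1 + 2 * pi)" for r
  define J where "J g = - arc_integral {\<epsilon>..} f1 c1 g + arc_integral A2 f2 c2 g + arc_integral {\<epsilon>..} f3 c3 g" for g
  have J: "contour_int \<theta>1 \<theta>2 \<epsilon> Fb g = J g" for g
    unfolding contour_int_arcs J_def f1_def f2_def f3_def c1_def c2_def c3_def A2_def by simp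
  obtain CF where CF: "\<forall>z\<in>- sector_disc \<theta>1 \<theta>2 \<epsilon>. cmod (F z) \<le> CF * cmod z powr s" using decay(3) by blast
  note Fbound = boundary_bound[OF boundary epsilon(1) angles(2) CF]
  have cFb: "continuous_on ({\<epsilon>..} \<times> {\<theta>2..\<theta>1 + 2 * pi}) (\<lambda>z. Fb (fst z) (snd z))"
    using boundary by (simp add: boundary_extension_def case_prod_unfold)
  have sec: "rcis r \<theta>2 \<in> S" "rcis r (\<theta>1 + 2 * pi) \<in> S" if "\<epsilon> \<le> r" for r
  proof -
    have "rcis r \<theta>2 \<in> sector \<theta>1 \<theta>2" unfolding sector_def
      by (intro CollectI exI[of _ r] exI[of _ \<theta>2]) (use that epsilon(1) angles in simp)
    then show "rcis r \<theta>2 \<in> S" by (simp add: S_def sector_disc_def)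
    have "rcis r \<theta>1 \<in> sector \<theta>1 \<theta>2" unfolding sector_def
      by (intro CollectI exI[of _ r] exI[of _ \<theta>1]) (use that epsilon(1) angles in simp)
    \<comment> \<open>The full turn matters only for \<open>Fb\<close>, whose values on the two
      sides may differ; the parametrix is evaluated at a point of the sector.\<close>
    moreover have "rcis r (\<theta>1 + 2 * pi) = rcis r \<theta>1" by (simp add: rcis_def cis_mult[symmetric])
    ultimately show "rcis r (\<theta>1 + 2 * pi) \<in> S" by (simp add: S_def sector_disc_def)
  qed
  have ang: "\<theta>2 \<le> \<theta>1 + 2 * pi" using angles by simp
  have arc1: "admissible_arc S m s {\<epsilon>..} f1 c1"
    unfolding c1_def[abs_def]
  proof (rule admissible_ray[OF orders(4) decay(1,2) epsilon(1)])
    show "continuous_on {\<epsilon>..} f1" unfolding f1_def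
      by (intro continuous_on_mult continuous_on_const continuous_on_compose2[OF cFb, of _ "\<lambda>r. (r, \<theta>2)", simplified]
          continuous_on_Pair continuous_on_id) (use ang in auto)
    show "cmod (f1 r) \<le> CF * r powr s" if "\<epsilon> \<le> r" for r
      using Fbound[OF that _ ang] by (simp add: f1_def norm_mult)
  qed (rule sec)
  have arc3: "admissible_arc S m s {\<epsilon>..} f3 c3"
    unfolding c3_def[abs_def]
  proof (rule admissible_ray[OF orders(4) decay(1,2) epsilon(1)])
    show "continuous_on {\<epsilon>..} f3" unfolding f3_def
      by (intro continuous_on_mult continuous_on_const continuous_on_compose2[OF cFb, of _ "\<lambda>r. (r, \<theta>1 + 2 * pi)", simplified]
          continuous_on_Pair continuous_on_id) (use ang in auto)
    show "cmod (f3 r) \<le> CF * r powr s" if "\<epsilon> \<le> r" for r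
      using Fbound[OF that ang] by (simp add: f3_def norm_mult)
  qed (rule sec)
  have arc2: "admissible_arc S m s A2 f2 c2"
    unfolding c2_def[abs_def] A2_def
  proof (rule admissible_circle[OF orders(4) decay(1) epsilon(1)])
    have "continuous_on {\<theta>2..\<theta>1 + 2 * pi} (\<lambda>\<theta>. Fb \<epsilon> \<theta>)"
      by (rule continuous_on_compose2[OF cFb, of _ "\<lambda>\<theta>. (\<epsilon>, \<theta>)", simplified])
        (intro continuous_on_Pair continuous_on_const continuous_on_id, auto)
    moreover have "continuous_on {\<theta>2..\<theta>1 + 2 * pi} (\<lambda>\<theta>. \<i> * rcis \<epsilon> \<theta>)"
      unfolding rcis_def cis_conv_exp by (intro continuous_intros)
    ultimately show "continuous_on {\<theta>2..\<theta>1 + 2 * pi} f2" unfolding f2_def[abs_def] by (rule continuous_on_mult)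
    show "cball 0 \<epsilon> \<subseteq> S" by (simp add: S_def sector_disc_def)
  qed
  define d where "d \<beta> z i j \<xi> y = diff_op K (q_power K \<beta>) (P z y) \<xi> $$ (i, j)" for \<beta> z i j \<xi> y
  have Psm: "smooth_mat_fun K (rdim \<xi>) (\<lambda>x. P z x \<xi>)" if "z \<in> S" "\<xi> \<in> dual K" for z \<xi>
    using parametrix that unfolding parametrix_def S_def smooth_symbol_def by blast
  have dsm: "smooth_fun K (d \<beta> z i j \<xi>)" if "z \<in> S" "\<xi> \<in> dual K" "i < rdim \<xi>" "j < rdim \<xi>" for \<beta> z i j \<xi>
    unfolding d_def by (rule smooth_diff_op[OF repfun_q_power that(2-4) Psm[OF that(1)]])
  have sd: "symbol_deriv K \<alpha> \<beta> (P w) x \<xi> $$ (i, j) = frame_deriv K \<alpha> (d \<beta> w i j \<xi>) x"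
    if "i < rdim \<xi>" "j < rdim \<xi>" for \<alpha> \<beta> w x \<xi> i j
    unfolding d_def using that by (simp add: symbol_deriv_mat)
  have dcont: "continuous_on S (\<lambda>z. frame_deriv K \<alpha> (d \<beta> z i j \<xi>) x)"
    if \<xi>: "\<xi> \<in> dual K - E" and ij: "i < rdim \<xi>" "j < rdim \<xi>" for \<alpha> \<beta> \<xi> i j x
    unfolding continuous_on_eq_continuous_within
  proof
    fix z assume z: "z \<in> S"
    have "\<forall>\<alpha> \<beta> k x. \<forall>\<xi>\<in>dual K - E. \<forall>i<rdim \<xi>. \<forall>j<rdim \<xi>. \<forall>z\<in>S.
        deriv_within S k (\<lambda>w. symbol_deriv K \<alpha> \<beta> (P w) x \<xi> $$ (i, j)) field_differentiable (at z within S)"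
      using parametrix unfolding parametrix_def S_def by blast
    \<comment> \<open>Differentiability in the parameter supplies continuity, and with it
      measurability along the arcs.\<close>
    from this[rule_format, OF \<xi> ij z, where k = 0 and \<alpha> = \<alpha> and \<beta> = \<beta> and x = x]
    have "(\<lambda>w. frame_deriv K \<alpha> (d \<beta> w i j \<xi>) x) field_differentiable (at z within S)"
      by (simp add: sd[OF ij])
    then show "continuous (at z within S) (\<lambda>z. frame_deriv K \<alpha> (d \<beta> z i j \<xi>) x)"
      by (rule field_differentiable_imp_continuous_at)
  qed
  \<comment> \<open>The part of the exponent that does not involve the parameter; the contour adds
    \<open>m * s\<close> to it.\<close>
  define \<kappa> where "\<kappa> \<alpha> \<beta> = - \<rho> * real (q_order K \<beta>) + \<delta> * real (frame_order K \<alpha>)" for \<alpha> \<beta>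
  have "\<exists>C\<ge>0. \<forall>x. \<forall>\<xi>\<in>dual K - E. \<forall>z\<in>S.
      op_norm (Matrix.mat (rdim \<xi>) (rdim \<xi>) (\<lambda>(i, j). frame_deriv K \<alpha> (d \<beta> z i j \<xi>) x))
        \<le> (C * bracket K \<xi> powr \<kappa> \<alpha> \<beta>) * (cmod z powr (1 / m) + bracket K \<xi>) powr (- m)" for \<alpha> \<beta>
  proof -
    have "\<exists>C. \<forall>x. \<forall>\<xi>\<in>dual K - E. \<forall>z\<in>S.
        op_norm (Matrix.mat (rdim \<xi>) (rdim \<xi>)
            (\<lambda>(i, j). deriv_within S 0 (\<lambda>w. symbol_deriv K \<alpha> \<beta> (P w) x \<xi> $$ (i, j)) z))
          \<le> C * (cmod z powr (1 / m) + bracket K \<xi>) powr (- m * (real 0 + 1))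
              * bracket K \<xi> powr (- \<rho> * real (q_order K \<beta>) + \<delta> * real (frame_order K \<alpha>))"
      using parametrix unfolding parametrix_def S_def by blast
    then obtain C where C: "\<And>x \<xi> z. \<xi> \<in> dual K - E \<Longrightarrow> z \<in> S \<Longrightarrow>
        op_norm (Matrix.mat (rdim \<xi>) (rdim \<xi>)
            (\<lambda>(i, j). deriv_within S 0 (\<lambda>w. symbol_deriv K \<alpha> \<beta> (P w) x \<xi> $$ (i, j)) z))
          \<le> C * (cmod z powr (1 / m) + bracket K \<xi>) powr (- m * (real 0 + 1))
              * bracket K \<xi> powr (- \<rho> * real (q_order K \<beta>) + \<delta> * real (frame_order K \<alpha>))" by blast
    show ?thesis
    \<comment> \<open>\<open>arc_op_bound\<close> is stated for nonnegative constants.\<close>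
    proof (intro exI[of _ "max C 0"] conjI allI ballI)
      fix x \<xi> z assume *: "\<xi> \<in> dual K - E" "z \<in> S"
      have "Matrix.mat (rdim \<xi>) (rdim \<xi>) (\<lambda>(i, j). frame_deriv K \<alpha> (d \<beta> z i j \<xi>) x) =
          Matrix.mat (rdim \<xi>) (rdim \<xi>)
            (\<lambda>(i, j). deriv_within S 0 (\<lambda>w. symbol_deriv K \<alpha> \<beta> (P w) x \<xi> $$ (i, j)) z)"
        by (rule cong_mat) (auto simp: sd)
      then have "op_norm (Matrix.mat (rdim \<xi>) (rdim \<xi>) (\<lambda>(i, j). frame_deriv K \<alpha> (d \<beta> z i j \<xi>) x)) \<le>
          C * ((cmod z powr (1 / m) + bracket K \<xi>) powr (- m) * bracket K \<xi> powr \<kappa> \<alpha> \<beta>)"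
        using C[OF *, of x] by (simp add: \<kappa>_def mult.assoc)
      also have "\<dots> \<le> max C 0 * ((cmod z powr (1 / m) + bracket K \<xi>) powr (- m) * bracket K \<xi> powr \<kappa> \<alpha> \<beta>)"
        by (intro mult_right_mono) auto
      finally show "op_norm (Matrix.mat (rdim \<xi>) (rdim \<xi>) (\<lambda>(i, j). frame_deriv K \<alpha> (d \<beta> z i j \<xi>) x)) \<le>
          (max C 0 * bracket K \<xi> powr \<kappa> \<alpha> \<beta>) * (cmod z powr (1 / m) + bracket K \<xi>) powr (- m)"
        by (simp only: mult_ac)
    qed simp
  qed
  then obtain CP where CP: "\<And>\<alpha> \<beta>. 0 \<le> CP \<alpha> \<beta>"
    "\<And>\<alpha> \<beta> x \<xi> z. \<xi> \<in> dual K - E \<Longrightarrow> z \<in> S \<Longrightarrow>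
      op_norm (Matrix.mat (rdim \<xi>) (rdim \<xi>) (\<lambda>(i, j). frame_deriv K \<alpha> (d \<beta> z i j \<xi>) x))
        \<le> (CP \<alpha> \<beta> * bracket K \<xi> powr \<kappa> \<alpha> \<beta>) * (cmod z powr (1 / m) + bracket K \<xi>) powr (- m)"
    by metis
  have dbd: "cmod (frame_deriv K \<alpha> (d \<beta> z i j \<xi>) x) \<le>
      (CP \<alpha> \<beta> * bracket K \<xi> powr \<kappa> \<alpha> \<beta>) * (cmod z powr (1 / m) + bracket K \<xi>) powr (- m)"
    if "\<xi> \<in> dual K - E" "z \<in> S" "i < rdim \<xi>" "j < rdim \<xi>" for \<alpha> \<beta> \<xi> z x i j
    using op_norm_entry[of "Matrix.mat (rdim \<xi>) (rdim \<xi>) (\<lambda>(i, j). frame_deriv K \<alpha> (d \<beta> z i j \<xi>) x)" "rdim \<xi>" i j]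
      CP(2)[OF that(1,2), of \<alpha> \<beta> x] that(3,4) by simp
  have asm: "smooth_fun K (\<lambda>x. arc_integral A \<phi> \<gamma> (\<lambda>z. d \<beta> z i j \<xi> x)) \<and>
      frame_deriv K \<alpha> (\<lambda>x. arc_integral A \<phi> \<gamma> (\<lambda>z. d \<beta> z i j \<xi> x)) =
        (\<lambda>x. arc_integral A \<phi> \<gamma> (\<lambda>z. frame_deriv K \<alpha> (d \<beta> z i j \<xi>) x))"
    if arc: "admissible_arc S m s A \<phi> \<gamma>" and \<xi>: "\<xi> \<in> dual K - E" and ij: "i < rdim \<xi>" "j < rdim \<xi>"
    for A \<phi> \<gamma> \<alpha> \<beta> \<xi> i j
  proof -
    have \<xi>D: "\<xi> \<in> dual K" using \<xi> by simp
    have "\<exists>C. \<forall>z\<in>S. \<forall>x. cmod (frame_deriv K \<alpha> (d \<beta> z i j \<xi>) x) \<le> C * (cmod z powr (1 / m) + bracket K \<xi>) powr (- m)" for \<alpha>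
      using dbd[OF \<xi> _ ij] by blast
    then show ?thesis
      using arc_smooth[OF arc bracket_ge_1[OF \<xi>D] dsm[OF _ \<xi>D ij] dcont[OF \<xi> ij]] by blast
  qed
  have Jsm: "smooth_fun K (\<lambda>x. J (\<lambda>z. d \<beta> z i j \<xi> x))"
    "frame_deriv K \<alpha> (\<lambda>x. J (\<lambda>z. d \<beta> z i j \<xi> x)) = (\<lambda>x. J (\<lambda>z. frame_deriv K \<alpha> (d \<beta> z i j \<xi>) x))"
    if \<xi>: "\<xi> \<in> dual K - E" and ij: "i < rdim \<xi>" "j < rdim \<xi>" for \<alpha> \<beta> \<xi> i j
  proof -
    note a = asm[OF arc1 \<xi> ij, of \<beta> \<alpha>] asm[OF arc2 \<xi> ij, of \<beta> \<alpha>] asm[OF arc3 \<xi> ij, of \<beta> \<alpha>]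
    \<comment> \<open>The sign becomes a scalar factor, so that the rules for multiples
      apply.\<close>
    have eq: "J g = (-1) * arc_integral {\<epsilon>..} f1 c1 g + arc_integral A2 f2 c2 g + arc_integral {\<epsilon>..} f3 c3 g" for g
      by (simp add: J_def)
    show "smooth_fun K (\<lambda>x. J (\<lambda>z. d \<beta> z i j \<xi> x))"
      unfolding eq using a by (intro smooth_fun_add smooth_fun_cmult) auto
    show "frame_deriv K \<alpha> (\<lambda>x. J (\<lambda>z. d \<beta> z i j \<xi> x)) = (\<lambda>x. J (\<lambda>z. frame_deriv K \<alpha> (d \<beta> z i j \<xi>) x))"
      unfolding eq using a
      by (simp only: frame_deriv_add frame_deriv_cmult smooth_fun_add smooth_fun_cmult)
  qed
  define c0 where "c0 = 1 / (2 * complex_of_real pi * \<i>)"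
  \<comment> \<open>With the zero multi-index the facts about \<open>d\<close> become facts about
    the parametrix itself.\<close>
  define z0 :: "nat \<Rightarrow> nat" where "z0 = (\<lambda>i. 0)"
  have q0: "q_power K z0 = (\<lambda>x. 1)" by (rule q_power_0) (simp add: z0_def)
  have Pc: "P z y \<eta> \<in> carrier_mat (rdim \<eta>) (rdim \<eta>)" if "z \<in> S" "\<eta> \<in> dual K" for z y \<eta>
    using Psm[OF that] by (simp add: smooth_mat_fun_def)
  have d0: "d z0 z i j \<xi> y = P z y \<xi> $$ (i, j)" if "z \<in> S" "\<xi> \<in> dual K" for z i j \<xi> y
  proof -
    have "diff_op K (\<lambda>x. 1) (P z y) \<xi> = P z y \<xi>" by (rule diff_op_one[OF that(2) Pc[OF that(1)]])
    then show ?thesis by (simp add: d_def q0)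
  qed
  \<comment> \<open>The identification of \<open>d z0\<close> with the parametrix holds only for
    parameters in \<open>S\<close>, and the arcs run inside \<open>S\<close>.\<close>
  have arcS: "arc_integral A \<phi> \<gamma> g = arc_integral A \<phi> \<gamma> g'"
    if "admissible_arc S m s A \<phi> \<gamma>" "\<And>z. z \<in> S \<Longrightarrow> g z = g' z" for A \<phi> \<gamma> g g'
    unfolding arc_integral_def
  proof (rule Bochner_Integration.integral_cong[OF refl])
    fix t
    show "indicator A t *\<^sub>R (\<phi> t * g (\<gamma> t)) = indicator A t *\<^sub>R (\<phi> t * g' (\<gamma> t))"
      using that by (cases "t \<in> A") (auto simp: admissible_arc_def)
  qed
  have JS: "J g = J g'" if "\<And>z. z \<in> S \<Longrightarrow> g z = g' z" for g g'
    unfolding J_def using arcS[OF arc1 that] arcS[OF arc2 that] arcS[OF arc3 that] by simp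
  have \<sigma>F: "\<sigma>F y \<xi> $$ (i, j) = c0 * J (\<lambda>z. d z0 z i j \<xi> y)"
    if \<xi>: "\<xi> \<in> dual K - E" and ij: "i < rdim \<xi>" "j < rdim \<xi>" for \<xi> y i j
  proof -
    have \<xi>D: "\<xi> \<in> dual K" using \<xi> by simp
    have "\<sigma>F y \<xi> $$ (i, j) = c0 * J (\<lambda>z. P z y \<xi> $$ (i, j))"
      using sigmaF \<xi> ij by (simp add: function_symbol_def J c0_def)
    also have "J (\<lambda>z. P z y \<xi> $$ (i, j)) = J (\<lambda>z. d z0 z i j \<xi> y)"
      by (rule JS) (simp add: d0[OF _ \<xi>D])
    finally show ?thesis .
  qed
  have \<sigma>Fsm: "smooth_mat_fun K (rdim \<xi>) (\<lambda>y. \<sigma>F y \<xi>)" if \<xi>: "\<xi> \<in> dual K" for \<xi>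
  proof (cases "\<xi> \<in> E")
    case True
    then show ?thesis using sigmaF_exceptional \<xi> by simp
  next
    case False
    then have \<xi>E: "\<xi> \<in> dual K - E" using \<xi> by simp
    show ?thesis unfolding smooth_mat_fun_def
    proof (intro conjI allI impI)
      show "\<sigma>F x \<xi> \<in> carrier_mat (rdim \<xi>) (rdim \<xi>)" for x
        using sigmaF \<xi>E by (simp add: function_symbol_def)
      show "smooth_fun K (\<lambda>x. \<sigma>F x \<xi> $$ (i, j))" if "i < rdim \<xi>" "j < rdim \<xi>" for i j
        unfolding \<sigma>F[OF \<xi>E that] by (rule smooth_fun_cmult[OF Jsm(1)[OF \<xi>E that]])
    qed
  qed
  have \<sigma>Fc: "\<sigma>F y \<eta> \<in> carrier_mat (rdim \<eta>) (rdim \<eta>)" if "\<eta> \<in> dual K" for y \<eta>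
    using \<sigma>Fsm[OF that] by (simp add: smooth_mat_fun_def)
  \<comment> \<open>If no exceptional representation is linked to \<xi>, every value of
    \<open>\<sigma>F\<close> that enters the difference is a contour integral, and the finite sum
    can be taken under it.\<close>
  have diffF: "diff_op K (q_power K \<beta>) (\<sigma>F y) \<xi> $$ (i, j) = c0 * J (\<lambda>z. d \<beta> z i j \<xi> y)"
    if \<xi>: "\<xi> \<in> dual K - E" and ij: "i < rdim \<xi>" "j < rdim \<xi>"
      and far: "\<And>\<eta>. \<eta> \<in> dual K \<Longrightarrow> linked (q_power K \<beta>) \<eta> \<xi> \<Longrightarrow> \<eta> \<notin> E" for \<beta> y \<xi> i j
  proof -
    have \<xi>D: "\<xi> \<in> dual K" using \<xi> by simp
    have \<sigma>Fy: "\<sigma>F y \<eta> \<in> carrier_mat (rdim \<eta>) (rdim \<eta>)" if "\<eta> \<in> dual K" for \<eta> by (rule \<sigma>Fc[OF that])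
    let ?N = "{\<eta>\<in>dual K. linked (q_power K \<beta>) \<eta> \<xi>}"
    \<comment> \<open>Representations and matrix indices form one index set, so that linearity of
      the arc integral is needed for a single sum.\<close>
    let ?I = "Sigma ?N (\<lambda>\<eta>. {..<rdim \<eta>} \<times> {..<rdim \<eta>})"
    define w where "w p = of_nat (rdim (fst p)) * dcoef (q_power K \<beta>) (fst p) (fst (snd p)) (snd (snd p)) \<xi> i j"
      for p :: "'g rep \<times> nat \<times> nat"
    define g where "g p z = d z0 z (snd (snd p)) (fst (snd p)) (fst p) y" for p :: "'g rep \<times> nat \<times> nat" and z
    have flat: "(\<Sum>\<eta>\<in>?N. \<Sum>k<rdim \<eta>. \<Sum>l<rdim \<eta>. G (\<eta>, k, l)) = (\<Sum>p\<in>?I. G p)"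
      for G :: "'g rep \<times> nat \<times> nat \<Rightarrow> complex"
      using finite_linked_left[OF repfun_q_power \<xi>D, of \<beta>]
      by (simp add: sum.Sigma sum.cartesian_product case_prod_unfold)
    have pE: "fst p \<in> dual K - E" "fst (snd p) < rdim (fst p)" "snd (snd p) < rdim (fst p)" if "p \<in> ?I" for p
      using that far by auto
    have g: "continuous_on S (g p)" "\<exists>C. \<forall>z\<in>S. cmod (g p z) \<le> C * (cmod z powr (1 / m) + bracket K (fst p)) powr (- m)"
      "1 \<le> bracket K (fst p)" if p: "p \<in> ?I" for p
    proof -
      note P' = pE[OF p]
      \<comment> \<open>Specialises the continuity and the bound of the frame derivatives to the
        undifferentiated entries.\<close>
      have fd: "frame_deriv K z0 f = f" for f
      proof -
        have "canonical z0 nf = []" by (simp add: canonical_def z0_def concat_eq_Nil_conv)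
        then show ?thesis by (simp add: frame_deriv_word)
      qed
      show "continuous_on S (g p)" using dcont[OF P'(1,3,2), of z0 z0 y] by (simp add: g_def[abs_def] fd)
      show "\<exists>C. \<forall>z\<in>S. cmod (g p z) \<le> C * (cmod z powr (1 / m) + bracket K (fst p)) powr (- m)"
        using dbd[OF P'(1) _ P'(3,2), of _ z0 z0 y] unfolding g_def fd by blast
      show "1 \<le> bracket K (fst p)" using P' by (intro bracket_ge_1) auto
    qed
    have "diff_op K (q_power K \<beta>) (\<sigma>F y) \<xi> $$ (i, j) = (\<Sum>\<eta>\<in>?N. \<Sum>k<rdim \<eta>. \<Sum>l<rdim \<eta>. w (\<eta>, k, l) * \<sigma>F y \<eta> $$ (l, k))"
      using diff_op_entry[OF repfun_q_power \<xi>D ij \<sigma>Fy] by (simp add: w_def)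
    also have "\<dots> = (\<Sum>\<eta>\<in>?N. \<Sum>k<rdim \<eta>. \<Sum>l<rdim \<eta>. w (\<eta>, k, l) * (c0 * J (g (\<eta>, k, l))))"
      using far by (intro sum.cong refl) (auto simp: \<sigma>F g_def[abs_def])
    also have "\<dots> = (\<Sum>p\<in>?I. w p * (c0 * J (g p)))"
      by (rule flat[of "\<lambda>p. w p * (c0 * J (g p))"])
    also have "\<dots> = c0 * (\<Sum>p\<in>?I. w p * J (g p))" by (simp add: sum_distrib_left mult_ac)
    also have "(\<Sum>p\<in>?I. w p * J (g p)) = J (\<lambda>z. \<Sum>p\<in>?I. w p * g p z)"
    proof -
      have "arc_integral A \<phi> \<gamma> (\<lambda>z. \<Sum>p\<in>?I. w p * g p z) = (\<Sum>p\<in>?I. w p * arc_integral A \<phi> \<gamma> (g p))"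
        if "admissible_arc S m s A \<phi> \<gamma>" for A \<phi> \<gamma>
        by (rule arc_integral_sum[OF that g(3) g(1,2)])
      from this[OF arc1] this[OF arc2] this[OF arc3] show ?thesis
        by (simp add: J_def distrib_left right_diff_distrib sum.distrib sum_negf sum_subtractf)
    qed
    also have "\<dots> = J (\<lambda>z. d \<beta> z i j \<xi> y)"
    proof (rule JS)
      fix z assume z: "z \<in> S"
      have Py: "P z y \<eta> \<in> carrier_mat (rdim \<eta>) (rdim \<eta>)" if "\<eta> \<in> dual K" for \<eta> by (rule Pc[OF z that])
      have "(\<Sum>p\<in>?I. w p * g p z) = (\<Sum>\<eta>\<in>?N. \<Sum>k<rdim \<eta>. \<Sum>l<rdim \<eta>. w (\<eta>, k, l) * g (\<eta>, k, l) z)"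
        by (rule flat[symmetric])
      also have "\<dots> = (\<Sum>\<eta>\<in>?N. \<Sum>k<rdim \<eta>. \<Sum>l<rdim \<eta>. w (\<eta>, k, l) * P z y \<eta> $$ (l, k))"
        by (intro sum.cong refl) (auto simp: g_def d0[OF z])
      also have "\<dots> = d \<beta> z i j \<xi> y"
        unfolding d_def using diff_op_entry[OF repfun_q_power \<xi>D ij Py] by (simp add: w_def)
      finally show "(\<Sum>p\<in>?I. w p * g p z) = d \<beta> z i j \<xi> y" .
    qed
    finally show ?thesis .
  qed
  obtain C1 C2 C3 where C: "arc_op_bound S m s {\<epsilon>..} f1 c1 C1" "arc_op_bound S m s A2 f2 c2 C2"
    "arc_op_bound S m s {\<epsilon>..} f3 c3 C3"
    using arc_op_bound[OF arc1] arc_op_bound[OF arc2] arc_op_bound[OF arc3] by blast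
  have C0: "0 \<le> C1" "0 \<le> C2" "0 \<le> C3" using C unfolding arc_op_bound_def by blast+
  \<comment> \<open>Adds the three arcs by the triangle inequality; \<open>C1 + C2 + C3\<close>
    depends neither on \<open>n\<close> nor on \<open>b\<close>.\<close>
  have JC: "op_norm (Matrix.mat n n (\<lambda>(i, j). c0 * J (\<lambda>z. a z i j))) \<le> cmod c0 * ((C1 + C2 + C3) * C * b powr (m * s))"
    if h: "1 \<le> b" "0 \<le> C" "\<And>i j. i < n \<Longrightarrow> j < n \<Longrightarrow> continuous_on S (\<lambda>z. a z i j)"
      "\<And>z. z \<in> S \<Longrightarrow> op_norm (Matrix.mat n n (\<lambda>(i, j). a z i j)) \<le> C * (cmod z powr (1 / m) + b) powr (- m)"
    for n a C b
  proof -
    let ?M = "\<lambda>L :: (complex \<Rightarrow> complex) \<Rightarrow> complex. Matrix.mat n n (\<lambda>(i, j). L (\<lambda>z. a z i j))"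
    have "op_norm (?M J) \<le> op_norm (?M (\<lambda>g. (-1) * arc_integral {\<epsilon>..} f1 c1 g)) +
        op_norm (?M (arc_integral A2 f2 c2)) + op_norm (?M (arc_integral {\<epsilon>..} f3 c3))"
    proof -
      have J': "?M J = Matrix.mat n n (\<lambda>(i, j). ((-1) * arc_integral {\<epsilon>..} f1 c1 (\<lambda>z. a z i j) +
          arc_integral A2 f2 c2 (\<lambda>z. a z i j)) + arc_integral {\<epsilon>..} f3 c3 (\<lambda>z. a z i j))"
        by (simp add: J_def)
      show ?thesis unfolding J'
        by (rule order_trans[OF op_norm_add add_right_mono[OF op_norm_add]])
    qed
    also have "\<dots> \<le> cmod (-1) * op_norm (?M (arc_integral {\<epsilon>..} f1 c1)) +
        op_norm (?M (arc_integral A2 f2 c2)) + op_norm (?M (arc_integral {\<epsilon>..} f3 c3))"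
      by (intro add_right_mono op_norm_cmult)
    also have "\<dots> \<le> C1 * C * b powr (m * s) + C2 * C * b powr (m * s) + C3 * C * b powr (m * s)"
      using arc_op_boundD[OF C(1) h] arc_op_boundD[OF C(2) h] arc_op_boundD[OF C(3) h] by simp
    finally have "op_norm (?M J) \<le> (C1 + C2 + C3) * C * b powr (m * s)" by (simp add: algebra_simps)
    from order_trans[OF op_norm_cmult mult_left_mono[OF this]] show ?thesis by simp
  qed
  have main: "\<exists>C. \<forall>x. \<forall>\<xi>\<in>dual K. op_norm (symbol_deriv K \<alpha> \<beta> \<sigma>F x \<xi>) \<le>
      C * bracket K \<xi> powr (m * s - \<rho> * real (q_order K \<beta>) + \<delta> * real (frame_order K \<alpha>))" for \<alpha> \<beta>
  proof -
    \<comment> \<open>the representations at which the exceptional values of the symbol enter\<close>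
    define X where "X = (E \<inter> dual K) \<union> (\<Union>\<eta>\<in>E \<inter> dual K. {\<xi>\<in>dual K. linked (q_power K \<beta>) \<eta> \<xi>})"
    have X: "finite X" unfolding X_def using exceptional
      by (intro finite_UnI finite_UN_I finite_linked_right repfun_q_power) auto
    define \<mu> where "\<mu> = m * s - \<rho> * real (q_order K \<beta>) + \<delta> * real (frame_order K \<alpha>)"
    have \<mu>: "\<mu> = m * s + \<kappa> \<alpha> \<beta>" by (simp add: \<mu>_def \<kappa>_def)
    have "\<exists>B. \<forall>x. op_norm (symbol_deriv K \<alpha> \<beta> \<sigma>F x \<xi>) \<le> B" if "\<xi> \<in> dual K" for \<xi>
      by (rule symbol_deriv_bounded[OF that \<sigma>Fsm])
    then obtain B where B: "\<And>\<xi> x. \<xi> \<in> dual K \<Longrightarrow> op_norm (symbol_deriv K \<alpha> \<beta> \<sigma>F x \<xi>) \<le> B \<xi>" by metis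
    \<comment> \<open>Finitely many representations: each summand alone suffices for its own \<xi>,
      and the sum dominates them all.\<close>
    define CX where "CX = (\<Sum>\<xi>\<in>X. \<bar>B \<xi>\<bar> / bracket K \<xi> powr \<mu>)"
    define CG where "CG = cmod c0 * ((C1 + C2 + C3) * CP \<alpha> \<beta>)"
    \<comment> \<open>Both constants are nonnegative, so that \<open>CX + CG\<close> serves for the
      exceptional and the remaining representations alike.\<close>
    have CX: "0 \<le> CX" unfolding CX_def by (intro sum_nonneg) auto
    have CG: "0 \<le> CG" unfolding CG_def using C0 CP by simp
    have "op_norm (symbol_deriv K \<alpha> \<beta> \<sigma>F x \<xi>) \<le> (CX + CG) * bracket K \<xi> powr \<mu>" if \<xi>: "\<xi> \<in> dual K" for x \<xi>
    proof (cases "\<xi> \<in> X")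
      case True
      have pos: "0 < bracket K \<xi> powr \<mu>" using bracket_ge_1[OF \<xi>] by simp
      have "\<bar>B \<xi>\<bar> / bracket K \<xi> powr \<mu> \<le> CX" unfolding CX_def by (rule member_le_sum[OF True _ X]) auto
      also have "\<dots> \<le> CX + CG" using CG by simp
      finally have "\<bar>B \<xi>\<bar> \<le> (CX + CG) * bracket K \<xi> powr \<mu>" using pos by (simp add: pos_divide_le_eq)
      then show ?thesis using B[OF \<xi>, of x] by linarith
    next
      case False
      then have \<xi>E: "\<xi> \<in> dual K - E" and far: "\<And>\<eta>. \<eta> \<in> dual K \<Longrightarrow> linked (q_power K \<beta>) \<eta> \<xi> \<Longrightarrow> \<eta> \<notin> E"
        using \<xi> unfolding X_def by blast+
      have "symbol_deriv K \<alpha> \<beta> \<sigma>F x \<xi> = Matrix.mat (rdim \<xi>) (rdim \<xi>)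
          (\<lambda>(i, j). c0 * J (\<lambda>z. frame_deriv K \<alpha> (d \<beta> z i j \<xi>) x))"
        unfolding symbol_deriv_mat
      proof (rule cong_mat)
        fix i j assume ij: "i < rdim \<xi>" "j < rdim \<xi>"
        have "(\<lambda>y. diff_op K (q_power K \<beta>) (\<sigma>F y) \<xi> $$ (i, j)) = (\<lambda>y. c0 * J (\<lambda>z. d \<beta> z i j \<xi> y))"
          using diffF[OF \<xi>E ij far] by blast
        then show "(\<lambda>(i, j). frame_deriv K \<alpha> (\<lambda>y. diff_op K (q_power K \<beta>) (\<sigma>F y) \<xi> $$ (i, j)) x) (i, j) =
            (\<lambda>(i, j). c0 * J (\<lambda>z. frame_deriv K \<alpha> (d \<beta> z i j \<xi>) x)) (i, j)"
          using frame_deriv_cmult[OF Jsm(1)[OF \<xi>E ij]] Jsm(2)[OF \<xi>E ij] by simp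
      qed auto
      also have "op_norm \<dots> \<le> cmod c0 * ((C1 + C2 + C3) * (CP \<alpha> \<beta> * bracket K \<xi> powr \<kappa> \<alpha> \<beta>) * bracket K \<xi> powr (m * s))"
        by (rule JC[OF bracket_ge_1[OF \<xi>] _ dcont[OF \<xi>E] CP(2)[OF \<xi>E]]) (use CP in auto)
      also have "\<dots> = CG * bracket K \<xi> powr \<mu>" unfolding CG_def \<mu> powr_add by simp
      also have "\<dots> \<le> (CX + CG) * bracket K \<xi> powr \<mu>" using CX by (intro mult_right_mono) auto
      finally show ?thesis .
    qed
    then show ?thesis unfolding \<mu>_def by blast
  qed
  have smooth: "smooth_symbol K \<sigma>F"
    unfolding smooth_symbol_def
  proof (intro conjI ballI allI)
    show "smooth_mat_fun K (rdim \<xi>) (\<lambda>x. \<sigma>F x \<xi>)" if "\<xi> \<in> dual K" for \<xi> by (rule \<sigma>Fsm[OF that])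
    fix \<alpha>
    \<comment> \<open>Moderate growth of all derivatives in the group variable is the estimate
      without differences.\<close>
    obtain C where C: "\<forall>x. \<forall>\<xi>\<in>dual K. op_norm (symbol_deriv K \<alpha> z0 \<sigma>F x \<xi>) \<le>
      C * bracket K \<xi> powr (m * s - \<rho> * real (q_order K z0) + \<delta> * real (frame_order K \<alpha>))" using main by blast
    have "symbol_deriv K \<alpha> z0 \<sigma>F x \<xi> = mat_deriv K \<alpha> (\<lambda>y. \<sigma>F y \<xi>) x" if "\<xi> \<in> dual K" for x \<xi>
      proof -
      have "diff_op K (\<lambda>x. 1) (\<sigma>F y) \<xi> = \<sigma>F y \<xi>" for y by (rule diff_op_one[OF that \<sigma>Fc])
      then show ?thesis unfolding symbol_deriv_def q0 by simp
    qed
    with C show "\<exists>C N. \<forall>x. \<forall>\<xi>\<in>dual K. op_norm (mat_deriv K \<alpha> (\<lambda>y. \<sigma>F y \<xi>) x) \<le> C * bracket K \<xi> powr N"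
      by (intro exI[of _ C] exI[of _ "m * s - \<rho> * real (q_order K z0) + \<delta> * real (frame_order K \<alpha>)"]) simp
  qed
  show ?thesis unfolding symbol_class_def using smooth main by blast
qed

end
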